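(* Let $D\subseteq\mathbb{R}^2$ be a closed disk and $Q\subseteq\mathbb{R}^2$ a closed square of the same area. Then $D$ and $Q$ can be equidecomposed using translations so that every piece has topological boundary of upper Minkowski dimension at most $1.987$, belongs to $\mathcal{B}(\boldsymbol{\Sigma}^0_2)$ (i.e. is a Boolean combination of $F_\sigma$ sets), and has positive Lebesgue measure.
   Context: Two sets $A,B\subseteq\mathbb{R}^k$ are equidecomposable using (by) translations if $A$ can be partitioned into finitely many sets $A_1,\dots,A_N$ (the pieces) and there are vectors $\boldsymbol{t}_1,\dots,\boldsymbol{t}_N\in\mathbb{R}^k$ such that $A_1+\boldsymbol{t}_1,\dots,A_N+\boldsymbol{t}_N$ form a partition of $B$. The upper Minkowski dimension of $X\subseteq\mathbb{R}^k$ is $\dim_\square(X):=\limsup_{\delta\to0^+}\frac{\log N_\delta(X)}{\log(\delta^{-1})}$, where $N_\delta(X)$ is the number of boxes of the regular grid in $\mathbb{R}^k$ of side-length $\delta$ that intersect $X$. $\boldsymbol{\Sigma}^0_2$ is the family of $F_\sigma$ subsets of $\mathbb{R}^2$, and for a set family $\mathcal{F}$, $\mathcal{B}(\mathcal{F})$ is the algebra of sets generated by $\mathcal{F}$ (all Boolean combinations of elements of $\mathcal{F}$). *)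

theory Defs
  imports "HOL-Analysis.Analysis"
begin

text \<open>Pieces are indexed, so equal translates of distinct pieces violate disjointness.\<close>

definition translation_equidecomposition ::
  "nat \<Rightarrow> (nat \<Rightarrow> 'a::ab_group_add set) \<Rightarrow> (nat \<Rightarrow> 'a) \<Rightarrow> 'a set \<Rightarrow> 'a set \<Rightarrow> bool" where
  "translation_equidecomposition N P t A B \<longleftrightarrow>
     (\<Union>i<N. P i) = A \<and> disjoint_family_on P {..<N} \<and>
     (\<Union>i<N. (+) (t i) ` P i) = B \<and> disjoint_family_on (\<lambda>i. (+) (t i) ` P i) {..<N}"

definition grid_boxes :: "real \<Rightarrow> (real ^ 'k) set set" where
  "grid_boxes \<delta> = range (\<lambda>n :: int ^ 'k.
     cbox (\<chi> i. \<delta> * of_int (n $ i)) (\<chi> i. \<delta> * (of_int (n $ i) + 1)))"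

definition meeting_boxes :: "real \<Rightarrow> (real ^ 'k) set \<Rightarrow> (real ^ 'k) set set" where
  "meeting_boxes \<delta> X = {C \<in> grid_boxes \<delta>. C \<inter> X \<noteq> {}}"

text \<open>
  \<open>log N\<^sub>\<delta>(X)\<close> as an extended real, with \<open>log \<infinity> = \<infinity>\<close> (for unbounded \<open>X\<close>) and
  \<open>log 0 = - \<infinity>\<close> (for empty \<open>X\<close>); on \<open>card\<close> and \<open>ln\<close> alone both would give \<open>0\<close>.
\<close>

definition log_box_count :: "real \<Rightarrow> (real ^ 'k) set \<Rightarrow> ereal" where
  "log_box_count \<delta> X =
     (if infinite (meeting_boxes \<delta> X) then \<infinity>
      else if meeting_boxes \<delta> X = {} then - \<infinity>
      else ereal (ln (real (card (meeting_boxes \<delta> X)))))"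

definition upper_minkowski_dim :: "(real ^ 'k) set \<Rightarrow> ereal" where
  "upper_minkowski_dim X =
     Limsup (at_right 0) (\<lambda>\<delta>. log_box_count \<delta> X / ereal (ln (1 / \<delta>)))"

definition generated_algebra :: "'a set set \<Rightarrow> 'a set set" where
  "generated_algebra F = algebra UNIV hull F"

definition closed_square :: "(real ^ 2) set \<Rightarrow> bool" where
  "closed_square Q \<longleftrightarrow>
     (\<exists>p u v. u \<noteq> 0 \<and> norm v = norm u \<and> u \<bullet> v = 0 \<and>
        Q = {p + a *\<^sub>R u + b *\<^sub>R v | a b. a \<in> {0..1} \<and> b \<in> {0..1}})"

end

theory Submission
  imports Defs "HOL-Library.Function_Algebras" "HOL-Library.Multiset"
begin

text \<open>
  Let \<open>\<lambda>\<close> be the real root of \<open>\<lambda>\<^sup>3 + \<lambda> = 1\<close>. A displacement by \<open>\<lambda>\<^sup>k\<close> is a composition of about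
  \<open>1.33\<^sup>k\<close> displacements by \<open>\<plusminus>1\<close>, \<open>\<plusminus>\<lambda>\<close> and \<open>\<plusminus>\<lambda>\<^sup>2\<close>. If the \<open>k\<close>-th of infinitely many pieces lies at height
  of order \<open>\<lambda>\<^sup>k\<close>, then the intermediate positions of all pieces are disjoint within three copies of one
  bounded set, which serve as catalysts: pieces that are present both before and after the move. Hence
  moving the \<open>k\<close>-th piece by \<open>\<lambda>\<^sup>k d\<close>, for all \<open>k\<close> at once, takes only finitely many translations of
  nice sets, and the dimension bound comes from \<open>1.33 \<lambda> < 1\<close>.

  Let \<open>\<phi>\<close> be Lipschitz and periodic with mean zero. Then \<open>\<phi> = \<Sum>\<^sub>n u\<^sub>n \<partial>\<^sub>n t\<^sub>n\<close>, where \<open>\<partial>\<^sub>n\<close> is the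
  difference operator of step \<open>\<tau> \<lambda>\<^sup>n\<close>, \<open>u\<^sub>n = \<upsilon> \<lambda>\<^sup>n\<close>, and \<open>t\<^sub>n\<close> is a bounded integer-valued step function:
  the real-valued solution comes from iterated averages, and its rounding errors are passed on to the
  finer scales. The term \<open>u\<^sub>n \<partial>\<^sub>n t\<^sub>n\<close> is a rearrangement of boxes of height \<open>u\<^sub>n\<close> on top of a slot at
  height of order \<open>\<lambda>\<^sup>n\<close>. After it, the \<open>n\<close>-th slot has become, up to a rectangle, the \<open>(n+1)\<close>-st one,
  and the shift by one scale of all slots turns the subgraph of \<open>\<phi>\<close> plus a constant into a rectangle.

  So the disk, a square with four caps, becomes a rectangle; the square itself hosts the catalysts. Finitely
  many segments are absorbed as in Hilbert's hotel, and shears change the shape of a rectangle; its area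
  is right because Lebesgue measure is invariant. Finally, pieces without interior are merged
  into pieces with interior, after an exchange of two small squares that makes their translations agree.
\<close>

subsection \<open>Sets with small boundary\<close>

text \<open>The obstacle is that an equidecomposition has finitely many translation vectors, while
  infinitely many pieces have to travel infinitely many different distances \<open>lam ^ k\<close>.
  The equation for \<open>lam\<close> is used in three ways. It writes each distance as a walk with
  three step lengths. Read from the other end, it is a substitution that confines the steps of each
  length to known intervals, and this makes the parked pieces disjoint across all scales. It also
  splits a difference of step \<open>lam ^ n\<close> into differences of the finer steps
  \<open>lam ^ (n + 1)\<close> and \<open>lam ^ (n + 3)\<close>, so that rounding errors can be
  postponed.

  The cascade through the scales is not undone scale by scale. It is run twice, for the given
  profile and for the zero profile. Both runs produce the same rectangles, and what remains of
  either run at the scales from 1 on is a nice bounded set, which is treated as a catalyst.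

  The exponent 1.987 is 2 - 1/76 rounded up: the fourth power of 1.33 \<open>lam\<close> is at most
  \<open>lam\<close>, and the resolution e is matched with the level n for which e is about
  \<open>lam ^ (19 * n)\<close>.\<close>

definition covered :: "'a::metric_space set \<Rightarrow> real \<Rightarrow> real \<Rightarrow> bool" where
  "covered S e c \<longleftrightarrow> (\<exists>F. finite F \<and> real (card F) \<le> c \<and> S \<subseteq> (\<Union>p\<in>F. cball p e))"

lemma covered_mono: "covered S e c \<Longrightarrow> T \<subseteq> S \<Longrightarrow> c \<le> d \<Longrightarrow> covered T e d"
  unfolding covered_def by (meson order_trans)

lemma covered_empty: "0 \<le> c \<Longrightarrow> covered {} e c"
  unfolding covered_def by (intro exI[of _ "{}"]) auto

lemma covered_nonneg: "covered S e c \<Longrightarrow> 0 \<le> c"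
  unfolding covered_def by (meson of_nat_0_le_iff order_trans)

lemma covered_Un:
  assumes "covered S e c" "covered T e d"
  shows "covered (S \<union> T) e (c + d)"
proof -
  obtain F G where F: "finite F" "real (card F) \<le> c" "S \<subseteq> (\<Union>p\<in>F. cball p e)"
    and G: "finite G" "real (card G) \<le> d" "T \<subseteq> (\<Union>p\<in>G. cball p e)"
    using assms unfolding covered_def by auto
  have "real (card (F \<union> G)) \<le> real (card F + card G)"
    by (simp only: of_nat_le_iff card_Un_le)
  with F G show ?thesis unfolding covered_def
    by (intro exI[of _ "F \<union> G"]) auto
qed

lemma covered_UN:
  assumes "finite I" "\<And>i. i \<in> I \<Longrightarrow> covered (S i) e (c i)"
  shows "covered (\<Union>i\<in>I. S i) e (\<Sum>i\<in>I. c i)"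
  using assms by (induction I) (auto intro: covered_Un covered_empty)

lemma covered_closure:
  assumes "covered S e c"
  shows "covered (closure S) e c"
proof -
  obtain F where F: "finite F" "real (card F) \<le> c" "S \<subseteq> (\<Union>p\<in>F. cball p e)"
    using assms unfolding covered_def by auto
  have "closed (\<Union>p\<in>F. cball p e)" using F by (intro closed_UN) auto
  with F have "closure S \<subseteq> (\<Union>p\<in>F. cball p e)" by (meson closure_minimal)
  with F show ?thesis unfolding covered_def by auto
qed

lemma covered_lipschitz_image:
  assumes "covered S e c" "\<And>x y. dist (f x) (f y) \<le> dist x y"
  shows "covered (f ` S) e c"
proof -
  obtain F where F: "finite F" "real (card F) \<le> c" "S \<subseteq> (\<Union>p\<in>F. cball p e)"
    using assms unfolding covered_def by auto
  have "card (f ` F) \<le> card F" using F card_image_le by auto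
  moreover have "f ` S \<subseteq> (\<Union>p\<in>f ` F. cball p e)"
  proof clarsimp
    fix x assume "x \<in> S"
    then obtain p where "p \<in> F" "dist p x \<le> e" using F by auto
    then show "\<exists>p\<in>F. dist (f p) (f x) \<le> e" using assms(2) order_trans by blast
  qed
  ultimately show ?thesis using F unfolding covered_def
    by (intro exI[of _ "f ` F"]) auto
qed

text \<open>The parameter interval is cut into cells of length e/M, and one image point is chosen
  for each cell that meets T. Choosing the centres in the image allows T to be any subset of the
  interval, for instance a half-open one.\<close>

lemma covered_lipschitz_arc:
  fixes f :: "real \<Rightarrow> 'a::metric_space"
  assumes "0 < M" "0 \<le> l" "0 < e" "e \<le> 1" "T \<subseteq> {a..a+l}"
    and lip: "\<And>x y. x \<in> T \<Longrightarrow> y \<in> T \<Longrightarrow> dist (f x) (f y) \<le> M * \<bar>x - y\<bar>"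
  shows "covered (f ` T) e ((M * l + 1) / e)"
proof -
  define h where "h = e / M"
  have h: "0 < h" "M * h = e" using assms by (auto simp: h_def)
  define c where "c t = nat \<lfloor>(t - a) / h\<rfloor>" for t
  define n where "n = nat \<lfloor>l / h\<rfloor>"
  define F where "F = (\<lambda>i. f (SOME t. t \<in> T \<and> c t = i)) ` {..n}"
  have "card F \<le> card {..n}" unfolding F_def by (rule card_image_le) simp
  then have "real (card F) \<le> real n + 1" by simp
  also have "real n \<le> l / h" using h(1) assms(2) by (simp add: n_def)
  also have "l / h + 1 \<le> (M * l + 1) / e" using assms by (simp add: h_def field_simps)
  finally have card: "real (card F) \<le> (M * l + 1) / e" by simp
  have "f ` T \<subseteq> (\<Union>p\<in>F. cball p e)"
  proof clarify
    fix x assume x: "x \<in> T"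
    define t where "t = (SOME t. t \<in> T \<and> c t = c x)"
    have t: "t \<in> T" "c t = c x" using someI[of "\<lambda>t. t \<in> T \<and> c t = c x" x] x by (auto simp: t_def)
    have nn: "0 \<le> (x - a) / h" "0 \<le> (t - a) / h" using x t assms(5) h(1) by auto
    have "c x \<le> n" unfolding c_def n_def
      using x assms(5) h(1) by (intro nat_mono floor_mono divide_right_mono) auto
    then have "f t \<in> F" unfolding F_def t_def by auto
    have "\<lfloor>(t - a) / h\<rfloor> = \<lfloor>(x - a) / h\<rfloor>" using t(2) nn unfolding c_def
      by (subst (asm) eq_nat_nat_iff) simp_all
    then have "\<bar>(t - a) / h - (x - a) / h\<bar> \<le> 1" by linarith
    then have "\<bar>(t - x) / h\<bar> \<le> 1" by (simp add: diff_divide_distrib)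
    then have "\<bar>t - x\<bar> \<le> h" using h(1) by (simp add: abs_divide divide_le_eq)
    have "dist (f t) (f x) \<le> M * \<bar>t - x\<bar>" using lip t x by auto
    also have "\<dots> \<le> M * h" using \<open>\<bar>t - x\<bar> \<le> h\<close> assms(1) by (intro mult_left_mono) auto
    finally have "f x \<in> cball (f t) e" using h by simp
    with \<open>f t \<in> F\<close> show "f x \<in> (\<Union>p\<in>F. cball p e)" by (rule UN_I)
  qed
  with card show ?thesis unfolding covered_def by (intro exI[of _ F]) (auto simp: F_def)
qed

text \<open>Box dimension at most 1.987 in covering form, with a constant uniform in e. In this form
  the property passes to finite unions and to 1-Lipschitz images at once.\<close>

definition small :: "'a::metric_space set \<Rightarrow> bool" where
  "small S \<longleftrightarrow> (\<exists>C. \<forall>e\<in>{0<..1}. covered S e (C * e powr - 1.987))"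

lemma small_mono: "small S \<Longrightarrow> T \<subseteq> S \<Longrightarrow> small T"
  unfolding small_def by (meson covered_mono order_refl)

lemma small_Un: "small S \<Longrightarrow> small T \<Longrightarrow> small (S \<union> T)"
  unfolding small_def
  by (metis covered_Un distrib_right)

lemma small_empty [simp]: "small {}"
  unfolding small_def by (intro exI[of _ 0]) (auto intro: covered_empty)

lemma small_image:
  assumes "small S" "\<And>x y. dist (f x) (f y) \<le> dist x y"
  shows "small (f ` S)"
  using assms covered_lipschitz_image unfolding small_def by blast

lemma small_if_covered:
  assumes "\<And>e. 0 < e \<Longrightarrow> e \<le> 1 \<Longrightarrow> covered S e (C / e)"
  shows "small S"
  unfolding small_def
proof (intro exI ballI)
  fix e :: real assume "e \<in> {0<..1}"
  then have e: "0 < e" "e \<le> 1" by auto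
  have "0 \<le> C / e" using covered_nonneg[OF assms[OF e]] .
  then have C: "0 \<le> C" using e by (simp add: zero_le_divide_iff)
  have "C / e \<le> C * e powr - 1.987"
  proof -
    have "1 / e = e powr (-1)" using e by (simp add: powr_minus_divide)
    also have "\<dots> \<le> e powr - 1.987" using e by (intro powr_mono') auto
    finally show ?thesis using C mult_left_mono[of "1/e"] by auto
  qed
  then show "covered S e (C * e powr - 1.987)"
    using assms[OF e] by (rule covered_mono[rotated 2]) auto
qed

section \<open>Boolean combinations of F_sigma sets, and the nice sets\<close>

definition boolean_fsigma :: "'a::metric_space set set" where
  "boolean_fsigma = generated_algebra {S. fsigma_in euclidean S}"

lemma boolean_fsigma_algebra: "algebra UNIV (boolean_fsigma :: 'a::metric_space set set)"
  unfolding boolean_fsigma_def generated_algebra_def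
proof (rule hull_in)
  fix T :: "'a set set set" assume "Ball T (algebra UNIV)"
  then show "algebra UNIV (\<Inter>T)"
    unfolding algebra_iff_Un by auto
qed

lemma boolean_fsigma_fsigma: "fsigma_in euclidean S \<Longrightarrow> S \<in> boolean_fsigma"
  unfolding boolean_fsigma_def generated_algebra_def by (rule hull_inc) auto

lemma boolean_fsigma_Un: "A \<in> boolean_fsigma \<Longrightarrow> B \<in> boolean_fsigma \<Longrightarrow> A \<union> B \<in> boolean_fsigma"
  and boolean_fsigma_Compl: "A \<in> boolean_fsigma \<Longrightarrow> - A \<in> boolean_fsigma"
  using boolean_fsigma_algebra unfolding algebra_iff_Un by (auto simp: Compl_eq_Diff_UNIV)

text \<open>The sets whose preimage under g belongs to the algebra form an algebra themselves, and
  by continuity it contains all F_sigma sets; hence it contains the hull.\<close>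

lemma boolean_fsigma_homeomorphic_image:
  fixes f :: "'a::metric_space \<Rightarrow> 'b::metric_space"
  assumes A: "A \<in> boolean_fsigma" and fg: "\<And>x. g (f x) = x" "\<And>y. f (g y) = y"
    and cont: "continuous_on UNIV g"
  shows "f ` A \<in> boolean_fsigma"
proof -
  have im: "f ` S = g -` S" for S using fg by (metis (no_types, lifting) image_eqI set_eqI vimageE vimage_eq imageE)
  have fs: "fsigma_in euclidean (g -` S)" if "fsigma_in euclidean S" for S
  proof -
    from that obtain C :: "nat \<Rightarrow> 'a set" where C: "\<And>n. closedin euclidean (C n)" "\<Union>(range C) = S"
      unfolding fsigma_in_ascending by blast
    have "fsigma_in euclidean (\<Union>n::nat. g -` (C n))"
    proof (rule fsigma_in_Union)
      show "countable (range (\<lambda>n. g -` C n))" by auto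
      fix T assume "T \<in> range (\<lambda>n. g -` C n)"
      then obtain n where "T = g -` C n" by auto
      moreover have "closed (g -` C n)" using C cont
        by (metis closed_closedin closed_vimage)
      ultimately show "fsigma_in euclidean T" by (simp add: closed_imp_fsigma_in)
    qed
    moreover have "(\<Union>n. g -` (C n)) = g -` S" using C by auto
    ultimately show ?thesis by simp
  qed
  have "A \<in> {A. g -` A \<in> boolean_fsigma}"
  proof -
    have "algebra UNIV {A. g -` A \<in> boolean_fsigma}"
      using boolean_fsigma_algebra[where 'a='b] unfolding algebra_iff_Un
      by (auto simp: vimage_Diff vimage_Un)
    moreover have "{S. fsigma_in euclidean S} \<subseteq> {A. g -` A \<in> boolean_fsigma}"
      using fs boolean_fsigma_fsigma by blast
    ultimately have "algebra UNIV hull {S. fsigma_in euclidean S} \<subseteq> {A. g -` A \<in> boolean_fsigma}"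
      by (intro hull_minimal)
    then show ?thesis using A unfolding boolean_fsigma_def generated_algebra_def by blast
  qed
  then show ?thesis using im by auto
qed

text \<open>The two requirements on the pieces that survive Boolean operations and isometries.
  Positive measure does not survive intersections, so it is restored only at the end, by merging
  pieces.\<close>

definition nice :: "'a::metric_space set \<Rightarrow> bool" where
  "nice A \<longleftrightarrow> A \<in> boolean_fsigma \<and> small (frontier A)"

lemma nice_Un: "nice A \<Longrightarrow> nice B \<Longrightarrow> nice (A \<union> B)"
  unfolding nice_def by (meson boolean_fsigma_Un frontier_Un_subset small_Un small_mono)

lemma nice_Compl: "nice A \<Longrightarrow> nice (- A)"
  unfolding nice_def by (simp add: boolean_fsigma_Compl frontier_complement)

lemma nice_Int: "nice A \<Longrightarrow> nice B \<Longrightarrow> nice (A \<inter> B)"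
  using nice_Un[of "-A" "-B"] nice_Compl by (metis Compl_Un double_compl)

lemma nice_Diff: "nice A \<Longrightarrow> nice B \<Longrightarrow> nice (A - B)"
  by (simp add: Diff_eq nice_Compl nice_Int)

lemma nice_empty [simp]: "nice {}"
  unfolding nice_def by (auto intro: boolean_fsigma_fsigma)

lemma nice_UNIV [simp]: "nice UNIV"
  using nice_Compl[OF nice_empty] by auto

lemma nice_UN: "finite I \<Longrightarrow> (\<And>i. i \<in> I \<Longrightarrow> nice (S i)) \<Longrightarrow> nice (\<Union>i\<in>I. S i)"
  by (induction I rule: finite_induct) (auto intro: nice_Un)

lemma frontier_homeomorphic_image:
  fixes f :: "'a::metric_space \<Rightarrow> 'b::metric_space"
  assumes fg: "\<And>x. g (f x) = x" "\<And>y. f (g y) = y"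
    and "continuous_on UNIV f" "continuous_on UNIV g"
  shows "frontier (f ` A) = f ` frontier A"
proof -
  have im: "f ` S = g -` S" for S using fg by (metis (no_types, lifting) image_eqI set_eqI vimageE vimage_eq imageE)
  have cl: "closure (f ` S) = f ` closure S" for S
  proof
    have "closed (g -` closure S)" using assms by (intro closed_vimage) auto
    then show "closure (f ` S) \<subseteq> f ` closure S"
      by (metis closure_minimal closure_subset im vimage_mono)
    show "f ` closure S \<subseteq> closure (f ` S)"
      using assms(3) by (metis closed_closure closure_subset continuous_on_subset image_closure_subset subset_UNIV)
  qed
  have inj: "inj f" using fg by (metis injI)
  have compl: "- f ` S = f ` (- S)" for S using im by (simp add: vimage_Compl)
  show ?thesis unfolding frontier_closures compl cl using inj by (simp add: image_Int)
qed

lemma nice_isometry: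
  fixes f :: "'a::metric_space \<Rightarrow> 'b::metric_space"
  assumes "nice A" "surj f" and iso: "\<And>x y. dist (f x) (f y) = dist x y"
  shows "nice (f ` A)"
proof -
  have "inj f" using iso by (metis dist_eq_0_iff injI)
  define g where "g = inv f"
  have fg: "g (f x) = x" "f (g y) = y" for x y
    using \<open>inj f\<close> assms by (auto simp: g_def surj_f_inv_f)
  have isog: "dist (g x) (g y) = dist x y" for x y using iso fg by metis
  have "continuous_on UNIV f" "continuous_on UNIV g"
    unfolding continuous_on_iff using iso isog by auto
  then show ?thesis using assms fg unfolding nice_def
    by (auto simp: frontier_homeomorphic_image[of g f] iso
        intro!: boolean_fsigma_homeomorphic_image[of A g f] small_image)
qed

lemma nice_translation:
  fixes v :: "'a::real_normed_vector"
  shows "nice A \<Longrightarrow> nice ((+) v ` A)"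
  by (rule nice_isometry) auto

text \<open>Adding one set to the family replaces Q by its shift on that set and keeps Q off it.
  This gives niceness of the sets on which pieces are matched by rank in
  \<open>eqf_trans\<close>.\<close>

lemma nice_Collect_card:
  assumes "finite I" "\<And>i. i \<in> I \<Longrightarrow> nice (A i)"
  shows "nice {x. Q (card {i \<in> I. x \<in> A i})}"
  using assms
proof (induction I arbitrary: Q rule: finite_induct)
  case empty
  then show ?case by (cases "Q 0") auto
next
  case (insert a I)
  have e: "card {i \<in> insert a I. x \<in> A i} = (if x \<in> A a then Suc (card {i \<in> I. x \<in> A i}) else card {i \<in> I. x \<in> A i})" for x
  proof -
    have "{i \<in> insert a I. x \<in> A i} = (if x \<in> A a then insert a {i \<in> I. x \<in> A i} else {i \<in> I. x \<in> A i})" by auto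
    then show ?thesis using insert by auto
  qed
  have "{x. Q (card {i \<in> insert a I. x \<in> A i})} =
     (A a \<inter> {x. Q (Suc (card {i \<in> I. x \<in> A i}))}) \<union> ({x. Q (card {i \<in> I. x \<in> A i})} - A a)"
    unfolding e by auto
  moreover have "nice (A a)" using insert by auto
  moreover have "nice {x. Q (Suc (card {i \<in> I. x \<in> A i}))}" "nice {x. Q (card {i \<in> I. x \<in> A i})}"
    using insert.IH[of "\<lambda>n. Q (Suc n)"] insert.IH[of Q] insert.prems by auto
  ultimately show ?case by (simp add: nice_Un nice_Int nice_Diff)
qed

subsection \<open>Equidecomposition of multisets of points\<close>

definition ind :: "'a set \<Rightarrow> 'a \<Rightarrow> nat" where
  "ind A x = of_bool (x \<in> A)"

lemma ind_Un: "A \<inter> B = {} \<Longrightarrow> ind (A \<union> B) = ind A + ind B"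
  by (auto simp: ind_def fun_eq_iff)

lemma ind_empty [simp]: "ind {} = 0"
  by (auto simp: ind_def fun_eq_iff)

lemma sum_fun_apply: "(\<Sum>i\<in>I. f i) x = (\<Sum>i\<in>I. f i x)" for f :: "'i \<Rightarrow> 'b \<Rightarrow> 'c::comm_monoid_add"
  by (induction I rule: infinite_finite_induct) auto

lemma ind_UN:
  assumes "finite I" "disjoint_family_on A I"
  shows "ind (\<Union>i\<in>I. A i) = (\<Sum>i\<in>I. ind (A i))"
  using assms
proof (induction I rule: finite_induct)
  case (insert i I)
  have "A i \<inter> (\<Union>j\<in>I. A j) = {}"
    using insert unfolding disjoint_family_on_def by fastforce
  moreover have "disjoint_family_on A I" using insert unfolding disjoint_family_on_def by auto
  ultimately show ?case using insert by (simp add: ind_Un)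
qed auto

lemma sum_ind_card: "finite I \<Longrightarrow> (\<Sum>i\<in>I. ind (A i)) x = card {i\<in>I. x \<in> A i}"
  by (simp add: sum_fun_apply ind_def of_bool_def sum.If_cases Collect_conj_eq)

text \<open>Functions with values in nat stand for multisets of points, since catalysts overlap each
  other and the pieces being moved. The relation is reflexive exactly on finite sums of indicators
  of nice sets, so a hypothesis \<open>F \<asymp> F\<close> below says that F is such a sum.\<close>

definition eqf :: "('a::real_normed_vector \<Rightarrow> nat) \<Rightarrow> ('a \<Rightarrow> nat) \<Rightarrow> bool"  (infix "\<asymp>" 50) where
  "F \<asymp> G \<longleftrightarrow> (\<exists>(n::nat) P v. (\<forall>i<n. nice (P i)) \<and> F = (\<Sum>i<n. ind (P i)) \<and>
     G = (\<Sum>i<n. ind ((+) (v i) ` P i)))"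

lemma eqf_sum:
  assumes "finite I" "\<And>i. i \<in> I \<Longrightarrow> nice (P i)"
  shows "(\<Sum>i\<in>I. ind (P i)) \<asymp> (\<Sum>i\<in>I. ind ((+) (v i) ` P i))"
proof -
  obtain h where h: "bij_betw h {..<card I} I"
    using assms(1) ex_bij_betw_nat_finite lessThan_atLeast0 by metis
  have "(\<Sum>i\<in>I. f i) = (\<Sum>i<card I. f (h i))" for f :: "_ \<Rightarrow> 'b \<Rightarrow> nat"
    using sum.reindex_bij_betw[OF h, of f] by simp
  then show ?thesis unfolding eqf_def using assms(2) h
    by (intro exI[of _ "card I"] exI[of _ "\<lambda>i. P (h i)"] exI[of _ "\<lambda>i. v (h i)"])
       (auto simp: bij_betw_def)
qed

lemma eqf_translate: "nice A \<Longrightarrow> ind A \<asymp> ind ((+) v ` A)"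
  using eqf_sum[of "{()}" "\<lambda>_. A" "\<lambda>_. v"] by simp

lemma eqf_ind: "nice A \<Longrightarrow> ind A \<asymp> ind A"
  using eqf_translate[of A 0] by simp

lemma eqf_0: "0 \<asymp> 0"
  using eqf_sum[of "{}"] by simp

lemma eqf_sym:
  assumes "F \<asymp> G" shows "G \<asymp> F"
proof -
  obtain n :: nat and P v where *: "\<And>i. i < n \<Longrightarrow> nice (P i)" "F = (\<Sum>i<n. ind (P i))"
     "G = (\<Sum>i<n. ind ((+) (v i) ` P i))" using assms unfolding eqf_def by auto
  have "(\<Sum>i<n. ind ((+) (v i) ` P i)) \<asymp> (\<Sum>i<n. ind ((+) (- v i) ` (+) (v i) ` P i))"
    using * by (intro eqf_sum) (auto intro: nice_translation)
  then show ?thesis using * by (simp add: image_image)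
qed

lemma eqf_add:
  assumes "F \<asymp> G" "F' \<asymp> G'" shows "F + F' \<asymp> G + G'"
proof -
  obtain n :: nat and P v where *: "\<And>i. i < n \<Longrightarrow> nice (P i)" "F = (\<Sum>i<n. ind (P i))"
     "G = (\<Sum>i<n. ind ((+) (v i) ` P i))" using assms unfolding eqf_def by auto
  obtain n' :: nat and P' v' where *: "\<And>i. i < n' \<Longrightarrow> nice (P' i)" "F' = (\<Sum>i<n'. ind (P' i))"
     "G' = (\<Sum>i<n'. ind ((+) (v' i) ` P' i))" using assms unfolding eqf_def by auto
  have "(\<Sum>i\<in>{..<n} <+> {..<n'}. ind (case_sum P P' i)) \<asymp>
     (\<Sum>i\<in>{..<n} <+> {..<n'}. ind ((+) (case_sum v v' i) ` case_sum P P' i))"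
    using \<open>\<And>i. i < n \<Longrightarrow> nice (P i)\<close> \<open>\<And>i. i < n' \<Longrightarrow> nice (P' i)\<close>
    by (intro eqf_sum) auto
  then show ?thesis
    by (simp add: sum.Plus \<open>F = _\<close> \<open>G = _\<close> \<open>F' = _\<close> \<open>G' = _\<close>)
qed

lemma eqf_sum_family:
  assumes "finite I" "\<And>i. i \<in> I \<Longrightarrow> F i \<asymp> G i"
  shows "(\<Sum>i\<in>I. F i) \<asymp> (\<Sum>i\<in>I. G i)"
  using assms by (induction I rule: finite_induct) (auto intro: eqf_0 eqf_add)

lemma bij_betw_rank:
  fixes S :: "nat set"
  assumes "finite S"
  shows "bij_betw (\<lambda>s. card {t\<in>S. t < s}) S {..<card S}"
proof -
  have mono: "card {t\<in>S. t < s} < card {t\<in>S. t < s'}" if "s \<in> S" "s < s'" for s s'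
    using assms that by (intro psubset_card_mono) auto
  have "inj_on (\<lambda>s. card {t\<in>S. t < s}) S"
  proof (rule inj_onI)
    fix x y assume "x \<in> S" "y \<in> S" and e: "card {t\<in>S. t < x} = card {t\<in>S. t < y}"
    then show "x = y" using mono[of x y] mono[of y x] by (cases x y rule: linorder_cases) auto
  qed
  moreover have "card {t\<in>S. t < s} < card S" if "s \<in> S" for s
    using assms that by (intro psubset_card_mono) auto
  then have "(\<lambda>s. card {t\<in>S. t < s}) ` S \<subseteq> {..<card S}" by auto
  ultimately show ?thesis unfolding bij_betw_def
    by (intro conjI card_subset_eq) (auto simp: card_image)
qed

lemma Collect_eq_singletonI:
  "a \<in> I \<Longrightarrow> Q a \<Longrightarrow> (\<And>b. b \<in> I \<Longrightarrow> Q b \<Longrightarrow> b = a) \<Longrightarrow> {b\<in>I. Q b} = {a}"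
  by blast

text \<open>Two partitions of the same multiset function are refined by matching, at every point, the
  \<open>r\<close>-th piece of the first family that contains it with the \<open>r\<close>-th one of the second.\<close>

lemma eqf_trans [trans]:
  assumes "F \<asymp> G" "G \<asymp> H" shows "F \<asymp> H"
proof -
  obtain n :: nat and A v where A: "\<And>i. i < n \<Longrightarrow> nice (A i)" "F = (\<Sum>i<n. ind (A i))"
     "G = (\<Sum>i<n. ind ((+) (v i) ` A i))" using assms(1) unfolding eqf_def by auto
  obtain m :: nat and B w where B: "\<And>i. i < m \<Longrightarrow> nice (B i)" "G = (\<Sum>i<m. ind (B i))"
     "H = (\<Sum>i<m. ind ((+) (w i) ` B i))" using assms(2) unfolding eqf_def by auto
  define A' where "A' i = (+) (v i) ` A i" for i
  have nA': "nice (A' i)" if "i < n" for i using A(1)[OF that] by (auto simp: A'_def nice_translation)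
  define S where "S x = {i\<in>{..<n}. x \<in> A' i}" for x
  define T where "T x = {j\<in>{..<m}. x \<in> B j}" for x
  have fin: "finite (S x)" "finite (T x)" for x by (auto simp: S_def T_def)
  have "card (S x) = card (T x)" for x
    using A(3) B(2) sum_ind_card[of "{..<n}" A' x] sum_ind_card[of "{..<m}" B x]
    by (simp add: S_def T_def A'_def)
  then have ST: "bij_betw (\<lambda>s. card {t\<in>S x. t < s}) (S x) {..<card (T x)}" for x
    using bij_betw_rank[OF fin(1), of x] by simp
  have TT: "bij_betw (\<lambda>s. card {t\<in>T x. t < s}) (T x) {..<card (T x)}" for x
    using bij_betw_rank[OF fin(2)] .
  define R where "R i j = {x \<in> A' i \<inter> B j. card {t\<in>S x. t < i} = card {t\<in>T x. t < j}}" for i j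
  have e1: "{t\<in>S x. t < i} = {t\<in>{..<min i n}. x \<in> A' t}" for x i by (auto simp: S_def)
  have e2: "{t\<in>T x. t < j} = {t\<in>{..<min j m}. x \<in> B t}" for x j by (auto simp: T_def)
  have nR: "nice (R i j)" if "i < n" "j < m" for i j
  proof -
    \<comment> \<open>Equality of the two ranks is split over its finitely many possible common
      values, and for each value both conditions are counts of nice sets.\<close>
    have "R i j = A' i \<inter> B j \<inter> (\<Union>c\<in>{..n}. {x. card {t\<in>{..<min i n}. x \<in> A' t} = c} \<inter> {x. card {t\<in>{..<min j m}. x \<in> B t} = c})"
    proof -
      have "card {t\<in>{..<min i n}. x \<in> A' t} \<le> n" for x
      proof -
        have "card {t\<in>{..<min i n}. x \<in> A' t} \<le> card {..<n}" by (intro card_mono) auto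
        then show ?thesis by simp
      qed
      then show ?thesis unfolding R_def e1 e2 by force
    qed
    moreover have "nice {x. card {t\<in>{..<min i n}. x \<in> A' t} = c}" for c
      using nA' nice_Collect_card[of "{..<min i n}" A' "\<lambda>k. k = c"] by auto
    moreover have "nice {x. card {t\<in>{..<min j m}. x \<in> B t} = c}" for c
      using B(1) nice_Collect_card[of "{..<min j m}" B "\<lambda>k. k = c"] by auto
    ultimately show ?thesis using nA' B(1) that by (auto intro!: nice_Int nice_UN)
  qed
  have s1: "(\<Sum>j<m. ind (R i j)) = ind (A' i)" if i: "i < n" for i
  proof
    fix x
    show "(\<Sum>j<m. ind (R i j)) x = ind (A' i) x"
    proof (cases "x \<in> A' i")
      case True
      then have "i \<in> S x" using i by (auto simp: S_def)
      then have "card {t\<in>S x. t < i} \<in> {..<card (T x)}" using bij_betwE[OF ST[of x]] by blast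
      then have "card {t\<in>S x. t < i} \<in> (\<lambda>s. card {t\<in>T x. t < s}) ` T x"
        using bij_betw_imp_surj_on[OF TT[of x]] by simp
      then obtain j where j: "j \<in> T x" "card {t\<in>T x. t < j} = card {t\<in>S x. t < i}"
        by (elim imageE) simp
      have "{j'\<in>{..<m}. x \<in> R i j'} = {j}"
      proof -
        have uniq: "j' = j" if "j' \<in> {..<m}" "x \<in> R i j'" for j'
        proof -
          have "j' \<in> T x" using that by (auto simp: T_def R_def)
          moreover have "card {t\<in>T x. t < j'} = card {t\<in>T x. t < j}" using that(2) j(2) unfolding R_def by simp
          ultimately show ?thesis using inj_onD[OF bij_betw_imp_inj_on[OF TT[of x]], of j' j] j(1) by blast
        qed
        have "j \<in> {..<m}" "x \<in> R i j" using j True unfolding R_def by (simp_all add: T_def)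
        then show ?thesis by (rule Collect_eq_singletonI) (rule uniq)
      qed
      then show ?thesis using True unfolding sum_ind_card[OF finite_lessThan] ind_def by simp
    next
      case False
      then have "{j'\<in>{..<m}. x \<in> R i j'} = {}" by (auto simp: R_def)
      then show ?thesis using False unfolding sum_ind_card[OF finite_lessThan] ind_def by simp
    qed
  qed
  have s2: "(\<Sum>i<n. ind (R i j)) = ind (B j)" if j: "j < m" for j
  proof
    fix x
    show "(\<Sum>i<n. ind (R i j)) x = ind (B j) x"
    proof (cases "x \<in> B j")
      case True
      then have "j \<in> T x" using j by (auto simp: T_def)
      then have "card {t\<in>T x. t < j} \<in> {..<card (T x)}" using bij_betwE[OF TT[of x]] by blast
      then have "card {t\<in>T x. t < j} \<in> (\<lambda>s. card {t\<in>S x. t < s}) ` S x"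
        using bij_betw_imp_surj_on[OF ST[of x]] by simp
      then obtain i where i: "i \<in> S x" "card {t\<in>S x. t < i} = card {t\<in>T x. t < j}"
        by (elim imageE) simp
      have "{i'\<in>{..<n}. x \<in> R i' j} = {i}"
      proof -
        have uniq: "i' = i" if "i' \<in> {..<n}" "x \<in> R i' j" for i'
        proof -
          have "i' \<in> S x" using that by (auto simp: S_def R_def)
          moreover have "card {t\<in>S x. t < i'} = card {t\<in>S x. t < i}" using that(2) i(2) unfolding R_def by simp
          ultimately show ?thesis using inj_onD[OF bij_betw_imp_inj_on[OF ST[of x]], of i' i] i(1) by blast
        qed
        have "i \<in> {..<n}" "x \<in> R i j" using i True unfolding R_def by (simp_all add: S_def)
        then show ?thesis by (rule Collect_eq_singletonI) (rule uniq)
      qed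
      then show ?thesis using True unfolding sum_ind_card[OF finite_lessThan] ind_def by simp
    next
      case False
      then have "{i'\<in>{..<n}. x \<in> R i' j} = {}" by (auto simp: R_def)
      then show ?thesis using False unfolding sum_ind_card[OF finite_lessThan] ind_def by simp
    qed
  qed
  have tr: "(\<lambda>x. f (x - u)) = (\<Sum>i\<in>I. (\<lambda>x. g i (x - u)))" if "f = (\<Sum>i\<in>I. g i)" for f u and I :: "nat set" and g :: "nat \<Rightarrow> 'a \<Rightarrow> nat"
    using that by (auto simp: fun_eq_iff sum_fun_apply)
  have it: "ind ((+) u ` C) = (\<lambda>x. ind C (x - u))" for u :: 'a and C
  proof
    fix x :: 'a
    have "x \<in> (+) u ` C \<longleftrightarrow> x - u \<in> C" by (metis add_diff_cancel_left' diff_add_cancel add.commute image_iff)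
    then show "ind ((+) u ` C) x = ind C (x - u)" by (simp add: ind_def)
  qed
  let ?I = "{..<n} \<times> {..<m}"
  \<comment> \<open>The piece matched for i and j lives in the middle multiset; it is pulled back by
    - v i to the first one and travels to the third one by v i + w j.\<close>
  have "(\<Sum>(i,j)\<in>?I. ind ((+) (- v i) ` R i j)) \<asymp>
      (\<Sum>(i,j)\<in>?I. ind ((+) (v i + w j) ` (+) (- v i) ` R i j))"
  proof -
    have "(\<Sum>p\<in>?I. ind ((+) (- v (fst p)) ` R (fst p) (snd p))) \<asymp>
      (\<Sum>p\<in>?I. ind ((+) (v (fst p) + w (snd p)) ` (+) (- v (fst p)) ` R (fst p) (snd p)))"
      by (intro eqf_sum nice_translation nR) auto
    then show ?thesis by (simp add: case_prod_beta)
  qed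
  also have "(\<Sum>(i,j)\<in>?I. ind ((+) (- v i) ` R i j)) = F"
  proof -
    have "(\<Sum>(i,j)\<in>?I. ind ((+) (- v i) ` R i j)) = (\<Sum>i<n. \<Sum>j<m. ind ((+) (- v i) ` R i j))"
      by (simp add: sum.cartesian_product)
    also have "\<dots> = (\<Sum>i<n. ind (A i))"
    proof (intro sum.cong refl)
      fix i assume "i \<in> {..<n}"
      then have "ind (A' i) = (\<Sum>j<m. ind (R i j))" using s1 by auto
      then have "(\<lambda>x. ind (A' i) (x - (- v i))) = (\<Sum>j<m. ind ((+) (- v i) ` R i j))"
        using tr[of "ind (A' i)" "\<lambda>j. ind (R i j)" "{..<m}" "- v i"] unfolding it by simp
      moreover have "(\<lambda>x. ind (A' i) (x - (- v i))) = ind (A i)"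
        by (auto simp: A'_def ind_def fun_eq_iff image_iff)
      ultimately show "(\<Sum>j<m. ind ((+) (- v i) ` R i j)) = ind (A i)" by simp
    qed
    finally show ?thesis using A by simp
  qed
  also have "(\<Sum>(i,j)\<in>?I. ind ((+) (v i + w j) ` (+) (- v i) ` R i j)) = H"
  proof -
    have "(\<Sum>(i,j)\<in>?I. ind ((+) (v i + w j) ` (+) (- v i) ` R i j)) = (\<Sum>(i,j)\<in>?I. ind ((+) (w j) ` R i j))"
      by (simp add: image_image algebra_simps)
    also have "\<dots> = (\<Sum>i<n. \<Sum>j<m. ind ((+) (w j) ` R i j))"
      by (simp add: sum.cartesian_product)
    also have "\<dots> = (\<Sum>j<m. \<Sum>i<n. ind ((+) (w j) ` R i j))" by (rule sum.swap)
    also have "\<dots> = (\<Sum>j<m. ind ((+) (w j) ` B j))"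
    proof (intro sum.cong refl)
      fix j assume "j \<in> {..<m}"
      then have "ind (B j) = (\<Sum>i<n. ind (R i j))" using s2 by auto
      then have "(\<lambda>x. ind (B j) (x - w j)) = (\<Sum>i<n. ind ((+) (w j) ` R i j))"
        using tr[of "ind (B j)" "\<lambda>i. ind (R i j)" "{..<n}" "w j"] unfolding it by simp
      then show "(\<Sum>i<n. ind ((+) (w j) ` R i j)) = ind ((+) (w j) ` B j)" using it by simp
    qed
    finally show ?thesis using B by simp
  qed
  finally show ?thesis .
qed

text \<open>Sets that occur on both sides act as catalysts, and a catalyst may be enlarged.\<close>

lemma eqf_cat:
  assumes "F + ind M \<asymp> G + ind M" "M \<subseteq> K" "nice M" "nice K"
  shows "F + ind K \<asymp> G + ind K"
proof -
  have "ind K = ind M + ind (K - M)"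
    using assms(2) ind_Un[of M "K - M"] by (simp add: Un_absorb1)
  then show ?thesis
    using eqf_add[OF assms(1) eqf_ind[OF nice_Diff[OF assms(4,3)]]] by (simp add: add.assoc)
qed

subsection \<open>Paths of steps \<open>1\<close>, \<open>\<lambda>\<close> and \<open>\<lambda>\<^sup>2\<close>\<close>

definition lam :: real where "lam = (SOME x. 0.682 < x \<and> x < 0.683 \<and> x ^ 3 + x = 1)"

lemma lam: "0.682 < lam" "lam < 0.683" "lam ^ 3 + lam = 1"
proof -
  have "\<exists>x\<ge>0.682. x \<le> 0.683 \<and> x ^ 3 + x = (1::real)"
    by (rule IVT') (auto intro!: continuous_intros simp: power3_eq_cube)
  then obtain x :: real where x: "0.682 \<le> x" "x \<le> 0.683" "x ^ 3 + x = 1" by blast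
  moreover have "(0.682::real) ^ 3 + 0.682 \<noteq> 1" "(0.683::real) ^ 3 + 0.683 \<noteq> 1"
    by (simp_all add: power3_eq_cube)
  then have "x \<noteq> 0.682" "x \<noteq> 0.683" using x(3) by metis+
  ultimately have "0.682 < x \<and> x < 0.683 \<and> x ^ 3 + x = 1" by auto
  then have "0.682 < lam \<and> lam < 0.683 \<and> lam ^ 3 + lam = 1"
    unfolding lam_def by (rule someI)
  then show "0.682 < lam" "lam < 0.683" "lam ^ 3 + lam = 1" by auto
qed

lemma lam_pos [simp]: "0 < lam" and lam_less_1 [simp]: "lam < 1" and lam_nz [simp]: "lam \<noteq> 0"
  using lam by auto

lemma lam_le_1 [simp]: "lam \<le> 1" and lam_ge_0 [simp]: "0 \<le> lam"
  using lam by auto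

lemma lam_pow_le_1 [simp]: "lam ^ n \<le> 1" and lam_pow_pos [simp]: "0 < lam ^ n" and lam_pow_ge_0 [simp]: "0 \<le> lam ^ n"
  by (auto simp: power_le_one)

lemma lam_cube: "lam ^ 3 = 1 - lam" using lam by simp

lemma lam_pow_add3: "lam ^ (n + 3) + lam ^ (n + 1) = lam ^ n"
proof -
  have "lam ^ (n + 3) + lam ^ (n + 1) = lam ^ n * (lam ^ 3 + lam)"
    by (simp only: power_add power_one_right distrib_left)
  then show ?thesis using lam by simp
qed

text \<open>A displacement by \<open>lam ^ n\<close> is realised by a path whose steps are displacements by
  \<open>1\<close>, \<open>lam\<close> and \<open>lam\<^sup>2\<close> (letters \<open>0\<close>, \<open>1\<close> and \<open>2\<close>): since \<open>lam ^ (n + 3) = lam ^ n - lam ^ (n + 1)\<close>,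
  run the path for \<open>lam ^ n\<close> and then the path for \<open>lam ^ (n + 1)\<close> backwards. An entry \<open>(g, x)\<close>
  records that the step between \<open>x\<close> and \<open>x + lam ^ g\<close> is used, in either direction.\<close>

fun path_steps :: "nat \<Rightarrow> (nat \<times> real) list" where
  "path_steps 0 = [(0, 0)]"
| "path_steps (Suc 0) = [(1, 0)]"
| "path_steps (Suc (Suc 0)) = [(2, 0)]"
| "path_steps (Suc (Suc (Suc n))) =
     path_steps n @ rev (map (\<lambda>(g, x). (g, x + lam ^ (n + 3))) (path_steps (Suc n)))"

lemma path_steps_add3:
  "path_steps (n + 3) = path_steps n @ rev (map (\<lambda>(g, x). (g, x + lam ^ (n + 3))) (path_steps (n + 1)))"
  by (simp add: numeral_3_eq_3)

lemma three_step_induct: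
  assumes "P 0" "P 1" "P 2" "\<And>n. P n \<Longrightarrow> P (n + 1) \<Longrightarrow> P (n + 2) \<Longrightarrow> P (n + 3)"
  shows "P (n::nat)"
proof -
  have "P n \<and> P (n + 1) \<and> P (n + 2)"
    using assms by (induction n) (auto simp: numeral_2_eq_2 numeral_3_eq_3)
  then show ?thesis by auto
qed

lemma path_steps_nonempty [simp]: "path_steps n \<noteq> []"
  by (induction n rule: three_step_induct) (auto simp: numeral_2_eq_2 path_steps_add3)

lemma path_steps_letter: "(g, x) \<in> set (path_steps n) \<Longrightarrow> g < 3"
  by (induction n arbitrary: x rule: three_step_induct) (auto simp: numeral_2_eq_2 path_steps_add3)

definition touches :: "nat \<times> real \<Rightarrow> real \<Rightarrow> bool" where
  "touches p t \<longleftrightarrow> t = snd p \<or> t = snd p + lam ^ fst p"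

lemma touches_shift: "touches ((\<lambda>(g, x). (g, x + c)) p) (t + c) = touches p t"
  by (auto simp: touches_def split: prod.splits)

text \<open>The second half of the recursion is shifted by \<open>lam ^ (n + 3)\<close> and
  reversed, so it begins at \<open>lam ^ (n + 1) + lam ^ (n + 3) = lam ^ n\<close>, where the first
  half ends, and finishes at \<open>lam ^ (n + 3)\<close>.\<close>

lemma path_steps_path:
  "touches (hd (path_steps n)) 0 \<and> touches (last (path_steps n)) (lam ^ n) \<and>
   successively (\<lambda>p q. \<exists>t. touches p t \<and> touches q t) (path_steps n)"
proof (induction n rule: three_step_induct)
  case (4 n)
  let ?s = "\<lambda>(g, x). (g, x + lam ^ (n + 3))"
  let ?R = "\<lambda>p q. \<exists>t. touches p t \<and> touches q t"
  have e: "lam ^ (n + 1) + lam ^ (n + 3) = lam ^ n" using lam_pow_add3[of n] by linarith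
  have l: "touches (?s (last (path_steps (n + 1)))) (lam ^ n)"
    using 4(2) touches_shift[of "lam ^ (n + 3)" "last (path_steps (n + 1))" "lam ^ (n + 1)"]
    unfolding e by blast
  have f: "touches (?s (hd (path_steps (n + 1)))) (lam ^ (n + 3))"
    using 4(2) touches_shift[of "lam ^ (n + 3)" "hd (path_steps (n + 1))" 0]
    unfolding add_0 by blast
  have "successively ?R (map ?s (path_steps (n + 1)))"
    unfolding successively_map
    by (rule successively_mono[where P = ?R]) (use 4(2) touches_shift in blast)+
  then have "successively ?R (rev (map ?s (path_steps (n + 1))))"
    unfolding successively_rev by (rule successively_mono) auto
  moreover have "?R (last (path_steps n)) (hd (rev (map ?s (path_steps (n + 1)))))"
    using 4(1) l by (auto simp: hd_rev last_map)
  ultimately show ?case using 4(1) f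
    by (auto simp: path_steps_add3 successively_append_iff last_rev hd_map)
qed (auto simp: touches_def numeral_2_eq_2)

text \<open>The lengths satisfy the recursion L (n + 3) = L n + L (n + 1), whose growth rate is the
  real root 1.3247... of x^3 = x + 1. The rational number 1.33 lies slightly above it, that is, 1 +
  1.33 is at most the cube of 1.33.\<close>

lemma length_path_steps: "real (length (path_steps n)) \<le> 2 * 1.33 ^ n"
proof (induction n rule: three_step_induct)
  case (4 n)
  have "real (length (path_steps (n + 3))) \<le> 2 * 1.33 ^ n + 2 * 1.33 ^ (n + 1)"
    using 4(1,2) by (simp add: path_steps_add3)
  also have "\<dots> = 2 * 1.33 ^ n * (1 + 1.33)" by (simp add: algebra_simps)
  also have "\<dots> \<le> 2 * 1.33 ^ n * 1.33 ^ 3" by (intro mult_left_mono) (auto simp: power3_eq_cube)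
  also have "\<dots> = 2 * 1.33 ^ (n + 3)" by (simp add: power_add)
  finally show ?case .
qed (auto simp: numeral_2_eq_2)

section \<open>Lanes of the paths: multiplicity, range and disjointness\<close>

definition lane_count :: "nat \<Rightarrow> nat \<Rightarrow> real \<Rightarrow> nat" where
  "lane_count n g x = count_list (path_steps n) (g, x)"

lemma lane_count_pos: "lane_count n g x > 0 \<longleftrightarrow> (g, x) \<in> set (path_steps n)"
  unfolding lane_count_def neq0_conv[symmetric] count_list_0_iff by simp

lemma count_list_shift: "count_list (map (\<lambda>(g, x). (g, x + c)) xs) (g, x) = count_list xs (g, x - c)"
  for c :: real
  by (induction xs) auto

lemma lane_count_add3: "lane_count (n + 3) g x = lane_count n g x + lane_count (n + 1) g (x - lam ^ (n + 3))"
  unfolding lane_count_def path_steps_add3 by (simp add: count_list_shift count_list_rev)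

text \<open>Reading the same recursion from the other end: every step of length \<open>lam ^ 3\<close> is replaced by
  one of length \<open>1\<close> and one of length \<open>lam\<close>.\<close>

lemma lane_count_Suc:
  "lane_count (Suc n) 0 x = lane_count n 2 (x / lam) \<and>
   lane_count (Suc n) 1 x = lane_count n 0 (x / lam) + lane_count n 2 ((x - lam ^ 3) / lam) \<and>
   lane_count (Suc n) 2 x = lane_count n 1 (x / lam)"
proof (induction n arbitrary: x rule: three_step_induct)
  case 3
  have "lane_count (Suc 2) g x = lane_count 0 g x + lane_count 1 g (x - lam ^ 3)" for g
    using lane_count_add3[of 0 g x] by (simp add: numeral_3_eq_3 numeral_2_eq_2)
  then show ?case by (auto simp: lane_count_def numeral_2_eq_2)
next
  case (4 n)
  have e: "Suc (n + 3) = Suc n + 3" "Suc n + 1 = Suc (n + 1)" "Suc n + 3 = Suc (n + 3)" by auto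
  have d: "(x - lam ^ (Suc n + 3)) / lam = x / lam - lam ^ (n + 3)"
    "(x - lam ^ (Suc n + 3) - lam ^ 3) / lam = (x - lam ^ 3) / lam - lam ^ (n + 3)" for x
    by (simp_all only: add_Suc power_Suc diff_divide_distrib nonzero_mult_div_cancel_left[OF lam_nz])
  show ?case unfolding e(1) lane_count_add3 e(2)
    using 4(1)[of x] 4(2)[of "x - lam ^ (Suc n + 3)"] unfolding d by linarith
qed (auto simp: lane_count_def numeral_2_eq_2)

lemma div_lam_nonneg [simp]: "0 \<le> x / lam \<longleftrightarrow> 0 \<le> x"
  by (meson divide_nonneg_pos lam_pos not_le divide_neg_pos)

lemma div_lam_less:
  assumes "x / lam + lam ^ n * z < c" shows "x + lam ^ Suc n * z < lam * c"
proof -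
  have "lam * (x / lam + lam ^ n * z) < lam * c" using assms by (intro mult_strict_left_mono) auto
  then show ?thesis by (simp add: distrib_left mult.assoc)
qed

lemma lane_range:
  assumes "lane_count n g x > 0" "0 \<le> z" "z < lam\<^sup>2"
  shows "0 \<le> x \<and> (g = 0 \<longrightarrow> n = 0 \<and> x = 0 \<or> x + lam ^ n * z < lam\<^sup>2 / (1 + lam)) \<and>
    (g = 1 \<longrightarrow> x + lam ^ n * z < 1 / (1 + lam)) \<and> (g = 2 \<longrightarrow> x + lam ^ n * z < lam / (1 + lam))"
  using assms(1)
proof (induction n arbitrary: g x)
  case 0
  then show ?case by (auto simp: lane_count_def split: if_splits)
next
  case (Suc n)
  have "g < 3" using Suc.prems path_steps_letter lane_count_pos by blast
  then consider "g = 0" | "g = 1" | "g = 2" by linarith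
  then show ?case
  proof cases
    case 1
    then have *: "lane_count n 2 (x / lam) > 0" using Suc.prems lane_count_Suc by simp
    then have r: "0 \<le> x / lam" "x / lam + lam ^ n * z < lam / (1 + lam)" using Suc.IH[OF *] by auto
    have "0 \<le> x" "x + lam ^ Suc n * z < lam * (lam / (1 + lam))"
      using r(1) div_lam_less[OF r(2)] by simp_all
    then show ?thesis using 1 by (simp add: power2_eq_square)
  next
    case 3
    then have *: "lane_count n 1 (x / lam) > 0" using Suc.prems lane_count_Suc by simp
    then have r: "0 \<le> x / lam" "x / lam + lam ^ n * z < 1 / (1 + lam)" using Suc.IH[OF *] by auto
    have "0 \<le> x" "x + lam ^ Suc n * z < lam * (1 / (1 + lam))"
      using r(1) div_lam_less[OF r(2)] by simp_all
    then show ?thesis using 3 by simp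
  next
    case 2
    then consider "lane_count n 0 (x / lam) > 0" | "lane_count n 2 ((x - lam ^ 3) / lam) > 0"
      using Suc.prems lane_count_Suc[of n x] by auto
    then show ?thesis
    proof cases
      case 1
      then have r: "0 \<le> x / lam" "n = 0 \<and> x / lam = 0 \<or> x / lam + lam ^ n * z < lam\<^sup>2 / (1 + lam)" using Suc.IH[OF 1] by auto
      have "x / lam + lam ^ n * z < lam\<^sup>2"
        using r(2)
      proof
        assume "x / lam + lam ^ n * z < lam\<^sup>2 / (1 + lam)"
        moreover have "lam\<^sup>2 / (1 + lam) \<le> lam\<^sup>2" by (simp add: divide_le_eq)
        ultimately show ?thesis by linarith
      qed (use assms in auto)
      then have "x + lam ^ Suc n * z < lam ^ 3" using div_lam_less[of x n z "lam\<^sup>2"]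
        by (simp add: power3_eq_cube power2_eq_square)
      moreover have "lam ^ 3 \<le> 1 / (1 + lam)"
      proof -
        have "(1 - lam) * (1 + lam) \<le> 1" by (simp add: algebra_simps)
        then show ?thesis unfolding lam_cube by (simp add: pos_le_divide_eq add_pos_pos)
      qed
      ultimately show ?thesis using r(1) 2 by auto
    next
      case 2
      then have r: "0 \<le> (x - lam ^ 3) / lam" "(x - lam ^ 3) / lam + lam ^ n * z < lam / (1 + lam)" using Suc.IH[OF 2] by auto
      then have "x - lam ^ 3 + lam ^ Suc n * z < lam\<^sup>2 / (1 + lam)"
        using div_lam_less[OF r(2)] by (simp add: power2_eq_square)
      moreover have "lam ^ 3 + lam\<^sup>2 / (1 + lam) = 1 / (1 + lam)"
      proof -
        have "1 + lam \<noteq> 0" using lam by auto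
        then show ?thesis unfolding lam_cube by (simp add: field_simps power2_eq_square)
      qed
      moreover have "0 \<le> x - lam ^ 3" using r(1) by simp
      then have "0 \<le> x" using lam_pow_ge_0[of 3] by linarith
      ultimately show ?thesis using \<open>g = 1\<close> by auto
    qed
  qed
qed

lemma lane_nonneg: "(g, x) \<in> set (path_steps n) \<Longrightarrow> 0 \<le> x"
  using lane_range[of n g x 0] lane_count_pos by auto

lemma lane_less_1: "(g, x) \<in> set (path_steps n) \<Longrightarrow> x < 1"
proof -
  assume a: "(g, x) \<in> set (path_steps n)"
  then have "g < 3" by (rule path_steps_letter)
  then have "g = 0 \<or> g = 1 \<or> g = 2" by auto
  moreover have p: "0 < 1 + lam" "lam\<^sup>2 < 1 + lam" using lam_pow_le_1[of 2] lam_pos by linarith+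
  have "1 / (1 + lam) < 1" "lam / (1 + lam) < 1" "lam\<^sup>2 / (1 + lam) < 1"
    using p(2) by (simp_all add: pos_divide_less_eq[OF p(1)])
  ultimately show ?thesis using lane_range[of n g x 0] a lane_count_pos by auto
qed

text \<open>Letter 1 has two origins in the substitution, and the height \<open>lam ^ 3\<close>
  separates them: what comes from letter 0 stays below it, because before scaling its height is less
  than \<open>lam\<^sup>2\<close>; what comes from letter 2 starts at or above it. So the height of
  a point reveals the origin of its lane.\<close>

lemma lane_step1_cases:
  assumes "lane_count (Suc n) 1 x > 0" "0 \<le> z" "z < lam\<^sup>2"
  shows "lane_count n 0 (x / lam) > 0 \<and> lane_count n 2 ((x - lam ^ 3) / lam) = 0 \<and> x + lam ^ Suc n * z < lam ^ 3 \<or>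
    lane_count n 2 ((x - lam ^ 3) / lam) > 0 \<and> lane_count n 0 (x / lam) = 0 \<and> lam ^ 3 \<le> x + lam ^ Suc n * z"
proof -
  have A: "x + lam ^ Suc n * z < lam ^ 3" if "lane_count n 0 (x / lam) > 0" "0 \<le> z" "z < lam\<^sup>2" for z
  proof -
    have "n = 0 \<and> x / lam = 0 \<or> x / lam + lam ^ n * z < lam\<^sup>2 / (1 + lam)" using lane_range[OF that] by blast
    then have "x / lam + lam ^ n * z < lam\<^sup>2"
    proof
      assume "x / lam + lam ^ n * z < lam\<^sup>2 / (1 + lam)"
      moreover have "lam\<^sup>2 / (1 + lam) \<le> lam\<^sup>2" by (simp add: divide_le_eq)
      ultimately show ?thesis by linarith
    qed (use that in auto)
    then show ?thesis using div_lam_less[of x n z "lam\<^sup>2"]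
      by (simp add: power3_eq_cube power2_eq_square)
  qed
  have B: "lam ^ 3 \<le> x" if "lane_count n 2 ((x - lam ^ 3) / lam) > 0"
    using lane_range[OF that, of 0] by simp
  have "0 \<le> lam ^ Suc n * z" using assms by simp
  then show ?thesis using A[OF _ assms(2,3)] B assms(1) lane_count_Suc[of n x]
    using A[of 0] by (cases "lane_count n 0 (x / lam) > 0") auto
qed

text \<open>Division by \<open>lam\<close> undoes one substitution step for both lanes together: the
  letter, and for letter 1 the side of \<open>lam ^ 3\<close>, tells which step it was. Only the
  letter has to agree, the scales n and n' may differ. The induction ends at the lane with n = 0,
  whose points have height z at least \<open>lam\<^sup>2 / (1 + lam)\<close> and so lie above all
  other lanes of letter 0. This is the origin of the lower end of the window for z; its upper end
  comes from \<open>lane_step1_cases\<close>.\<close>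

lemma lanes_disjoint:
  assumes "lane_count n g x > 0" "lane_count n' g x' > 0" "x + lam ^ n * z = x' + lam ^ n' * z'"
    and z: "lam\<^sup>2 / (1 + lam) \<le> z" "z < lam\<^sup>2" "lam\<^sup>2 / (1 + lam) \<le> z'" "z' < lam\<^sup>2"
  shows "n = n' \<and> x = x'"
  using assms(1-3)
proof (induction n arbitrary: g x n' x')
  case 0
  then have x: "g = 0" "x = 0" by (auto simp: lane_count_def split: if_splits)
  have z0: "0 \<le> z'" using z(3) by (rule order_trans[rotated]) auto
  then show ?case using lane_range[OF 0(2) z0 z(4)] 0(3) x z by auto
next
  case (Suc n)
  have z0: "0 \<le> z" "0 \<le> z'" using z(1,3) by (auto intro: order_trans[rotated])
  show ?case
  proof (cases n')
    case 0
    then have x: "g = 0" "x' = 0" using Suc.prems by (auto simp: lane_count_def split: if_splits)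
    then show ?thesis using lane_range[OF Suc.prems(1) z0(1) z(2)] Suc.prems(3) 0 z by auto
  next
    case (Suc m)
    have sc: "x / lam + lam ^ n * z = x' / lam + lam ^ m * z'"
    proof -
      have "(x + lam ^ Suc n * z) / lam = (x' + lam ^ Suc m * z') / lam" using Suc.prems Suc by simp
      then show ?thesis by (simp add: add_divide_distrib)
    qed
    then have sc': "(x - lam ^ 3) / lam + lam ^ n * z = (x' - lam ^ 3) / lam + lam ^ m * z'"
      by (simp add: diff_divide_distrib)
    have "g < 3" using Suc.prems path_steps_letter lane_count_pos by blast
    then consider "g = 0" | "g = 1" | "g = 2" by linarith
    then show ?thesis
    proof cases
      case 1
      then show ?thesis using Suc.IH[of 2 "x / lam" m "x' / lam"] Suc.prems Suc lane_count_Suc sc by auto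
    next
      case 3
      then show ?thesis using Suc.IH[of 1 "x / lam" m "x' / lam"] Suc.prems Suc lane_count_Suc sc by auto
    next
      case 2
      have a: "lane_count (Suc n) 1 x > 0" "lane_count (Suc m) 1 x' > 0" using Suc.prems Suc 2 by auto
      from lane_step1_cases[OF a(1) z0(1) z(2)] lane_step1_cases[OF a(2) z0(2) z(4)] Suc.prems(3) Suc
      consider "lane_count n 0 (x / lam) > 0" "lane_count m 0 (x' / lam) > 0"
        | "lane_count n 2 ((x - lam ^ 3) / lam) > 0" "lane_count m 2 ((x' - lam ^ 3) / lam) > 0"
        by fastforce
      then show ?thesis
      proof cases
        case 1
        then show ?thesis using Suc.IH[of 0 "x / lam" m "x' / lam"] Suc sc by auto
      next
        case 2
        then show ?thesis using Suc.IH[of 2 "(x - lam ^ 3) / lam" m "(x' - lam ^ 3) / lam"] Suc sc' by auto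
      qed
    qed
  qed
qed

lemma lane_count_le_1: "lane_count n g x \<le> 1"
proof (induction n arbitrary: g x)
  case 0
  then show ?case by (auto simp: lane_count_def)
next
  case (Suc n)
  show ?case
  proof (cases "lane_count (Suc n) g x > 0")
    case True
    then have "g < 3" using path_steps_letter lane_count_pos by blast
    then consider "g = 0" | "g = 1" | "g = 2" by linarith
    then show ?thesis
    proof cases
      case 2
      have "lane_count n 2 ((x - lam ^ 3) / lam) = 0 \<or> lane_count n 0 (x / lam) = 0"
        using lane_step1_cases[of n x 0] True 2 by auto
      then show ?thesis using Suc.IH[of 0 "x / lam"] Suc.IH[of 2 "(x - lam ^ 3) / lam"] lane_count_Suc[of n x] 2 by auto
    qed (use Suc.IH lane_count_Suc in auto)
  qed auto
qed

lemma distinct_if_count_list_le_1: "(\<And>a. count_list xs a \<le> 1) \<Longrightarrow> distinct xs"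
proof (induction xs)
  case (Cons b xs)
  have "count_list xs a \<le> 1" for a using Cons.prems[of a] by (simp split: if_splits)
  moreover have "count_list xs b = 0" using Cons.prems[of b] by simp
  ultimately show ?case using Cons.IH by (simp add: count_list_0_iff)
qed auto

lemma distinct_path_steps: "distinct (path_steps n)"
proof (rule distinct_if_count_list_le_1)
  show "count_list (path_steps n) a \<le> 1" for a
    using lane_count_le_1[of n "fst a" "snd a"] by (simp add: lane_count_def)
qed

lemma path_steps_mem_add3:
  "(g, x) \<in> set (path_steps (n + 3)) \<longleftrightarrow>
   (g, x) \<in> set (path_steps n) \<or> (g, x - lam ^ (n + 3)) \<in> set (path_steps (n + 1))"
  using lane_count_add3[of n g x] lane_count_pos[of _ g] by (metis add_gr_0)

text \<open>The path for n + j is the path for j with every step of letter i, scaled by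
  \<open>lam ^ n\<close>, replaced by the path for n + i or its reversal. Hence lanes of all later
  levels sit near few base points.\<close>

lemma path_steps_compose:
  "(g, x) \<in> set (path_steps (n + j)) \<Longrightarrow>
   \<exists>i y x'. i < 3 \<and> (g, x') \<in> set (path_steps (n + i)) \<and> (i, y) \<in> set (path_steps j) \<and> x = x' + lam ^ n * y"
proof (induction j arbitrary: x rule: three_step_induct)
  case (4 j)
  have "(g, x) \<in> set (path_steps (n + j + 3))" using 4(4) by (simp only: add.assoc)
  then consider "(g, x) \<in> set (path_steps (n + j))" | "(g, x - lam ^ (n + j + 3)) \<in> set (path_steps (n + (j + 1)))"
    unfolding path_steps_mem_add3 by (metis add.assoc)
  then show ?case
  proof cases
    case 1
    then obtain i y x' where *: "i < 3" "(g, x') \<in> set (path_steps (n + i))" "(i, y) \<in> set (path_steps j)"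
      "x = x' + lam ^ n * y" using 4(1)[of x] by blast
    moreover have "(i, y) \<in> set (path_steps (j + 3))"
      using *(3) unfolding path_steps_mem_add3 by blast
    ultimately show ?thesis by blast
  next
    case 2
    then obtain i y x' where *: "i < 3" "(g, x') \<in> set (path_steps (n + i))" "(i, y) \<in> set (path_steps (j + 1))"
      "x - lam ^ (n + j + 3) = x' + lam ^ n * y" using 4(2)[of "x - lam ^ (n + j + 3)"] by blast
    have "(i, y + lam ^ (j + 3)) \<in> set (path_steps (j + 3))"
      using *(3) unfolding path_steps_mem_add3 by simp
    moreover have "x = x' + lam ^ n * (y + lam ^ (j + 3))"
      using *(4) by (simp add: power_add algebra_simps)
    ultimately show ?thesis using * by blast
  qed
next
  case 1
  then show ?case by (intro exI[of _ "0::nat"] exI[of _ 0] exI[of _ x]) simp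
next
  case 2
  then show ?case by (intro exI[of _ "1::nat"] exI[of _ 0] exI[of _ x]) simp
next
  case 3
  then show ?case by (intro exI[of _ "2::nat"] exI[of _ 0] exI[of _ x]) (simp add: numeral_2_eq_2)
qed

subsection \<open>Unions over all scales\<close>

text \<open>The class Delta^0_2. It is closed under complements and finite unions, and countable
  unions of its members are F_sigma; the algebra \<open>boolean_fsigma\<close> itself would not
  allow the infinite unions over all scales.\<close>

definition delta2 :: "'a::metric_space set \<Rightarrow> bool" where
  "delta2 A \<longleftrightarrow> fsigma_in euclidean A \<and> fsigma_in euclidean (- A)"

lemma delta2_closed: "closed A \<Longrightarrow> delta2 A"
  unfolding delta2_def
  by (metis closed_closedin closed_imp_fsigma_in metrizable_space_euclidean open_Compl open_imp_fsigma_in open_openin)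

lemma delta2_Compl: "delta2 A \<Longrightarrow> delta2 (- A)"
  unfolding delta2_def by simp

lemma delta2_open: "open A \<Longrightarrow> delta2 A"
  using delta2_closed[of "- A"] delta2_Compl[of "- A"] by (simp add: closed_Compl)

lemma delta2_Un: "delta2 A \<Longrightarrow> delta2 B \<Longrightarrow> delta2 (A \<union> B)"
  unfolding delta2_def by (simp add: fsigma_in_Un fsigma_in_Int)

lemma delta2_Int: "delta2 A \<Longrightarrow> delta2 B \<Longrightarrow> delta2 (A \<inter> B)"
  unfolding delta2_def by (simp add: fsigma_in_Un fsigma_in_Int)

lemma delta2_UN: "finite I \<Longrightarrow> (\<And>i. i \<in> I \<Longrightarrow> delta2 (A i)) \<Longrightarrow> delta2 (\<Union>i\<in>I. A i)"
  by (induction I rule: finite_induct) (auto intro: delta2_Un delta2_closed)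

lemma translation_vimage: "(+) v ` A = (\<lambda>x. x - v) -` A" for v :: "'a::ab_group_add"
  by (auto simp: image_iff) (metis add.commute diff_add_cancel)

lemma fsigma_translation:
  fixes v :: "'a::real_normed_vector"
  assumes "fsigma_in euclidean A" shows "fsigma_in euclidean ((+) v ` A)"
proof -
  obtain C :: "nat \<Rightarrow> 'a set" where C: "\<And>n. closedin euclidean (C n)" "\<Union>(range C) = A"
    using assms unfolding fsigma_in_ascending by blast
  have "fsigma_in euclidean (\<Union>n. (+) v ` C n)"
  proof (rule fsigma_in_Union)
    fix T assume "T \<in> range (\<lambda>n. (+) v ` C n)"
    then obtain n where "T = (+) v ` C n" by auto
    then have "closed T" using C(1)[of n] closed_translation[of "C n" v] by simp
    then show "fsigma_in euclidean T" by (simp add: closed_imp_fsigma_in)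
  qed auto
  moreover have "(\<Union>n. (+) v ` C n) = (+) v ` A" using C(2) by auto
  ultimately show ?thesis by simp
qed

lemma delta2_translation:
  fixes v :: "'a::real_normed_vector"
  assumes "delta2 A" shows "delta2 ((+) v ` A)"
proof -
  have "- ((+) v ` A) = (+) v ` (- A)" by (simp only: translation_vimage vimage_Compl)
  then show ?thesis using assms unfolding delta2_def by (simp add: fsigma_translation)
qed

text \<open>A quantitative form of niceness for the k-th piece of a family: a one-dimensional
  boundary whose length may grow like 10^k, with the constant C shared by all k.\<close>

definition tame :: "real \<Rightarrow> nat \<Rightarrow> 'a::metric_space set \<Rightarrow> bool" where
  "tame C k A \<longleftrightarrow> delta2 A \<and> (\<forall>e\<in>{0<..1}. covered (frontier A) e (C * 10 ^ k / e))"

lemma tame_Un: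
  assumes "tame C k A" "tame D k B" shows "tame (C + D) k (A \<union> B)"
proof -
  have "covered (frontier (A \<union> B)) e ((C + D) * 10 ^ k / e)" if "e \<in> {0<..1}" for e
    using covered_mono[OF covered_Un frontier_Un_subset] assms that
    unfolding tame_def by (fastforce simp: distrib_right add_divide_distrib)
  then show ?thesis using assms delta2_Un unfolding tame_def by blast
qed

lemma tame_Compl: "tame C k A \<Longrightarrow> tame C k (- A)"
  unfolding tame_def by (simp add: delta2_Compl frontier_complement)

lemma tame_Int: "tame C k A \<Longrightarrow> tame D k B \<Longrightarrow> tame (C + D) k (A \<inter> B)"
  using tame_Un[of C k "-A" D "-B"] tame_Compl by (metis Compl_Un double_compl)

lemma tame_Diff: "tame C k A \<Longrightarrow> tame D k B \<Longrightarrow> tame (C + D) k (A - B)"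
  by (simp add: Diff_eq tame_Compl tame_Int)

lemma tame_translation:
  fixes v :: "'a::real_normed_vector"
  assumes "tame C k A" shows "tame C k ((+) v ` A)"
proof -
  have "covered (frontier ((+) v ` A)) e c" if "covered (frontier A) e c" for e c
    unfolding frontier_translation by (rule covered_lipschitz_image[OF that]) simp
  then show ?thesis using assms unfolding tame_def by (simp add: delta2_translation)
qed

lemma tame_nice:
  assumes "tame C k A" shows "nice A"
proof -
  have "small (frontier A)" using assms unfolding tame_def
    by (intro small_if_covered[of _ "C * 10 ^ k"]) auto
  then show ?thesis using assms unfolding tame_def nice_def delta2_def
    by (simp add: boolean_fsigma_fsigma)
qed

lemma covered_rectangle:
  assumes "0 \<le> l" "0 \<le> m" "0 < e"
  shows "covered ({a..a+l} \<times> {b..b+m}) e ((2 * l / e + 1) * (2 * m / e + 1))"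
proof -
  define p q where "p = nat \<lfloor>2 * l / e\<rfloor>" and "q = nat \<lfloor>2 * m / e\<rfloor>"
  define F where "F = (\<lambda>(i, j). (a + real i * e / 2, b + real j * e / 2)) ` ({..p} \<times> {..q})"
  have "card F \<le> card ({..p} \<times> {..q})" unfolding F_def by (rule card_image_le) simp
  then have "real (card F) \<le> real (card ({..p} \<times> {..q}))" by (simp only: of_nat_le_iff)
  also have "\<dots> = (real p + 1) * (real q + 1)" by (simp add: card_cartesian_product algebra_simps)
  also have "\<dots> \<le> (2 * l / e + 1) * (2 * m / e + 1)"
    using assms by (intro mult_mono add_mono) (auto simp: p_def q_def)
  finally have card: "real (card F) \<le> (2 * l / e + 1) * (2 * m / e + 1)" .
  have cell: "\<exists>i\<le>nat \<lfloor>2 * l / e\<rfloor>. \<bar>(a + real i * e / 2) - x\<bar> \<le> e / 2"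
    if "x \<in> {a..a+l}" "0 \<le> l" for x a l :: real
  proof (intro exI conjI)
    let ?i = "nat \<lfloor>2 * (x - a) / e\<rfloor>"
    show "?i \<le> nat \<lfloor>2 * l / e\<rfloor>"
      using that assms(3) by (intro nat_mono floor_mono divide_right_mono) auto
    have "0 \<le> 2 * (x - a) / e" using that assms by auto
    then have "real ?i \<le> 2 * (x - a) / e" "2 * (x - a) / e \<le> real ?i + 1" by linarith+
    then have "real ?i * e \<le> 2 * (x - a)" "2 * (x - a) \<le> (real ?i + 1) * e"
      using assms(3) by (simp_all add: pos_le_divide_eq pos_divide_le_eq)
    then show "\<bar>(a + real ?i * e / 2) - x\<bar> \<le> e / 2" by (simp add: distrib_right abs_le_iff)
  qed
  have "{a..a+l} \<times> {b..b+m} \<subseteq> (\<Union>p\<in>F. cball p e)"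
  proof clarify
    fix x y assume x: "x \<in> {a..a+l}" and y: "y \<in> {b..b+m}"
    obtain i where i: "i \<le> p" "\<bar>(a + real i * e / 2) - x\<bar> \<le> e / 2"
      using cell[OF x assms(1)] unfolding p_def by blast
    obtain j where j: "j \<le> q" "\<bar>(b + real j * e / 2) - y\<bar> \<le> e / 2"
      using cell[OF y assms(2)] unfolding q_def by blast
    let ?c = "(a + real i * e / 2, b + real j * e / 2)"
    have "dist ?c (x, y) \<le> \<bar>(a + real i * e / 2) - x\<bar> + \<bar>(b + real j * e / 2) - y\<bar>"
      unfolding dist_Pair_Pair dist_real_def by (rule order_trans[OF sqrt_sum_squares_le_sum]) auto
    then have "(x, y) \<in> cball ?c e" using i j by simp
    moreover have "?c \<in> F" unfolding F_def using i j by force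
    ultimately show "(x, y) \<in> (\<Union>p\<in>F. cball p e)" by blast
  qed
  with card show ?thesis unfolding covered_def by (intro exI[of _ F]) (auto simp: F_def)
qed

text \<open>The ends 0 and \<open>lam ^ k\<close> are included so that the pieces before and after
  the whole move are treated together with the intermediate ones.\<close>

definition lanes :: "nat \<Rightarrow> real set" where
  "lanes k = {0, lam ^ k} \<union> snd ` set (path_steps k)"

lemma finite_lanes [simp]: "finite (lanes k)"
  by (simp add: lanes_def)

lemma lanes_ge_0: "x \<in> lanes k \<Longrightarrow> 0 \<le> x"
  by (auto simp: lanes_def dest: lane_nonneg)

lemma lanes_le_1: "x \<in> lanes k \<Longrightarrow> x \<le> 1"
  by (auto simp: lanes_def dest: lane_less_1[THEN less_imp_le])

lemma one_le_pow133: "1 \<le> (1.33::real) ^ k" by (rule one_le_power) simp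

lemma card_lanes: "real (card (lanes k)) \<le> 4 * 1.33 ^ k"
proof -
  have "card (lanes k) \<le> card {0, lam ^ k} + card (snd ` set (path_steps k))"
    unfolding lanes_def by (rule card_Un_le)
  also have "card {0, lam ^ k} \<le> 2" by (simp add: card_insert_if)
  also have "card (snd ` set (path_steps k)) \<le> length (path_steps k)"
    by (meson List.finite_set card_image_le card_length order_trans)
  finally have "real (card (lanes k)) \<le> 2 + real (length (path_steps k))" by linarith
  then show ?thesis using length_path_steps[of k] one_le_pow133[of k] by linarith
qed

text \<open>About 1.33^n base points; all lanes of levels k at least n lie within
  \<open>lam ^ n\<close> above one of them. The three values of i are the letters in
  \<open>path_steps_compose\<close>.\<close>

definition hubs :: "nat \<Rightarrow> real set" where
  "hubs n = {0} \<union> (\<Union>i<3. snd ` set (path_steps (n + i)))"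

lemma finite_hubs [simp]: "finite (hubs n)" by (simp add: hubs_def)

lemma card_hubs: "real (card (hubs n)) \<le> 10 * 1.33 ^ n"
proof -
  have i: "real (card (snd ` set (path_steps (n + i)))) \<le> 2 * 1.33 ^ n * 1.33 ^ i" for i
  proof -
    have "card (snd ` set (path_steps (n + i))) \<le> length (path_steps (n + i))"
      by (meson List.finite_set card_image_le card_length order_trans)
    then show ?thesis using length_path_steps[of "n + i"] by (simp add: power_add)
  qed
  have "card (hubs n) \<le> 1 + (\<Sum>i<3. card (snd ` set (path_steps (n + i))))"
    unfolding hubs_def by (rule order_trans[OF card_Un_le]) (auto intro: card_UN_le)
  then have "real (card (hubs n)) \<le> 1 + (\<Sum>i<3. real (card (snd ` set (path_steps (n + i)))))"
    by (simp flip: of_nat_sum)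
  also have "\<dots> \<le> 1 + (\<Sum>i<3. 2 * 1.33 ^ n * 1.33 ^ i)" by (intro add_mono sum_mono i) auto
  also have "\<dots> = 1 + 1.33 ^ n * 8.1978" by (simp add: numeral_3_eq_3 power2_eq_square)
  also have "\<dots> \<le> 10 * 1.33 ^ n"
  proof -
    have "1 \<le> q \<Longrightarrow> 1 + q * 8.1978 \<le> 10 * q" for q :: real by simp
    then show ?thesis using one_le_pow133[of n] by blast
  qed
  finally show ?thesis .
qed

lemma lanes_near_hub:
  assumes "n \<le> k" "x \<in> lanes k"
  shows "\<exists>h\<in>hubs n. \<exists>y\<in>{0..1}. x = h + lam ^ n * y"
proof -
  obtain j where k: "k = n + j" using assms(1) le_Suc_ex by blast
  consider "x = 0" | "x = lam ^ k" | "x \<in> snd ` set (path_steps k)"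
    using assms(2) by (auto simp: lanes_def)
  then show ?thesis
  proof cases
    case 1
    then show ?thesis by (intro bexI[of _ 0]) (auto simp: hubs_def)
  next
    case 2
    then have "x = 0 + lam ^ n * lam ^ j" by (simp add: k power_add)
    moreover have "lam ^ j \<in> {0..1}" by simp
    moreover have "0 \<in> hubs n" by (simp add: hubs_def)
    ultimately show ?thesis by blast
  next
    case 3
    then obtain g where "(g, x) \<in> set (path_steps (n + j))" unfolding k by auto
    then obtain i y x' where *: "i < 3" "(g, x') \<in> set (path_steps (n + i))" "(i, y) \<in> set (path_steps j)"
      "x = x' + lam ^ n * y" using path_steps_compose by blast
    have "x' \<in> hubs n" unfolding hubs_def using *(1,2) by force
    moreover have "y \<in> {0..1}" using lane_nonneg[OF *(3)] lane_less_1[OF *(3)] by simp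
    ultimately show ?thesis using *(4) by blast
  qed
qed

lemma frontier_UN_subset: "finite I \<Longrightarrow> frontier (\<Union>i\<in>I. A i) \<subseteq> (\<Union>i\<in>I. frontier (A i))"
proof (induction I rule: finite_induct)
  case (insert i I)
  then show ?case using frontier_Un_subset[of "A i" "\<Union>i\<in>I. A i"] by auto
qed auto

lemma scale_exists:
  assumes "0 < e" "e \<le> 1"
  shows "\<exists>n. lam ^ (19 * (n + 1)) < e \<and> e \<le> lam ^ (19 * n)"
proof -
  have "\<exists>m. lam ^ (19 * m) < e"
    using real_arch_pow_inv[of e "lam ^ 19"] assms by (auto simp: power_mult power_less_one_iff)
  then obtain m where m: "lam ^ (19 * m) < e" "\<And>j. j < m \<Longrightarrow> \<not> lam ^ (19 * j) < e"
    using exists_least_iff[of "\<lambda>m. lam ^ (19 * m) < e"] by blast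
  have "m \<noteq> 0" using m(1) assms by (auto intro!: gr0I)
  then obtain n where "m = n + 1" using not0_implies_Suc by fastforce
  then show ?thesis using m by (intro exI[of _ n]) (auto simp: not_less)
qed

text \<open>The two terms are the cost of the boundaries below level n and the cost of strips of
  height \<open>lam ^ n\<close>. The strips save a factor \<open>lam ^ n * 1.33 ^ n\<close>, at most
  the power n/4 of \<open>lam\<close>, which at e about \<open>lam ^ (19 * n)\<close> is e to the
  power 1/76, and 1/76 exceeds 0.013. The number 19 is the largest integer N with 1/(4 N) at least
  0.013; it leaves ample room in the first bound, where 13.3 \<open>lam ^ 18\<close> is at most
  1.\<close>

lemma scale_bounds:
  assumes "0 < e" "e \<le> 1" "lam ^ (19 * (n + 1)) < e" "e \<le> lam ^ (19 * n)"
  shows "13.3 ^ n / e \<le> e powr - 1.987" "(1.33 * lam) ^ n / e\<^sup>2 \<le> 2 * e powr - 1.987"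
proof -
  have "13.3 * lam ^ 18 \<le> 1"
  proof -
    have "lam ^ 18 = (lam ^ 3) ^ 6" by (simp flip: power_mult)
    also have "\<dots> \<le> 0.318 ^ 6" unfolding lam_cube using lam by (intro power_mono) auto
    finally show ?thesis by (simp add: power_numeral_reduce)
  qed
  then have "(13.3 * lam ^ 18) ^ n \<le> 1" by (intro power_le_one) auto
  then have a: "13.3 ^ n * lam ^ (18 * n) \<le> 1" by (simp only: power_mult_distrib power_mult)
  have "e powr (18/19) \<le> (lam ^ (19 * n)) powr (18/19)" using assms by (intro powr_mono2) auto
  also have "\<dots> = lam ^ (18 * n)"
    by (simp add: powr_powr flip: powr_realpow)
  finally have b: "e powr (18/19) \<le> lam ^ (18 * n)" .
  have "e powr 0.987 \<le> e powr (18/19)" using assms by (intro powr_mono') auto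
  then have "13.3 ^ n * e powr 0.987 \<le> 13.3 ^ n * lam ^ (18 * n)" using b by (intro mult_left_mono) auto
  then have "13.3 ^ n * e powr 0.987 \<le> 1" using a by linarith
  then have "13.3 ^ n \<le> e powr - 0.987" using assms by (simp add: powr_minus field_simps)
  then have "13.3 ^ n / e \<le> e powr - 0.987 / e powr 1" using assms by (simp add: divide_right_mono)
  moreover have "e powr - 1.987 = e powr - 0.987 / e powr 1" unfolding powr_diff[symmetric] by simp
  ultimately show "13.3 ^ n / e \<le> e powr - 1.987" by linarith
  have "1.33 ^ 4 * lam ^ 3 \<le> 1" unfolding lam_cube using lam by (simp add: power_numeral_reduce)
  then have "(1.33 ^ 4 * lam ^ 3) * lam \<le> 1 * lam" by (intro mult_right_mono) auto
  moreover have "lam ^ 4 = lam ^ 3 * lam" using power_add[of lam 3 1] by simp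
  ultimately have "(1.33 * lam) ^ 4 \<le> lam" by (simp only: power_mult_distrib mult.assoc mult_1)
  then have "((1.33 * lam) ^ 4) powr (1/4) \<le> lam powr (1/4)" by (intro powr_mono2) auto
  moreover have "((1.33 * lam) powr 4) powr (1/4) = 1.33 * lam" unfolding powr_powr by simp
  moreover have "(1.33 * lam) powr 4 = (1.33 * lam) ^ 4" by (rule powr_numeral) simp
  ultimately have "1.33 * lam \<le> lam powr (1/4)" by simp
  then have "(1.33 * lam) ^ n \<le> (lam powr (1/4)) ^ n" by (intro power_mono) auto
  also have "\<dots> = lam powr (real n / 4)" by (simp add: powr_powr flip: powr_realpow)
  finally have c: "(1.33 * lam) ^ n \<le> lam powr (real n / 4)" .
  have "lam powr (real n / 4) * lam powr (1/4) = lam powr (real (n + 1) / 4)"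
    by (simp add: add_divide_distrib add.commute flip: powr_add)
  also have "\<dots> \<le> lam powr (real (19 * (n + 1)) * 0.013)" by (intro powr_mono') auto
  also have "\<dots> = (lam ^ (19 * (n + 1))) powr 0.013" by (simp add: powr_powr flip: powr_realpow)
  also have "\<dots> \<le> e powr 0.013" using assms by (intro powr_mono2) auto
  finally have d: "lam powr (real n / 4) * lam powr (1/4) \<le> e powr 0.013" .
  have "0.5 \<le> lam powr (1/4)"
  proof -
    have "lam powr 1 \<le> lam powr (1/4)" by (intro powr_mono') auto
    then show ?thesis using lam by simp
  qed
  then have "lam powr (real n / 4) * 0.5 \<le> lam powr (real n / 4) * lam powr (1/4)"
    by (intro mult_left_mono) auto
  then have "(1.33 * lam) ^ n \<le> 2 * e powr 0.013" using c d by linarith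
  then have "(1.33 * lam) ^ n / e\<^sup>2 \<le> 2 * e powr 0.013 / e\<^sup>2" by (intro divide_right_mono) auto
  also have "\<dots> = 2 * (e powr 0.013 / e powr 2)" using assms by simp
  also have "\<dots> = 2 * e powr - 1.987" by (simp flip: powr_diff)
  finally show "(1.33 * lam) ^ n / e\<^sup>2 \<le> 2 * e powr - 1.987" .
qed

text \<open>At scale \<open>e\<close> the levels below \<open>n\<close>, where \<open>lam ^ (19 * n)\<close> is about \<open>e\<close>, are covered piece by
  piece along their frontiers; all later levels together lie in few strips of height \<open>lam ^ n\<close>.\<close>

lemma nice_lanes:
  fixes P :: "nat \<Rightarrow> (real \<times> real) set" and d :: "real \<times> real"
  assumes tame: "\<And>k. tame C k (P k)"
    and slim: "\<And>k. P k \<subseteq> {-R..R} \<times> {-R * lam ^ k..R * lam ^ k}"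
    and S: "\<And>k. S k \<subseteq> lanes k"
  shows "nice (\<Union>k. \<Union>x\<in>S k. (+) (x *\<^sub>R d) ` P k)" (is "nice ?U")
proof -
  define Q where "Q k x = (+) (x *\<^sub>R d) ` P k" for k x
  have U: "?U = (\<Union>k. \<Union>x\<in>S k. Q k x)" by (simp add: Q_def)
  have finS: "finite (S k)" for k using S finite_lanes finite_subset by blast
  have tQ: "tame C k (Q k x)" for k x unfolding Q_def by (rule tame_translation[OF tame])
  have fsQ: "fsigma_in euclidean (Q k x)" for k x using tQ[of k x] by (simp add: tame_def delta2_def)
  have "countable (SIGMA k:UNIV. S k)" by (intro countable_SIGMA) (auto intro: countable_finite finS)
  then have "fsigma_in euclidean (\<Union>((\<lambda>(k,x). Q k x) ` (SIGMA k:UNIV. S k)))"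
    by (intro fsigma_in_Union countable_image) (auto intro: fsQ)
  also have "\<Union>((\<lambda>(k,x). Q k x) ` (SIGMA k:UNIV. S k)) = ?U" unfolding U by blast
  finally have fs: "?U \<in> boolean_fsigma" by (rule boolean_fsigma_fsigma)
  have "covered (frontier (P 0)) 1 (C * 10 ^ 0 / 1)"
    using tame[of 0] unfolding tame_def by (elim conjE bspec) simp
  then have C0: "0 \<le> C" using covered_nonneg by fastforce
  define R1 R2 where "R1 = \<bar>R\<bar> + \<bar>fst d\<bar>" and "R2 = \<bar>R\<bar> + \<bar>snd d\<bar>"
  have R12: "0 \<le> R1" "0 \<le> R2" by (auto simp: R1_def R2_def)
  define K where "K = 4 * C + 10 * (4 * R1 + 1) + 20 * (4 * R1 + 1) * 4 * R2"
  have "covered (frontier ?U) e (K * e powr - 1.987)" if e: "0 < e" "e \<le> 1" for e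
  proof -
    obtain n where n: "lam ^ (19 * (n + 1)) < e" "e \<le> lam ^ (19 * n)" using scale_exists[OF e] by blast
    define A where "A = (\<Union>k<n. \<Union>x\<in>S k. Q k x)"
    define B where "B = (\<Union>k\<in>{n..}. \<Union>x\<in>S k. Q k x)"
    have UAB: "?U = A \<union> B"
    proof -
      have "(UNIV::nat set) = {..<n} \<union> {n..}" by auto
      then show ?thesis unfolding U A_def B_def by (metis UN_Un)
    qed
    have frA: "frontier A \<subseteq> (\<Union>k<n. \<Union>x\<in>S k. frontier (Q k x))"
    proof -
      have "frontier A \<subseteq> (\<Union>k<n. frontier (\<Union>x\<in>S k. Q k x))"
        unfolding A_def by (rule frontier_UN_subset) simp
      also have "\<dots> \<subseteq> (\<Union>k<n. \<Union>x\<in>S k. frontier (Q k x))"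
        using frontier_UN_subset[OF finS] by (intro UN_mono) auto
      finally show ?thesis .
    qed
    have "covered (\<Union>k<n. \<Union>x\<in>S k. frontier (Q k x)) e (\<Sum>k<n. \<Sum>x\<in>S k. C * 10 ^ k / e)"
      using finS tQ e by (intro covered_UN) (auto simp: tame_def)
    moreover have "(\<Sum>k<n. \<Sum>x\<in>S k. C * 10 ^ k / e) \<le> 4 * C * (13.3 ^ n / e)"
    proof -
      have "(\<Sum>x\<in>S k. C * 10 ^ k / e) \<le> 4 * C / e * 13.3 ^ k" for k
      proof -
        have "real (card (S k)) \<le> 4 * 1.33 ^ k"
          using card_mono[OF finite_lanes S[of k]] card_lanes[of k] by linarith
        then have "real (card (S k)) * (C * 10 ^ k / e) \<le> 4 * 1.33 ^ k * (C * 10 ^ k / e)"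
          using C0 e by (intro mult_right_mono) auto
        also have "\<dots> = 4 * C / e * (1.33 * 10) ^ k" unfolding power_mult_distrib by simp
        finally show ?thesis by simp
      qed
      then have "(\<Sum>k<n. \<Sum>x\<in>S k. C * 10 ^ k / e) \<le> (\<Sum>k<n. 4 * C / e * 13.3 ^ k)"
        by (intro sum_mono)
      also have "\<dots> = 4 * C / e * (\<Sum>k<n. 13.3 ^ k)" by (simp add: sum_distrib_left)
      also have "\<dots> \<le> 4 * C / e * 13.3 ^ n"
      proof -
        have "(\<Sum>k<n. 13.3 ^ k) \<le> (13.3::real) ^ n"
        proof (induction n)
          case (Suc n)
          have "(\<Sum>k<Suc n. 13.3 ^ k) = (\<Sum>k<n. 13.3 ^ k) + (13.3::real) ^ n" by simp
          also have "\<dots> \<le> 13.3 ^ n + 13.3 ^ n" by (intro add_mono Suc.IH order_refl)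
          also have "\<dots> \<le> 13.3 ^ Suc n" by simp
          finally show ?case .
        qed auto
        then show ?thesis using C0 e by (intro mult_left_mono) auto
      qed
      finally show ?thesis by simp
    qed
    ultimately have covA: "covered (frontier A) e (4 * C * (13.3 ^ n / e))"
      using frA covered_mono by blast
    define strip where "strip h = {-R1..-R1 + 2 * R1} \<times> {h * snd d - R2 * lam ^ n..h * snd d - R2 * lam ^ n + 2 * R2 * lam ^ n}" for h
    have Bsub: "B \<subseteq> (\<Union>h\<in>hubs n. strip h)"
    proof
      fix z assume "z \<in> B"
      then obtain k x p where k: "n \<le> k" and x: "x \<in> S k" and p: "p \<in> P k" and z: "z = x *\<^sub>R d + p"
        by (auto simp: B_def Q_def)
      obtain h y where h: "h \<in> hubs n" "y \<in> {0..1}" "x = h + lam ^ n * y"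
        using lanes_near_hub[OF k] S x by blast
      have x01: "0 \<le> x" "x \<le> 1" using S x lanes_ge_0 lanes_le_1 by blast+
      have p1: "\<bar>fst p\<bar> \<le> \<bar>R\<bar>" "\<bar>snd p\<bar> \<le> \<bar>R\<bar> * lam ^ k"
      proof -
        have "p \<in> {-R..R} \<times> {-R * lam ^ k..R * lam ^ k}" using slim p by blast
        then have q: "\<bar>fst p\<bar> \<le> R" "\<bar>snd p\<bar> \<le> R * lam ^ k" by (auto simp: mem_Times_iff abs_le_iff)
        then show "\<bar>fst p\<bar> \<le> \<bar>R\<bar>" by linarith
        have "R * lam ^ k \<le> \<bar>R\<bar> * lam ^ k" by (intro mult_right_mono) auto
        then show "\<bar>snd p\<bar> \<le> \<bar>R\<bar> * lam ^ k" using q by linarith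
      qed
      have "\<bar>x * fst d\<bar> \<le> \<bar>fst d\<bar>" using x01 by (simp add: abs_mult mult_left_le_one_le)
      then have f: "\<bar>fst z\<bar> \<le> R1" using p1 by (simp add: z R1_def)
      have "lam ^ k \<le> lam ^ n" using k by (intro power_decreasing) auto
      then have "\<bar>snd p\<bar> \<le> \<bar>R\<bar> * lam ^ n" using p1(2) mult_left_mono[of "lam ^ k" "lam ^ n" "\<bar>R\<bar>"] by linarith
      moreover have "\<bar>lam ^ n * y * snd d\<bar> \<le> \<bar>snd d\<bar> * lam ^ n"
        using h(2) by (simp add: abs_mult mult.commute mult.left_commute mult_left_le_one_le)
      moreover have "snd z = h * snd d + (lam ^ n * y * snd d + snd p)"
        by (simp add: z h(3) algebra_simps)
      ultimately have "\<bar>snd z - h * snd d\<bar> \<le> R2 * lam ^ n"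
        by (simp add: R2_def distrib_right)
      then have "z \<in> strip h" using f unfolding strip_def by (auto simp: mem_Times_iff abs_le_iff)
      with h(1) show "z \<in> (\<Union>h\<in>hubs n. strip h)" by blast
    qed
    have "covered (strip h) e ((2 * (2 * R1) / e + 1) * (2 * (2 * R2 * lam ^ n) / e + 1))" for h
      unfolding strip_def using R12 e by (intro covered_rectangle) auto
    then have "covered (\<Union>h\<in>hubs n. strip h) e (\<Sum>h\<in>hubs n. (2 * (2 * R1) / e + 1) * (2 * (2 * R2 * lam ^ n) / e + 1))"
      by (intro covered_UN) auto
    moreover have "(\<Sum>h\<in>hubs n. (2 * (2 * R1) / e + 1) * (2 * (2 * R2 * lam ^ n) / e + 1)) \<le>
       10 * (4 * R1 + 1) * (13.3 ^ n / e) + 10 * (4 * R1 + 1) * 4 * R2 * ((1.33 * lam) ^ n / e\<^sup>2)"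
    proof -
      have "2 * (2 * R1) / e + 1 \<le> (4 * R1 + 1) / e" using e by (simp add: field_simps)
      then have m: "(2 * (2 * R1) / e + 1) * (2 * (2 * R2 * lam ^ n) / e + 1) \<le> (4 * R1 + 1) / e * (4 * R2 * lam ^ n / e + 1)"
        using R12 e by (intro mult_mono) auto
      have "real (card (hubs n)) * ((2 * (2 * R1) / e + 1) * (2 * (2 * R2 * lam ^ n) / e + 1)) \<le>
          10 * 1.33 ^ n * ((4 * R1 + 1) / e * (4 * R2 * lam ^ n / e + 1))"
        by (rule mult_mono[OF card_hubs m]) (use R12 e in \<open>auto intro!: mult_nonneg_nonneg add_nonneg_nonneg\<close>)
      also have "\<dots> = 10 * (4 * R1 + 1) * (1.33 ^ n / e) + 10 * (4 * R1 + 1) * 4 * R2 * ((1.33 * lam) ^ n / e\<^sup>2)"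
        using e by (simp only: power_mult_distrib) (simp add: field_simps power2_eq_square)
      also have "\<dots> \<le> 10 * (4 * R1 + 1) * (13.3 ^ n / e) + 10 * (4 * R1 + 1) * 4 * R2 * ((1.33 * lam) ^ n / e\<^sup>2)"
        using e R12 by (intro add_mono mult_left_mono divide_right_mono power_mono) auto
      finally show ?thesis by simp
    qed
    ultimately have covB: "covered B e (10 * (4 * R1 + 1) * (13.3 ^ n / e) + 10 * (4 * R1 + 1) * 4 * R2 * ((1.33 * lam) ^ n / e\<^sup>2))"
      using Bsub covered_mono by blast
    \<comment> \<open>The infinite tail B enters only through its closure, which is covered by the
      same closed balls as B. So the growing boundaries of the late pieces never have to be
      counted.\<close>
    have "frontier ?U \<subseteq> frontier A \<union> closure B"
      using frontier_Un_subset[of A B] unfolding UAB by (auto simp: frontier_def)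
    moreover have "covered (frontier A \<union> closure B) e (4 * C * (13.3 ^ n / e) +
       (10 * (4 * R1 + 1) * (13.3 ^ n / e) + 10 * (4 * R1 + 1) * 4 * R2 * ((1.33 * lam) ^ n / e\<^sup>2)))"
      by (intro covered_Un covA covered_closure covB)
    moreover have "4 * C * (13.3 ^ n / e) +
       (10 * (4 * R1 + 1) * (13.3 ^ n / e) + 10 * (4 * R1 + 1) * 4 * R2 * ((1.33 * lam) ^ n / e\<^sup>2)) \<le> K * e powr - 1.987"
    proof -
      have "4 * C * (13.3 ^ n / e) \<le> 4 * C * e powr - 1.987"
        "10 * (4 * R1 + 1) * (13.3 ^ n / e) \<le> 10 * (4 * R1 + 1) * e powr - 1.987"
        "10 * (4 * R1 + 1) * 4 * R2 * ((1.33 * lam) ^ n / e\<^sup>2) \<le> 10 * (4 * R1 + 1) * 4 * R2 * (2 * e powr - 1.987)"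
        using scale_bounds[OF e n] C0 R12 by (intro mult_left_mono; simp)+
      then show ?thesis unfolding K_def by (simp add: distrib_right mult.assoc)
    qed
    ultimately show ?thesis using covered_mono by blast
  qed
  then have "small (frontier ?U)" unfolding small_def
    by (intro exI[of _ K] ballI) simp
  with fs show ?thesis by (simp add: nice_def)
qed

subsection \<open>Simultaneous displacement at all scales\<close>

lemma card_subsingleton:
  assumes "\<And>a b. a \<in> S \<Longrightarrow> b \<in> S \<Longrightarrow> a = b"
  shows "finite S" "card S = of_bool (S \<noteq> {})"
proof -
  have "S = {} \<or> (\<exists>a. S = {a})" using assms by blast
  then show "finite S" "card S = of_bool (S \<noteq> {})" by auto
qed

lemma card_group:
  assumes "finite S" "finite T" "f ` S \<subseteq> T"
  shows "(\<Sum>t\<in>T. card {x\<in>S. f x = t}) = card S"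
  using sum.group[OF assms, of "\<lambda>_. 1::nat"] by simp

lemma ind_translate: "ind ((+) v ` A) p = ind A (p - v)" for v :: "'a::ab_group_add"
  by (simp add: ind_def translation_vimage)

lemma eqf_cat3:
  assumes "F + (ind A + ind B + ind C) \<asymp> G + (ind A + ind B + ind C)"
    and sub: "A \<subseteq> K" "B \<subseteq> K" "C \<subseteq> K" and nice: "nice A" "nice B" "nice C" "nice K"
  shows "F + (ind K + ind K + ind K) \<asymp> G + (ind K + ind K + ind K)"
proof -
  have "(F + ind A + ind B) + ind C \<asymp> (G + ind A + ind B) + ind C" using assms(1) by (simp only: ac_simps)
  then have "(F + ind A + ind B) + ind K \<asymp> (G + ind A + ind B) + ind K" by (rule eqf_cat[OF _ sub(3) nice(3,4)])
  then have "(F + ind A + ind K) + ind B \<asymp> (G + ind A + ind K) + ind B" by (simp only: ac_simps)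
  then have "(F + ind A + ind K) + ind K \<asymp> (G + ind A + ind K) + ind K" by (rule eqf_cat[OF _ sub(2) nice(2,4)])
  then have "(F + ind K + ind K) + ind A \<asymp> (G + ind K + ind K) + ind A" by (simp only: ac_simps)
  then have "(F + ind K + ind K) + ind K \<asymp> (G + ind K + ind K) + ind K" by (rule eqf_cat[OF _ sub(1) nice(1,4)])
  then show ?thesis by (simp only: ac_simps)
qed

text \<open>Pieces \<open>src i\<close> are moved to \<open>tgt i\<close>. Pieces with the same label \<open>lt\<close> are disjoint, and so are
  targets with the same label \<open>lt'\<close>, hence each label contributes one set to either side.\<close>

lemma eqf_relabel:
  fixes src tgt :: "'i \<Rightarrow> 'a::real_normed_vector set" and lt lt' :: "'i \<Rightarrow> nat" and df :: "'i \<Rightarrow> 'a"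
  assumes A: "\<And>i j p. i \<in> I \<Longrightarrow> j \<in> I \<Longrightarrow> lt i = lt j \<Longrightarrow> p \<in> src i \<Longrightarrow> p \<in> src j \<Longrightarrow> i = j"
    and B: "\<And>i j p. i \<in> I \<Longrightarrow> j \<in> I \<Longrightarrow> lt' i = lt' j \<Longrightarrow> p \<in> tgt i \<Longrightarrow> p \<in> tgt j \<Longrightarrow> i = j"
    and C: "\<And>i. i \<in> I \<Longrightarrow> tgt i = (+) (df i) ` src i" "\<And>i. i \<in> I \<Longrightarrow> df i \<in> V"
       "\<And>i. i \<in> I \<Longrightarrow> lt i < n" "\<And>i. i \<in> I \<Longrightarrow> lt' i < n" "finite V"
    and D: "\<And>g v. nice (\<Union>i\<in>{i\<in>I. lt i = g \<and> df i = v}. src i)"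
  shows "(\<Sum>g<n. ind (\<Union>i\<in>{i\<in>I. lt i = g}. src i)) \<asymp> (\<Sum>g<n. ind (\<Union>i\<in>{i\<in>I. lt' i = g}. tgt i))"
proof -
  \<comment> \<open>Pieces are grouped by label and displacement. There are finitely many groups,
    although the index set may be infinite, and each group moves as one set.\<close>
  define M where "M g v = (\<Union>i\<in>{i\<in>I. lt i = g \<and> df i = v}. src i)" for g v
  have s: "finite {i\<in>I. lt i = g \<and> p \<in> src i}" "card {i\<in>I. lt i = g \<and> p \<in> src i} = of_bool ({i\<in>I. lt i = g \<and> p \<in> src i} \<noteq> {})" for g p
    by (intro card_subsingleton; use A in blast)+
  have t: "finite {i\<in>I. lt' i = g \<and> p \<in> tgt i}" "card {i\<in>I. lt' i = g \<and> p \<in> tgt i} = of_bool ({i\<in>I. lt' i = g \<and> p \<in> tgt i} \<noteq> {})" for g p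
    by (intro card_subsingleton; use B in blast)+
  have indM: "ind (M g v) p = card {i\<in>I. lt i = g \<and> df i = v \<and> p \<in> src i}" for g v p
  proof -
    have "card {i\<in>I. lt i = g \<and> df i = v \<and> p \<in> src i} = of_bool ({i\<in>I. lt i = g \<and> df i = v \<and> p \<in> src i} \<noteq> {})"
      by (intro card_subsingleton) (use A in blast)
    moreover have "p \<in> M g v \<longleftrightarrow> {i\<in>I. lt i = g \<and> df i = v \<and> p \<in> src i} \<noteq> {}" unfolding M_def by blast
    ultimately show ?thesis unfolding ind_def by simp
  qed
  have "(\<Sum>q\<in>{..<n} \<times> V. ind (M (fst q) (snd q))) \<asymp> (\<Sum>q\<in>{..<n} \<times> V. ind ((+) (snd q) ` M (fst q) (snd q)))"
    using C(5) D unfolding M_def by (intro eqf_sum) auto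
  also have "(\<Sum>q\<in>{..<n} \<times> V. ind (M (fst q) (snd q))) = (\<Sum>g<n. ind (\<Union>i\<in>{i\<in>I. lt i = g}. src i))"
  proof
    fix p
    have "(\<Sum>q\<in>{..<n} \<times> V. ind (M (fst q) (snd q))) p = (\<Sum>g<n. \<Sum>v\<in>V. card {i\<in>I. lt i = g \<and> df i = v \<and> p \<in> src i})"
      by (simp add: sum_fun_apply indM sum.cartesian_product case_prod_beta)
    also have "\<dots> = (\<Sum>g<n. card {i\<in>I. lt i = g \<and> p \<in> src i})"
    proof (intro sum.cong refl)
      fix g
      have "(\<Sum>v\<in>V. card {i\<in>{i\<in>I. lt i = g \<and> p \<in> src i}. df i = v}) = card {i\<in>I. lt i = g \<and> p \<in> src i}"
        using C(2) by (intro card_group s C(5)) auto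
      moreover have "{i\<in>{i\<in>I. lt i = g \<and> p \<in> src i}. df i = v} = {i\<in>I. lt i = g \<and> df i = v \<and> p \<in> src i}" for v by auto
      ultimately show "(\<Sum>v\<in>V. card {i\<in>I. lt i = g \<and> df i = v \<and> p \<in> src i}) = card {i\<in>I. lt i = g \<and> p \<in> src i}" by simp
    qed
    also have "\<dots> = (\<Sum>g<n. ind (\<Union>i\<in>{i\<in>I. lt i = g}. src i) p)"
    proof (intro sum.cong refl)
      fix g
      have "p \<in> (\<Union>i\<in>{i\<in>I. lt i = g}. src i) \<longleftrightarrow> {i\<in>I. lt i = g \<and> p \<in> src i} \<noteq> {}" by blast
      then show "card {i\<in>I. lt i = g \<and> p \<in> src i} = ind (\<Union>i\<in>{i\<in>I. lt i = g}. src i) p"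
        unfolding s(2) ind_def by simp
    qed
    finally show "(\<Sum>q\<in>{..<n} \<times> V. ind (M (fst q) (snd q))) p = (\<Sum>g<n. ind (\<Union>i\<in>{i\<in>I. lt i = g}. src i)) p"
      by (simp add: sum_fun_apply)
  qed
  also have "(\<Sum>q\<in>{..<n} \<times> V. ind ((+) (snd q) ` M (fst q) (snd q))) = (\<Sum>g<n. ind (\<Union>i\<in>{i\<in>I. lt' i = g}. tgt i))"
  proof
    fix p
    define T where "T = {i\<in>I. p \<in> tgt i}"
    have "T = (\<Union>g<n. {i\<in>I. lt' i = g \<and> p \<in> tgt i})" using C(4) unfolding T_def by blast
    then have finT: "finite T" using t(1) by simp
    have e: "{i\<in>I. lt i = g \<and> df i = v \<and> p - v \<in> src i} = {i\<in>T. (lt i, df i) = (g, v)}" for g v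
      unfolding T_def using C(1) by (auto simp: translation_vimage)
    have "(\<Sum>q\<in>{..<n} \<times> V. ind ((+) (snd q) ` M (fst q) (snd q))) p = (\<Sum>q\<in>{..<n} \<times> V. card {i\<in>T. (lt i, df i) = q})"
      by (simp add: sum_fun_apply ind_translate indM e)
    also have "\<dots> = card T" using C finT unfolding T_def by (intro card_group) auto
    also have "\<dots> = (\<Sum>g<n. card {i\<in>T. lt' i = g})"
      using C finT unfolding T_def by (intro card_group[symmetric]) auto
    also have "\<dots> = (\<Sum>g<n. ind (\<Union>i\<in>{i\<in>I. lt' i = g}. tgt i) p)"
    proof (intro sum.cong refl)
      fix g
      have "{i\<in>T. lt' i = g} = {i\<in>I. lt' i = g \<and> p \<in> tgt i}" by (auto simp: T_def)
      moreover have "p \<in> (\<Union>i\<in>{i\<in>I. lt' i = g}. tgt i) \<longleftrightarrow> {i\<in>I. lt' i = g \<and> p \<in> tgt i} \<noteq> {}" by blast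
      ultimately show "card {i\<in>T. lt' i = g} = ind (\<Union>i\<in>{i\<in>I. lt' i = g}. tgt i) p"
        using t(2)[of g p] unfolding ind_def by simp
    qed
    finally show "(\<Sum>q\<in>{..<n} \<times> V. ind ((+) (snd q) ` M (fst q) (snd q))) p = (\<Sum>g<n. ind (\<Union>i\<in>{i\<in>I. lt' i = g}. tgt i)) p"
      by (simp add: sum_fun_apply)
  qed
  finally show ?thesis .
qed

text \<open>The successive parking positions of the k-th piece: one for every step of the path,
  namely its lower end, labelled by the letter of the step. Label 3 marks the first and the last
  position, the ones that do not belong to catalysts.\<close>

definition nodes :: "nat \<Rightarrow> (nat \<times> real) list" where
  "nodes k = (3, 0) # path_steps k @ [(3, lam ^ k)]"

lemma nodes_letter: assumes "j < length (nodes k)" shows "fst (nodes k ! j) < 4"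
proof -
  obtain p where p: "p = nodes k ! j" "p \<in> set (nodes k)" using nth_mem[OF assms] by blast
  have "p = (3, 0) \<or> p \<in> set (path_steps k) \<or> p = (3, lam ^ k)" using p(2) by (auto simp: nodes_def)
  then have "fst p < 4" using path_steps_letter[of "fst p" "snd p" k] by auto
  then show ?thesis using p(1) by simp
qed

lemma nodes_lane: assumes "j < length (nodes k)" shows "snd (nodes k ! j) \<in> lanes k"
proof -
  obtain p where p: "p = nodes k ! j" "p \<in> set (nodes k)" using nth_mem[OF assms] by blast
  have "snd p \<in> lanes k" using p(2) by (auto simp: nodes_def lanes_def)
  then show ?thesis using p(1) by simp
qed

lemma length_nodes: "length (nodes k) = length (path_steps k) + 2"
  by (simp add: nodes_def)

text \<open>Consecutive steps of a path share an endpoint, and an endpoint of a step is its lower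
  end plus 0, 1, \<open>lam\<close> or \<open>lam\<^sup>2\<close>. So the displacement between
  consecutive parking positions is a difference of two such numbers.\<close>

definition jumps :: "real set" where
  "jumps = (\<lambda>(a, b). a - b) ` (({0} \<union> (\<lambda>g. lam ^ g) ` {..<3::nat}) \<times> ({0} \<union> (\<lambda>g. lam ^ g) ` {..<3::nat}))"

lemma finite_jumps: "finite jumps" by (simp add: jumps_def)

lemma touches_jump:
  assumes "touches p t" "touches q t" "fst p < 3" "fst q < 3"
  shows "snd q - snd p \<in> jumps"
proof -
  define a b where "a = t - snd p" and "b = t - snd q"
  have "a = 0 \<or> a = lam ^ fst p" "b = 0 \<or> b = lam ^ fst q"
    using assms(1,2) by (auto simp: a_def b_def touches_def)
  then have "a \<in> {0} \<union> (\<lambda>g. lam ^ g) ` {..<3::nat}" "b \<in> {0} \<union> (\<lambda>g. lam ^ g) ` {..<3::nat}"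
    using assms(3,4) by auto
  then have "(\<lambda>(a, b). a - b) (a, b) \<in> jumps" unfolding jumps_def by (intro imageI SigmaI)
  then show ?thesis by (simp add: a_def b_def)
qed

lemma nodes_jump:
  assumes "j < length (path_steps k) + 1"
  shows "snd (nodes k ! Suc j) - snd (nodes k ! j) \<in> jumps"
proof -
  let ?l = "length (path_steps k)"
  have l0: "0 < ?l" by simp
  have let3: "fst (path_steps k ! i) < 3" if "i < ?l" for i
    using path_steps_letter[of "fst (path_steps k ! i)" "snd (path_steps k ! i)" k] that by simp
  have path: "touches (path_steps k ! 0) 0" "touches (path_steps k ! (?l - 1)) (lam ^ k)"
     "successively (\<lambda>p q. \<exists>t. touches p t \<and> touches q t) (path_steps k)"
    using path_steps_path[of k] by (simp_all add: hd_conv_nth last_conv_nth)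
  consider "j = 0" | "0 < j" "j < ?l" | "j = ?l" using assms by linarith
  then show ?thesis
  proof cases
    case 1
    \<comment> \<open>The first node carries label 3 and is no step of the path; a fictitious step
      of letter 0 with lower end 0 takes its place. The last node is treated likewise.\<close>
    have "touches (0, 0) 0" by (simp add: touches_def)
    then have "snd (path_steps k ! 0) - snd (0::nat, 0::real) \<in> jumps"
      by (intro touches_jump[OF _ path(1)] let3 l0) auto
    then show ?thesis using 1 by (simp add: nodes_def nth_append)
  next
    case 2
    then have "\<exists>t. touches (path_steps k ! (j - 1)) t \<and> touches (path_steps k ! j) t"
      using path(3) unfolding successively_conv_nth by (metis Suc_diff_1)
    then show ?thesis using 2 touches_jump[OF _ _ let3 let3, of "j - 1" _ j]
      by (auto simp: nodes_def nth_append nth_Cons')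
  next
    case 3
    have "touches (0, lam ^ k) (lam ^ k)" by (simp add: touches_def)
    then have "snd (0::nat, lam ^ k) - snd (path_steps k ! (?l - 1)) \<in> jumps"
      by (intro touches_jump[OF path(2)] let3) (use l0 in auto)
    then show ?thesis using 3 l0 by (simp add: nodes_def nth_append nth_Cons')
  qed
qed

text \<open>A copy of every piece is present at each of its parking positions, and all copies
  advance by one position at the same time. The positions with labels 0, 1 and 2 are therefore
  occupied before and after, and only label 3 changes, from the start to the end. Positions with the
  same letter are disjoint across all scales by \<open>lanes_disjoint\<close>, for which the pieces
  must lie in its window of heights; positions with different letters may overlap, hence three
  catalysts.\<close>

lemma chain:
  fixes P :: "nat \<Rightarrow> (real \<times> real) set" and d :: "real \<times> real"
  assumes tame: "\<And>k. tame C k (P k)"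
    and zone: "\<And>k. P k \<subseteq> {0..R} \<times> {y1 * lam ^ k..y2 * lam ^ k}"
    and d: "0 < snd d" "0 \<le> fst d"
    and y: "lam\<^sup>2 / (1 + lam) * snd d \<le> y1" "y2 < lam\<^sup>2 * snd d" "lam * y2 < y1"
    and K: "nice K" "{0..R + fst d} \<times> {0..2 * snd d} \<subseteq> K"
  shows "ind (\<Union>k. P k) + (ind K + ind K + ind K) \<asymp> ind (\<Union>k. (+) (lam ^ k *\<^sub>R d) ` P k) + (ind K + ind K + ind K)"
proof -
  define N where "N i = (+) (snd (nodes (fst i) ! snd i) *\<^sub>R d) ` P (fst i)" for i
  define I where "I = {(k, j). j < length (path_steps k) + 1}"
  define nx where "nx i = (fst i, Suc (snd i))" for i :: "nat \<times> nat"
  define lt where "lt i = fst (nodes (fst i) ! snd i)" for i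
  define x where "x i = snd (nodes (fst i) ! snd i)" for i
  have Nx: "N i = (+) (x i *\<^sub>R d) ` P (fst i)" for i by (simp add: N_def x_def)
  define J where "J = {(k, j). j < length (nodes k)}"
  have IJ: "i \<in> I \<Longrightarrow> i \<in> J" "i \<in> I \<Longrightarrow> nx i \<in> J" for i
    by (auto simp: I_def J_def nx_def length_nodes)
  have lane: "x i \<in> lanes (fst i)" "lt i < 4" if "i \<in> J" for i
    using nodes_lane nodes_letter that by (auto simp: J_def x_def lt_def)
  have zoneD: "0 \<le> fst q" "fst q \<le> R" "y1 * lam ^ k \<le> snd q" "snd q \<le> y2 * lam ^ k" if "q \<in> P k" for q k
    using subsetD[OF zone that] by (auto simp: mem_Times_iff)
  have y0: "0 < y1"
  proof -
    have "0 < lam\<^sup>2 / (1 + lam) * snd d" using d(1) by (intro mult_pos_pos divide_pos_pos) (auto intro: add_pos_pos)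
    then show ?thesis using y(1) by linarith
  qed
  have zonep: "\<exists>z. snd p = snd d * (x i + lam ^ fst i * z) \<and> lam\<^sup>2 / (1 + lam) \<le> z \<and> z < lam\<^sup>2 \<and> y1 \<le> z * snd d \<and> z * snd d \<le> y2" if pN: "p \<in> N i" for p i
  proof -
    obtain q where q: "q \<in> P (fst i)" "p = x i *\<^sub>R d + q" using pN unfolding Nx by blast
    define z where "z = snd q / lam ^ fst i / snd d"
    have sq: "snd q = lam ^ fst i * (z * snd d)" using d(1) by (simp add: z_def)
    have "y1 * lam ^ fst i \<le> snd q" "snd q \<le> y2 * lam ^ fst i" using zoneD q(1) by blast+
    then have z: "y1 \<le> z * snd d" "z * snd d \<le> y2"
      unfolding sq by (simp_all add: mult.commute[of y1] mult.commute[of y2])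
    then have zz: "lam\<^sup>2 / (1 + lam) * snd d \<le> z * snd d" "z * snd d < lam\<^sup>2 * snd d" using y by linarith+
    have "lam\<^sup>2 / (1 + lam) \<le> z" using zz(1) d(1) by (rule mult_right_le_imp_le)
    moreover have "z < lam\<^sup>2" using zz(2) d(1) by (intro mult_right_less_imp_less[OF zz(2)]) simp
    moreover have "snd p = snd d * (x i + lam ^ fst i * z)" by (simp add: q(2) sq algebra_simps)
    ultimately show ?thesis using z by blast
  qed
  \<comment> \<open>For the ends of the paths the disjointness is elementary: the heights are
    \<open>lam ^ k\<close> times a number between t \<open>snd d\<close> + y1 and t
    \<open>snd d\<close> + y2 with t = 0 or 1, and \<open>lam * y2 < y1\<close> separates different
    k.\<close>
  have uniq3: "i = j" if u: "i \<in> J" "j \<in> J" "lt i = 3" "lt j = 3" "x i = t * lam ^ fst i" "x j = t * lam ^ fst j" "t \<in> {0, 1}"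
     "p \<in> N i" "p \<in> N j" "snd i = snd j \<or> fst i \<noteq> fst j" for i j p t
  proof -
    obtain z where z: "snd p = snd d * (x i + lam ^ fst i * z)" "y1 \<le> z * snd d" "z * snd d \<le> y2" using zonep u(8) by blast
    obtain z' where z': "snd p = snd d * (x j + lam ^ fst j * z')" "y1 \<le> z' * snd d" "z' * snd d \<le> y2" using zonep u(9) by blast
    have e: "lam ^ fst i * (t * snd d + z * snd d) = lam ^ fst j * (t * snd d + z' * snd d)"
      using z(1) z'(1) u(5,6) by (simp add: algebra_simps)
    have t01: "t = 0 \<or> t = 1" using u(7) by blast
    have no: "False" if v: "k < l" "lam ^ k * (t * snd d + a) = lam ^ l * (t * snd d + b)" "y1 \<le> a" "b \<le> y2" "y1 \<le> b" for k l :: nat and a b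
    proof -
      have "lam ^ l \<le> lam ^ (Suc k)" using v(1) by (intro power_decreasing) auto
      then have "lam ^ l * (t * snd d + b) \<le> lam ^ Suc k * (t * snd d + b)"
        using t01 d(1) y0 v(5) by (intro mult_right_mono) auto
      then have "lam ^ k * (t * snd d + a) \<le> lam ^ k * (lam * (t * snd d + b))" using v(2) by (simp add: mult.assoc mult.left_commute)
      then have "t * snd d + a \<le> lam * (t * snd d + b)" by simp
      moreover have "lam * (t * snd d) \<le> t * snd d" using t01 d(1) by auto
      moreover have "lam * b \<le> lam * y2" using v(4) by simp
      ultimately show False using v(3) y(3) by (simp add: distrib_left)
    qed
    have "fst i = fst j"
      using no[of "fst i" "fst j"] no[of "fst j" "fst i"] e z z'
      by (metis linorder_neqE_nat)
    then show ?thesis using u(10) by (auto simp: prod_eq_iff)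
  qed
  have uniq: "i = j" if ij: "i \<in> J" "j \<in> J" "lt i = lt j" "p \<in> N i" "p \<in> N j" and src: "0 < snd i \<and> snd i < length (path_steps (fst i)) + 1" "0 < snd j \<and> snd j < length (path_steps (fst j)) + 1" for i j p
  proof -
    have m: "nodes (fst i) ! snd i = path_steps (fst i) ! (snd i - 1)" "nodes (fst j) ! snd j = path_steps (fst j) ! (snd j - 1)"
      using src by (auto simp: nodes_def nth_append nth_Cons')
    have s: "snd i - 1 < length (path_steps (fst i))" "snd j - 1 < length (path_steps (fst j))" using src by auto
    have p: "(lt i, x i) = path_steps (fst i) ! (snd i - 1)" "(lt j, x j) = path_steps (fst j) ! (snd j - 1)"
      by (simp_all add: lt_def x_def m)
    have c: "lane_count (fst i) (lt i) (x i) > 0" "lane_count (fst j) (lt i) (x j) > 0"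
      unfolding lane_count_pos using p s nth_mem ij(3) by metis+
    obtain z where z: "snd p = snd d * (x i + lam ^ fst i * z)" "lam\<^sup>2 / (1 + lam) \<le> z" "z < lam\<^sup>2" using zonep ij(4) by blast
    obtain z' where z': "snd p = snd d * (x j + lam ^ fst j * z')" "lam\<^sup>2 / (1 + lam) \<le> z'" "z' < lam\<^sup>2" using zonep ij(5) by blast
    have "x i + lam ^ fst i * z = x j + lam ^ fst j * z'" using z(1) z'(1) d(1) by simp
    then have k: "fst i = fst j" "x i = x j" using lanes_disjoint[OF c _ z(2,3) z'(2,3)] by blast+
    then have "path_steps (fst i) ! (snd i - 1) = path_steps (fst i) ! (snd j - 1)" using p ij(3) by metis
    then have "snd i - 1 = snd j - 1" using s k distinct_path_steps nth_eq_iff_index_eq by metis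
    then show ?thesis using src k by (auto simp: prod_eq_iff)
  qed
  have lt3: "lt i = 3 \<longleftrightarrow> snd i = 0 \<or> snd i = length (path_steps (fst i)) + 1" if "i \<in> J" for i
  proof -
    have "lt i < 3" if "0 < snd i" "snd i < length (path_steps (fst i)) + 1"
    proof -
      have m: "nodes (fst i) ! snd i = path_steps (fst i) ! (snd i - 1)" using that by (auto simp: nodes_def nth_append nth_Cons')
      have "snd i - 1 < length (path_steps (fst i))" using that by auto
      then have "nodes (fst i) ! snd i \<in> set (path_steps (fst i))" unfolding m by (rule nth_mem)
      then show ?thesis unfolding lt_def using path_steps_letter by (metis prod.collapse)
    qed
    moreover have "snd i < length (path_steps (fst i)) + 2" using that by (auto simp: J_def length_nodes)
    moreover have "lt i = 3" if "snd i = 0" using that by (simp add: lt_def nodes_def)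
    moreover have "lt i = 3" if "snd i = length (path_steps (fst i)) + 1" using that by (simp add: lt_def nodes_def nth_append)
    ultimately show ?thesis by (metis Suc_eq_plus1 add_2_eq_Suc' less_antisym nat_neq_iff neq0_conv)
  qed
  have x0: "x i = 0 * lam ^ fst i" if "snd i = 0" for i using that by (simp add: x_def nodes_def)
  have x1: "x i = 1 * lam ^ fst i" if "snd i = length (path_steps (fst i)) + 1" for i
    using that by (simp add: x_def nodes_def nth_append)
  have "(\<Sum>g<4. ind (\<Union>i\<in>{i\<in>I. lt i = g}. N i)) \<asymp> (\<Sum>g<4. ind (\<Union>i\<in>{i\<in>I. lt (nx i) = g}. N (nx i)))"
  proof (rule eqf_relabel[where df = "\<lambda>i. (x (nx i) - x i) *\<^sub>R d" and V = "(\<lambda>v. v *\<^sub>R d) ` jumps"])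
    fix i j p assume a: "i \<in> I" "j \<in> I" "lt i = lt j" "p \<in> N i" "p \<in> N j"
    show "i = j"
    proof (cases "lt i = 3")
      case True
      then have "snd i = 0" "snd j = 0" using a lt3[OF IJ(1)] by (auto simp: I_def)
      then show ?thesis using uniq3[of i j 0 p] a True IJ x0 by auto
    next
      case False
      then have "0 < snd i" "0 < snd j" using lt3[OF IJ(1)[OF a(1)]] lt3[OF IJ(1)[OF a(2)]] a(3) by auto
      then show ?thesis using uniq[of i j p] a IJ by (auto simp: I_def)
    qed
  next
    fix i j p assume a: "i \<in> I" "j \<in> I" "lt (nx i) = lt (nx j)" "p \<in> N (nx i)" "p \<in> N (nx j)"
    have "nx i = nx j"
    proof (cases "lt (nx i) = 3")
      case True
      then have "snd (nx i) = length (path_steps (fst (nx i))) + 1" "snd (nx j) = length (path_steps (fst (nx j))) + 1"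
        using a(3) lt3[OF IJ(2)[OF a(1)]] lt3[OF IJ(2)[OF a(2)]] by (auto simp: nx_def)
      moreover have "lt (nx j) = 3" using True a(3) by simp
      moreover have "snd (nx i) = snd (nx j) \<or> fst (nx i) \<noteq> fst (nx j)" using calculation by metis
      ultimately show ?thesis
        using uniq3[OF IJ(2)[OF a(1)] IJ(2)[OF a(2)] True _ x1 x1 _ a(4,5)] by blast
    next
      case False
      then have "snd (nx i) \<noteq> length (path_steps (fst (nx i))) + 1" "snd (nx j) \<noteq> length (path_steps (fst (nx j))) + 1"
        using lt3[OF IJ(2)[OF a(1)]] lt3[OF IJ(2)[OF a(2)]] a(3) by auto
      then show ?thesis using uniq[of "nx i" "nx j" p] a IJ by (auto simp: I_def nx_def)
    qed
    then show "i = j" by (auto simp: nx_def prod_eq_iff)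
  next
    fix i assume i: "i \<in> I"
    show "N (nx i) = (+) ((x (nx i) - x i) *\<^sub>R d) ` N i"
    proof -
      have "fst (nx i) = fst i" by (simp add: nx_def)
      then show ?thesis unfolding Nx image_image by (simp add: algebra_simps)
    qed
    show "(x (nx i) - x i) *\<^sub>R d \<in> (\<lambda>v. v *\<^sub>R d) ` jumps"
      using i nodes_jump[of "snd i" "fst i"] by (auto simp: x_def nx_def I_def)
    show "lt i < 4" "lt (nx i) < 4" using lane IJ i by auto
  next
    show "finite ((\<lambda>v. v *\<^sub>R d) ` jumps)" using finite_jumps by simp
  next
    fix g v
    define S where "S k = x ` {i\<in>I. fst i = k \<and> lt i = g \<and> (x (nx i) - x i) *\<^sub>R d = v}" for k
    have "(\<Union>i\<in>{i\<in>I. lt i = g \<and> (x (nx i) - x i) *\<^sub>R d = v}. N i) = (\<Union>k. \<Union>x\<in>S k. (+) (x *\<^sub>R d) ` P k)"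
      unfolding S_def Nx by blast
    moreover have "nice (\<Union>k. \<Union>x\<in>S k. (+) (x *\<^sub>R d) ` P k)"
    proof (rule nice_lanes[OF tame])
      show "P k \<subseteq> {- (\<bar>R\<bar> + \<bar>y2\<bar>)..\<bar>R\<bar> + \<bar>y2\<bar>} \<times> {- (\<bar>R\<bar> + \<bar>y2\<bar>) * lam ^ k..(\<bar>R\<bar> + \<bar>y2\<bar>) * lam ^ k}" for k
      proof
        fix p assume "p \<in> P k"
        then have p: "0 \<le> fst p" "fst p \<le> R" "y1 * lam ^ k \<le> snd p" "snd p \<le> y2 * lam ^ k"
          using zoneD by blast+
        have "0 \<le> y1 * lam ^ k" using y0 by simp
        moreover have "y2 * lam ^ k \<le> (\<bar>R\<bar> + \<bar>y2\<bar>) * lam ^ k" by (intro mult_right_mono) auto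
        moreover have "- (\<bar>R\<bar> + \<bar>y2\<bar>) * lam ^ k \<le> 0" by (simp add: mult_nonpos_nonneg)
        ultimately have "- (\<bar>R\<bar> + \<bar>y2\<bar>) * lam ^ k \<le> snd p" "snd p \<le> (\<bar>R\<bar> + \<bar>y2\<bar>) * lam ^ k" using p by linarith+
        then show "p \<in> {- (\<bar>R\<bar> + \<bar>y2\<bar>)..\<bar>R\<bar> + \<bar>y2\<bar>} \<times> {- (\<bar>R\<bar> + \<bar>y2\<bar>) * lam ^ k..(\<bar>R\<bar> + \<bar>y2\<bar>) * lam ^ k}"
          using p by (auto simp: mem_Times_iff)
      qed
      show "S k \<subseteq> lanes k" for k unfolding S_def using lane(1) IJ(1) by blast
    qed
    ultimately show "nice (\<Union>i\<in>{i\<in>I. lt i = g \<and> (x (nx i) - x i) *\<^sub>R d = v}. N i)" by simp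
  qed
  moreover have "{..<4::nat} = insert 3 {..<3}" by auto
  ultimately have main: "ind (\<Union>i\<in>{i\<in>I. lt i = 3}. N i) + (\<Sum>g<3. ind (\<Union>i\<in>{i\<in>I. lt i = g}. N i)) \<asymp>
     ind (\<Union>i\<in>{i\<in>I. lt (nx i) = 3}. N (nx i)) + (\<Sum>g<3. ind (\<Union>i\<in>{i\<in>I. lt (nx i) = g}. N (nx i)))" by simp
  have s3: "(\<Union>i\<in>{i\<in>I. lt i = 3}. N i) = (\<Union>k. P k)"
  proof -
    have "{i\<in>I. lt i = 3} = range (\<lambda>k. (k, 0))" using lt3[OF IJ(1)] by (auto simp: I_def)
    then show ?thesis by (simp add: Nx x0)
  qed
  have t3: "(\<Union>i\<in>{i\<in>I. lt (nx i) = 3}. N (nx i)) = (\<Union>k. (+) (lam ^ k *\<^sub>R d) ` P k)"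
  proof -
    have "{i\<in>I. lt (nx i) = 3} = range (\<lambda>k. (k, length (path_steps k)))" using lt3[OF IJ(2)] by (auto simp: I_def nx_def)
    moreover have "N (nx (k, length (path_steps k))) = (+) (lam ^ k *\<^sub>R d) ` P k" for k
      using x1[of "nx (k, length (path_steps k))"] unfolding Nx by (simp add: nx_def)
    ultimately show ?thesis by simp
  qed
  define M where "M g = (\<Union>i\<in>{i\<in>I. lt i = g}. N i)" for g
  have t: "(\<Union>i\<in>{i\<in>I. lt (nx i) = g}. N (nx i)) = M g" if "g < 3" for g
  proof -
    have "nx ` {i\<in>I. lt (nx i) = g} = {i\<in>I. lt i = g}"
    proof
      show "nx ` {i\<in>I. lt (nx i) = g} \<subseteq> {i\<in>I. lt i = g}"
      proof
        fix j assume "j \<in> nx ` {i\<in>I. lt (nx i) = g}"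
        then obtain i where i: "i \<in> I" "lt (nx i) = g" "j = nx i" by blast
        then have "snd (nx i) \<noteq> length (path_steps (fst (nx i))) + 1" using lt3[OF IJ(2)[OF i(1)]] that by auto
        then have "nx i \<in> I" using i by (auto simp: I_def nx_def)
        then show "j \<in> {i\<in>I. lt i = g}" using i by simp
      qed
      show "{i\<in>I. lt i = g} \<subseteq> nx ` {i\<in>I. lt (nx i) = g}"
      proof
        fix i assume "i \<in> {i\<in>I. lt i = g}"
        then obtain k j where i: "i = (k, j)" "(k, j) \<in> I" "lt (k, j) = g" by (cases i) auto
        then have "j \<noteq> 0" using lt3[OF IJ(1)[OF i(2)]] that by auto
        then obtain j' where "j = Suc j'" using not0_implies_Suc by blast
        then have j': "nx (k, j') = (k, j)" "(k, j') \<in> I" using i by (auto simp: nx_def I_def)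
        then show "i \<in> nx ` {i\<in>I. lt (nx i) = g}" using i by (intro image_eqI[of _ _ "(k, j')"]) auto
      qed
    qed
    then show ?thesis unfolding M_def by (metis (no_types, lifting) SUP_cong UN_extend_simps(10) image_image)
  qed
  have MK: "M g \<subseteq> K" for g
  proof
    fix p assume "p \<in> M g"
    then obtain i where i: "i \<in> I" "p \<in> N i" by (auto simp: M_def)
    obtain q where q: "q \<in> P (fst i)" "p = x i *\<^sub>R d + q" using i(2) unfolding Nx by blast
    have xi: "0 \<le> x i" "x i \<le> 1" using lane(1)[OF IJ(1)[OF i(1)]] lanes_ge_0 lanes_le_1 by auto
    have qz: "0 \<le> fst q" "fst q \<le> R" "y1 * lam ^ fst i \<le> snd q" "snd q \<le> y2 * lam ^ fst i"
      using zoneD q(1) by blast+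
    have "y1 * lam ^ fst i \<le> y2 * lam ^ fst i" using qz by linarith
    then have "y1 \<le> y2" by simp
    then have "y2 * lam ^ fst i \<le> y2 * 1" using y0 by (intro mult_left_mono) auto
    moreover have "lam\<^sup>2 * snd d \<le> 1 * snd d" using d(1) by (intro mult_right_mono) auto
    ultimately have a: "snd q \<le> snd d" using qz y(2) by linarith
    have b: "0 \<le> snd q" using qz(3) y0 by (meson lam_pow_ge_0 less_imp_le mult_nonneg_nonneg order_trans)
    have "x i * fst d \<le> fst d" "0 \<le> x i * fst d" "x i * snd d \<le> snd d" "0 \<le> x i * snd d"
      using xi d by (auto simp: mult_left_le_one_le)
    then have "p \<in> {0..R + fst d} \<times> {0..2 * snd d}" using a b qz q(2) by (auto simp: mem_Times_iff)
    then show "p \<in> K" using K(2) by blast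
  qed
  have nM: "nice (M g)" for g
  proof -
    define S where "S k = x ` {i\<in>I. fst i = k \<and> lt i = g}" for k
    have "M g = (\<Union>k. \<Union>x\<in>S k. (+) (x *\<^sub>R d) ` P k)" unfolding S_def M_def Nx by blast
    moreover have "nice (\<Union>k. \<Union>x\<in>S k. (+) (x *\<^sub>R d) ` P k)"
    proof (rule nice_lanes[OF tame])
      show "P k \<subseteq> {- (\<bar>R\<bar> + \<bar>y2\<bar>)..\<bar>R\<bar> + \<bar>y2\<bar>} \<times> {- (\<bar>R\<bar> + \<bar>y2\<bar>) * lam ^ k..(\<bar>R\<bar> + \<bar>y2\<bar>) * lam ^ k}" for k
      proof
        fix p assume "p \<in> P k"
        then have p: "0 \<le> fst p" "fst p \<le> R" "y1 * lam ^ k \<le> snd p" "snd p \<le> y2 * lam ^ k"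
          using zoneD by blast+
        have "0 \<le> y1 * lam ^ k" using y0 by simp
        moreover have "y2 * lam ^ k \<le> (\<bar>R\<bar> + \<bar>y2\<bar>) * lam ^ k" by (intro mult_right_mono) auto
        moreover have "- (\<bar>R\<bar> + \<bar>y2\<bar>) * lam ^ k \<le> 0" by (simp add: mult_nonpos_nonneg)
        ultimately have "- (\<bar>R\<bar> + \<bar>y2\<bar>) * lam ^ k \<le> snd p" "snd p \<le> (\<bar>R\<bar> + \<bar>y2\<bar>) * lam ^ k" using p by linarith+
        then show "p \<in> {- (\<bar>R\<bar> + \<bar>y2\<bar>)..\<bar>R\<bar> + \<bar>y2\<bar>} \<times> {- (\<bar>R\<bar> + \<bar>y2\<bar>) * lam ^ k..(\<bar>R\<bar> + \<bar>y2\<bar>) * lam ^ k}"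
          using p by (auto simp: mem_Times_iff)
      qed
      show "S k \<subseteq> lanes k" for k unfolding S_def using lane(1) IJ(1) by blast
    qed
    ultimately show ?thesis by simp
  qed
  have "{..<3::nat} = {0, 1, 2}" by auto
  then have sum3: "(\<Sum>g<3. f g) = f 0 + f 1 + f 2" for f :: "nat \<Rightarrow> real \<times> real \<Rightarrow> nat" by (simp add: add.assoc)
  have t012: "(\<Union>i\<in>{i\<in>I. lt (nx i) = 0}. N (nx i)) = M 0" "(\<Union>i\<in>{i\<in>I. lt (nx i) = 1}. N (nx i)) = M 1"
    "(\<Union>i\<in>{i\<in>I. lt (nx i) = 2}. N (nx i)) = M 2" by (rule t, simp)+
  have "ind (\<Union>k. P k) + (ind (M 0) + ind (M 1) + ind (M 2)) \<asymp> ind (\<Union>k. (+) (lam ^ k *\<^sub>R d) ` P k) + (ind (M 0) + ind (M 1) + ind (M 2))"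
    using main unfolding s3 t3 sum3 t012 M_def[symmetric] .
  then show ?thesis by (rule eqf_cat3) (auto intro: MK nM K(1) del: subsetI)
qed

subsection \<open>Piecewise Lipschitz families\<close>

text \<open>Breakpoints are forbidden in \<open>{x<..y}\<close> and allowed at x: a piece contains
  its left end but not its right end, in accordance with the half-open sets below. The values
  outside [0, w) are left to periodicity.\<close>

definition pw_lipschitz :: "real \<Rightarrow> real \<Rightarrow> real \<Rightarrow> (real \<Rightarrow> real) \<Rightarrow> bool" where
  "pw_lipschitz w N L f \<longleftrightarrow> (\<exists>X. finite X \<and> real (card X) \<le> N \<and>
     (\<forall>x y. 0 \<le> x \<longrightarrow> x \<le> y \<longrightarrow> y < w \<longrightarrow> X \<inter> {x<..y} = {} \<longrightarrow> \<bar>f x - f y\<bar> \<le> L * (y - x)))"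

lemma pw_lipschitzI:
  assumes "\<And>x y. 0 \<le> x \<Longrightarrow> x \<le> y \<Longrightarrow> y < w \<Longrightarrow> \<bar>f x - f y\<bar> \<le> L * (y - x)"
  shows "pw_lipschitz w 0 L f"
  unfolding pw_lipschitz_def using assms by (intro exI[of _ "{}"]) auto

lemma pw_lipschitz_mono:
  assumes "pw_lipschitz w N L f" "N \<le> N'" "L \<le> L'"
  shows "pw_lipschitz w N' L' f"
proof -
  obtain X where X: "finite X" "real (card X) \<le> N"
    "\<And>x y. 0 \<le> x \<Longrightarrow> x \<le> y \<Longrightarrow> y < w \<Longrightarrow> X \<inter> {x<..y} = {} \<Longrightarrow> \<bar>f x - f y\<bar> \<le> L * (y - x)"
    using assms(1) unfolding pw_lipschitz_def by blast
  have "\<bar>f x - f y\<bar> \<le> L' * (y - x)" if "0 \<le> x" "x \<le> y" "y < w" "X \<inter> {x<..y} = {}" for x y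
  proof -
    have "L * (y - x) \<le> L' * (y - x)" using that assms(3) by (intro mult_right_mono) auto
    then show ?thesis using X(3)[OF that] by linarith
  qed
  then show ?thesis unfolding pw_lipschitz_def using X assms(2)
    by (intro exI[of _ X]) auto
qed

lemma pw_lipschitz_combine:
  assumes f: "pw_lipschitz w N L f" and g: "pw_lipschitz w M K g"
    and h: "\<And>x y. 0 \<le> x \<Longrightarrow> x \<le> y \<Longrightarrow> y < w \<Longrightarrow> \<bar>f x - f y\<bar> \<le> L * (y - x) \<Longrightarrow> \<bar>g x - g y\<bar> \<le> K * (y - x) \<Longrightarrow>
      \<bar>h x - h y\<bar> \<le> H * (y - x)"
  shows "pw_lipschitz w (N + M) H h"
proof -
  obtain X where X: "finite X" "real (card X) \<le> N"
    "\<And>x y. 0 \<le> x \<Longrightarrow> x \<le> y \<Longrightarrow> y < w \<Longrightarrow> X \<inter> {x<..y} = {} \<Longrightarrow> \<bar>f x - f y\<bar> \<le> L * (y - x)"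
    using f unfolding pw_lipschitz_def by blast
  obtain Y where Y: "finite Y" "real (card Y) \<le> M"
    "\<And>x y. 0 \<le> x \<Longrightarrow> x \<le> y \<Longrightarrow> y < w \<Longrightarrow> Y \<inter> {x<..y} = {} \<Longrightarrow> \<bar>g x - g y\<bar> \<le> K * (y - x)"
    using g unfolding pw_lipschitz_def by blast
  have "real (card (X \<union> Y)) \<le> real (card X + card Y)" by (simp only: of_nat_le_iff card_Un_le)
  then have c: "real (card (X \<union> Y)) \<le> N + M" using X(2) Y(2) by simp
  have "\<bar>h x - h y\<bar> \<le> H * (y - x)" if "0 \<le> x" "x \<le> y" "y < w" "(X \<union> Y) \<inter> {x<..y} = {}" for x y
  proof -
    have "X \<inter> {x<..y} = {}" "Y \<inter> {x<..y} = {}" using that(4) by blast+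
    then show ?thesis using h X(3) Y(3) that(1-3) by blast
  qed
  then show ?thesis unfolding pw_lipschitz_def using c X(1) Y(1)
    by (intro exI[of _ "X \<union> Y"]) auto
qed

lemma pw_lipschitz_add:
  assumes "pw_lipschitz w N L f" "pw_lipschitz w M K g"
  shows "pw_lipschitz w (N + M) (L + K) (\<lambda>x. f x + g x)"
  by (rule pw_lipschitz_combine[OF assms]) (auto simp: distrib_right abs_le_iff)

lemma pw_lipschitz_cmult:
  assumes "pw_lipschitz w N L f"
  shows "pw_lipschitz w N (\<bar>c\<bar> * L) (\<lambda>x. c * f x)"
proof -
  have "pw_lipschitz w 0 0 (\<lambda>x. 0)" by (rule pw_lipschitzI) auto
  then have "pw_lipschitz w (N + 0) (\<bar>c\<bar> * L) (\<lambda>x. c * f x)"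
  proof (rule pw_lipschitz_combine[OF assms])
    fix x y :: real assume "\<bar>f x - f y\<bar> \<le> L * (y - x)"
    then have "\<bar>c\<bar> * \<bar>f x - f y\<bar> \<le> \<bar>c\<bar> * (L * (y - x))" by (intro mult_left_mono) auto
    then show "\<bar>c * f x - c * f y\<bar> \<le> \<bar>c\<bar> * L * (y - x)"
      by (simp add: abs_mult mult.assoc flip: right_diff_distrib)
  qed
  then show ?thesis by simp
qed

section \<open>Periodic functions and their shifts\<close>

definition wrap :: "real \<Rightarrow> real \<Rightarrow> real" where
  "wrap w x = x - w * \<lfloor>x / w\<rfloor>"

lemma wrap_range: "0 < w \<Longrightarrow> 0 \<le> wrap w x" "0 < w \<Longrightarrow> wrap w x < w"
proof -
  assume w: "0 < w"
  have "of_int \<lfloor>x / w\<rfloor> * w \<le> x" "x < (of_int \<lfloor>x / w\<rfloor> + 1) * w"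
    by (rule floor_divide_lower[OF w] floor_divide_upper[OF w])+
  then show "0 \<le> wrap w x" "wrap w x < w" by (auto simp: wrap_def algebra_simps)
qed

lemma wrap_eqI:
  assumes "0 < w" "0 \<le> y" "y < w" "x = y + w * of_int n"
  shows "wrap w x = y"
proof -
  have "x / w = y / w + of_int n" using assms by (simp add: add_divide_distrib)
  moreover have "\<lfloor>y / w\<rfloor> = 0" using assms by (simp add: floor_eq_iff)
  ultimately show ?thesis using assms by (simp add: wrap_def)
qed

definition periodic :: "real \<Rightarrow> (real \<Rightarrow> 'a) \<Rightarrow> bool" where
  "periodic w f \<longleftrightarrow> (\<forall>x. f (x + w) = f x)"

lemma periodic_int: assumes "periodic w f" shows "f (x + w * of_int n) = f x"
proof -
  have n: "f (x + w * real m) = f x" for m x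
  proof (induction m)
    case (Suc m)
    have "f (x + w * real (Suc m)) = f ((x + w * real m) + w)" by (simp add: algebra_simps)
    then show ?case using Suc assms by (simp add: periodic_def)
  qed simp
  show ?thesis
  proof (cases "0 \<le> n")
    case True
    then show ?thesis using n[of x "nat n"] by simp
  next
    case False
    then show ?thesis using n[of "x + w * of_int n" "nat (- n)"] by (simp add: algebra_simps)
  qed
qed

lemma periodic_wrap: "periodic w f \<Longrightarrow> f (wrap w x) = f x"
  using periodic_int[of w f x "- \<lfloor>x / w\<rfloor>"] by (simp add: wrap_def)

lemma periodic_shift: "periodic w f \<Longrightarrow> periodic w (\<lambda>x. f (x - s))"
  unfolding periodic_def by (metis add_diff_eq diff_add_eq)

text \<open>The breakpoints are shifted modulo w. The additional one is the image of 0, where the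
  end of one period meets the beginning of the next.\<close>

lemma pw_lipschitz_shift:
  assumes f: "pw_lipschitz w N L f" "periodic w f" and w: "0 < w"
  shows "pw_lipschitz w (N + 1) L (\<lambda>x. f (x - s))"
proof -
  obtain X where X: "finite X" "real (card X) \<le> N"
    "\<And>x y. 0 \<le> x \<Longrightarrow> x \<le> y \<Longrightarrow> y < w \<Longrightarrow> X \<inter> {x<..y} = {} \<Longrightarrow> \<bar>f x - f y\<bar> \<le> L * (y - x)"
    using f(1) unfolding pw_lipschitz_def by blast
  define Y where "Y = (\<lambda>p. wrap w (p + s)) ` (X \<union> {0})"
  have "card Y \<le> card (X \<union> {0})" unfolding Y_def using X by (intro card_image_le) auto
  also have "\<dots> \<le> card X + 1" using card_Un_le[of X "{0}"] by simp
  finally have cY: "real (card Y) \<le> N + 1" using X(2) by linarith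
  have "\<bar>f (x - s) - f (y - s)\<bar> \<le> L * (y - x)" if "0 \<le> x" "x \<le> y" "y < w" "Y \<inter> {x<..y} = {}" for x y
  proof -
    define n where "n = \<lfloor>(x - s) / w\<rfloor>"
    have nx: "of_int n * w \<le> x - s" "x - s < (of_int n + 1) * w"
      unfolding n_def using w floor_divide_lower floor_divide_upper by blast+
    have ny: "y - s < (of_int n + 1) * w"
    proof (rule ccontr)
      assume "\<not> y - s < (of_int n + 1) * w"
      then have z: "(of_int n + 1) * w + s \<le> y" "x < (of_int n + 1) * w + s" using nx by linarith+
      have "wrap w (0 + s) = (of_int n + 1) * w + s"
        using z that w by (intro wrap_eqI[where n = "- (n + 1)"]) (auto simp: algebra_simps)
      then have "(of_int n + 1) * w + s \<in> Y" unfolding Y_def by (metis Un_iff imageI insertI1)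
      then show False using that(4) z by auto
    qed
    define x' y' where "x' = x - s - of_int n * w" and "y' = y - s - of_int n * w"
    have xy: "0 \<le> x'" "x' \<le> y'" "y' < w" using nx ny that by (auto simp: x'_def y'_def algebra_simps)
    have "X \<inter> {x'<..y'} = {}"
    proof (rule ccontr)
      assume "X \<inter> {x'<..y'} \<noteq> {}"
      then obtain p where p: "p \<in> X" "x' < p" "p \<le> y'" by auto
      have "wrap w (p + s) = p + s + of_int n * w"
        using p that w by (intro wrap_eqI[where n = "- n"]) (auto simp: algebra_simps x'_def y'_def)
      then have "p + s + of_int n * w \<in> Y" unfolding Y_def using p(1) by (metis UnI1 imageI)
      then show False using that(4) p by (auto simp: x'_def y'_def)
    qed
    then have "\<bar>f x' - f y'\<bar> \<le> L * (y' - x')" using X(3) xy by blast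
    moreover have "f x' = f (x - s)" "f y' = f (y - s)"
      using periodic_int[OF f(2), of x' n] periodic_int[OF f(2), of y' n]
      by (auto simp: x'_def y'_def mult.commute)
    ultimately show ?thesis by (simp add: x'_def y'_def)
  qed
  then show ?thesis unfolding pw_lipschitz_def using cY X(1)
    by (intro exI[of _ Y]) (auto simp: Y_def)
qed

section \<open>Boundaries of subgraphs of piecewise Lipschitz functions\<close>

definition subgraph :: "real \<Rightarrow> real \<Rightarrow> (real \<Rightarrow> real) \<Rightarrow> (real \<times> real) set" where
  "subgraph p q f = {z. p \<le> fst z \<and> fst z < q \<and> 0 < snd z \<and> snd z \<le> f (fst z)}"

lemma subgraph_piece:
  assumes lip: "\<And>x y. p \<le> x \<Longrightarrow> x \<le> y \<Longrightarrow> y < q \<Longrightarrow> \<bar>f x - f y\<bar> \<le> L * (y - x)"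
    and Y: "\<And>x. p \<le> x \<Longrightarrow> x < q \<Longrightarrow> f x \<le> Y" "0 \<le> Y" and w: "p \<le> q" "q - p \<le> w" and L: "0 \<le> L"
  shows "delta2 (subgraph p q f)"
    and "0 < e \<Longrightarrow> e \<le> 1 \<Longrightarrow> covered (frontier (subgraph p q f)) e ((2 * (Y + 1) + (w + 1) + ((1 + L) * w + 1)) / e)"
proof -
  let ?G = "subgraph p q f"
  have lip': "\<bar>f x - f y\<bar> \<le> L * \<bar>x - y\<bar>" if "p \<le> x" "x < q" "p \<le> y" "y < q" for x y
    using lip[of x y] lip[of y x] that by (cases "x \<le> y") auto
  have "L-lipschitz_on {p..<q} f"
    by (intro lipschitz_onI L) (use lip' in \<open>auto simp: dist_real_def\<close>)
  then have cf: "continuous_on {p..<q} f" by (rule lipschitz_on_continuous_on)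
  have cg: "continuous_on (A \<times> UNIV) (\<lambda>z::real \<times> real. f (fst z) - snd z)" if "A \<subseteq> {p..<q}" for A
    by (intro continuous_intros continuous_on_compose2[OF cf]) (use that in auto)
  show "delta2 ?G"
  proof -
    have "closedin (top_of_set ({p..<q} \<times> UNIV)) (({p..<q} \<times> UNIV) \<inter> (\<lambda>z. f (fst z) - snd z) -` {0..})"
      by (intro continuous_closedin_preimage cg) auto
    then obtain K where K: "closed K" "({p..<q} \<times> UNIV) \<inter> (\<lambda>z. f (fst z) - snd z) -` {0..} = ({p..<q} \<times> UNIV) \<inter> K"
      unfolding closedin_closed by blast
    have "?G = ({p..} \<times> UNIV) \<inter> ({..<q} \<times> {0<..}) \<inter> K"
    proof -
      have "z \<in> ?G \<longleftrightarrow> z \<in> ({p..<q} \<times> UNIV) \<inter> (\<lambda>z. f (fst z) - snd z) -` {0..} \<and> 0 < snd z" for z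
        by (auto simp: subgraph_def mem_Times_iff)
      then show ?thesis unfolding K(2) by (auto simp: mem_Times_iff)
    qed
    moreover have "closed ({p..} \<times> (UNIV :: real set))" by (intro closed_Times) auto
    moreover have "open ({..<q} \<times> {0::real<..})" by (intro open_Times) auto
    ultimately show ?thesis using K(1) by (simp add: delta2_Int delta2_closed delta2_open)
  qed
  assume e: "0 < e" "e \<le> 1"
  let ?gr = "(\<lambda>x. (x, f x)) ` {p..<q}"
  \<comment> \<open>A frontier point lies on one of the two vertical sides, on the base or on the
    graph: elsewhere one of the strict inequalities f > y or f < y persists in a
    neighbourhood.\<close>
  have sub: "frontier ?G \<subseteq> (\<lambda>t. (p, t)) ` {0..0+Y} \<union> (\<lambda>t. (q, t)) ` {0..0+Y} \<union> (\<lambda>t. (t, 0)) ` {p..p+(q-p)} \<union> ?gr"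
  proof
    fix z assume z: "z \<in> frontier ?G"
    have "?G \<subseteq> {p..q} \<times> {0..Y}" using Y by (fastforce simp: subgraph_def mem_Times_iff)
    moreover have "closed ({p..q} \<times> {0..Y})" by (intro closed_Times) auto
    ultimately have "closure ?G \<subseteq> {p..q} \<times> {0..Y}" by (rule closure_minimal)
    then have zc: "p \<le> fst z" "fst z \<le> q" "0 \<le> snd z" "snd z \<le> Y" using z by (auto simp: frontier_def mem_Times_iff)
    consider "fst z = p" | "fst z = q" | "snd z = 0" | "p < fst z" "fst z < q" "0 < snd z" using zc by linarith
    then show "z \<in> (\<lambda>t. (p, t)) ` {0..0+Y} \<union> (\<lambda>t. (q, t)) ` {0..0+Y} \<union> (\<lambda>t. (t, 0)) ` {p..p+(q-p)} \<union> ?gr"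
    proof cases
      case 4
      have op: "open (({p<..<q} \<times> UNIV) \<inter> (\<lambda>z. f (fst z) - snd z) -` S)" if "open S" for S
        by (rule continuous_open_preimage[OF cg _ that]) (auto intro: open_Times)
      have "snd z = f (fst z)"
      proof (rule ccontr)
        assume "snd z \<noteq> f (fst z)"
        then consider "snd z < f (fst z)" | "f (fst z) < snd z" by linarith
        then show False
        proof cases
          case 1
          have "open (({p<..<q} \<times> UNIV) \<inter> (\<lambda>z. f (fst z) - snd z) -` {0<..} \<inter> (UNIV \<times> {0<..}))"
            by (intro open_Int op open_Times) auto
          moreover have "({p<..<q} \<times> UNIV) \<inter> (\<lambda>z. f (fst z) - snd z) -` {0<..} \<inter> (UNIV \<times> {0<..}) \<subseteq> ?G"
            by (auto simp: subgraph_def)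
          moreover have "z \<in> ({p<..<q} \<times> UNIV) \<inter> (\<lambda>z. f (fst z) - snd z) -` {0<..} \<inter> (UNIV \<times> {0<..})"
            using 1 4 by (auto simp: mem_Times_iff)
          ultimately have "z \<in> interior ?G" by (meson interiorI)
          then show False using z by (simp add: frontier_def)
        next
          case 2
          let ?O = "({p<..<q} \<times> UNIV) \<inter> (\<lambda>z. f (fst z) - snd z) -` {..<0}"
          have "z \<in> ?O" using 2 4 by (auto simp: mem_Times_iff)
          moreover have "?O \<inter> ?G = {}" by (auto simp: subgraph_def)
          ultimately have "z \<notin> closure ?G" using op[of "{..<0}"] open_Int_closure_eq_empty[of ?O ?G] by auto
          then show False using z by (simp add: frontier_def)
        qed
      qed
      then have "z = (fst z, f (fst z))" by (simp add: prod_eq_iff)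
      moreover have "fst z \<in> {p..<q}" using 4 by auto
      ultimately show ?thesis by blast
    next
      case 1
      then have "z = (\<lambda>t. (p, t)) (snd z)" "snd z \<in> {0..0+Y}" using zc by (auto simp: prod_eq_iff)
      then show ?thesis by blast
    next
      case 2
      then have "z = (\<lambda>t. (q, t)) (snd z)" "snd z \<in> {0..0+Y}" using zc by (auto simp: prod_eq_iff)
      then show ?thesis by blast
    next
      case 3
      then have "z = (\<lambda>t. (t, 0)) (fst z)" "fst z \<in> {p..p+(q-p)}" using zc by (auto simp: prod_eq_iff)
      then show ?thesis by blast
    qed
  qed
  have c1: "covered ((\<lambda>t. (a, t)) ` {0..0+Y}) e ((1 * Y + 1) / e)" for a :: real
    by (rule covered_lipschitz_arc[OF _ Y(2) e order_refl]) (auto simp: dist_Pair_Pair dist_real_def)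
  have "covered ((\<lambda>t. (t, 0::real)) ` {p..p+(q-p)}) e ((1 * (q - p) + 1) / e)"
    using w by (intro covered_lipschitz_arc[OF _ _ e order_refl]) (auto simp: dist_Pair_Pair dist_real_def)
  moreover have "(1 * (q - p) + 1) / e \<le> (w + 1) / e" using w e by (intro divide_right_mono) auto
  ultimately have c2: "covered ((\<lambda>t. (t, 0::real)) ` {p..p+(q-p)}) e ((w + 1) / e)"
    by (rule covered_mono[OF _ order_refl])
  have "covered ?gr e (((1 + L) * (q - p) + 1) / e)"
  proof (rule covered_lipschitz_arc[OF _ _ e])
    show "{p..<q} \<subseteq> {p..p+(q-p)}" by auto
    fix x y assume "x \<in> {p..<q}" "y \<in> {p..<q}"
    then have "\<bar>f x - f y\<bar> \<le> L * \<bar>x - y\<bar>" using lip' by auto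
    moreover have "dist (x, f x) (y, f y) \<le> \<bar>x - y\<bar> + \<bar>f x - f y\<bar>"
      unfolding dist_Pair_Pair dist_real_def by (rule order_trans[OF sqrt_sum_squares_le_sum]) auto
    ultimately show "dist (x, f x) (y, f y) \<le> (1 + L) * \<bar>x - y\<bar>" by (simp add: distrib_right)
  qed (use L w in auto)
  moreover have "((1 + L) * (q - p) + 1) / e \<le> ((1 + L) * w + 1) / e"
    using w e L by (intro divide_right_mono add_mono mult_left_mono) auto
  ultimately have c3: "covered ?gr e (((1 + L) * w + 1) / e)" by (rule covered_mono[OF _ order_refl])
  have "covered ((\<lambda>t. (p, t)) ` {0..0+Y} \<union> (\<lambda>t. (q, t)) ` {0..0+Y} \<union> (\<lambda>t. (t, 0)) ` {p..p+(q-p)} \<union> ?gr) e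
     ((1 * Y + 1) / e + (1 * Y + 1) / e + (w + 1) / e + ((1 + L) * w + 1) / e)"
    by (intro covered_Un c1 c2 c3)
  then show "covered (frontier ?G) e ((2 * (Y + 1) + (w + 1) + ((1 + L) * w + 1)) / e)"
    by (rule covered_mono[OF _ sub]) (simp add: add_divide_distrib)
qed

lemma subgraph_pw_lipschitz:
  assumes f: "pw_lipschitz w N L f" and w: "0 < w" and L: "0 \<le> L"
    and Y: "\<And>x. 0 \<le> x \<Longrightarrow> x < w \<Longrightarrow> f x \<le> Y" "0 \<le> Y"
  shows "delta2 (subgraph 0 w f)"
    and "0 < e \<Longrightarrow> e \<le> 1 \<Longrightarrow> covered (frontier (subgraph 0 w f)) e ((N + 1) * (2 * (Y + 1) + (w + 1) + ((1 + L) * w + 1)) / e)"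
proof -
  obtain X where X: "finite X" "real (card X) \<le> N"
    "\<And>x y. 0 \<le> x \<Longrightarrow> x \<le> y \<Longrightarrow> y < w \<Longrightarrow> X \<inter> {x<..y} = {} \<Longrightarrow> \<bar>f x - f y\<bar> \<le> L * (y - x)"
    using f unfolding pw_lipschitz_def by blast
  define X' where "X' = (X \<inter> {0<..<w}) \<union> {0}"
  have X': "finite X'" "X' \<subseteq> {0..<w}" "0 \<in> X'" using X w by (auto simp: X'_def)
  have "card X' \<le> card (X \<inter> {0<..<w}) + 1" unfolding X'_def using card_Un_le[of "X \<inter> {0<..<w}" "{0}"] by simp
  also have "\<dots> \<le> card X + 1" using X(1) by (simp add: card_mono)
  finally have cX': "real (card X') \<le> N + 1" using X(2) by linarith
  define nx where "nx p = Min ({q\<in>X'. p < q} \<union> {w})" for p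
  have nx: "p < nx p" "nx p \<le> w" if "p \<in> X'" for p
    using that X' by (auto simp: nx_def)
  have nxX: "q \<notin> X'" if "p < q" "q < nx p" for p q
    using that X'(1) Min_le[of "{q\<in>X'. p < q} \<union> {w}" q] by (auto simp: nx_def)
  have lip: "\<bar>f x - f y\<bar> \<le> L * (y - x)" if "p \<in> X'" "p \<le> x" "x \<le> y" "y < nx p" for p x y
  proof (rule X(3))
    show "0 \<le> x" using that X' by auto
    show "y < w" using that nx(2)[OF that(1)] by simp
    show "X \<inter> {x<..y} = {}"
    proof (rule ccontr)
      assume "X \<inter> {x<..y} \<noteq> {}"
      then obtain q where "q \<in> X" "x < q" "q \<le> y" by auto
      then have "q \<in> X'" "p < q" "q < nx p" using that \<open>0 \<le> x\<close> \<open>y < w\<close> by (auto simp: X'_def)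
      then show False using nxX by blast
    qed
  qed (use that in auto)
  have G: "subgraph 0 w f = (\<Union>p\<in>X'. subgraph p (nx p) f)"
  proof
    show "subgraph 0 w f \<subseteq> (\<Union>p\<in>X'. subgraph p (nx p) f)"
    proof
      fix z assume z: "z \<in> subgraph 0 w f"
      define p where "p = Max {q\<in>X'. q \<le> fst z}"
      have ne: "{q\<in>X'. q \<le> fst z} \<noteq> {}" using X'(3) z by (auto simp: subgraph_def)
      have p: "p \<in> X'" "p \<le> fst z" using Max_in[OF _ ne] X'(1) unfolding p_def by auto
      have "fst z < nx p"
      proof (rule ccontr)
        assume "\<not> fst z < nx p"
        moreover have "nx p \<in> {q\<in>X'. p < q} \<union> {w}" unfolding nx_def using X'(1) by (intro Min_in) auto
        ultimately have "nx p \<in> {q\<in>X'. q \<le> fst z}" using z by (auto simp: subgraph_def)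
        then have "nx p \<le> p" unfolding p_def using X'(1) by (intro Max_ge) auto
        then show False using nx(1)[OF p(1)] by simp
      qed
      then have "z \<in> subgraph p (nx p) f" using z p by (auto simp: subgraph_def)
      then show "z \<in> (\<Union>p\<in>X'. subgraph p (nx p) f)" using p(1) by blast
    qed
    show "(\<Union>p\<in>X'. subgraph p (nx p) f) \<subseteq> subgraph 0 w f"
    proof clarify
      fix p a b assume "p \<in> X'" "(a, b) \<in> subgraph p (nx p) f"
      then show "(a, b) \<in> subgraph 0 w f" using X'(2) nx(2)[of p] by (auto simp: subgraph_def)
    qed
  qed
  have pc: "delta2 (subgraph p (nx p) f)"
     "0 < e \<Longrightarrow> e \<le> 1 \<Longrightarrow> covered (frontier (subgraph p (nx p) f)) e ((2 * (Y + 1) + (w + 1) + ((1 + L) * w + 1)) / e)"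
    if p: "p \<in> X'" for p e
  proof -
    have a: "\<And>x. p \<le> x \<Longrightarrow> x < nx p \<Longrightarrow> f x \<le> Y" using p X'(2) nx(2)[OF p] Y(1) by force
    have b: "p \<le> nx p" "nx p - p \<le> w" using nx[OF p] p X'(2) by force+
    show "delta2 (subgraph p (nx p) f)"
     "0 < e \<Longrightarrow> e \<le> 1 \<Longrightarrow> covered (frontier (subgraph p (nx p) f)) e ((2 * (Y + 1) + (w + 1) + ((1 + L) * w + 1)) / e)"
      using subgraph_piece[OF lip[OF p] a Y(2) b L] by auto
  qed
  show "delta2 (subgraph 0 w f)" unfolding G by (intro delta2_UN X'(1) pc(1))
  assume e: "0 < e" "e \<le> 1"
  let ?c = "(2 * (Y + 1) + (w + 1) + ((1 + L) * w + 1)) / e"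
  have "covered (\<Union>p\<in>X'. frontier (subgraph p (nx p) f)) e (\<Sum>p\<in>X'. ?c)"
    by (intro covered_UN X'(1) pc(2) e)
  moreover have "(\<Sum>p\<in>X'. ?c) \<le> (N + 1) * ?c"
  proof -
    have "0 \<le> ?c" using Y w L e by auto
    then have "real (card X') * ?c \<le> (N + 1) * ?c" by (rule mult_right_mono[OF cX'])
    then show ?thesis by (simp only: sum_constant)
  qed
  ultimately show "covered (frontier (subgraph 0 w f)) e ((N + 1) * (2 * (Y + 1) + (w + 1) + ((1 + L) * w + 1)) / e)"
    unfolding G using covered_mono[OF _ frontier_UN_subset[OF X'(1)]] by simp
qed

text \<open>Height and slope stay bounded over all scales while the number of jumps may grow. The
  integer rounding at scale k produces jumps at rate 6^k; 9^k leaves room for the operations on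
  families and stays below the rate 10^k that \<open>tame\<close> permits.\<close>

definition pl_family :: "real \<Rightarrow> (nat \<Rightarrow> real \<Rightarrow> real) \<Rightarrow> bool" where
  "pl_family w F \<longleftrightarrow> (\<exists>C\<ge>0. \<forall>k. pw_lipschitz w (C * 9 ^ k) C (F k) \<and> (\<forall>x\<in>{0..<w}. \<bar>F k x\<bar> \<le> C))"

definition step_family :: "real \<Rightarrow> (nat \<Rightarrow> real \<Rightarrow> bool) \<Rightarrow> bool" where
  "step_family w T \<longleftrightarrow> (\<exists>C\<ge>0. \<forall>k. pw_lipschitz w (C * 9 ^ k) 0 (\<lambda>x. of_bool (T k x)))"

definition tame_family :: "(nat \<Rightarrow> 'a::metric_space set) \<Rightarrow> bool" where
  "tame_family P \<longleftrightarrow> (\<exists>C. \<forall>k. tame C k (P k))"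

lemma pl_family_add:
  assumes "pl_family w F" "pl_family w G"
  shows "pl_family w (\<lambda>k x. F k x + G k x)"
proof -
  obtain C where C: "0 \<le> C" "\<And>k. pw_lipschitz w (C * 9 ^ k) C (F k)" "\<And>k x. x \<in> {0..<w} \<Longrightarrow> \<bar>F k x\<bar> \<le> C"
    using assms(1) unfolding pl_family_def by blast
  obtain D where D: "0 \<le> D" "\<And>k. pw_lipschitz w (D * 9 ^ k) D (G k)" "\<And>k x. x \<in> {0..<w} \<Longrightarrow> \<bar>G k x\<bar> \<le> D"
    using assms(2) unfolding pl_family_def by blast
  have "pw_lipschitz w ((C + D) * 9 ^ k) (C + D) (\<lambda>x. F k x + G k x)" for k
    using pw_lipschitz_add[OF C(2) D(2), of k k] by (simp add: distrib_right)
  moreover have "\<bar>F k x + G k x\<bar> \<le> C + D" if "x \<in> {0..<w}" for k x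
    using C(3)[OF that, of k] D(3)[OF that, of k] by linarith
  ultimately show ?thesis unfolding pl_family_def using C(1) D(1) by (intro exI[of _ "C + D"]) auto
qed

lemma pl_family_const:
  assumes "\<And>k. \<bar>c k\<bar> \<le> B" shows "pl_family w (\<lambda>k x. c k)"
proof -
  have "0 \<le> B" using assms[of 0] by linarith
  moreover have "pw_lipschitz w (B * 9 ^ k) B (\<lambda>x. c k)" for k
    using \<open>0 \<le> B\<close> by (intro pw_lipschitz_mono[OF pw_lipschitzI]) auto
  ultimately show ?thesis unfolding pl_family_def using assms by (intro exI[of _ B]) auto
qed

lemma pl_family_scale:
  assumes "pl_family w F" "\<And>k. \<bar>c k\<bar> \<le> B"
  shows "pl_family w (\<lambda>k x. c k * F k x)"
proof -
  obtain C where C: "0 \<le> C" "\<And>k. pw_lipschitz w (C * 9 ^ k) C (F k)" "\<And>k x. x \<in> {0..<w} \<Longrightarrow> \<bar>F k x\<bar> \<le> C"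
    using assms(1) unfolding pl_family_def by blast
  have B: "0 \<le> B" using assms(2)[of 0] by linarith
  have "pw_lipschitz w ((C + B * C) * 9 ^ k) (C + B * C) (\<lambda>x. c k * F k x)" for k
  proof (rule pw_lipschitz_mono[OF pw_lipschitz_cmult[OF C(2)]])
    show "C * 9 ^ k \<le> (C + B * C) * 9 ^ k" using B C(1) by (intro mult_right_mono) auto
    have "\<bar>c k\<bar> * C \<le> B * C" using assms(2) C(1) by (intro mult_right_mono) auto
    then show "\<bar>c k\<bar> * C \<le> C + B * C" using C(1) by linarith
  qed
  moreover have "\<bar>c k * F k x\<bar> \<le> C + B * C" if "x \<in> {0..<w}" for k x
  proof -
    have "\<bar>c k\<bar> * \<bar>F k x\<bar> \<le> B * C" using assms(2) C(3)[OF that] B by (intro mult_mono) auto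
    then show ?thesis using C(1) by (simp add: abs_mult)
  qed
  ultimately show ?thesis unfolding pl_family_def using C(1) B by (intro exI[of _ "C + B * C"]) auto
qed

lemma pl_family_diff:
  assumes "pl_family w F" "pl_family w G"
  shows "pl_family w (\<lambda>k x. F k x - G k x)"
  using pl_family_add[OF assms(1) pl_family_scale[OF assms(2), of "\<lambda>_. -1" 1]] by simp

lemma pl_family_of_bool:
  assumes "step_family w T" shows "pl_family w (\<lambda>k x. of_bool (T k x))"
proof -
  obtain C where C: "0 \<le> C" "\<And>k. pw_lipschitz w (C * 9 ^ k) 0 (\<lambda>x. of_bool (T k x))"
    using assms unfolding step_family_def by blast
  have "pw_lipschitz w ((C + 1) * 9 ^ k) (C + 1) (\<lambda>x. of_bool (T k x))" for k
    using C(1) by (intro pw_lipschitz_mono[OF C(2)]) auto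
  then show ?thesis unfolding pl_family_def using C(1) by (intro exI[of _ "C + 1"]) auto
qed

lemma pl_family_shift:
  assumes "pl_family w F" "\<And>k. periodic w (F k)" "0 < w"
  shows "pl_family w (\<lambda>k x. F k (x - s k))"
proof -
  obtain C where C: "0 \<le> C" "\<And>k. pw_lipschitz w (C * 9 ^ k) C (F k)" "\<And>k x. x \<in> {0..<w} \<Longrightarrow> \<bar>F k x\<bar> \<le> C"
    using assms(1) unfolding pl_family_def by blast
  have "pw_lipschitz w ((C + 1) * 9 ^ k) (C + 1) (\<lambda>x. F k (x - s k))" for k
    using C(1) by (intro pw_lipschitz_mono[OF pw_lipschitz_shift[OF C(2) assms(2,3)]]) (auto simp: distrib_right)
  moreover have "\<bar>F k (x - s k)\<bar> \<le> C + 1" for k x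
    using C(3)[of "wrap w (x - s k)" k] wrap_range[OF assms(3)] periodic_wrap[OF assms(2)] by auto
  ultimately show ?thesis unfolding pl_family_def using C(1) by (intro exI[of _ "C + 1"]) auto
qed

lemma step_family_shift:
  assumes "step_family w T" "\<And>k. periodic w (T k)" "0 < w"
  shows "step_family w (\<lambda>k x. T k (x - s k))"
proof -
  obtain C where C: "0 \<le> C" "\<And>k. pw_lipschitz w (C * 9 ^ k) 0 (\<lambda>x. of_bool (T k x))"
    using assms(1) unfolding step_family_def by blast
  have per: "periodic w (\<lambda>x. of_bool (T k x) :: real)" for k using assms(2) by (simp add: periodic_def)
  have "pw_lipschitz w ((C + 1) * 9 ^ k) 0 (\<lambda>x. of_bool (T k (x - s k)))" for k
    using C(1) by (intro pw_lipschitz_mono[OF pw_lipschitz_shift[OF C(2) per assms(3)]]) (auto simp: distrib_right)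
  then show ?thesis unfolding step_family_def using C(1) by (intro exI[of _ "C + 1"]) auto
qed

lemma tame_family_subgraph:
  assumes "pl_family w F" "0 < w" shows "tame_family (\<lambda>k. subgraph 0 w (F k))"
proof -
  obtain C where C: "0 \<le> C" "\<And>k. pw_lipschitz w (C * 9 ^ k) C (F k)" "\<And>k x. x \<in> {0..<w} \<Longrightarrow> \<bar>F k x\<bar> \<le> C"
    using assms(1) unfolding pl_family_def by blast
  define c where "c = 2 * (C + 1) + (w + 1) + ((1 + C) * w + 1)"
  have c0: "0 \<le> c" using C(1) assms(2) by (simp add: c_def)
  have Y: "\<And>x. 0 \<le> x \<Longrightarrow> x < w \<Longrightarrow> F k x \<le> C" for k using C(3)[of _ k] by (auto simp: abs_le_iff)
  have "tame ((C + 1) * c) k (subgraph 0 w (F k))" for k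
    unfolding tame_def
  proof (intro conjI ballI)
    show "delta2 (subgraph 0 w (F k))" by (rule subgraph_pw_lipschitz(1)[OF C(2) assms(2) C(1) Y C(1)])
    fix e :: real assume "e \<in> {0<..1}"
    then have e: "0 < e" "e \<le> 1" by auto
    have "C * 9 ^ k + 1 \<le> (C + 1) * 10 ^ k"
    proof -
      have "C * 9 ^ k \<le> C * 10 ^ k" using C(1) by (intro mult_left_mono power_mono) auto
      moreover have "(1::real) \<le> 10 ^ k" by (intro one_le_power) auto
      ultimately show ?thesis unfolding distrib_right mult_1 by linarith
    qed
    then have "(C * 9 ^ k + 1) * c / e \<le> (C + 1) * 10 ^ k * c / e"
      using c0 e by (intro divide_right_mono mult_right_mono) auto
    then show "covered (frontier (subgraph 0 w (F k))) e ((C + 1) * c * 10 ^ k / e)"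
      using covered_mono[OF subgraph_pw_lipschitz(2)[OF C(2) assms(2) C(1) Y C(1) e] order_refl]
      unfolding c_def by (simp add: mult.assoc mult.commute mult.left_commute)
  qed
  then show ?thesis unfolding tame_family_def by blast
qed

lemma tame_family_Diff: "tame_family P \<Longrightarrow> tame_family Q \<Longrightarrow> tame_family (\<lambda>k. P k - Q k)"
  unfolding tame_family_def using tame_Diff by meson

lemma tame_family_Int: "tame_family P \<Longrightarrow> tame_family Q \<Longrightarrow> tame_family (\<lambda>k. P k \<inter> Q k)"
  unfolding tame_family_def using tame_Int by meson

lemma tame_family_translation:
  fixes P :: "nat \<Rightarrow> 'a::real_normed_vector set"
  shows "tame_family P \<Longrightarrow> tame_family (\<lambda>k. (+) (v k) ` P k)"
  unfolding tame_family_def using tame_translation by meson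

definition strip :: "real \<Rightarrow> (real \<Rightarrow> real) \<Rightarrow> (real \<Rightarrow> real) \<Rightarrow> (real \<times> real) set" where
  "strip w lo hi = {z. 0 \<le> fst z \<and> fst z < w \<and> lo (fst z) < snd z \<and> snd z \<le> hi (fst z)}"

lemma tame_family_strip:
  assumes "pl_family w F" "pl_family w G" "0 < w" "\<And>k x. 0 \<le> x \<Longrightarrow> x < w \<Longrightarrow> 0 \<le> F k x"
  shows "tame_family (\<lambda>k. strip w (F k) (G k))"
proof -
  have "strip w (F k) (G k) = subgraph 0 w (G k) - subgraph 0 w (F k)" for k
    using assms(4)[of _ k] by (force simp: strip_def subgraph_def)
  then show ?thesis using assms by (simp add: tame_family_Diff tame_family_subgraph)
qed

subsection \<open>Moving stacks of pieces\<close>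

text \<open>Equidecomposability with the help of three copies of K, one for each letter of the
  paths. Since catalysts come back unchanged, the same three copies serve any number of moves one
  after the other.\<close>

definition ceq :: "('a::real_normed_vector) set \<Rightarrow> ('a \<Rightarrow> nat) \<Rightarrow> ('a \<Rightarrow> nat) \<Rightarrow> bool" where
  "ceq K F G \<longleftrightarrow> F + (ind K + ind K + ind K) \<asymp> G + (ind K + ind K + ind K)"

lemma ceq_sym: "ceq K F G \<Longrightarrow> ceq K G F"
  unfolding ceq_def by (rule eqf_sym)

lemma ceq_trans [trans]: "ceq K F G \<Longrightarrow> ceq K G H \<Longrightarrow> ceq K F H"
  unfolding ceq_def by (rule eqf_trans)

lemma ceq_add_eqf:
  assumes "ceq K F G" "F' \<asymp> G'" shows "ceq K (F + F') (G + G')"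
  using eqf_add[OF assms(1)[unfolded ceq_def] assms(2)] unfolding ceq_def by (simp add: add_ac)

text \<open>The two moves are made successively, the other summand standing by. The reflexivity
  hypotheses say that the bystanders are finite sums of nice sets.\<close>

lemma ceq_add:
  assumes "ceq K F G" "ceq K F' G'" "F' \<asymp> F'" "G \<asymp> G" shows "ceq K (F + F') (G + G')"
proof -
  have "ceq K (F + F') (G + F')" by (rule ceq_add_eqf[OF assms(1,3)])
  also have "ceq K (G + F') (G + G')"
    using ceq_add_eqf[OF assms(2,4)] by (simp add: add.commute)
  finally show ?thesis .
qed

lemma ceq_eqf: "nice K \<Longrightarrow> F \<asymp> G \<Longrightarrow> ceq K F G"
  unfolding ceq_def by (intro eqf_add eqf_ind)

lemma eqf_ind_sum: "finite I \<Longrightarrow> (\<And>i. i \<in> I \<Longrightarrow> nice (A i)) \<Longrightarrow> (\<Sum>i\<in>I. ind (A i)) \<asymp> (\<Sum>i\<in>I. ind (A i))"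
  by (intro eqf_sum_family eqf_ind)

lemma ceq_sum:
  assumes "finite I" "nice K" "\<And>i. i \<in> I \<Longrightarrow> ceq K (ind (A i)) (ind (B i))"
    "\<And>i. i \<in> I \<Longrightarrow> nice (A i)" "\<And>i. i \<in> I \<Longrightarrow> nice (B i)"
  shows "ceq K (\<Sum>i\<in>I. ind (A i)) (\<Sum>i\<in>I. ind (B i))"
  using assms
proof (induction I rule: finite_induct)
  case empty
  then show ?case unfolding sum.empty by (intro ceq_eqf eqf_0)
next
  case (insert i I)
  have "ceq K (ind (A i) + (\<Sum>i\<in>I. ind (A i))) (ind (B i) + (\<Sum>i\<in>I. ind (B i)))"
    using insert by (intro ceq_add eqf_ind eqf_ind_sum) auto
  then show ?case unfolding sum.insert[OF insert.hyps] .
qed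

lemma nice_slices:
  fixes P :: "nat \<Rightarrow> (real \<times> real) set"
  assumes "tame_family P" "\<And>k. P k \<subseteq> {0..R} \<times> {0..Y * lam ^ k}"
  shows "nice (\<Union>k. (+) (lam ^ k *\<^sub>R d) ` P k)" "nice (\<Union>k. P k)"
proof -
  obtain C where C: "\<And>k. tame C k (P k)" using assms(1) unfolding tame_family_def by blast
  define M where "M = max \<bar>R\<bar> \<bar>Y\<bar>"
  have M: "P k \<subseteq> {-M..M} \<times> {-M * lam ^ k..M * lam ^ k}" for k
  proof
    fix z :: "real \<times> real" assume "z \<in> P k"
    then have z: "0 \<le> fst z" "fst z \<le> R" "0 \<le> snd z" "snd z \<le> Y * lam ^ k"
      using subsetD[OF assms(2)] by (auto simp: mem_Times_iff)
    have "Y * lam ^ k \<le> M * lam ^ k" using lam by (intro mult_right_mono) (auto simp: M_def)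
    moreover have "0 \<le> M * lam ^ k" using lam by (auto simp: M_def)
    moreover have "R \<le> M" by (auto simp: M_def)
    ultimately show "z \<in> {-M..M} \<times> {-M * lam ^ k..M * lam ^ k}"
      using z unfolding mem_Times_iff atLeastAtMost_iff minus_mult_left[symmetric] by linarith
  qed
  show "nice (\<Union>k. (+) (lam ^ k *\<^sub>R d) ` P k)"
    using nice_lanes[OF C M, of "\<lambda>k. {lam ^ k}" d] by (simp add: lanes_def)
  show "nice (\<Union>k. P k)"
    using nice_lanes[OF C M, of "\<lambda>k. {0}" d] by (simp add: lanes_def)
qed

text \<open>The window of \<open>chain\<close> with rational ends:
  \<open>lam\<^sup>2 / (1 + lam)\<close> is at most 0.278 and \<open>lam\<^sup>2\<close> exceeds
  0.465.\<close>

lemma chain_family: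
  fixes P :: "nat \<Rightarrow> (real \<times> real) set"
  assumes P: "tame_family P"
    and zone: "\<And>k. P k \<subseteq> {0..R} \<times> {y1 * lam ^ k..y2 * lam ^ k}"
    and d: "0 < snd d" "0 \<le> fst d" and y: "0.278 * snd d \<le> y1" "y2 \<le> 0.465 * snd d" "0.683 * y2 < y1"
    and K: "nice K" "{0..R + fst d} \<times> {0..2 * snd d} \<subseteq> K"
  shows "ceq K (ind (\<Union>k. P k)) (ind (\<Union>k. (+) (lam ^ k *\<^sub>R d) ` P k))"
proof -
  obtain C where C: "\<And>k. tame C k (P k)" using P unfolding tame_family_def by blast
  have "0.682 * 0.682 < lam * lam" "lam * lam < 0.683 * 0.683" using lam by (intro mult_strict_mono; simp)+
  then have l2: "0.465 < lam\<^sup>2" "lam\<^sup>2 < 0.4665" by (auto simp: power2_eq_square)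
  have "lam\<^sup>2 \<le> 0.278 * (1 + lam)"
  proof -
    have "lam * lam \<le> 0.683 * lam" using lam by (intro mult_right_mono) auto
    then have "lam\<^sup>2 \<le> 0.683 * lam" by (simp add: power2_eq_square)
    then show ?thesis using lam by simp
  qed
  then have "lam\<^sup>2 / (1 + lam) \<le> 0.278" using lam by (simp add: pos_divide_le_eq)
  then have "lam\<^sup>2 / (1 + lam) * snd d \<le> 0.278 * snd d" using d by (intro mult_right_mono) auto
  then have y1: "lam\<^sup>2 / (1 + lam) * snd d \<le> y1" using y(1) by (rule order_trans)
  have "0.465 * snd d < lam\<^sup>2 * snd d" using l2 d by (intro mult_strict_right_mono) auto
  then have y2: "y2 < lam\<^sup>2 * snd d" using y by simp
  have y3: "lam * y2 < y1"
  proof (cases "0 \<le> y2")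
    case True
    then have "lam * y2 \<le> 0.683 * y2" using lam by (intro mult_right_mono) auto
    then show ?thesis using y by simp
  next
    case False
    then have "lam * y2 \<le> 0" using lam by (simp add: mult_le_0_iff)
    moreover have "0 < 0.278 * snd d" using d by simp
    ultimately show ?thesis using y by linarith
  qed
  show ?thesis unfolding ceq_def by (rule chain[OF C zone d y1 y2 y3 K])
qed

text \<open>A chain only moves upwards, and only from heights in a fixed proportion to its
  displacement. A displacement s that is horizontal or downward is obtained by a meeting: P rises by
  s + d, its translate by s rises by d, and the results coincide.\<close>

lemma ceq_bump:
  fixes P :: "nat \<Rightarrow> (real \<times> real) set"
  assumes P: "tame_family P"
    and zone: "\<And>k. P k \<subseteq> {0..R} \<times> {y1 * lam ^ k..y2 * lam ^ k}"
       "\<And>k. (+) (lam ^ k *\<^sub>R s) ` P k \<subseteq> {0..R'} \<times> {zl * lam ^ k..zu * lam ^ k}"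
    and d: "0 < snd (s + d)" "0 \<le> fst (s + d)" "0 < snd d" "0 \<le> fst d"
    and y: "0.278 * snd (s + d) \<le> y1" "y2 \<le> 0.465 * snd (s + d)" "0.683 * y2 < y1"
       "0.278 * snd d \<le> zl" "zu \<le> 0.465 * snd d" "0.683 * zu < zl"
    and K: "nice K" "{0..R + fst (s + d)} \<times> {0..2 * snd (s + d)} \<subseteq> K" "{0..R' + fst d} \<times> {0..2 * snd d} \<subseteq> K"
  shows "ceq K (ind (\<Union>k. P k)) (ind (\<Union>k. (+) (lam ^ k *\<^sub>R s) ` P k))"
proof -
  have "ceq K (ind (\<Union>k. (+) (lam ^ k *\<^sub>R s) ` P k))
      (ind (\<Union>k. (+) (lam ^ k *\<^sub>R d) ` (+) (lam ^ k *\<^sub>R s) ` P k))"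
    by (rule chain_family[OF tame_family_translation[OF P] zone(2) d(3,4) y(4-6) K(1,3)])
  moreover have "(+) (lam ^ k *\<^sub>R d) ` (+) (lam ^ k *\<^sub>R s) ` P k = (+) (lam ^ k *\<^sub>R (s + d)) ` P k" for k
  proof -
    have "lam ^ k *\<^sub>R d + (lam ^ k *\<^sub>R s + p) = lam ^ k *\<^sub>R (s + d) + p" for p
      by (simp add: scaleR_add_right)
    then show ?thesis by (simp only: image_image)
  qed
  ultimately have "ceq K (ind (\<Union>k. (+) (lam ^ k *\<^sub>R s) ` P k)) (ind (\<Union>k. (+) (lam ^ k *\<^sub>R (s + d)) ` P k))"
    by (simp only:)
  then show ?thesis
    using chain_family[OF P zone(1) d(1,2) y(1-3) K(1,2)] ceq_sym ceq_trans by blast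
qed

lemma box_mono: "R \<le> R' \<Longrightarrow> Y \<le> Y' \<Longrightarrow> {0..R} \<times> {0..Y} \<subseteq> {0..R'} \<times> {0..Y'}" for R R' Y Y' :: real
  by auto

text \<open>The bases meet at height 3.5 b, after a rise by 2.5 b from b and by (3.5 - \<kappa>) b
  from \<kappa> b. The window of the first rise contains [b, 1.05 b], because 0.278 times 2.5 is
  below 1 and 0.465 times 2.5 is above 1.05. The second rise lies between 2.65 b and 2.7 b, so its
  window reaches from below 0.8 b to above 0.9 b.\<close>

lemma ceq_vertical_step:
  fixes P :: "nat \<Rightarrow> (real \<times> real) set"
  assumes P: "tame_family P"
    and zone: "\<And>k. P k \<subseteq> {0..R} \<times> {b * lam ^ k..(1.05 * b) * lam ^ k}"
    and b: "0 < b" and \<kappa>: "0.8 \<le> \<kappa>" "\<kappa> \<le> 0.85"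
    and K: "nice K" "{0..R} \<times> {0..6 * b} \<subseteq> K"
  shows "ceq K (ind (\<Union>k. P k)) (ind (\<Union>k. (+) (lam ^ k *\<^sub>R (0, (\<kappa> - 1) * b)) ` P k))"
proof -
  have "4 / 5 * b \<le> \<kappa> * b" "\<kappa> * b \<le> 17 / 20 * b" using b \<kappa> by (intro mult_right_mono; simp)+
  then have kb: "4 * b \<le> 5 * (\<kappa> * b)" "20 * (\<kappa> * b) \<le> 17 * b" by simp_all
  show ?thesis
  proof (rule ceq_bump[OF P zone, where d = "(0, (3.5 - \<kappa>) * b)" and R' = R and zl = "\<kappa> * b" and zu = "(\<kappa> + 0.05) * b"])
    fix k
    show "(+) (lam ^ k *\<^sub>R (0, (\<kappa> - 1) * b)) ` P k \<subseteq> {0..R} \<times> {\<kappa> * b * lam ^ k..(\<kappa> + 0.05) * b * lam ^ k}"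
    proof
      fix z assume "z \<in> (+) (lam ^ k *\<^sub>R (0, (\<kappa> - 1) * b)) ` P k"
      then obtain p where p: "p \<in> P k" "z = lam ^ k *\<^sub>R (0, (\<kappa> - 1) * b) + p" by blast
      then show "z \<in> {0..R} \<times> {\<kappa> * b * lam ^ k..(\<kappa> + 0.05) * b * lam ^ k}"
        using subsetD[OF zone p(1)] by (auto simp: mem_Times_iff algebra_simps)
    qed
    have "{0..R + fst ((0::real, (\<kappa> - 1) * b) + (0, (3.5 - \<kappa>) * b))} \<times> {0..2 * snd ((0::real, (\<kappa> - 1) * b) + (0, (3.5 - \<kappa>) * b))} \<subseteq> {0..R} \<times> {0..6 * b}"
      "{0..R + fst (0::real, (3.5 - \<kappa>) * b)} \<times> {0..2 * snd (0::real, (3.5 - \<kappa>) * b)} \<subseteq> {0..R} \<times> {0..6 * b}"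
    proof -
      have eq: "(3.5 - \<kappa>) * b = 7 / 2 * b - \<kappa> * b" "(\<kappa> - 1) * b = \<kappa> * b - b" by (simp_all add: algebra_simps)
      show "{0..R + fst ((0::real, (\<kappa> - 1) * b) + (0, (3.5 - \<kappa>) * b))} \<times> {0..2 * snd ((0::real, (\<kappa> - 1) * b) + (0, (3.5 - \<kappa>) * b))} \<subseteq> {0..R} \<times> {0..6 * b}"
        "{0..R + fst (0::real, (3.5 - \<kappa>) * b)} \<times> {0..2 * snd (0::real, (3.5 - \<kappa>) * b)} \<subseteq> {0..R} \<times> {0..6 * b}"
        unfolding fst_add snd_add fst_conv snd_conv eq using kb b by (intro box_mono; auto)+
    qed
    then show "{0..R + fst ((0::real, (\<kappa> - 1) * b) + (0, (3.5 - \<kappa>) * b))} \<times> {0..2 * snd ((0::real, (\<kappa> - 1) * b) + (0, (3.5 - \<kappa>) * b))} \<subseteq> K"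
      "{0..R + fst (0::real, (3.5 - \<kappa>) * b)} \<times> {0..2 * snd (0::real, (3.5 - \<kappa>) * b)} \<subseteq> K"
      using K(2) by blast+
  qed (use b kb K(1) in \<open>simp_all add: algebra_simps\<close>)
qed

text \<open>Two steps with ratio sqrt \<rho> replace one step with ratio \<rho>. For \<rho> =
  \<open>lam\<close> a single meeting is out of reach of the rational window: in units of b the
  upper rise d would have to be at least 1/0.465 + 1 - \<open>lam\<close>, more than 2.46, and at
  most \<open>lam\<close>/0.278, less than 2.46. The range of \<rho> consists of the squares of
  [0.8, 0.85].\<close>

lemma ceq_vertical:
  fixes P :: "nat \<Rightarrow> (real \<times> real) set"
  assumes P: "tame_family P"
    and zone: "\<And>k. P k \<subseteq> {0..R} \<times> {b * lam ^ k..(1.04 * b) * lam ^ k}"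
    and b: "0 < b" and \<rho>: "0.64 \<le> \<rho>" "\<rho> \<le> 0.7225"
    and K: "nice K" "{0..R} \<times> {0..6 * b} \<subseteq> K"
  shows "ceq K (ind (\<Union>k. P k)) (ind (\<Union>k. (+) (lam ^ k *\<^sub>R (0, (\<rho> - 1) * b)) ` P k))"
proof -
  define \<kappa> where "\<kappa> = sqrt \<rho>"
  have sq: "\<kappa> * \<kappa> = \<rho>" using \<rho> by (simp add: \<kappa>_def)
  have \<kappa>: "0.8 \<le> \<kappa>" "\<kappa> \<le> 0.85" unfolding \<kappa>_def
    using \<rho> by (intro real_le_rsqrt real_le_lsqrt; simp add: power2_eq_square)+
  have "4 / 5 * b \<le> \<kappa> * b" "\<kappa> * b \<le> 17 / 20 * b" using b \<kappa> by (intro mult_right_mono; simp)+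
  then have kb: "4 * b \<le> 5 * (\<kappa> * b)" "20 * (\<kappa> * b) \<le> 17 * b" by simp_all
  have L: "0 \<le> lam ^ k" for k using lam by simp
  have z1: "P k \<subseteq> {0..R} \<times> {b * lam ^ k..(1.05 * b) * lam ^ k}" for k
  proof -
    have "(1.04 * b) * lam ^ k \<le> (1.05 * b) * lam ^ k" using b L by (intro mult_right_mono) auto
    then show ?thesis using zone[of k] by fastforce
  qed
  have z2: "(+) (lam ^ k *\<^sub>R (0, (\<kappa> - 1) * b)) ` P k \<subseteq> {0..R} \<times> {(\<kappa> * b) * lam ^ k..(1.05 * (\<kappa> * b)) * lam ^ k}" for k
  proof
    fix z assume "z \<in> (+) (lam ^ k *\<^sub>R (0, (\<kappa> - 1) * b)) ` P k"
    then obtain p where p: "p \<in> P k" "z = lam ^ k *\<^sub>R (0, (\<kappa> - 1) * b) + p" by blast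
    \<comment> \<open>The thickness 0.04 b is unchanged by the first step but larger relative to the
      new base \<kappa> b; since \<kappa> is at least 0.8, it is at most 0.05 \<kappa> b.\<close>
    have "((\<kappa> + 0.04) * b) * lam ^ k \<le> (1.05 * (\<kappa> * b)) * lam ^ k"
      using kb L by (intro mult_right_mono) (auto simp: algebra_simps)
    then show "z \<in> {0..R} \<times> {(\<kappa> * b) * lam ^ k..(1.05 * (\<kappa> * b)) * lam ^ k}"
      using p(2) subsetD[OF zone p(1)] by (auto simp: mem_Times_iff algebra_simps)
  qed
  have comp: "(+) (lam ^ k *\<^sub>R (0, (\<kappa> - 1) * (\<kappa> * b))) ` (+) (lam ^ k *\<^sub>R (0, (\<kappa> - 1) * b)) ` P k
      = (+) (lam ^ k *\<^sub>R (0, (\<rho> - 1) * b)) ` P k" for k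
  proof -
    have "(\<kappa> - 1) * (\<kappa> * b) + (\<kappa> - 1) * b = (\<rho> - 1) * b" unfolding sq[symmetric] by (simp add: algebra_simps)
    then have "lam ^ k *\<^sub>R (0::real, (\<kappa> - 1) * (\<kappa> * b)) + lam ^ k *\<^sub>R (0, (\<kappa> - 1) * b) = lam ^ k *\<^sub>R (0, (\<rho> - 1) * b)"
      by (simp flip: distrib_left)
    then show ?thesis by (simp only: image_image flip: add.assoc)
  qed
  have "ceq K (ind (\<Union>k. P k)) (ind (\<Union>k. (+) (lam ^ k *\<^sub>R (0, (\<kappa> - 1) * b)) ` P k))"
    by (rule ceq_vertical_step[OF P z1 b \<kappa> K])
  also have "ceq K \<dots> (ind (\<Union>k. (+) (lam ^ k *\<^sub>R (0, (\<kappa> - 1) * (\<kappa> * b))) ` (+) (lam ^ k *\<^sub>R (0, (\<kappa> - 1) * b)) ` P k))"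
  proof (rule ceq_vertical_step[OF tame_family_translation[OF P] z2 _ \<kappa> K(1)])
    have "{0..R} \<times> {0..6 * (\<kappa> * b)} \<subseteq> {0..R} \<times> {0..6 * b}"
    proof (rule box_mono)
      show "6 * (\<kappa> * b) \<le> 6 * b" using kb(2) b by linarith
    qed simp
    then show "{0..R} \<times> {0..6 * (\<kappa> * b)} \<subseteq> K" using K(2) by blast
  qed (use b kb in auto)
  finally show ?thesis unfolding comp .
qed

text \<open>The piece rises by 2.7 b and its translate by 2.7 b - s, which lies between 2.6 b and
  2.8 b. The windows of all these rises contain [b, 1.1 b].\<close>

lemma ceq_diagonal:
  fixes P :: "nat \<Rightarrow> (real \<times> real) set"
  assumes P: "tame_family P"
    and zone: "\<And>k. P k \<subseteq> {0..R} \<times> {b * lam ^ k..(1.1 * b) * lam ^ k}"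
       "\<And>k. (+) (lam ^ k *\<^sub>R (t, s)) ` P k \<subseteq> {0..R + t} \<times> {b * lam ^ k..(1.1 * b) * lam ^ k}"
    and b: "0 < b" "0 \<le> t" "\<bar>s\<bar> \<le> 0.1 * b"
    and K: "nice K" "{0..R + t} \<times> {0..6 * b} \<subseteq> K"
  shows "ceq K (ind (\<Union>k. P k)) (ind (\<Union>k. (+) (lam ^ k *\<^sub>R (t, s)) ` P k))"
proof (rule ceq_bump[OF P zone, where d = "(0, 2.7 * b - s)"])
  have s: "- 0.1 * b \<le> s" "s \<le> 0.1 * b" using b(3) by linarith+
  have "{0..R + fst ((t, s) + (0, 2.7 * b - s))} \<times> {0..2 * snd ((t, s) + (0, 2.7 * b - s))} \<subseteq> {0..R + t} \<times> {0..6 * b}"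
     "{0..R + t + fst (0::real, 2.7 * b - s)} \<times> {0..2 * snd (0::real, 2.7 * b - s)} \<subseteq> {0..R + t} \<times> {0..6 * b}"
    using s b by auto
  then show "{0..R + fst ((t, s) + (0, 2.7 * b - s))} \<times> {0..2 * snd ((t, s) + (0, 2.7 * b - s))} \<subseteq> K"
     "{0..R + t + fst (0::real, 2.7 * b - s)} \<times> {0..2 * snd (0::real, 2.7 * b - s)} \<subseteq> K"
    using K(2) by blast+
  show "0.278 * snd (0::real, 2.7 * b - s) \<le> b" "1.1 * b \<le> 0.465 * snd (0::real, 2.7 * b - s)" "0 < snd (0::real, 2.7 * b - s)"
    using s b by auto
qed (use b K in auto)

lemma zone_unique:
  assumes "b * lam ^ k \<le> y" "y \<le> (1.1 * b) * lam ^ k" "b * lam ^ l \<le> y" "y \<le> (1.1 * b) * lam ^ l" "0 < b"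
  shows "k = l"
proof -
  have "\<not> k < l" if kl: "b * lam ^ k \<le> y" "y \<le> (1.1 * b) * lam ^ l" for k l
  proof
    assume "k < l"
    then have "lam ^ l \<le> lam ^ Suc k" using lam by (intro power_decreasing) auto
    also have "\<dots> \<le> 0.683 * lam ^ k" using lam by (simp add: mult_right_mono)
    finally have "(1.1 * b) * lam ^ l \<le> (1.1 * b) * (0.683 * lam ^ k)" using assms(5) by (intro mult_left_mono) auto
    then have "b * lam ^ k \<le> (1.1 * b) * (0.683 * lam ^ k)" using kl by linarith
    moreover have "0 < b * lam ^ k" using lam assms(5) by simp
    ultimately show False by simp
  qed
  then show ?thesis using assms by (meson linorder_neqE_nat)
qed

text \<open>Two stacks of the same horizontal cross sections and constant thickness \<open>\<upsilon>\<close>, but with different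
  bases: cutting the first along the grid of \<open>\<upsilon>\<close>-translates of the second leaves finitely many
  shifts.\<close>

lemma ind_stack:
  fixes P Q :: "nat \<Rightarrow> (real \<times> real) set" and t :: "nat \<Rightarrow> real" and \<sigma> :: int
  assumes P: "\<And>k. P k = strip w (g k) (\<lambda>x. g k x + \<upsilon> * lam ^ k * of_bool (T k x))"
    and Q: "\<And>k. Q k = strip w (h k) (\<lambda>x. h k x + \<upsilon> * lam ^ k * of_bool (T k x))"
    and zone: "\<And>k. P k \<subseteq> UNIV \<times> {b * lam ^ k..(1.1 * b) * lam ^ k}"
    and gh: "\<And>k x. 0 \<le> x \<Longrightarrow> x < w \<Longrightarrow> \<bar>g k x - h k x\<bar> \<le> M * lam ^ k"
    and b: "0 < b" "0 < \<upsilon>" "M + 3 * \<upsilon> \<le> real N * \<upsilon>" and \<sigma>: "\<sigma> = 1 \<or> \<sigma> = -1"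
  shows "ind (\<Union>k. (+) (t k, 0) ` P k)
    = (\<Sum>i\<in>{-int N..int N}. ind (\<Union>k. (+) (t k, 0) ` (P k \<inter> (+) (0, of_int (\<sigma> * i) * \<upsilon> * lam ^ k) ` Q k)))"
proof -
  \<comment> \<open>The sign \<sigma> lets one index number both the cuts of the first stack by
    translates of the second and, with the roles exchanged, the cuts of the second by translates of
    the first.\<close>
  define B where "B i k = P k \<inter> (+) (0, of_int (\<sigma> * i) * \<upsilon> * lam ^ k) ` Q k" for i k
  have L: "0 < \<upsilon> * lam ^ k" for k using b lam by simp
  have memB: "(x, y) \<in> B i k \<longleftrightarrow> (x, y) \<in> P k \<and> T k x \<and> h k x + of_int (\<sigma> * i) * (\<upsilon> * lam ^ k) < y \<and>
     y \<le> h k x + of_int (\<sigma> * i) * (\<upsilon> * lam ^ k) + \<upsilon> * lam ^ k" for x y i k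
  proof -
    have "(x, y) \<in> (+) (0, of_int (\<sigma> * i) * \<upsilon> * lam ^ k) ` Q k \<longleftrightarrow> (x, y - of_int (\<sigma> * i) * (\<upsilon> * lam ^ k)) \<in> Q k"
      unfolding translation_vimage by (simp add: mult.assoc)
    then show ?thesis unfolding B_def P Q by (auto simp: strip_def algebra_simps)
  qed
  have PB: "P k = (\<Union>i\<in>{-int N..int N}. B i k)" for k
  proof
    show "(\<Union>i\<in>{-int N..int N}. B i k) \<subseteq> P k" by (auto simp: B_def)
    show "P k \<subseteq> (\<Union>i\<in>{-int N..int N}. B i k)"
    proof clarify
      fix x y assume p: "(x, y) \<in> P k"
      have T: "T k x" using p by (rule contrapos_pp) (auto simp: P strip_def)
      then have xy: "0 \<le> x" "x < w" "g k x < y" "y \<le> g k x + \<upsilon> * lam ^ k" using p by (auto simp: P strip_def)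
      \<comment> \<open>Strips are open below and closed above, so the grid cell of y is found by a
        ceiling minus one instead of a floor.\<close>
      define j where "j = \<lceil>(y - h k x) / (\<upsilon> * lam ^ k)\<rceil> - 1"
      have "of_int j < (y - h k x) / (\<upsilon> * lam ^ k)" "(y - h k x) / (\<upsilon> * lam ^ k) \<le> of_int j + 1"
        unfolding j_def by linarith+
      then have j: "of_int j * (\<upsilon> * lam ^ k) < y - h k x" "y - h k x \<le> (of_int j + 1) * (\<upsilon> * lam ^ k)"
        using L[of k] by (simp_all add: pos_less_divide_eq pos_divide_le_eq)
      have bd: "\<bar>y - h k x\<bar> \<le> (M + \<upsilon>) * lam ^ k" using gh[OF xy(1,2), of k] xy by (simp add: algebra_simps)
      have MN: "(M + 3 * \<upsilon>) * lam ^ k \<le> real N * \<upsilon> * lam ^ k" using b lam by (intro mult_right_mono) auto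
      have "of_int j * (\<upsilon> * lam ^ k) < real N * (\<upsilon> * lam ^ k)" "- real N * (\<upsilon> * lam ^ k) < of_int j * (\<upsilon> * lam ^ k)"
        using j bd MN L[of k] by (simp_all add: algebra_simps abs_le_iff)
      then have "of_int j < real N" "- real N < of_int j"
        using L[of k] by (simp_all only: mult_less_cancel_right_pos)
      then have jN: "j \<in> {-int N..int N}" by auto
      have \<sigma>j: "\<sigma> * (\<sigma> * j) = j" using \<sigma> by auto
      have "(x, y) \<in> B (\<sigma> * j) k" unfolding memB \<sigma>j using p T j by (simp add: algebra_simps)
      moreover have "\<sigma> * j \<in> {-int N..int N}" using jN \<sigma> by auto
      ultimately show "(x, y) \<in> (\<Union>i\<in>{-int N..int N}. B i k)" by blast
    qed
  qed
  have "(\<Union>k. (+) (t k, 0) ` P k) = (\<Union>i\<in>{-int N..int N}. \<Union>k. (+) (t k, 0) ` B i k)"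
    unfolding PB by blast
  moreover have "disjoint_family_on (\<lambda>i. \<Union>k. (+) (t k, 0) ` B i k) {-int N..int N}"
    unfolding disjoint_family_on_def
  proof (intro ballI impI)
    fix i j :: int assume ij: "i \<noteq> j"
    have False if z: "z \<in> (+) (t k, 0) ` B i k" "z \<in> (+) (t l, 0) ` B j l" for z k l
    proof -
      obtain x y x' y' where p: "(x, y) \<in> B i k" "z = (t k, 0) + (x, y)" "(x', y') \<in> B j l" "z = (t l, 0) + (x', y')"
        using z by auto
      have yy: "y = y'" using p by auto
      have "(x, y) \<in> P k" "(x', y) \<in> P l" using p unfolding memB yy by auto
      then have kl: "k = l" using zone[of k] zone[of l] b(1) by (intro zone_unique[of b k y l]) auto
      have xx: "x = x'" using p kl by auto
      have e: "of_int (\<sigma> * i) * (\<upsilon> * lam ^ k) < (of_int (\<sigma> * j) + 1) * (\<upsilon> * lam ^ k)"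
         "of_int (\<sigma> * j) * (\<upsilon> * lam ^ k) < (of_int (\<sigma> * i) + 1) * (\<upsilon> * lam ^ k)"
        using p unfolding memB xx yy kl distrib_right by linarith+
      then have "of_int (\<sigma> * i) < (of_int (\<sigma> * j) + 1 :: real)" "of_int (\<sigma> * j) < (of_int (\<sigma> * i) + 1 :: real)"
        using L[of k] by (simp_all only: mult_less_cancel_right_pos)
      then have "\<sigma> * i = \<sigma> * j" by linarith
      then show False using \<sigma> ij by auto
    qed
    then show "(\<Union>k. (+) (t k, 0) ` B i k) \<inter> (\<Union>k. (+) (t k, 0) ` B j k) = {}" by blast
  qed
  ultimately show ?thesis unfolding B_def[symmetric] by (simp add: ind_UN)
qed

text \<open>The part with index i moves by \<open>lam ^ k\<close> times (\<tau>, i \<upsilon>), a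
  vector proportional to \<open>lam ^ k\<close>, as the chains demand. The hypothesis on M makes the
  indices up to 0.1 b/\<upsilon> suffice, which are those within the reach of
  \<open>ceq_diagonal\<close>.\<close>

lemma ceq_restack:
  fixes P Q :: "nat \<Rightarrow> (real \<times> real) set"
  assumes P: "\<And>k. P k = strip w (g k) (\<lambda>x. g k x + \<upsilon> * lam ^ k * of_bool (T k x))"
    and Q: "\<And>k. Q k = strip w (h k) (\<lambda>x. h k x + \<upsilon> * lam ^ k * of_bool (T k x))"
    and tame: "tame_family P" "tame_family Q"
    and zone: "\<And>k. P k \<subseteq> {0..w} \<times> {b * lam ^ k..(1.1 * b) * lam ^ k}" "\<And>k. Q k \<subseteq> {0..w} \<times> {b * lam ^ k..(1.1 * b) * lam ^ k}"
    and gh: "\<And>k x. 0 \<le> x \<Longrightarrow> x < w \<Longrightarrow> \<bar>g k x - h k x\<bar> \<le> M * lam ^ k"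
    and b: "0 < b" "0 < \<upsilon>" "M + 4 * \<upsilon> \<le> 0.1 * b" "0 \<le> \<tau>"
    and K: "nice K" "{0..w + \<tau>} \<times> {0..6 * b} \<subseteq> K"
  shows "ceq K (ind (\<Union>k. P k)) (ind (\<Union>k. (+) (lam ^ k *\<^sub>R (\<tau>, 0)) ` Q k))"
proof -
  define N where "N = nat \<lfloor>0.1 * b / \<upsilon>\<rfloor>"
  have "real N \<le> 0.1 * b / \<upsilon>" "0.1 * b / \<upsilon> < real N + 1"
    unfolding N_def using b by (simp_all add: of_nat_nat floor_le_iff)
  then have N: "real N * \<upsilon> \<le> 0.1 * b" "0.1 * b < (real N + 1) * \<upsilon>"
    using b(2) by (simp_all add: pos_le_divide_eq pos_divide_less_eq)
  then have MN: "M + 3 * \<upsilon> \<le> real N * \<upsilon>" using b by (simp add: distrib_right)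
  define A where "A i k = P k \<inter> (+) (0, of_int (-1 * i) * \<upsilon> * lam ^ k) ` Q k" for i k
  define s where "s i = (\<tau>, of_int i * \<upsilon>)" for i
  have AQ: "(+) (lam ^ k *\<^sub>R s i) ` A i k = (+) (\<tau> * lam ^ k, 0) ` (Q k \<inter> (+) (0, of_int (1 * i) * \<upsilon> * lam ^ k) ` P k)" for i k
    unfolding A_def translation_vimage by (auto simp: s_def algebra_simps)
  have zP: "P k \<subseteq> UNIV \<times> {b * lam ^ k..(1.1 * b) * lam ^ k}" "Q k \<subseteq> UNIV \<times> {b * lam ^ k..(1.1 * b) * lam ^ k}" for k
    using zone[of k] by auto
  have gh': "\<bar>h k x - g k x\<bar> \<le> M * lam ^ k" if "0 \<le> x" "x < w" for k x using gh[OF that, of k] by linarith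
  have e1: "ind (\<Union>k. P k) = (\<Sum>i\<in>{-int N..int N}. ind (\<Union>k. A i k))"
    using ind_stack[OF P Q zP(1) gh b(1,2) MN, of "-1" "\<lambda>_. 0"] unfolding A_def by (simp add: translation_vimage flip: zero_prod_def)
  have e2: "ind (\<Union>k. (+) (lam ^ k *\<^sub>R (\<tau>, 0)) ` Q k) = (\<Sum>i\<in>{-int N..int N}. ind (\<Union>k. (+) (lam ^ k *\<^sub>R s i) ` A i k))"
    using ind_stack[OF Q P zP(2) gh' b(1,2) MN, of 1 "\<lambda>k. \<tau> * lam ^ k"] unfolding AQ by (simp add: mult.commute)
  have tA: "tame_family (A i)" for i
    unfolding A_def by (intro tame_family_Int tame tame_family_translation)
  have zA: "A i k \<subseteq> {0..w} \<times> {b * lam ^ k..(1.1 * b) * lam ^ k}" for i k using zone(1)[of k] by (auto simp: A_def)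
  have zA': "(+) (lam ^ k *\<^sub>R s i) ` A i k \<subseteq> {0..w + \<tau>} \<times> {b * lam ^ k..(1.1 * b) * lam ^ k}" for i k
  proof -
    have "0 \<le> lam ^ k" "lam ^ k \<le> 1" using lam by (auto intro: power_le_one)
    then have "0 \<le> \<tau> * lam ^ k" "\<tau> * lam ^ k \<le> \<tau>" using b(4) mult_left_mono[of "lam ^ k" 1 \<tau>] by auto
    then show ?thesis unfolding AQ using zone(2)[of k] by fastforce
  qed
  have zA0: "A i k \<subseteq> {0..w} \<times> {0..1.1 * b * lam ^ k}" for i k
  proof -
    have "0 \<le> b * lam ^ k" using b lam by simp
    then show ?thesis using zA[of i k] by force
  qed
  show ?thesis unfolding e1 e2
  proof (rule ceq_sum)
    fix i assume "i \<in> {-int N..int N}"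
    then have "\<bar>real_of_int i\<bar> \<le> real N" by auto
    then have "\<bar>real_of_int i\<bar> * \<upsilon> \<le> real N * \<upsilon>" using b(2) by (intro mult_right_mono) auto
    then have "\<bar>of_int i * \<upsilon>\<bar> \<le> 0.1 * b" unfolding abs_mult using N(1) b(2) by linarith
    then show "ceq K (ind (\<Union>k. A i k)) (ind (\<Union>k. (+) (lam ^ k *\<^sub>R s i) ` A i k))"
      unfolding s_def using ceq_diagonal[OF tA zA zA'[unfolded s_def] b(1,4) _ K] by blast
  qed (use K nice_slices[OF tA zA0] in auto)
qed

subsection \<open>Transport of the tops of slots\<close>

definition slots :: "real \<Rightarrow> real \<Rightarrow> (nat \<Rightarrow> real \<Rightarrow> real) \<Rightarrow> (real \<times> real) set" where
  "slots w b F = (\<Union>k. strip w (\<lambda>_. b * lam ^ k) (\<lambda>x. b * lam ^ k + F k x))"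

lemma ind_slots_split:
  assumes b: "0 < b" and FG: "\<And>k x. 0 \<le> x \<Longrightarrow> x < w \<Longrightarrow> 0 \<le> G k x \<and> G k x \<le> F k x \<and> F k x \<le> 0.1 * b * lam ^ k"
  shows "ind (slots w b F) = ind (slots w b G) + ind (\<Union>k. strip w (\<lambda>x. b * lam ^ k + G k x) (\<lambda>x. b * lam ^ k + F k x))"
proof -
  let ?D = "\<lambda>k. strip w (\<lambda>x. b * lam ^ k + G k x) (\<lambda>x. b * lam ^ k + F k x)"
  have "slots w b F = slots w b G \<union> (\<Union>k. ?D k)"
  proof -
    have "strip w (\<lambda>_. b * lam ^ k) (\<lambda>x. b * lam ^ k + F k x) = strip w (\<lambda>_. b * lam ^ k) (\<lambda>x. b * lam ^ k + G k x) \<union> ?D k" for k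
      using FG[of _ k] by (fastforce simp: strip_def)
    then show ?thesis unfolding slots_def by auto
  qed
  moreover have "slots w b G \<inter> (\<Union>k. ?D k) = {}"
  proof -
    have False if z: "z \<in> strip w (\<lambda>_. b * lam ^ k) (\<lambda>x. b * lam ^ k + G k x)" "z \<in> ?D l" for z k l
    proof -
      have x: "0 \<le> fst z" "fst z < w" using z by (auto simp: strip_def)
      have "snd z \<le> (1.1 * b) * lam ^ k" "snd z \<le> (1.1 * b) * lam ^ l" "b * lam ^ k \<le> snd z" "b * lam ^ l \<le> snd z"
        using z FG[OF x, of k] FG[OF x, of l] by (auto simp: strip_def algebra_simps)
      then have "k = l" using zone_unique[of b k "snd z" l] b by blast
      then show False using z by (auto simp: strip_def)
    qed
    then show ?thesis unfolding slots_def by blast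
  qed
  ultimately show ?thesis by (simp add: ind_Un)
qed

lemma pl_family_base: "0 \<le> b \<Longrightarrow> pl_family w (\<lambda>k x. b * lam ^ k)"
  using lam by (intro pl_family_const[of _ b]) (auto simp: abs_mult intro!: mult_left_le power_le_one)

lemma nice_slots:
  assumes "pl_family w F" "0 < w" "0 \<le> b" "\<And>k x. 0 \<le> x \<Longrightarrow> x < w \<Longrightarrow> F k x \<le> Y * lam ^ k"
  shows "nice (slots w b F)"
  unfolding slots_def
proof (rule nice_slices(2))
  have L: "0 \<le> b * lam ^ k" for k using assms lam by simp
  show "tame_family (\<lambda>k. strip w (\<lambda>_. b * lam ^ k) (\<lambda>x. b * lam ^ k + F k x))"
    using L by (intro tame_family_strip pl_family_add pl_family_base assms)
  show "strip w (\<lambda>_. b * lam ^ k) (\<lambda>x. b * lam ^ k + F k x) \<subseteq> {0..w} \<times> {0..(b + Y) * lam ^ k}" for k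
    using L[of k] assms(4)[of _ k] by (fastforce simp: strip_def distrib_right mem_Times_iff)
qed

lemma nice_halfopen_box:
  fixes a b c d :: real
  shows "nice ({a..<b} \<times> {c<..d})"
proof (cases "a < b")
  case True
  have "pl_family (b - a) (\<lambda>k x. 0)" "pl_family (b - a) (\<lambda>k x. d - c)"
    using pl_family_const[of "\<lambda>_. 0" 0] pl_family_const[of "\<lambda>_. d - c" "\<bar>d - c\<bar>"] by auto
  then have "tame_family (\<lambda>k::nat. strip (b - a) (\<lambda>x. 0) (\<lambda>x. d - c))" using True by (intro tame_family_strip) auto
  then have "nice (strip (b - a) (\<lambda>x. 0) (\<lambda>x. d - c))" unfolding tame_family_def using tame_nice by blast
  then have "nice ((+) (a, c) ` strip (b - a) (\<lambda>x. 0) (\<lambda>x. d - c))" by (rule nice_translation)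
  also have "(+) (a, c) ` strip (b - a) (\<lambda>x. 0) (\<lambda>x. d - c) = {a..<b} \<times> {c<..d}"
    unfolding translation_vimage by (auto simp: strip_def)
  finally show ?thesis .
qed simp

text \<open>From the top of slot k the layer of thickness \<open>\<upsilon> * lam ^ k\<close> over T
  k is removed, shifted by \<open>\<tau> * lam ^ k\<close>, and laid on what remains, G. The top of
  G at the new place has a different shape, which is why the layer is cut and restacked. What is
  pushed beyond w comes back by the single vector (-w, 0), the same for all scales.\<close>

lemma ceq_transport:
  assumes w: "0 < w" and F: "pl_family w F" "\<And>k. periodic w (F k)" and T: "step_family w T" "\<And>k. periodic w (T k)"
    and \<upsilon>: "0 < \<upsilon>" "\<And>k x. 0 \<le> F k x" "\<And>k x. T k x \<Longrightarrow> \<upsilon> * lam ^ k \<le> F k x"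
    and M: "\<And>k x. F k x \<le> M * lam ^ k" "M + 4 * \<upsilon> \<le> 0.1 * b"
    and \<tau>: "0 \<le> \<tau>" "\<tau> \<le> w" and K: "nice K" "{0..2 * w} \<times> {0..6 * b} \<subseteq> K"
    and F': "\<And>k x. F' k x = F k x - \<upsilon> * lam ^ k * of_bool (T k x) + \<upsilon> * lam ^ k * of_bool (T k (x - \<tau> * lam ^ k))"
  shows "ceq K (ind (slots w b F)) (ind (slots w b F'))"
proof -
  define G where "G k x = F k x - \<upsilon> * lam ^ k * of_bool (T k x)" for k x
  have L: "0 < \<upsilon> * lam ^ k" "0 < lam ^ k" "lam ^ k \<le> 1" for k
    using \<upsilon> lam by (auto intro: power_le_one)
  have M0: "0 \<le> M" using order_trans[OF \<upsilon>(2)[of 0 0] M(1)[of 0 0]] by simp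
  have b: "0 < b" using M(2) M0 \<upsilon>(1) by linarith
  have Lb: "0 \<le> b * lam ^ k" for k using b L(2)[of k] by simp
  have G: "0 \<le> G k x" "G k x \<le> F k x" "G k x \<le> F' k x" "F k x = G k x + \<upsilon> * lam ^ k * of_bool (T k x)"
     "F' k x = G k x + \<upsilon> * lam ^ k * of_bool (T k (x - \<tau> * lam ^ k))" for k x
    using \<upsilon>(2)[of k x] \<upsilon>(3)[of k x] L(1)[of k] by (auto simp: G_def F')
  have GM: "G k x \<le> M * lam ^ k" for k x using G(2) M(1) order_trans by blast
  have Mb: "M * lam ^ k + 4 * (\<upsilon> * lam ^ k) \<le> 0.1 * b * lam ^ k" for k
    using mult_right_mono[OF M(2), of "lam ^ k"] L(2)[of k] by (simp add: algebra_simps)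
  have Fb: "F k x \<le> 0.1 * b * lam ^ k" "F' k x \<le> 0.1 * b * lam ^ k" for k x
  proof -
    show "F k x \<le> 0.1 * b * lam ^ k" using M(1)[of k x] Mb[of k] L(1)[of k] by linarith
    have "F' k x \<le> G k x + \<upsilon> * lam ^ k" unfolding G(5) using L(1)[of k] by auto
    then show "F' k x \<le> 0.1 * b * lam ^ k" using GM[of k x] Mb[of k] L(1)[of k] by linarith
  qed
  have perG: "periodic w (G k)" for k using F(2)[of k] T(2)[of k] unfolding periodic_def G_def by simp
  have sh: "periodic w (T k) \<Longrightarrow> T k (x + w - s) = T k (x - s)" for k x s
    unfolding periodic_def by (metis add_diff_eq diff_add_eq)
  define C where "C k x y \<longleftrightarrow> b * lam ^ k + G k x < y \<and> y \<le> b * lam ^ k + G k x + \<upsilon> * lam ^ k * of_bool (T k (x - \<tau> * lam ^ k))" for k x y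
  have Cper: "C k (x + w) y = C k x y" for k x y
    using perG[of k] sh[OF T(2)] unfolding C_def periodic_def by simp
  have Cuniq: "k = l" if "C k x y" "C l x y" for k l x y
  proof -
    have "b * lam ^ k \<le> y" "y \<le> (1.1 * b) * lam ^ k" if "C k x y" for k
      using that G(1)[of k x] Fb(2)[of k x] unfolding G(5) C_def by (auto simp: algebra_simps)
    then show ?thesis using zone_unique[of b k y l] that b by blast
  qed
  define P where "P k = strip w (\<lambda>x. b * lam ^ k + G k x) (\<lambda>x. b * lam ^ k + G k x + \<upsilon> * lam ^ k * of_bool (T k x))" for k
  \<comment> \<open>The layer in its final place, pulled back by \<open>\<tau> * lam ^ k\<close>, so
    that it stands over the same abscissas as the removed layer P k.\<close>
  define Q where "Q k = strip w (\<lambda>x. b * lam ^ k + G k (x + \<tau> * lam ^ k)) (\<lambda>x. b * lam ^ k + G k (x + \<tau> * lam ^ k) + \<upsilon> * lam ^ k * of_bool (T k x))" for k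
  define W where "W = (\<Union>k. strip w (\<lambda>x. b * lam ^ k + G k x) (\<lambda>x. b * lam ^ k + F' k x))"
  define B where "B = (\<Union>k. (+) (lam ^ k *\<^sub>R (\<tau>, 0)) ` Q k)"
  have memB: "(x, y) \<in> B \<longleftrightarrow> (\<exists>k. \<tau> * lam ^ k \<le> x \<and> x < w + \<tau> * lam ^ k \<and> C k x y)" for x y
    unfolding B_def translation_vimage Q_def by (auto simp: strip_def C_def algebra_simps)
  have memW: "(x, y) \<in> W \<longleftrightarrow> 0 \<le> x \<and> x < w \<and> (\<exists>k. C k x y)" for x y
    unfolding W_def strip_def C_def G(5) by (auto simp: algebra_simps)
  have plu: "pl_family w (\<lambda>k x. \<upsilon> * lam ^ k * of_bool (T k x))"
    using L \<upsilon>(1) by (intro pl_family_scale[OF pl_family_of_bool[OF T(1)], of _ \<upsilon>]) (auto simp: abs_mult intro!: mult_left_le)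
  have plG: "pl_family w G" unfolding G_def by (intro pl_family_diff F plu)
  have plGs: "pl_family w (\<lambda>k x. G k (x + \<tau> * lam ^ k))"
    using pl_family_shift[OF plG perG w, of "\<lambda>k. - (\<tau> * lam ^ k)"] by simp
  have tP: "tame_family P" unfolding P_def
    using b w G(1) Lb by (intro tame_family_strip pl_family_add pl_family_base plG plu) (auto intro: add_nonneg_nonneg)
  have tQ: "tame_family Q" unfolding Q_def
    using b w G(1) Lb by (intro tame_family_strip pl_family_add pl_family_base plGs plu) (auto intro: add_nonneg_nonneg)
  have top: "G k y + \<upsilon> * lam ^ k * of_bool (T k x) \<le> 0.1 * b * lam ^ k" for k x y
  proof -
    have "\<upsilon> * lam ^ k * of_bool (T k x) \<le> \<upsilon> * lam ^ k" using L(1)[of k] by auto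
    then show ?thesis using GM[of k y] Mb[of k] L(1)[of k] by linarith
  qed
  have zP: "P k \<subseteq> {0..w} \<times> {b * lam ^ k..(1.1 * b) * lam ^ k}" for k
  proof clarify
    fix x y assume "(x, y) \<in> P k"
    then show "x \<in> {0..w} \<and> y \<in> {b * lam ^ k..(1.1 * b) * lam ^ k}"
      using G(1)[of k x] top[of k x x] by (auto simp: P_def strip_def algebra_simps)
  qed
  have zQ: "Q k \<subseteq> {0..w} \<times> {b * lam ^ k..(1.1 * b) * lam ^ k}" for k
  proof clarify
    fix x y assume "(x, y) \<in> Q k"
    then show "x \<in> {0..w} \<and> y \<in> {b * lam ^ k..(1.1 * b) * lam ^ k}"
      using G(1)[of k "x + \<tau> * lam ^ k"] top[of k "x + \<tau> * lam ^ k" x] by (auto simp: Q_def strip_def algebra_simps)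
  qed
  have zQ0: "Q k \<subseteq> {0..w} \<times> {0..(1.1 * b) * lam ^ k}" for k using zQ[of k] Lb[of k] by force
  have gh: "\<bar>b * lam ^ k + G k x - (b * lam ^ k + G k (x + \<tau> * lam ^ k))\<bar> \<le> M * lam ^ k" for k x
    using G(1)[of k x] G(1)[of k "x + \<tau> * lam ^ k"] GM[of k x] GM[of k "x + \<tau> * lam ^ k"] by linarith
  have PB: "ceq K (ind (\<Union>k. P k)) (ind B)"
    unfolding B_def
  proof (rule ceq_restack[OF P_def Q_def tP tQ zP zQ gh b \<upsilon>(1) M(2) \<tau>(1) K(1)])
    have "{0..w + \<tau>} \<times> {0..6 * b} \<subseteq> {0..2 * w} \<times> {0..6 * b}" using \<tau> by (intro box_mono) auto
    then show "{0..w + \<tau>} \<times> {0..6 * b} \<subseteq> K" using K(2) by blast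
  qed
  have "ind B \<asymp> ind W"
  proof -
    define H where "H = {w..<2 * w} \<times> {0<..1.1 * b}"
    have tl: "\<tau> * lam ^ k \<le> w" "0 \<le> \<tau> * lam ^ k" for k
      using \<tau> L(2,3)[of k] mult_left_mono[of "lam ^ k" 1 \<tau>] by auto
    have CH: "0 < y" "y \<le> 1.1 * b" if "C k x y" for k x y
    proof -
      have "0 < b * lam ^ k" using b L(2) by simp
      then show "0 < y" using that G(1)[of k x] unfolding C_def by linarith
      have "0.1 * b * lam ^ k \<le> 0.1 * b" "b * lam ^ k \<le> b" using b L(2,3)[of k] by (auto intro: mult_left_le)
      then show "y \<le> 1.1 * b" using that top[of k x "x - \<tau> * lam ^ k"] unfolding C_def by linarith
    qed
    have memH: "(x, y) \<in> B \<inter> H \<longleftrightarrow> (x, y) \<in> B \<and> w \<le> x" for x y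
    proof -
      have "x < 2 * w \<and> 0 < y \<and> y \<le> 1.1 * b" if xy: "(x, y) \<in> B"
      proof -
        obtain k where k: "x < w + \<tau> * lam ^ k" "C k x y" using xy unfolding memB by blast
        then show ?thesis using CH[OF k(2)] tl(1)[of k] by simp
      qed
      then show ?thesis unfolding H_def by auto
    qed
    have nB: "nice B" unfolding B_def by (rule nice_slices(1)[OF tQ zQ0])
    then have n: "nice (B \<inter> H)" "nice (B - H)" using nice_halfopen_box unfolding H_def by (auto intro: nice_Int nice_Diff)
    have "ind B = ind ((B - H) \<union> (B \<inter> H))" by (rule arg_cong[where f = ind]) blast
    also have "\<dots> = ind (B - H) + ind (B \<inter> H)" by (rule ind_Un) blast
    finally have e: "ind B = ind (B - H) + ind (B \<inter> H)" .
    have "ind B \<asymp> ind (B - H) + ind ((+) (- w, 0) ` (B \<inter> H))" unfolding e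
      using n by (intro eqf_add eqf_ind eqf_translate)
    also have "\<dots> = ind ((B - H) \<union> (+) (- w, 0) ` (B \<inter> H))"
    proof (rule ind_Un[symmetric])
      have False if xy: "(x, y) \<in> B - H" "(x, y) \<in> (+) (- w, 0) ` (B \<inter> H)" for x y
      proof -
        have "(x + w, y) \<in> B \<inter> H" using xy(2) unfolding translation_vimage by simp
        then obtain l where l: "0 \<le> x" "x < \<tau> * lam ^ l" "C l x y" unfolding memH memB Cper by auto
        obtain k where k: "\<tau> * lam ^ k \<le> x" "C k x y" using xy(1) unfolding Diff_iff memB by blast
        show False using Cuniq[OF k(2) l(3)] k l by auto
      qed
      then show "(B - H) \<inter> (+) (- w, 0) ` (B \<inter> H) = {}" by fast
    qed
    also have "(B - H) \<union> (+) (- w, 0) ` (B \<inter> H) = W"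
    proof -
      have "(x, y) \<in> (B - H) \<union> (+) (- w, 0) ` (B \<inter> H) \<longleftrightarrow> (x, y) \<in> W" for x y
      proof -
        have 1: "(x, y) \<in> (+) (- w, 0) ` (B \<inter> H) \<longleftrightarrow> 0 \<le> x \<and> (\<exists>k. x < \<tau> * lam ^ k \<and> C k x y)"
        proof -
          have "(x, y) \<in> (+) (- w, 0) ` (B \<inter> H) \<longleftrightarrow> (x + w, y) \<in> B \<inter> H" unfolding translation_vimage by simp
          also have "\<dots> \<longleftrightarrow> 0 \<le> x \<and> (\<exists>k. \<tau> * lam ^ k \<le> x + w \<and> x < \<tau> * lam ^ k \<and> C k x y)"
            unfolding memH memB Cper by auto
          also have "\<dots> \<longleftrightarrow> 0 \<le> x \<and> (\<exists>k. x < \<tau> * lam ^ k \<and> C k x y)"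
          proof -
            have "\<tau> * lam ^ k \<le> x + w" if "0 \<le> x" for k using tl(1)[of k] that by linarith
            then show ?thesis by blast
          qed
          finally show ?thesis .
        qed
        have 2: "(x, y) \<in> B - H \<longleftrightarrow> x < w \<and> (\<exists>k. \<tau> * lam ^ k \<le> x \<and> C k x y)"
        proof -
          have "(x, y) \<in> B - H \<longleftrightarrow> (x, y) \<in> B \<and> x < w" using memH[of x y] by auto
          also have "\<dots> \<longleftrightarrow> x < w \<and> (\<exists>k. \<tau> * lam ^ k \<le> x \<and> C k x y)"
          proof -
            have "x < w + \<tau> * lam ^ k" if "x < w" for k using tl(2)[of k] that by linarith
            then show ?thesis unfolding memB by blast
          qed
          finally show ?thesis .
        qed
        have 3: "x < w" if "x < \<tau> * lam ^ k" for k using tl(1)[of k] that by linarith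
        have 4: "0 \<le> x" if "\<tau> * lam ^ k \<le> x" for k using tl(2)[of k] that by linarith
        show ?thesis unfolding Un_iff 1 2 memW using 3 4 not_le by metis
      qed
      then show ?thesis by (simp add: set_eq_iff split_paired_all)
    qed
    finally show ?thesis .
  qed
  then have PW: "ceq K (ind (\<Union>k. P k)) (ind W)" using ceq_trans[OF PB ceq_eqf[OF K(1)]] by blast
  have nG: "nice (slots w b G)" using b GM by (intro nice_slots[OF plG w]) auto
  have "ceq K (ind (\<Union>k. P k) + ind (slots w b G)) (ind W + ind (slots w b G))"
    by (rule ceq_add_eqf[OF PW eqf_ind[OF nG]])
  moreover have "ind (slots w b F) = ind (slots w b G) + ind (\<Union>k. P k)"
  proof -
    have "P k = strip w (\<lambda>x. b * lam ^ k + G k x) (\<lambda>x. b * lam ^ k + F k x)" for k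
      unfolding P_def G(4) by (simp add: add.assoc)
    then show ?thesis using ind_slots_split[of b w G F] b G(1,2) Fb(1) by simp
  qed
  moreover have "ind (slots w b F') = ind (slots w b G) + ind W"
    unfolding W_def using b G(1,3) Fb(2) by (intro ind_slots_split) auto
  ultimately show ?thesis by (simp only: add.commute)
qed

subsection \<open>Integer rounding of a zero-mean function\<close>

lemma mvt_lipschitz:
  fixes f f' :: "real \<Rightarrow> real"
  assumes "\<And>x. DERIV f x :> f' x" "\<And>x. \<bar>f' x\<bar> \<le> B"
  shows "\<bar>f x - f y\<bar> \<le> B * \<bar>x - y\<bar>"
proof -
  have *: "\<bar>f x - f y\<bar> \<le> B * \<bar>x - y\<bar>" if xy: "x < y" for x y
  proof -
    obtain z where z: "f y - f x = (y - x) * f' z" using MVT2[OF xy, of f f'] assms(1) by blast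
    have "\<bar>y - x\<bar> * \<bar>f' z\<bar> \<le> \<bar>y - x\<bar> * B" using assms(2) by (intro mult_left_mono) auto
    then have "\<bar>f y - f x\<bar> \<le> \<bar>y - x\<bar> * B" unfolding z abs_mult .
    then show ?thesis by (simp only: abs_minus_commute mult.commute)
  qed
  show ?thesis using *[of x y] *[of y x] by (cases x y rule: linorder_cases) (auto simp: abs_minus_commute)
qed

text \<open>For an antiderivative f this is the average of f' over the interval of length s centred
  at x, so iterated central differences are iterated averages.\<close>

definition cdiff :: "(real \<Rightarrow> real) \<Rightarrow> real \<Rightarrow> real \<Rightarrow> real" where
  "cdiff f s x = (f (x + s / 2) - f (x - s / 2)) / s"

lemma cdiff_mean_value:
  assumes "\<And>x. DERIV f x :> f' x" "0 < s"
  obtains z where "\<bar>z - x\<bar> \<le> s / 2" "cdiff f s x = f' z"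
proof -
  have lt: "x - s / 2 < x + s / 2" using assms by simp
  obtain z where z: "x - s / 2 < z" "z < x + s / 2" "f (x + s / 2) - f (x - s / 2) = (x + s / 2 - (x - s / 2)) * f' z"
    using MVT2[OF lt, of f f'] assms(1) by blast
  have "\<bar>z - x\<bar> \<le> s / 2" using z by linarith
  moreover have "cdiff f s x = f' z" unfolding cdiff_def z(3) using assms(2) by simp
  ultimately show thesis by (rule that)
qed

lemma DERIV_cdiff:
  assumes "\<And>x. DERIV f x :> f' x"
  shows "DERIV (cdiff f s) x :> cdiff f' s x"
proof -
  have "DERIV (\<lambda>x. f (x + s / 2)) x :> f' (x + s / 2)" and "DERIV (\<lambda>x. f (x - s / 2)) x :> f' (x - s / 2)"
    by (rule DERIV_chain2[OF assms, of _ 1, simplified]; auto intro!: derivative_eq_intros)+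
  then have "DERIV (\<lambda>x. (f (x + s / 2) - f (x - s / 2)) / s) x :> (f' (x + s / 2) - f' (x - s / 2)) / s"
    by (intro DERIV_cdivide DERIV_diff)
  then show ?thesis unfolding cdiff_def by (simp add: cdiff_def[abs_def])
qed

lemma cdiff_commute: "cdiff (cdiff f s) t x = cdiff (cdiff f t) s x"
proof -
  have "x + t / 2 - s / 2 = x - s / 2 + t / 2" "x - t / 2 + s / 2 = x + s / 2 - t / 2" "x - t / 2 - s / 2 = x - s / 2 - t / 2"
    "x + t / 2 + s / 2 = x + s / 2 + t / 2"
    by linarith+
  then show ?thesis by (simp add: cdiff_def diff_divide_distrib add_divide_distrib divide_divide_eq_left algebra_simps)
qed

text \<open>Centring removes the error term of first order. In
  \<open>difference_decomposition\<close> the error is divided by a step of length comparable with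
  s, and only a quadratic error leaves a quotient that decays like \<open>lam ^ n\<close>.\<close>

lemma cdiff_second_order:
  fixes \<Phi> H \<phi> :: "real \<Rightarrow> real"
  assumes d: "\<And>x. DERIV \<Phi> x :> H x" "\<And>x. DERIV H x :> \<phi> x"
    and L: "\<And>x y. \<bar>\<phi> x - \<phi> y\<bar> \<le> L * \<bar>x - y\<bar>" and s: "0 < s"
  shows "\<bar>cdiff \<Phi> s x - H x\<bar> \<le> L * s\<^sup>2 / 4"
proof -
  define g where "g h = \<Phi> (x + h) - \<Phi> (x - h) - 2 * h * H x" for h
  have L0: "0 \<le> L" using L[of 0 1] by simp
  have dg: "DERIV g h :> H (x + h) + H (x - h) - 2 * H x" for h
    unfolding g_def by (auto intro!: derivative_eq_intros DERIV_chain2[OF d(1)])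
  have hp: "0 < s / 2" using s by simp
  obtain z where z: "0 < z" "z < s / 2" "g (s / 2) - g 0 = (s / 2 - 0) * (H (x + z) + H (x - z) - 2 * H x)"
    using MVT2[OF hp, of g "\<lambda>h. H (x + h) + H (x - h) - 2 * H x"] dg by blast
  have l1: "x < x + z" "x - z < x" using z by auto
  obtain a where a: "x < a" "a < x + z" "H (x + z) - H x = (x + z - x) * \<phi> a"
    using MVT2[OF l1(1), of H \<phi>] d(2) by blast
  obtain b where b: "x - z < b" "b < x" "H x - H (x - z) = (x - (x - z)) * \<phi> b"
    using MVT2[OF l1(2), of H \<phi>] d(2) by blast
  have "H (x + z) + H (x - z) - 2 * H x = z * (\<phi> a - \<phi> b)" using a(3) b(3) by (simp add: algebra_simps)
  then have geq: "g (s / 2) = s / 2 * (z * (\<phi> a - \<phi> b))" using z(3) by (simp add: g_def)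
  have "\<bar>z * (\<phi> a - \<phi> b)\<bar> \<le> (s / 2) * (L * s)"
  proof -
    have "\<bar>\<phi> a - \<phi> b\<bar> \<le> L * \<bar>a - b\<bar>" by (rule L)
    also have "\<dots> \<le> L * s" using a b z L0 by (intro mult_left_mono) auto
    finally have "\<bar>z\<bar> * \<bar>\<phi> a - \<phi> b\<bar> \<le> (s / 2) * (L * s)" using z L0 s by (intro mult_mono) auto
    then show ?thesis by (simp add: abs_mult)
  qed
  then have "s / 2 * \<bar>z * (\<phi> a - \<phi> b)\<bar> \<le> s / 2 * ((s / 2) * (L * s))" using s by (intro mult_left_mono) auto
  moreover have "\<bar>s / 2\<bar> = s / 2" using s by simp
  ultimately have "\<bar>g (s / 2)\<bar> \<le> s / 2 * ((s / 2) * (L * s))"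
    unfolding geq by (simp only: abs_mult)
  then have "\<bar>g (s / 2)\<bar> / s \<le> L * s\<^sup>2 / 4" using s by (simp add: pos_divide_le_eq power2_eq_square algebra_simps)
  moreover have "cdiff \<Phi> s x - H x = g (s / 2) / s" using s by (simp add: cdiff_def g_def diff_divide_distrib)
  ultimately show ?thesis using s by simp
qed

lemma periodic_cdiff:
  assumes "\<And>x. f (x + w) - f x = c"
  shows "periodic w (cdiff f s)"
proof -
  have "f (x + w + s / 2) - f (x + w - s / 2) = f (x + s / 2) - f (x - s / 2)" for x
    using assms[of "x + s / 2"] assms[of "x - s / 2"] by (simp add: algebra_simps)
  then show ?thesis unfolding periodic_def cdiff_def by simp
qed

text \<open>Partial sums of iterated central differences: the doubly averaged functions
  \<open>cdiff (cdiff \<Phi> \<tau>\<^sub>n\<^sub>+\<^sub>1) \<tau>\<^sub>n\<close> differ from their predecessors by a difference of step \<open>\<tau>\<^sub>n\<close>.\<close>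

lemma difference_decomposition:
  fixes \<Phi> H \<phi> :: "real \<Rightarrow> real"
  assumes w: "0 < w" and \<tau>: "0 < \<tau>"
    and d: "\<And>x. DERIV \<Phi> x :> H x" "\<And>x. DERIV H x :> \<phi> x" and per: "\<And>x. \<Phi> (x + w) - \<Phi> x = c"
    and L: "\<And>x y. \<bar>\<phi> x - \<phi> y\<bar> \<le> L * \<bar>x - y\<bar>" and \<eta>: "\<And>x. \<bar>\<phi> x\<bar> \<le> \<eta>" "\<And>x. \<bar>H x\<bar> \<le> \<eta> * w"
    and \<upsilon>: "2 * (L * \<tau>) \<le> \<upsilon>" "\<eta> * w \<le> \<upsilon> * \<tau>" "\<eta> \<le> 2 * \<upsilon>"
  obtains i P :: "nat \<Rightarrow> real \<Rightarrow> real" and D where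
    "\<And>x. P 0 x = 0" "\<And>n x. P (Suc n) x = P n x + (i n x - i n (x - \<tau> * lam ^ n))"
    "\<And>n x. \<bar>\<phi> x - P n x\<bar> \<le> 2 * \<upsilon> * lam ^ n" "\<And>n x. \<bar>i n x\<bar> \<le> \<upsilon> * lam ^ n"
    "\<And>n. periodic w (i n)" "\<And>n x y. \<bar>i n x - i n y\<bar> \<le> D * 3 ^ n * \<bar>x - y\<bar>"
proof -
  define T where "T n = \<tau> * lam ^ n" for n
  have T: "0 < T n" "T (Suc n) = lam * T n" for n using \<tau> by (auto simp: T_def)
  define d where "d n = cdiff \<Phi> (T n)" for n
  \<comment> \<open>The double averages \<open>P n\<close> and \<open>P (Suc n)\<close> have one
    step length in common, T n; their difference is a central difference with this step, and the
    argument is moved by T n / 2 to make it a backward one. For n = 0 the predecessor is the zero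
    function instead of an average.\<close>
  define i where "i n x = (case n of 0 \<Rightarrow> d 1 (x + T 0 / 2) / T 0 | Suc m \<Rightarrow> (d (m + 2) (x + T n / 2) - d m (x + T n / 2)) / T n)" for n x
  define P where "P n x = (case n of 0 \<Rightarrow> 0 | Suc m \<Rightarrow> cdiff (d (Suc m)) (T m) x)" for n x
  have L0: "0 \<le> L" using L[of 0 1] by simp
  have \<eta>0: "0 \<le> \<eta>" using \<eta>(1)[of 0] by linarith
  have \<upsilon>0: "0 \<le> \<upsilon>" using \<upsilon>(1) L0 \<tau> by (smt (verit) mult_nonneg_nonneg)
  have dd: "DERIV (d n) x :> cdiff H (T n) x" for n x unfolding d_def by (rule DERIV_cdiff[OF d(1)])
  have bd: "\<bar>cdiff H (T n) x\<bar> \<le> \<eta>" for n x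
    using cdiff_mean_value[of H \<phi> "T n" x] d(2) T(1) \<eta>(1) by metis
  have Ld: "\<bar>d n x - d n y\<bar> \<le> \<eta> * \<bar>x - y\<bar>" for n x y by (rule mvt_lipschitz[OF dd bd])
  have bH: "\<bar>d n x - H x\<bar> \<le> L * (T n)\<^sup>2 / 4" for n x unfolding d_def by (rule cdiff_second_order[OF d L T(1)])
  have bd0: "\<bar>d n x\<bar> \<le> \<eta> * w" for n x
    using cdiff_mean_value[of \<Phi> H "T n" x] d(1) T(1) \<eta>(2) unfolding d_def by metis
  have perd: "d n (x + w) = d n x" for n x using periodic_cdiff[of \<Phi> w c "T n"] per unfolding d_def periodic_def by blast
  have "P 0 x = 0" for x by (simp add: P_def)
  moreover have "P (Suc n) x = P n x + (i n x - i n (x - \<tau> * lam ^ n))" for n x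
  proof (cases n)
    case 0
    have "x - \<tau> + \<tau> / 2 = x - \<tau> / 2" by (simp add: field_simps)
    then show ?thesis using 0 by (simp add: P_def i_def T_def cdiff_def diff_divide_distrib)
  next
    case (Suc m)
    have "P (Suc m) x = cdiff (d m) (T (Suc m)) x" unfolding P_def by (simp add: d_def cdiff_commute)
    moreover have "x - T n + T n / 2 = x - T n / 2" by (simp add: field_simps)
    then have "i n x - i n (x - \<tau> * lam ^ n) = cdiff (d (m + 2)) (T n) x - cdiff (d m) (T n) x"
      unfolding i_def T_def[symmetric] Suc by (simp add: cdiff_def diff_divide_distrib)
    ultimately show ?thesis unfolding Suc by (simp add: P_def)
  qed
  moreover have "\<bar>\<phi> x - P n x\<bar> \<le> 2 * \<upsilon> * lam ^ n" for n x
  proof (cases n)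
    case 0
    then show ?thesis using \<eta>(1)[of x] \<upsilon>(3) by (simp add: P_def)
  next
    case (Suc m)
    \<comment> \<open>Two applications of the mean value theorem: a double average of \<phi> is a
      value of \<phi> at a point within T m of x.\<close>
    obtain z where z: "\<bar>z - x\<bar> \<le> T m / 2" "P n x = cdiff H (T (Suc m)) z"
      using cdiff_mean_value[of "d (Suc m)" "cdiff H (T (Suc m))" "T m" x] dd T(1) unfolding Suc P_def by auto
    obtain y where y: "\<bar>y - z\<bar> \<le> T (Suc m) / 2" "P n x = \<phi> y"
      using cdiff_mean_value[of H \<phi> "T (Suc m)" z] d(2) T(1) z(2) by metis
    have "\<bar>x - y\<bar> \<le> T m" using y(1) z(1) T(2)[of m] T(1)[of m] lam_less_1
      by (smt (verit) field_sum_of_halves mult_left_le_one_le lam_ge_0 lam_le_1)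
    then have "\<bar>\<phi> x - P n x\<bar> \<le> L * T m" using L[of x y] L0 unfolding y(2)
      by (meson mult_left_mono order_trans)
    also have "\<dots> = L * \<tau> * lam ^ m" by (simp add: T_def)
    also have "\<dots> \<le> (2 * \<upsilon> * lam) * lam ^ m"
    proof (intro mult_right_mono)
      have "0.682 * \<upsilon> \<le> lam * \<upsilon>" using lam \<upsilon>0 by (intro mult_right_mono) auto
      then show "L * \<tau> \<le> 2 * \<upsilon> * lam" using \<upsilon>(1) \<upsilon>0 by (simp add: mult.commute)
    qed simp
    finally show ?thesis unfolding Suc by simp
  qed
  moreover have "\<bar>i n x\<bar> \<le> \<upsilon> * lam ^ n" for n x
  proof (cases n)
    case 0
    have "\<bar>d 1 (x + T 0 / 2)\<bar> / T 0 \<le> \<upsilon> * T 0 / T 0"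
      using bd0[of 1 "x + T 0 / 2"] \<upsilon>(2) T(1)[of 0] by (intro divide_right_mono) (auto simp: T_def)
    then show ?thesis using T(1)[of 0] by (simp add: 0 i_def)
  next
    case (Suc m)
    define y where "y = x + T n / 2"
    have "\<bar>d (m + 2) y - d m y\<bar> \<le> L * (T (m + 2))\<^sup>2 / 4 + L * (T m)\<^sup>2 / 4"
      using bH[of "m + 2" y] bH[of m y] by linarith
    also have "\<dots> \<le> L * (T m)\<^sup>2 / 4 + L * (T m)\<^sup>2 / 4"
    proof -
      have "T (m + 2) \<le> T m" using \<tau> by (simp add: T_def mult_le_one mult_left_le)
      then have "(T (m + 2))\<^sup>2 \<le> (T m)\<^sup>2" using T(1)[of "m + 2"] by (intro power_mono) auto
      then have "L * (T (m + 2))\<^sup>2 \<le> L * (T m)\<^sup>2" using L0 by (rule mult_left_mono)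
      then show ?thesis by linarith
    qed
    also have "\<dots> = L * \<tau> / 2 * (lam ^ m * T m)" by (simp add: T_def power2_eq_square)
    also have "\<dots> \<le> (\<upsilon> * lam * lam) * (lam ^ m * T m)"
    proof (intro mult_right_mono)
      have "0.682 * 0.682 \<le> lam * lam" using lam by (intro mult_mono) auto
      then have "\<upsilon> * (0.682 * 0.682) \<le> \<upsilon> * (lam * lam)" using \<upsilon>0 by (rule mult_left_mono)
      then show "L * \<tau> / 2 \<le> \<upsilon> * lam * lam" using \<upsilon>(1) \<upsilon>0 by (simp add: mult.assoc)
    qed (use T(1)[of m] in auto)
    also have "\<dots> = \<upsilon> * lam ^ n * T n" by (simp add: Suc T(2))
    finally have "\<bar>d (m + 2) y - d m y\<bar> / T n \<le> \<upsilon> * lam ^ n" using T(1)[of n] by (simp add: pos_divide_le_eq)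
    then show ?thesis using T(1)[of n] by (simp add: Suc i_def y_def)
  qed
  moreover have "periodic w (i n)" for n
  proof -
    have "d k (x + w + s) = d k (x + s)" for k x s using perd[of k "x + s"] by (simp add: algebra_simps)
    then show ?thesis unfolding periodic_def i_def by (cases n) auto
  qed
  moreover have "\<bar>i n x - i n y\<bar> \<le> (2 * \<eta> / \<tau>) * 3 ^ n * \<bar>x - y\<bar>" for n x y
  proof -
    have "\<bar>i n x - i n y\<bar> * T n \<le> 2 * \<eta> * \<bar>x - y\<bar>"
    proof (cases n)
      case 0
      have "i n x - i n y = (d 1 (x + T 0 / 2) - d 1 (y + T 0 / 2)) / T n" by (simp add: 0 i_def diff_divide_distrib)
      then have "\<bar>i n x - i n y\<bar> * T n = \<bar>d 1 (x + T 0 / 2) - d 1 (y + T 0 / 2)\<bar>" using T(1)[of n] by simp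
      moreover have "0 \<le> \<eta> * \<bar>x - y\<bar>" using \<eta>0 by simp
      ultimately show ?thesis using Ld[of 1 "x + T 0 / 2" "y + T 0 / 2"] by (simp only: add_diff_cancel_right)
    next
      case (Suc m)
      have "i n x - i n y = (d (m + 2) (x + T n / 2) - d (m + 2) (y + T n / 2) - (d m (x + T n / 2) - d m (y + T n / 2))) / T n"
        by (simp add: Suc i_def diff_divide_distrib)
      then have "\<bar>i n x - i n y\<bar> * T n = \<bar>d (m + 2) (x + T n / 2) - d (m + 2) (y + T n / 2) - (d m (x + T n / 2) - d m (y + T n / 2))\<bar>"
        using T(1)[of n] by simp
      also have "\<dots> \<le> \<eta> * \<bar>x - y\<bar> + \<eta> * \<bar>x - y\<bar>"
        using Ld[of "m + 2" "x + T n / 2" "y + T n / 2"] Ld[of m "x + T n / 2" "y + T n / 2"] by simp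
      finally show ?thesis by simp
    qed
    then have "\<bar>i n x - i n y\<bar> \<le> 2 * \<eta> * \<bar>x - y\<bar> / T n" using T(1)[of n] by (simp add: pos_le_divide_eq)
    also have "\<dots> = (2 * \<eta> / \<tau>) * (1 / lam) ^ n * \<bar>x - y\<bar>" by (simp add: T_def power_divide)
    also have "\<dots> \<le> (2 * \<eta> / \<tau>) * 3 ^ n * \<bar>x - y\<bar>"
    proof (intro mult_right_mono mult_left_mono power_mono)
      show "1 / lam \<le> 3" using lam by (simp add: pos_divide_le_eq)
    qed (use \<eta>0 \<tau> in auto)
    finally show ?thesis .
  qed
  ultimately show thesis by (rule that)
qed

text \<open>Between the points of a mesh of width u/L and the breakpoints of r, the function r
  varies by at most u; t is the floor of r/u at the last such point, which costs another u. Then 14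
  = 12 + 2 bounds t.\<close>

lemma rounding_step:
  fixes r :: "real \<Rightarrow> real"
  assumes w: "0 < w" and r: "periodic w r" "pw_lipschitz w N L r" and L: "0 < L" and u: "0 < u"
    and bd: "\<And>x. \<bar>r x\<bar> \<le> 12 * u"
  obtains t :: "real \<Rightarrow> int" where "periodic w t" "pw_lipschitz w (N + w * L / u + 2) 0 (\<lambda>x. real_of_int (t x))"
    "\<And>x. \<bar>r x - u * t x\<bar> \<le> 2 * u" "\<And>x. \<bar>t x\<bar> \<le> 14"
proof -
  obtain X where X: "finite X" "real (card X) \<le> N"
    "\<And>x y. 0 \<le> x \<Longrightarrow> x \<le> y \<Longrightarrow> y < w \<Longrightarrow> X \<inter> {x<..y} = {} \<Longrightarrow> \<bar>r x - r y\<bar> \<le> L * (y - x)"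
    using r(2) unfolding pw_lipschitz_def by blast
  define h where "h = u / L"
  have h: "0 < h" "L * h = u" using u L by (auto simp: h_def)
  define M where "M = (\<lambda>k. real k * h) ` {..nat \<lfloor>w / h\<rfloor>}"
  define p where "p x = Max {q \<in> X \<union> M. 0 \<le> q \<and> q \<le> x}" for x
  define t where "t x = \<lfloor>r (p (wrap w x)) / u\<rfloor>" for x
  have fin: "finite (X \<union> M)" using X by (auto simp: M_def)
  have "card M \<le> card {..nat \<lfloor>w / h\<rfloor>}" unfolding M_def by (rule card_image_le) simp
  moreover have "real (nat \<lfloor>w / h\<rfloor>) \<le> w / h" using w h by simp
  ultimately have "real (card M) \<le> w * L / u + 1" by (simp add: h_def)
  moreover have "real (card (X \<union> M)) \<le> real (card X) + real (card M)" by (metis card_Un_le of_nat_add of_nat_mono)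
  ultimately have card: "real (card (X \<union> M)) \<le> N + w * L / u + 2" using X(2) by linarith
  have p: "p x \<in> X \<union> M" "0 \<le> p x" "p x \<le> x" "x - p x \<le> h" "X \<inter> {p x<..x} = {}" if x: "0 \<le> x" "x < w" for x
  proof -
    let ?S = "{q \<in> X \<union> M. 0 \<le> q \<and> q \<le> x}"
    have fS: "finite ?S" using fin by simp
    define k where "k = nat \<lfloor>x / h\<rfloor>"
    have k: "real k \<le> x / h" "x / h < real k + 1" using x h unfolding k_def by (simp_all add: of_nat_nat)
    then have kh: "real k * h \<le> x" "x < real k * h + h" using h(1) by (simp_all add: pos_le_divide_eq pos_divide_less_eq distrib_right)
    have "k \<le> nat \<lfloor>w / h\<rfloor>" unfolding k_def using x h by (intro nat_mono floor_mono divide_right_mono) auto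
    then have kS: "real k * h \<in> ?S" using kh(1) h(1) by (auto simp: M_def)
    have pS: "p x \<in> ?S" unfolding p_def by (rule Max_in[OF fS]) (use kS in blast)
    then show "p x \<in> X \<union> M" "0 \<le> p x" "p x \<le> x" by auto
    have "real k * h \<le> p x" unfolding p_def by (rule Max_ge[OF fS kS])
    then show "x - p x \<le> h" using kh by simp
    show "X \<inter> {p x<..x} = {}"
    proof (rule ccontr)
      assume "X \<inter> {p x<..x} \<noteq> {}"
      then obtain q where q: "q \<in> X" "p x < q" "q \<le> x" by auto
      then have "q \<in> ?S" using pS by auto
      then have "q \<le> p x" unfolding p_def by (rule Max_ge[OF fS])
      then show False using q by simp
    qed
  qed
  have "periodic w t"
  proof -
    have "wrap w (x + w) = wrap w x" for x using w by (simp add: wrap_def add_divide_distrib algebra_simps)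
    then show ?thesis by (simp add: periodic_def t_def)
  qed
  moreover have "pw_lipschitz w (N + w * L / u + 2) 0 (\<lambda>x. real_of_int (t x))"
    unfolding pw_lipschitz_def
  proof (intro exI[of _ "X \<union> M"] conjI allI impI fin card)
    fix x y assume xy: "0 \<le> x" "x \<le> y" "y < w" "(X \<union> M) \<inter> {x<..y} = {}"
    have "wrap w x = x" "wrap w y = y" using xy w by (auto intro!: wrap_eqI[where n = 0])
    moreover have "{q \<in> X \<union> M. 0 \<le> q \<and> q \<le> x} = {q \<in> X \<union> M. 0 \<le> q \<and> q \<le> y}" using xy by force
    ultimately show "\<bar>real_of_int (t x) - real_of_int (t y)\<bar> \<le> 0 * (y - x)" by (simp add: t_def p_def)
  qed
  moreover have rt: "\<bar>r x - u * t x\<bar> \<le> 2 * u" for x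
  proof -
    define y where "y = wrap w x"
    have y: "0 \<le> y" "y < w" using wrap_range[OF w] by (auto simp: y_def)
    have "\<bar>r (p y) - r y\<bar> \<le> L * (y - p y)" using X(3) p[OF y] y by blast
    also have "\<dots> \<le> L * h" using p(4)[OF y] L by (intro mult_left_mono) auto
    finally have 1: "\<bar>r (p y) - r y\<bar> \<le> u" unfolding h(2) .
    have "t x \<le> r (p y) / u" "r (p y) / u < t x + 1" unfolding t_def y_def by linarith+
    then have "t x * u \<le> r (p y)" "r (p y) < t x * u + u" using u by (simp_all add: pos_le_divide_eq pos_divide_less_eq distrib_right)
    then have "\<bar>r (p y) - u * t x\<bar> \<le> u" by (simp add: mult.commute)
    moreover have "r y = r x" unfolding y_def by (rule periodic_wrap[OF r(1)])
    ultimately show ?thesis using 1 by linarith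
  qed
  moreover have "\<bar>t x\<bar> \<le> 14" for x
  proof -
    have "\<bar>u * t x\<bar> \<le> 14 * u" using rt[of x] bd[of x] by linarith
    then have "\<bar>real_of_int (t x)\<bar> \<le> 14" using u by (simp add: abs_mult mult.commute)
    then show ?thesis by linarith
  qed
  ultimately show thesis by (rule that)
qed

text \<open>The remainders of the rounding are carried along with three different step sizes, because
  \<open>\<tau>\<^sub>n = \<tau>\<^sub>n\<^sub>+\<^sub>1 + \<tau>\<^sub>n\<^sub>+\<^sub>3\<close> turns a difference of step \<open>\<tau>\<^sub>n\<close> into differences of steps
  \<open>\<tau>\<^sub>n\<^sub>+\<^sub>1\<close> and \<open>\<tau>\<^sub>n\<^sub>+\<^sub>3\<close>.\<close>

lemma integer_rounding:
  fixes \<phi> :: "real \<Rightarrow> real" and i P :: "nat \<Rightarrow> real \<Rightarrow> real"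
  assumes w: "0 < w" and \<upsilon>: "0 < \<upsilon>"
    and P: "\<And>x. P 0 x = 0" "\<And>n x. P (Suc n) x = P n x + (i n x - i n (x - \<tau> * lam ^ n))"
    "\<And>n x. \<bar>\<phi> x - P n x\<bar> \<le> 2 * \<upsilon> * lam ^ n"
    and i: "\<And>n x. \<bar>i n x\<bar> \<le> \<upsilon> * lam ^ n" "\<And>n. periodic w (i n)" "\<And>n x y. \<bar>i n x - i n y\<bar> \<le> D * 3 ^ n * \<bar>x - y\<bar>"
  obtains t :: "nat \<Rightarrow> real \<Rightarrow> int" and C where
    "\<And>n. periodic w (t n)" "\<And>n x. \<bar>t n x\<bar> \<le> 14" "0 \<le> C" "\<And>n. pw_lipschitz w (C * 6 ^ n) 0 (\<lambda>x. real_of_int (t n x))"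
    "\<And>n x. \<bar>\<phi> x - (\<Sum>m<n. \<upsilon> * lam ^ m * (t m x - t m (x - \<tau> * lam ^ m)))\<bar> \<le> 40 * \<upsilon> * lam ^ n"
proof -
  define T where "T n = \<tau> * lam ^ n" for n
  define u where "u n = \<upsilon> * lam ^ n" for n
  have u: "0 < u n" "u (Suc n) = lam * u n" for n using \<upsilon> by (auto simp: u_def)
  have us: "u n * 341 \<le> u (Suc n) * 500" for n unfolding u(2) using lam(1) u(1)[of n] by simp
  have D0: "0 \<le> D" using i(3)[of 0 0 1] by simp
  define A where "A = D + 1"
  \<comment> \<open>The Lipschitz constants grow like 3^n. At level n the mesh has width u n / (2 A
    3^n), so the number of its points grows like (3/\<open>lam\<close>)^n, and 3/\<open>lam\<close>
    is at most 6; J absorbs the constants.\<close>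
  define J where "J = 2 * A * w / \<upsilon> + 2"
  have A: "0 < A" "D \<le> A" using D0 by (auto simp: A_def)
  have J: "2 \<le> J" using A w \<upsilon> by (simp add: J_def)
  define good where "good b n f \<longleftrightarrow> periodic w f \<and> pw_lipschitz w (J * 6 ^ n) (A * 3 ^ n) f \<and> (\<forall>x. \<bar>f x\<bar> \<le> b * u n)"
    for b n and f :: "real \<Rightarrow> real"
  \<comment> \<open>With u n at most u (n + 1) / 0.682 the bounds reproduce themselves: a remainder
    of size 2 becomes at most 3, the bound 3 becomes at most 5, and 2 + 5 = 7 becomes at most 11.
    The first component together with \<open>i n\<close> stays below 11 + 1 = 12, as
    \<open>rounding_step\<close> requires.\<close>
  define inv where "inv n s \<longleftrightarrow> (case s of (\<alpha>, \<beta>, \<gamma>) \<Rightarrow> good 11 n \<alpha> \<and> good 5 n \<beta> \<and> good 3 n \<gamma> \<and>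
     (n = 0 \<longrightarrow> (\<forall>x. \<alpha> x = 0 \<and> \<beta> x = 0 \<and> \<gamma> x = 0)))" for n s
  define \<rho> where "\<rho> n \<alpha> t x = i n x + \<alpha> x - u n * real_of_int (t x)" for n \<alpha> x and t :: "real \<Rightarrow> int"
  \<comment> \<open>At level n the functions \<alpha>, \<beta>, \<gamma> wait for differences of
    steps T n, T (n + 1), T (n + 2). The remainder \<rho> of rounding is due at step T n = T (n + 1)
    + T (n + 3): it joins \<beta> at step T (n + 1), and its shift by T (n + 1) becomes the new
    \<gamma>, due at step T (n + 3).\<close>
  define nxt where "nxt n s s' \<longleftrightarrow> (case s of (\<alpha>, \<beta>, \<gamma>) \<Rightarrow> \<exists>t::real \<Rightarrow> int. periodic w t \<and>
     pw_lipschitz w (2 * J * 6 ^ n) 0 (\<lambda>x. real_of_int (t x)) \<and> (\<forall>x. \<bar>t x\<bar> \<le> 14) \<and>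
     s' = (\<lambda>x. \<rho> n \<alpha> t x + \<beta> x, \<gamma>, \<lambda>x. \<rho> n \<alpha> t (x - T (Suc n))))"
    for n and s s' :: "(real \<Rightarrow> real) \<times> (real \<Rightarrow> real) \<times> (real \<Rightarrow> real)"
  have "\<exists>f. \<forall>n. inv n (f n) \<and> nxt n (f n) (f (Suc n))"
  proof (rule dependent_nat_choice)
    have "pw_lipschitz w (J * 6 ^ 0) (A * 3 ^ 0) (\<lambda>x. 0)"
      using A J by (intro pw_lipschitz_mono[OF pw_lipschitzI[of w "\<lambda>x. 0" 0]]) auto
    then have "good b 0 (\<lambda>x. 0)" if "0 \<le> b" for b
      using that u(1)[of 0] by (simp add: good_def periodic_def)
    then have "inv 0 (\<lambda>x. 0, \<lambda>x. 0, \<lambda>x. 0)" by (simp add: inv_def)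
    then show "\<exists>s. inv 0 s" by blast
  next
    fix s n assume s: "inv n s"
    obtain \<alpha> \<beta> \<gamma> where abc: "s = (\<alpha>, \<beta>, \<gamma>)" by (cases s)
    have a: "periodic w \<alpha>" "pw_lipschitz w (J * 6 ^ n) (A * 3 ^ n) \<alpha>" "\<And>x. \<bar>\<alpha> x\<bar> \<le> 11 * u n"
      and b: "periodic w \<beta>" "pw_lipschitz w (J * 6 ^ n) (A * 3 ^ n) \<beta>" "\<And>x. \<bar>\<beta> x\<bar> \<le> 5 * u n"
      and c: "periodic w \<gamma>" "pw_lipschitz w (J * 6 ^ n) (A * 3 ^ n) \<gamma>" "\<And>x. \<bar>\<gamma> x\<bar> \<le> 3 * u n"
      using s unfolding abc inv_def good_def by auto
    have p3: "(1::real) \<le> 3 ^ n" "(1::real) \<le> 6 ^ n" by auto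
    have "pw_lipschitz w 0 (D * 3 ^ n) (i n)"
    proof (rule pw_lipschitzI)
      fix x y :: real assume "x \<le> y"
      then show "\<bar>i n x - i n y\<bar> \<le> D * 3 ^ n * (y - x)" using i(3)[of n x y] by simp
    qed
    then have "pw_lipschitz w (0 + J * 6 ^ n) (D * 3 ^ n + A * 3 ^ n) (\<lambda>x. i n x + \<alpha> x)"
      by (rule pw_lipschitz_add[OF _ a(2)])
    then have r: "pw_lipschitz w (J * 6 ^ n) (2 * A * 3 ^ n) (\<lambda>x. i n x + \<alpha> x)"
      using A by (elim pw_lipschitz_mono) auto
    have pr: "periodic w (\<lambda>x. i n x + \<alpha> x)" using i(2)[of n] a(1) by (simp add: periodic_def)
    have br: "\<bar>i n x + \<alpha> x\<bar> \<le> 12 * u n" for x using i(1)[of n x] a(3)[of x] by (simp add: u_def)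
    have L2: "0 < 2 * A * 3 ^ n" using A by simp
    obtain t :: "real \<Rightarrow> int" where t: "periodic w t" "pw_lipschitz w (J * 6 ^ n + w * (2 * A * 3 ^ n) / u n + 2) 0 (\<lambda>x. real_of_int (t x))"
        "\<And>x. \<bar>i n x + \<alpha> x - u n * t x\<bar> \<le> 2 * u n" "\<And>x. \<bar>t x\<bar> \<le> 14"
      using rounding_step[OF w pr r L2 u(1) br] by blast
    have tJ: "pw_lipschitz w (2 * J * 6 ^ n) 0 (\<lambda>x. real_of_int (t x))"
    proof (rule pw_lipschitz_mono[OF t(2) _ order_refl])
      have "w * (2 * A * 3 ^ n) / u n = (2 * A * w / \<upsilon>) * (3 / lam) ^ n" by (simp add: u_def power_divide)
      also have "\<dots> \<le> (2 * A * w / \<upsilon>) * 6 ^ n"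
      proof (intro mult_left_mono power_mono)
        show "3 / lam \<le> 6" using lam by (simp add: pos_divide_le_eq)
      qed (use A w \<upsilon> in auto)
      finally have "w * (2 * A * 3 ^ n) / u n + 2 \<le> J * 6 ^ n" unfolding J_def distrib_right using p3(2) by linarith
      then show "J * 6 ^ n + w * (2 * A * 3 ^ n) / u n + 2 \<le> 2 * J * 6 ^ n" by simp
    qed
    have p\<rho>: "periodic w (\<rho> n \<alpha> t)" using pr t(1) by (simp add: periodic_def \<rho>_def)
    have b\<rho>: "\<bar>\<rho> n \<alpha> t x\<bar> \<le> 2 * u n" for x using t(3)[of x] by (simp add: \<rho>_def)
    have "pw_lipschitz w (J * 6 ^ n + 2 * J * 6 ^ n) (2 * A * 3 ^ n + \<bar>- u n\<bar> * 0) (\<lambda>x. i n x + \<alpha> x + - u n * real_of_int (t x))"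
      by (intro pw_lipschitz_add r pw_lipschitz_cmult tJ)
    then have l\<rho>: "pw_lipschitz w (3 * J * 6 ^ n) (2 * A * 3 ^ n) (\<rho> n \<alpha> t)" by (simp add: \<rho>_def[abs_def] mult.assoc)
    have J6: "2 \<le> J * 6 ^ n" using J p3(2) mult_mono[of 2 J 1 "6 ^ n"] by simp
    have A3: "0 \<le> A * 3 ^ n" using A by simp
    have "good 11 (Suc n) (\<lambda>x. \<rho> n \<alpha> t x + \<beta> x)"
    proof -
      have "pw_lipschitz w (3 * J * 6 ^ n + J * 6 ^ n) (2 * A * 3 ^ n + A * 3 ^ n) (\<lambda>x. \<rho> n \<alpha> t x + \<beta> x)"
        by (rule pw_lipschitz_add[OF l\<rho> b(2)])
      then have "pw_lipschitz w (J * 6 ^ Suc n) (A * 3 ^ Suc n) (\<lambda>x. \<rho> n \<alpha> t x + \<beta> x)"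
        using J6 A3 by (elim pw_lipschitz_mono) auto
      moreover have "\<bar>\<rho> n \<alpha> t x + \<beta> x\<bar> \<le> 11 * u (Suc n)" for x
        using b\<rho>[of x] b(3)[of x] us[of n] u(1)[of n] by linarith
      moreover have "periodic w (\<lambda>x. \<rho> n \<alpha> t x + \<beta> x)" using p\<rho> b(1) by (simp add: periodic_def)
      ultimately show ?thesis by (simp add: good_def)
    qed
    moreover have "good 5 (Suc n) \<gamma>"
    proof -
      have "pw_lipschitz w (J * 6 ^ Suc n) (A * 3 ^ Suc n) \<gamma>"
        using J6 A3 by (intro pw_lipschitz_mono[OF c(2)]) auto
      moreover have "\<bar>\<gamma> x\<bar> \<le> 5 * u (Suc n)" for x
        using c(3)[of x] us[of n] u(1)[of n] by linarith
      ultimately show ?thesis using c(1) by (simp add: good_def)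
    qed
    moreover have "good 3 (Suc n) (\<lambda>x. \<rho> n \<alpha> t (x - T (Suc n)))"
    proof -
      have "pw_lipschitz w (3 * J * 6 ^ n + 1) (2 * A * 3 ^ n) (\<lambda>x. \<rho> n \<alpha> t (x - T (Suc n)))"
        by (rule pw_lipschitz_shift[OF l\<rho> p\<rho> w])
      then have "pw_lipschitz w (J * 6 ^ Suc n) (A * 3 ^ Suc n) (\<lambda>x. \<rho> n \<alpha> t (x - T (Suc n)))"
        using J6 A3 by (elim pw_lipschitz_mono) auto
      moreover have "\<bar>\<rho> n \<alpha> t (x - T (Suc n))\<bar> \<le> 3 * u (Suc n)" for x
        using b\<rho>[of "x - T (Suc n)"] us[of n] u(1)[of n] by linarith
      ultimately show ?thesis using periodic_shift[OF p\<rho>] by (simp add: good_def)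
    qed
    ultimately have "inv (Suc n) (\<lambda>x. \<rho> n \<alpha> t x + \<beta> x, \<gamma>, \<lambda>x. \<rho> n \<alpha> t (x - T (Suc n)))" by (simp add: inv_def)
    moreover have "nxt n s (\<lambda>x. \<rho> n \<alpha> t x + \<beta> x, \<gamma>, \<lambda>x. \<rho> n \<alpha> t (x - T (Suc n)))"
      unfolding nxt_def abc using t(1,4) tJ by auto
    ultimately show "\<exists>s'. inv (Suc n) s' \<and> nxt n s s'" by blast
  qed
  then obtain f where f: "\<And>n. inv n (f n)" "\<And>n. nxt n (f n) (f (Suc n))" by blast
  define \<alpha> \<beta> \<gamma> where "\<alpha> n = fst (f n)" and "\<beta> n = fst (snd (f n))" and "\<gamma> n = snd (snd (f n))" for n
  have fn: "f n = (\<alpha> n, \<beta> n, \<gamma> n)" for n by (simp add: \<alpha>_def \<beta>_def \<gamma>_def)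
  have bd: "\<bar>\<alpha> n x\<bar> \<le> 11 * u n" "\<bar>\<beta> n x\<bar> \<le> 5 * u n" "\<bar>\<gamma> n x\<bar> \<le> 3 * u n" for n x
    using f(1)[of n] unfolding fn inv_def good_def by auto
  have z: "\<alpha> 0 x = 0" "\<beta> 0 x = 0" "\<gamma> 0 x = 0" for x
    using f(1)[of 0] unfolding fn inv_def by auto
  have "\<forall>n. \<exists>t::real \<Rightarrow> int. periodic w t \<and> pw_lipschitz w (2 * J * 6 ^ n) 0 (\<lambda>x. real_of_int (t x)) \<and> (\<forall>x. \<bar>t x\<bar> \<le> 14) \<and>
     \<alpha> (Suc n) = (\<lambda>x. \<rho> n (\<alpha> n) t x + \<beta> n x) \<and> \<beta> (Suc n) = \<gamma> n \<and> \<gamma> (Suc n) = (\<lambda>x. \<rho> n (\<alpha> n) t (x - T (Suc n)))"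
    using f(2) unfolding fn nxt_def by simp
  then have "\<exists>t. \<forall>n. periodic w (t n) \<and> pw_lipschitz w (2 * J * 6 ^ n) 0 (\<lambda>x. real_of_int (t n x)) \<and> (\<forall>x. \<bar>t n x\<bar> \<le> 14) \<and>
     \<alpha> (Suc n) = (\<lambda>x. \<rho> n (\<alpha> n) (t n) x + \<beta> n x) \<and> \<beta> (Suc n) = \<gamma> n \<and> \<gamma> (Suc n) = (\<lambda>x. \<rho> n (\<alpha> n) (t n) (x - T (Suc n)))"
    by (rule choice)
  then obtain t :: "nat \<Rightarrow> real \<Rightarrow> int" where t: "\<And>n. periodic w (t n)" "\<And>n. pw_lipschitz w (2 * J * 6 ^ n) 0 (\<lambda>x. real_of_int (t n x))"
     "\<And>n x. \<bar>t n x\<bar> \<le> 14" "\<And>n. \<alpha> (Suc n) = (\<lambda>x. \<rho> n (\<alpha> n) (t n) x + \<beta> n x)" "\<And>n. \<beta> (Suc n) = \<gamma> n"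
     "\<And>n. \<gamma> (Suc n) = (\<lambda>x. \<rho> n (\<alpha> n) (t n) (x - T (Suc n)))"
    by blast
  have inv: "\<phi> x - (\<Sum>m<n. u m * (t m x - t m (x - T m))) = (\<phi> x - P n x) + (\<alpha> n x - \<alpha> n (x - T n)) +
      (\<beta> n x - \<beta> n (x - T (n + 1))) + (\<gamma> n x - \<gamma> n (x - T (n + 2)))" for n x
  proof (induction n)
    case 0
    then show ?case by (simp add: P z)
  next
    case (Suc n)
    have "T (n + 3) + T (n + 1) = T n" unfolding T_def using lam_pow_add3[of n] by (simp flip: distrib_left)
    then have e: "x - T (Suc n + 2) - T (Suc n) = x - T n" by (simp add: eval_nat_numeral)
    have "\<phi> x - (\<Sum>m<Suc n. u m * (t m x - t m (x - T m))) = (\<phi> x - P n x) + (\<alpha> n x - \<alpha> n (x - T n)) +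
      (\<beta> n x - \<beta> n (x - T (n + 1))) + (\<gamma> n x - \<gamma> n (x - T (n + 2))) - u n * (t n x - t n (x - T n))"
      using Suc.IH by simp
    also have "\<dots> = (\<phi> x - P (Suc n) x) + (\<alpha> (Suc n) x - \<alpha> (Suc n) (x - T (Suc n))) +
      (\<beta> (Suc n) x - \<beta> (Suc n) (x - T (Suc n + 1))) + (\<gamma> (Suc n) x - \<gamma> (Suc n) (x - T (Suc n + 2)))"
    proof -
      have n: "Suc n + 1 = n + 2" "n + 1 = Suc n" by simp_all
      show ?thesis
        unfolding t(4-6) e P(2) \<rho>_def T_def[symmetric] n of_int_diff right_diff_distrib by linarith
    qed
    finally show ?case .
  qed
  \<comment> \<open>The approximation error 2 and twice the bounds 11, 5 and 3 add up to 40.\<close>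
  have "\<bar>\<phi> x - (\<Sum>m<n. u m * (t m x - t m (x - T m)))\<bar> \<le> 40 * u n" for n x
  proof -
    have 1: "\<bar>\<alpha> n x - \<alpha> n y\<bar> \<le> 22 * u n" for y using bd(1)[of n x] bd(1)[of n y] by linarith
    have 2: "\<bar>\<beta> n x - \<beta> n y\<bar> \<le> 10 * u n" for y using bd(2)[of n x] bd(2)[of n y] by linarith
    have 3: "\<bar>\<gamma> n x - \<gamma> n y\<bar> \<le> 6 * u n" for y using bd(3)[of n x] bd(3)[of n y] by linarith
    have 4: "\<bar>\<phi> x - P n x\<bar> \<le> 2 * u n" using P(3)[of x n] by (simp add: u_def mult.assoc)
    show ?thesis unfolding inv using 1[of "x - T n"] 2[of "x - T (n + 1)"] 3[of "x - T (n + 2)"] 4 by linarith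
  qed
  then have "\<bar>\<phi> x - (\<Sum>m<n. \<upsilon> * lam ^ m * (t m x - t m (x - \<tau> * lam ^ m)))\<bar> \<le> 40 * \<upsilon> * lam ^ n" for n x
    unfolding u_def T_def by (simp add: mult.assoc)
  then show thesis using t(1-3) J by (intro that[of t "2 * J"]) auto
qed

subsection \<open>Thin Lipschitz subgraphs\<close>

lemma lipschitz_isCont:
  fixes f :: "real \<Rightarrow> real"
  assumes "\<And>x y. \<bar>f x - f y\<bar> \<le> L * \<bar>x - y\<bar>" shows "isCont f x"
proof -
  have "0 \<le> L" using assms[of 0 1] by simp
  then have "L-lipschitz_on UNIV f" using assms by (intro lipschitz_onI) (auto simp: dist_real_def)
  then have "continuous_on UNIV f" by (rule lipschitz_on_continuous_on)
  then show ?thesis by (simp add: continuous_on_eq_continuous_at)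
qed

lemma antiderivative:
  fixes f :: "real \<Rightarrow> real"
  assumes "\<And>x. isCont f x" obtains F where "\<And>x. DERIV F x :> f x"
  using einterval_antiderivative[of "-\<infinity>" "\<infinity>" f] assms
  unfolding has_real_derivative_iff_has_vector_derivative by auto

text \<open>Subtraction of the mean c makes the antiderivative H periodic. Then \<Phi> is periodic
  up to an additive constant, and its central differences are periodic, which is all that the
  decomposition into differences asks for.\<close>

lemma periodic_antiderivatives:
  fixes f :: "real \<Rightarrow> real"
  assumes w: "0 < w" and f: "periodic w f" "\<And>x y. \<bar>f x - f y\<bar> \<le> L * \<bar>x - y\<bar>" "\<And>x. 0 \<le> f x" "\<And>x. f x \<le> \<eta>"
  obtains c H \<Phi> k where "0 \<le> c" "c \<le> \<eta>" "\<And>x. DERIV H x :> f x - c" "\<And>x. \<bar>H x\<bar> \<le> \<eta> * w"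
    "\<And>x. DERIV \<Phi> x :> H x" "\<And>x. \<Phi> (x + w) - \<Phi> x = k"
proof -
  obtain F where F: "\<And>x. DERIV F x :> f x" using antiderivative[of f] lipschitz_isCont[OF f(2)] by blast
  obtain z where z: "F w - F 0 = (w - 0) * f z" using MVT2[OF w, of F f] F by blast
  define c where "c = f z"
  define H where "H x = F x - c * x - F 0" for x
  have c: "0 \<le> c" "c \<le> \<eta>" using f(3,4)[of z] by (auto simp: c_def)
  have H: "DERIV H x :> f x - c" for x unfolding H_def by (auto intro!: derivative_eq_intros F)
  have shift: "DERIV (\<lambda>x. g (x + w) - g x) x :> g' (x + w) - g' x" if "\<And>x. DERIV g x :> g' x" for g g' :: "real \<Rightarrow> real" and x
    using DERIV_shift[of g "g' (x + w)" x w] that by (auto intro!: derivative_eq_intros)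
  have Hw: "H (x + w) - H x = 0" for x
  proof -
    have "DERIV (\<lambda>x. H (x + w) - H x) y :> 0" for y
      using shift[OF H, of y] f(1) by (simp add: periodic_def)
    then have "H (x + w) - H x = H (0 + w) - H 0" using DERIV_isconst_all[of "\<lambda>x. H (x + w) - H x" x 0] by blast
    also have "\<dots> = 0" using z by (simp add: H_def c_def mult.commute)
    finally show ?thesis .
  qed
  have bH: "\<bar>H x\<bar> \<le> \<eta> * w" for x
  proof -
    have b: "\<bar>f x - c\<bar> \<le> \<eta>" for x using f(3,4)[of x] c by linarith
    have "\<bar>H (wrap w x) - H 0\<bar> \<le> \<eta> * \<bar>wrap w x - 0\<bar>" by (rule mvt_lipschitz[OF H b])
    also have "\<dots> \<le> \<eta> * w" using wrap_range[OF w, of x] c by (intro mult_left_mono) auto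
    finally have "\<bar>H (wrap w x)\<bar> \<le> \<eta> * w" by (simp add: H_def)
    moreover have "H (wrap w x) = H x" using Hw by (intro periodic_wrap) (simp add: periodic_def)
    ultimately show ?thesis by simp
  qed
  obtain \<Phi> where \<Phi>: "\<And>x. DERIV \<Phi> x :> H x" using antiderivative[of H] DERIV_isCont[OF H] by blast
  have "\<Phi> (x + w) - \<Phi> x = \<Phi> (0 + w) - \<Phi> 0" for x
    using DERIV_isconst_all[of "\<lambda>x. \<Phi> (x + w) - \<Phi> x" x 0] shift[OF \<Phi>] by (simp add: Hw)
  then show thesis using c H bH \<Phi> by (intro that[of c H \<Phi> "\<Phi> (0 + w) - \<Phi> 0"]) auto
qed

lemma step_family_threshold:
  assumes "0 \<le> C" "\<And>n. pw_lipschitz w (C * 6 ^ n) 0 (\<lambda>x. real_of_int (t n x))"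
  shows "step_family w (\<lambda>n x. j \<le> t n x)"
  unfolding step_family_def
proof (intro exI conjI allI)
  fix n
  have "C * 6 ^ n \<le> C * 9 ^ n" using assms(1) by (intro mult_left_mono power_mono) auto
  moreover have "pw_lipschitz w (C * 6 ^ n + C * 6 ^ n) 0 (\<lambda>x. of_bool (j \<le> t n x))"
    by (rule pw_lipschitz_combine[OF assms(2) assms(2)]) auto
  ultimately show "pw_lipschitz w (2 * C * 9 ^ n) 0 (\<lambda>x. of_bool (j \<le> t n x))"
    by (elim pw_lipschitz_mono) auto
qed (use assms in auto)

lemma sum_of_bool_int: "0 \<le> k \<Longrightarrow> k \<le> int n \<Longrightarrow> (\<Sum>j=1..n. of_bool (int j \<le> k)) = real_of_int k"
proof (induction n)
  case (Suc n)
  show ?case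
  proof (cases "k \<le> int n")
    case True
    then show ?thesis using Suc by simp
  next
    case False
    then have "k = int (Suc n)" using Suc.prems by simp
    then show ?thesis by (simp add: sum.If_cases of_bool_def)
  qed
qed simp

text \<open>The integers t + 14 lie between 0 and 28, so they are the sum of the indicators of 28
  superlevel sets, and each of these is one layer for \<open>ceq_transport\<close>. In units of
  \<open>\<upsilon> * lam ^ n\<close> the offset 100, the error 40 and the at most 28 transported
  layers keep every intermediate height between 32 and 168; and 168 + 4 is at most 400, a tenth of
  the base 4000.\<close>

lemma slots_rounding:
  fixes t :: "nat \<Rightarrow> real \<Rightarrow> int" and e :: "nat \<Rightarrow> real \<Rightarrow> real"
  assumes w: "0 < w" and \<tau>: "0 \<le> \<tau>" "\<tau> \<le> w" and \<upsilon>: "0 < \<upsilon>"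
    and t: "\<And>n. periodic w (t n)" "\<And>n x. \<bar>t n x\<bar> \<le> 14" "0 \<le> C" "\<And>n. pw_lipschitz w (C * 6 ^ n) 0 (\<lambda>x. real_of_int (t n x))"
    and e: "\<And>n. periodic w (e n)" "pl_family w e" "\<And>n x. \<bar>e n x\<bar> \<le> 40 * (\<upsilon> * lam ^ n)"
       "\<And>n x. e (Suc n) x = e n x - \<upsilon> * lam ^ n * (t n x - t n (x - \<tau> * lam ^ n))"
    and K: "nice K" "{0..2 * w} \<times> {0..25000 * \<upsilon>} \<subseteq> K"
  shows "ceq K (ind (slots w (4000 * \<upsilon>) (\<lambda>n x. e n x + 100 * (\<upsilon> * lam ^ n))))
     (ind (slots w (4000 * \<upsilon>) (\<lambda>n x. e (Suc n) x + 100 * (\<upsilon> * lam ^ n))))"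
proof -
  define T where "T j n x \<longleftrightarrow> int j - 14 \<le> t n x" for j n x
  define S where "S j n x = (\<Sum>i=1..j. of_bool (T i n x) - of_bool (T i n (x - \<tau> * lam ^ n)) :: real)" for j n x
  define F where "F j n x = e n x + 100 * (\<upsilon> * lam ^ n) - \<upsilon> * lam ^ n * S j n x" for j n x
  have u: "0 < \<upsilon> * lam ^ n" for n using \<upsilon> by simp
  have T: "step_family w (T j)" "\<And>n. periodic w (T j n)" for j
    unfolding T_def using step_family_threshold[OF t(3,4)] t(1) by (auto simp: periodic_def)
  have per_s: "f (x + w - s) = f (x - s)" if "periodic w f" for f :: "real \<Rightarrow> 'a" and x s
    using periodic_shift[OF that, of s] by (simp add: periodic_def)
  have perF: "periodic w (F j n)" for j n
    using e(1)[of n] T(2) per_s[OF T(2)] by (simp add: periodic_def F_def S_def)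
  have F_Suc: "F (Suc j) n x = F j n x - \<upsilon> * lam ^ n * of_bool (T (Suc j) n x) + \<upsilon> * lam ^ n * of_bool (T (Suc j) n (x - \<tau> * lam ^ n))" for j n x
    by (simp add: F_def S_def algebra_simps)
  have S: "\<bar>S j n x\<bar> \<le> real j" for j n x
  proof -
    have "\<bar>S j n x\<bar> \<le> (\<Sum>i=1..j. \<bar>of_bool (T i n x) - of_bool (T i n (x - \<tau> * lam ^ n)) :: real\<bar>)" unfolding S_def by (rule sum_abs)
    also have "\<dots> \<le> (\<Sum>i=1..j. 1)" by (intro sum_mono) auto
    finally show ?thesis by simp
  qed
  have Fb: "32 * (\<upsilon> * lam ^ n) \<le> F j n x" "F j n x \<le> 168 * (\<upsilon> * lam ^ n)" if "j \<le> 28" for j n x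
  proof -
    have "\<bar>S j n x\<bar> \<le> 28" using S[of j n x] that by simp
    then have "\<bar>\<upsilon> * lam ^ n * S j n x\<bar> \<le> (\<upsilon> * lam ^ n) * 28"
      unfolding abs_mult[of "\<upsilon> * lam ^ n"] using u[of n] by (simp add: mult_left_mono)
    then show "32 * (\<upsilon> * lam ^ n) \<le> F j n x" "F j n x \<le> 168 * (\<upsilon> * lam ^ n)"
      using e(3)[of n x] unfolding F_def abs_le_iff by linarith+
  qed
  have plu: "pl_family w (\<lambda>n x. \<upsilon> * lam ^ n * of_bool (Q n x))" if "step_family w Q" for Q
    using \<upsilon> by (intro pl_family_scale[OF pl_family_of_bool[OF that], of _ \<upsilon>]) (auto simp: abs_mult intro!: mult_left_le)
  have plF: "pl_family w (F j)" for j
  proof (induction j)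
    case 0
    have "pl_family w (\<lambda>n x. e n x + 100 * \<upsilon> * lam ^ n)" using \<upsilon> by (intro pl_family_add e(2) pl_family_base) auto
    then show ?case by (simp add: F_def[abs_def] S_def mult.assoc)
  next
    case (Suc j)
    have "F (Suc j) = (\<lambda>n x. F j n x - \<upsilon> * lam ^ n * of_bool (T (Suc j) n x) + \<upsilon> * lam ^ n * of_bool (T (Suc j) n (x - \<tau> * lam ^ n)))"
      using F_Suc by blast
    moreover have "pl_family w \<dots>"
      by (intro pl_family_add pl_family_diff Suc plu T(1) step_family_shift[OF T w])
    ultimately show ?case by simp
  qed
  have "ceq K (ind (slots w (4000 * \<upsilon>) (F 0))) (ind (slots w (4000 * \<upsilon>) (F j)))" if "j \<le> 28" for j
    using that
  proof (induction j)
    case 0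
    have "nice (slots w (4000 * \<upsilon>) (F 0))"
      using Fb(2)[of 0] \<upsilon> by (intro nice_slots[OF plF w, where Y = "168 * \<upsilon>"]) (auto simp: mult.assoc)
    then show ?case by (intro ceq_eqf K eqf_ind)
  next
    case (Suc j)
    have j: "j \<le> 28" using Suc.prems by simp
    have "ceq K (ind (slots w (4000 * \<upsilon>) (F j))) (ind (slots w (4000 * \<upsilon>) (F (Suc j))))"
    proof (rule ceq_transport[OF w plF perF T(1)[of "Suc j"] T(2)[of "Suc j"] \<upsilon> _ _ _ _ \<tau> K(1) _ F_Suc, where M = "168 * \<upsilon>"])
      fix n x
      show "0 \<le> F j n x" "\<upsilon> * lam ^ n \<le> F j n x" "F j n x \<le> 168 * \<upsilon> * lam ^ n"
        using Fb[OF j, of n x] u[of n] by linarith+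
      have "{0..2 * w} \<times> {0..6 * (4000 * \<upsilon>)} \<subseteq> {0..2 * w} \<times> {0..25000 * \<upsilon>}" using \<upsilon> by (intro box_mono) auto
      then show "{0..2 * w} \<times> {0..6 * (4000 * \<upsilon>)} \<subseteq> K" using K(2) by blast
    qed (use \<upsilon> in auto)
    with Suc.IH[OF j] show ?case by (rule ceq_trans)
  qed
  from this[of 28] have "ceq K (ind (slots w (4000 * \<upsilon>) (F 0))) (ind (slots w (4000 * \<upsilon>) (F 28)))" by simp
  moreover have "F 0 = (\<lambda>n x. e n x + 100 * (\<upsilon> * lam ^ n))" by (simp add: F_def[abs_def] S_def)
  moreover have "F 28 = (\<lambda>n x. e (Suc n) x + 100 * (\<upsilon> * lam ^ n))"
  proof (intro ext)
    fix n x
    have "(\<Sum>i=1..28. of_bool (T i n y)) = real_of_int (t n y + 14)" for y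
    proof -
      have "(\<Sum>i=1..28. of_bool (int i \<le> t n y + 14)) = real_of_int (t n y + 14)"
        using t(2)[of n y] by (intro sum_of_bool_int) auto
      moreover have "T i n y \<longleftrightarrow> int i \<le> t n y + 14" for i by (auto simp: T_def)
      ultimately show ?thesis by simp
    qed
    then have "S 28 n x = t n x - t n (x - \<tau> * lam ^ n)" unfolding S_def sum_subtractf by simp
    then show "F 28 n x = e (Suc n) x + 100 * (\<upsilon> * lam ^ n)" unfolding F_def e(4) by simp
  qed
  ultimately show ?thesis by simp
qed

text \<open>Every slot is cut 100 (1 - \<open>lam\<close>) units above its base. The lower part is a
  rectangle; the upper part has mean thickness 100 \<open>lam\<close> units when f has mean zero,
  the offset of the next slot, and is lowered to the next base. The ratio of the bases is 4000
  \<open>lam\<close> / (4000 + 100 (1 - \<open>lam\<close>)), about 0.677 and in the range of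
  \<open>ceq_vertical\<close>.\<close>

lemma slots_move:
  fixes f :: "nat \<Rightarrow> real \<Rightarrow> real"
  assumes w: "0 < w" and \<upsilon>: "0 < \<upsilon>" and f: "pl_family w f" "\<And>n x. \<bar>f n x\<bar> \<le> 40 * (\<upsilon> * lam ^ Suc n)"
    and K: "nice K" "{0..2 * w} \<times> {0..25000 * \<upsilon>} \<subseteq> K"
  shows "ceq K (ind (slots w (4000 * \<upsilon>) (\<lambda>n x. f n x + 100 * (\<upsilon> * lam ^ n))))
     (ind (slots w (4000 * \<upsilon>) (\<lambda>n x. 100 * ((1 - lam) * (\<upsilon> * lam ^ n)))) +
      ind (\<Union>n. strip w (\<lambda>_. 4000 * \<upsilon> * lam ^ Suc n) (\<lambda>x. 4000 * \<upsilon> * lam ^ Suc n + (f n x + 100 * (\<upsilon> * lam ^ Suc n)))))"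
proof -
  define m where "m = (1 - lam) * \<upsilon>"
  define b where "b = 4000 * \<upsilon> + 100 * m"
  have lv: "0.317 * \<upsilon> \<le> m" "m \<le> 0.318 * \<upsilon>" unfolding m_def using lam \<upsilon> by (intro mult_right_mono; simp)+
  have b: "0 < b" "6 * b \<le> 25000 * \<upsilon>" using \<upsilon> lv by (auto simp: b_def)
  define \<rho> where "\<rho> = 1 - 4100 * m / b"
  have \<rho>b: "(\<rho> - 1) * b = - (4100 * m)" using b by (simp add: \<rho>_def)
  have "4100 * m / b \<le> 0.36" "0.2775 \<le> 4100 * m / b"
    using lv b(1) \<upsilon> unfolding pos_divide_le_eq[OF b(1)] pos_le_divide_eq[OF b(1)] by (simp_all add: b_def)
  then have \<rho>: "0.64 \<le> \<rho>" "\<rho> \<le> 0.7225" by (simp_all add: \<rho>_def)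
  have u: "0 < \<upsilon> * lam ^ n" for n using \<upsilon> by simp
  have us: "\<upsilon> * lam ^ Suc n \<le> 0.683 * (\<upsilon> * lam ^ n)" "\<upsilon> * lam ^ Suc n = lam * (\<upsilon> * lam ^ n)" for n
  proof -
    show 1: "\<upsilon> * lam ^ Suc n = lam * (\<upsilon> * lam ^ n)" by simp
    show "\<upsilon> * lam ^ Suc n \<le> 0.683 * (\<upsilon> * lam ^ n)" unfolding 1 using lam u[of n] by (intro mult_right_mono) auto
  qed
  let ?G = "\<lambda>n x. 100 * ((1 - lam) * (\<upsilon> * lam ^ n))" and ?F = "\<lambda>n x. f n x + 100 * (\<upsilon> * lam ^ n)"
  define U where "U n = strip w (\<lambda>x. 4000 * \<upsilon> * lam ^ n + ?G n x) (\<lambda>x. 4000 * \<upsilon> * lam ^ n + ?F n x)" for n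
  have "ind (slots w (4000 * \<upsilon>) ?F) = ind (slots w (4000 * \<upsilon>) ?G) + ind (\<Union>n. U n)"
    unfolding U_def
  proof (rule ind_slots_split)
    fix n x
    have "(1 - lam) * (\<upsilon> * lam ^ n) = \<upsilon> * lam ^ n - \<upsilon> * lam ^ Suc n" by (simp add: algebra_simps)
    moreover have "0 \<le> (1 - lam) * (\<upsilon> * lam ^ n)" using \<upsilon> lam by simp
    ultimately show "0 \<le> ?G n x \<and> ?G n x \<le> ?F n x \<and> ?F n x \<le> 0.1 * (4000 * \<upsilon>) * lam ^ n"
      using f(2)[of n x] us(1)[of n] u[of n] u[of "Suc n"] unfolding abs_le_iff by simp
  qed (use \<upsilon> in simp)
  moreover have "ceq K (ind (\<Union>n. U n)) (ind (\<Union>n. (+) (lam ^ n *\<^sub>R (0, (\<rho> - 1) * b)) ` U n))"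
  proof (rule ceq_vertical[OF _ _ b(1) \<rho> K(1)])
    have G: "pl_family w (\<lambda>n x. 4000 * \<upsilon> * lam ^ n + ?G n x)"
    proof -
      have "pl_family w (\<lambda>n x. (4000 * \<upsilon>) * lam ^ n + (100 * m) * lam ^ n)"
        using lv \<upsilon> by (intro pl_family_add pl_family_base) auto
      then show ?thesis by (simp add: mult.assoc m_def)
    qed
    have F: "pl_family w (\<lambda>n x. 4000 * \<upsilon> * lam ^ n + ?F n x)"
    proof -
      have "pl_family w (\<lambda>n x. (4000 * \<upsilon>) * lam ^ n + (f n x + (100 * \<upsilon>) * lam ^ n))"
        using \<upsilon> by (intro pl_family_add pl_family_base f) auto
      then show ?thesis by (simp add: mult.assoc)
    qed
    show "tame_family U" unfolding U_def using \<upsilon> by (intro tame_family_strip G F w) auto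
    have "{0..w} \<times> {0..6 * b} \<subseteq> {0..2 * w} \<times> {0..25000 * \<upsilon>}" using b w by (intro box_mono) auto
    then show "{0..w} \<times> {0..6 * b} \<subseteq> K" using K(2) by blast
    fix n
    have bl: "b * lam ^ n = 4000 * \<upsilon> * lam ^ n + ?G n 0" by (simp add: b_def m_def algebra_simps)
    show "U n \<subseteq> {0..w} \<times> {b * lam ^ n..(1.04 * b) * lam ^ n}"
    proof clarify
      fix x y assume "(x, y) \<in> U n"
      then have xy: "0 \<le> x" "x < w" "b * lam ^ n < y" "y \<le> 4000 * \<upsilon> * lam ^ n + ?F n x"
        unfolding bl by (auto simp: U_def strip_def)
      have "?F n x - ?G n 0 \<le> 140 * (\<upsilon> * lam ^ Suc n)"
        using f(2)[of n x] unfolding abs_le_iff by (simp add: algebra_simps)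
      then have "y \<le> b * lam ^ n + 160 * (\<upsilon> * lam ^ n)" using xy(4) bl us(1)[of n] u[of n] by simp
      also have "160 * (\<upsilon> * lam ^ n) \<le> 0.04 * (b * lam ^ n)"
      proof -
        have "0 \<le> ?G n 0" using u[of n] by simp
        then show ?thesis unfolding bl by simp
      qed
      finally show "x \<in> {0..w} \<and> y \<in> {b * lam ^ n..(1.04 * b) * lam ^ n}" using xy by simp
    qed
  qed
  moreover have "(+) (lam ^ n *\<^sub>R (0, (\<rho> - 1) * b)) ` U n =
     strip w (\<lambda>_. 4000 * \<upsilon> * lam ^ Suc n) (\<lambda>x. 4000 * \<upsilon> * lam ^ Suc n + (f n x + 100 * (\<upsilon> * lam ^ Suc n)))" for n
    unfolding translation_vimage \<rho>b U_def m_def by (auto simp: strip_def algebra_simps)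
  ultimately have 1: "ceq K (ind (\<Union>n. U n)) (ind (\<Union>n. strip w (\<lambda>_. 4000 * \<upsilon> * lam ^ Suc n) (\<lambda>x. 4000 * \<upsilon> * lam ^ Suc n + (f n x + 100 * (\<upsilon> * lam ^ Suc n)))))"
    and 2: "ind (slots w (4000 * \<upsilon>) ?F) = ind (slots w (4000 * \<upsilon>) ?G) + ind (\<Union>n. U n)" by simp_all
  have nG: "nice (slots w (4000 * \<upsilon>) ?G)"
  proof (rule nice_slots[OF _ w, where Y = "100 * ((1 - lam) * \<upsilon>)"])
    have "pl_family w (\<lambda>n x. (100 * m) * lam ^ n)" using lv \<upsilon> by (intro pl_family_base) auto
    then show "pl_family w ?G" by (simp add: mult.assoc m_def)
  qed (use \<upsilon> in auto)
  show ?thesis unfolding 2 using ceq_add_eqf[OF 1 eqf_ind[OF nG]] by (simp only: add.commute)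
qed

lemma pl_family_Suc:
  assumes "pl_family w F" shows "pl_family w (\<lambda>n. F (Suc n))"
proof -
  obtain C where C: "0 \<le> C" "\<And>k. pw_lipschitz w (C * 9 ^ k) C (F k)" "\<And>k x. x \<in> {0..<w} \<Longrightarrow> \<bar>F k x\<bar> \<le> C"
    using assms unfolding pl_family_def by blast
  have "pw_lipschitz w ((9 * C) * 9 ^ k) (9 * C) (F (Suc k))" for k
    using C(1) by (intro pw_lipschitz_mono[OF C(2)]) auto
  moreover have "\<bar>F (Suc k) x\<bar> \<le> 9 * C" if "x \<in> {0..<w}" for k x
    using C(3)[OF that, of "Suc k"] C(1) by linarith
  ultimately show ?thesis unfolding pl_family_def using C(1) by (intro exI[of _ "9 * C"]) auto
qed

lemma ind_slots_first:
  assumes b: "0 < b" and F: "\<And>k x. 0 \<le> x \<Longrightarrow> x < w \<Longrightarrow> F k x \<le> 0.1 * b * lam ^ k"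
  shows "ind (slots w b F) = ind (strip w (\<lambda>_. b) (\<lambda>x. b + F 0 x)) + ind (slots w (b * lam) (\<lambda>n. F (Suc n)))"
proof -
  define S where "S k = strip w (\<lambda>_. b * lam ^ k) (\<lambda>x. b * lam ^ k + F k x)" for k
  have "(\<Union>k. S k) = S 0 \<union> (\<Union>k. S (Suc k))"
    by (metis UN_Un_distrib UN_insert UNIV_nat_eq image_image)
  moreover have "S 0 \<inter> (\<Union>k. S (Suc k)) = {}"
  proof -
    have False if z: "z \<in> S 0" "z \<in> S (Suc l)" for z l
    proof -
      have x: "0 \<le> fst z" "fst z < w" using z by (auto simp: S_def strip_def)
      have "b * lam ^ k \<le> snd z \<and> snd z \<le> (1.1 * b) * lam ^ k" if "z \<in> S k" for k
        using that F[OF x, of k] by (auto simp: S_def strip_def algebra_simps)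
      then have "0 = Suc l" using z b by (meson zone_unique)
      then show False by simp
    qed
    then show ?thesis by blast
  qed
  ultimately have "ind (\<Union>k. S k) = ind (S 0) + ind (\<Union>k. S (Suc k))" by (simp add: ind_Un)
  then show ?thesis by (simp add: S_def slots_def mult.assoc)
qed

text \<open>Three further copies of K are present. In \<open>profile\<close> they absorb the two
  leftovers R e and R z and the common rectangle A.\<close>

definition ceq2 :: "('a::real_normed_vector) set \<Rightarrow> ('a \<Rightarrow> nat) \<Rightarrow> ('a \<Rightarrow> nat) \<Rightarrow> bool" where
  "ceq2 K F G \<longleftrightarrow> ceq K (F + (ind K + ind K + ind K)) (G + (ind K + ind K + ind K))"

lemma ceq_cat:
  assumes "ceq K (F + ind M) (G + ind M)" "M \<subseteq> K" "nice M" "nice K"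
  shows "ceq K (F + ind K) (G + ind K)"
  using eqf_cat[of "F + (ind K + ind K + ind K)" M "G + (ind K + ind K + ind K)" K] assms
  unfolding ceq_def by (simp add: add_ac)

text \<open>A level subtracts integer step functions, so it adds jumps at rate 6^n but leaves the
  Lipschitz constant between the jumps as it was.\<close>

lemma rounding_errors_pl_family:
  fixes t :: "nat \<Rightarrow> real \<Rightarrow> int" and e :: "nat \<Rightarrow> real \<Rightarrow> real" and u s :: "nat \<Rightarrow> real"
  assumes w: "0 < w" and t: "\<And>n. periodic w (t n)" "0 \<le> C" "\<And>n. pw_lipschitz w (C * 6 ^ n) 0 (\<lambda>x. real_of_int (t n x))"
    and e: "\<And>x y. \<bar>e 0 x - e 0 y\<bar> \<le> L * \<bar>x - y\<bar>" "\<And>n x. \<bar>e n x\<bar> \<le> B"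
       "\<And>n x. e (Suc n) x = e n x - u n * (t n x - t n (x - s n))"
  shows "pl_family w e"
proof -
  have L: "0 \<le> L" using e(1)[of 0 1] by simp
  have B: "0 \<le> B" using e(2)[of 0 0] by linarith
  have pw: "pw_lipschitz w ((2 * C + 1) * 6 ^ n) L (e n)" for n
  proof (induction n)
    case 0
    have "pw_lipschitz w 0 L (e 0)" using e(1) by (intro pw_lipschitzI) (metis abs_minus_commute abs_of_nonneg diff_ge_0_iff_ge)
    then show ?case using t(2) by (elim pw_lipschitz_mono) auto
  next
    case (Suc n)
    have pt: "periodic w (\<lambda>x. real_of_int (t n x))" using t(1) by (simp add: periodic_def)
    have "pw_lipschitz w ((2 * C + 1) * 6 ^ n + C * 6 ^ n + (C * 6 ^ n + 1)) (L + \<bar>- u n\<bar> * 0 + \<bar>u n\<bar> * 0)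
      (\<lambda>x. e n x + - u n * real_of_int (t n x) + u n * real_of_int (t n (x - s n)))"
      by (intro pw_lipschitz_add pw_lipschitz_cmult Suc t(3) pw_lipschitz_shift[OF t(3) pt w])
    moreover have "(\<lambda>x. e n x + - u n * real_of_int (t n x) + u n * real_of_int (t n (x - s n))) = e (Suc n)"
      by (rule ext) (simp add: e(3) algebra_simps)
    moreover have "(2 * C + 1) * 6 ^ n + C * 6 ^ n + (C * 6 ^ n + 1) \<le> (2 * C + 1) * 6 ^ Suc n"
    proof -
      have "0 \<le> C * 6 ^ n" "(1::real) \<le> 6 ^ n" using t(2) by auto
      moreover have "(2 * C + 1) * 6 ^ Suc n = 12 * (C * 6 ^ n) + 6 * 6 ^ n"
        "(2 * C + 1) * 6 ^ n = 2 * (C * 6 ^ n) + 6 ^ n" by (simp_all add: algebra_simps)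
      ultimately show ?thesis by linarith
    qed
    ultimately show ?case by (auto elim: pw_lipschitz_mono)
  qed
  define D where "D = 2 * C + 1 + L + B"
  have D: "0 \<le> D" "2 * C + 1 \<le> D" "L \<le> D" "B \<le> D" using t(2) L B by (auto simp: D_def)
  have "pw_lipschitz w (D * 9 ^ n) D (e n)" for n
  proof (rule pw_lipschitz_mono[OF pw _ D(3)])
    show "(2 * C + 1) * 6 ^ n \<le> D * 9 ^ n" using D t(2) by (intro mult_mono power_mono) auto
  qed
  moreover have "\<bar>e n x\<bar> \<le> D" for n x using e(2)[of n x] D(4) by linarith
  ultimately show ?thesis unfolding pl_family_def using D(1) by (intro exI[of _ D]) auto
qed

lemma nice_strip:
  assumes w: "0 < w" and f: "\<And>x y. \<bar>f x - f y\<bar> \<le> L * \<bar>x - y\<bar>" and g: "\<And>x y. \<bar>g x - g y\<bar> \<le> L * \<bar>x - y\<bar>"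
  shows "nice (strip w f g)"
proof -
  have L: "0 \<le> L" using f[of 0 1] by simp
  have bound: "\<bar>h x\<bar> \<le> \<bar>h 0\<bar> + L * w" if h: "\<And>x y. \<bar>h x - h y\<bar> \<le> L * \<bar>x - y\<bar>" and x: "0 \<le> x" "x < w" for h :: "real \<Rightarrow> real" and x
  proof -
    have "\<bar>h x - h 0\<bar> \<le> L * \<bar>x - 0\<bar>" by (rule h)
    also have "\<dots> \<le> L * w" using x L by (intro mult_left_mono) auto
    finally show ?thesis by linarith
  qed
  have pl: "pl_family w (\<lambda>n. h)" if h: "\<And>x y. \<bar>h x - h y\<bar> \<le> L * \<bar>x - y\<bar>" for h :: "real \<Rightarrow> real"
  proof -
    define B where "B = \<bar>h 0\<bar> + L * w + L"
    have "0 \<le> L * w" using L w by simp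
    then have B: "0 \<le> B" "L \<le> B" using L by (auto simp: B_def)
    have pw: "pw_lipschitz w 0 L h"
      using h by (intro pw_lipschitzI) (metis abs_minus_commute abs_of_nonneg diff_ge_0_iff_ge)
    have "pw_lipschitz w (B * 9 ^ k) B h" for k
      using L B by (intro pw_lipschitz_mono[OF pw]) auto
    moreover have "\<bar>h x\<bar> \<le> B" if "x \<in> {0..<w}" for x using bound[OF h, of x] that L by (auto simp: B_def)
    ultimately show ?thesis unfolding pl_family_def using B by (intro exI[of _ B]) auto
  qed
  \<comment> \<open>Raised by m, the strip has a nonnegative lower boundary, as
    \<open>tame_family_strip\<close> requires; the translation is undone afterwards.\<close>
  define m where "m = \<bar>f 0\<bar> + L * w"
  have "tame_family (\<lambda>n::nat. strip w (\<lambda>x. f x + m) (\<lambda>x. g x + m))"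
  proof (rule tame_family_strip[OF _ _ w])
    show "pl_family w (\<lambda>n x. f x + m)" "pl_family w (\<lambda>n x. g x + m)" using f g by (intro pl; simp)+
    show "0 \<le> f x + m" if "0 \<le> x" "x < w" for x
      using bound[OF f that] unfolding m_def by linarith
  qed
  then have "nice (strip w (\<lambda>x. f x + m) (\<lambda>x. g x + m))" unfolding tame_family_def using tame_nice by blast
  then have "nice ((+) (0, - m) ` strip w (\<lambda>x. f x + m) (\<lambda>x. g x + m))" by (rule nice_translation)
  also have "(+) (0, - m) ` strip w (\<lambda>x. f x + m) (\<lambda>x. g x + m) = strip w f g"
    unfolding translation_vimage by (auto simp: strip_def)
  finally show ?thesis .
qed

text \<open>Write S for the first slot and R for the later ones. Rounding followed by the shift of
  scales turns S e + R e into rectangles Lo plus R e again, since the errors after level n are those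
  before level n + 1. The zero profile gives S z + R z and Lo + R z in the same way. So S e and S z
  are exchangeable in the presence of R e and R z, and they differ only in their tops. The threshold
  \<eta> is fixed before l, so that it serves all layers of a Lipschitz function.\<close>

lemma profile:
  assumes w: "0 < w" and Y: "0 < Y" and L: "0 \<le> L"
  obtains \<eta> where "0 < \<eta>"
    "\<And>l K. periodic w l \<Longrightarrow> (\<And>x y. \<bar>l x - l y\<bar> \<le> L * \<bar>x - y\<bar>) \<Longrightarrow> (\<And>x. 0 \<le> l x) \<Longrightarrow> (\<And>x. l x \<le> \<eta>) \<Longrightarrow>
      nice K \<Longrightarrow> {0..2 * w} \<times> {0..Y} \<subseteq> K \<Longrightarrow>
      \<exists>c. 0 \<le> c \<and> c \<le> \<eta> \<and> ceq2 K (ind (strip w (\<lambda>_. 0) l)) (ind (strip w (\<lambda>_. 0) (\<lambda>_. c)))"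
proof -
  \<comment> \<open>The catalyst has to reach the height 25000 \<upsilon> of the slot constructions.
    The choices of \<tau> and \<eta> give the three smallness conditions of
    \<open>difference_decomposition\<close>.\<close>
  define \<upsilon> where "\<upsilon> = Y / 25000"
  define \<tau> where "\<tau> = min w (\<upsilon> / (2 * L + 1))"
  define \<eta> where "\<eta> = min (\<upsilon> * \<tau> / w) \<upsilon>"
  have \<upsilon>: "0 < \<upsilon>" using Y by (simp add: \<upsilon>_def)
  have \<tau>: "0 < \<tau>" "\<tau> \<le> w" using w \<upsilon> L by (auto simp: \<tau>_def)
  have \<eta>: "0 < \<eta>" "\<eta> \<le> \<upsilon>" using w \<upsilon> \<tau> by (auto simp: \<eta>_def)
  have "\<tau> \<le> \<upsilon> / (2 * L + 1)" by (simp add: \<tau>_def)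
  then have "\<tau> * (2 * L + 1) \<le> \<upsilon>" using L by (simp add: pos_le_divide_eq)
  then have L\<tau>: "2 * (L * \<tau>) \<le> \<upsilon>" using \<tau>(1) by (simp add: algebra_simps)
  have "\<eta> \<le> \<upsilon> * \<tau> / w" by (simp add: \<eta>_def)
  then have \<eta>w: "\<eta> * w \<le> \<upsilon> * \<tau>" using w by (simp add: pos_le_divide_eq)
  have u: "0 < \<upsilon> * lam ^ n" for n using \<upsilon> by simp
  have "\<exists>c. 0 \<le> c \<and> c \<le> \<eta> \<and> ceq2 K (ind (strip w (\<lambda>_. 0) l)) (ind (strip w (\<lambda>_. 0) (\<lambda>_. c)))"
    if l: "periodic w l" "\<And>x y. \<bar>l x - l y\<bar> \<le> L * \<bar>x - y\<bar>" "\<And>x. 0 \<le> l x" "\<And>x. l x \<le> \<eta>"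
      and K: "nice K" "{0..2 * w} \<times> {0..Y} \<subseteq> K" for l K
  proof -
    obtain c H \<Phi> q where c: "0 \<le> c" "c \<le> \<eta>" and H: "\<And>x. DERIV H x :> l x - c" "\<And>x. \<bar>H x\<bar> \<le> \<eta> * w"
      and \<Phi>: "\<And>x. DERIV \<Phi> x :> H x" "\<And>x. \<Phi> (x + w) - \<Phi> x = q"
      by (rule periodic_antiderivatives[OF w l]) (rule that)
    have \<phi>: "\<bar>(l x - c) - (l y - c)\<bar> \<le> L * \<bar>x - y\<bar>" "\<bar>l x - c\<bar> \<le> \<eta>" for x y
      using l(2)[of x y] l(3,4)[of x] c by auto
    have \<eta>2: "\<eta> \<le> 2 * \<upsilon>" using \<eta> \<upsilon> by linarith
    obtain i P D where iP: "\<And>x. P 0 x = 0" "\<And>n x. P (Suc n) x = P n x + (i n x - i n (x - \<tau> * lam ^ n))"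
      "\<And>n x. \<bar>(l x - c) - P n x\<bar> \<le> 2 * \<upsilon> * lam ^ n" "\<And>n x. \<bar>i n x\<bar> \<le> \<upsilon> * lam ^ n"
      "\<And>n. periodic w (i n)" "\<And>n x y. \<bar>i n x - i n y\<bar> \<le> D * 3 ^ n * \<bar>x - y\<bar>"
      by (rule difference_decomposition[OF w \<tau>(1) \<Phi>(1) H(1) \<Phi>(2) \<phi> H(2) L\<tau> \<eta>w \<eta>2]) (rule that)
    obtain t :: "nat \<Rightarrow> real \<Rightarrow> int" and C where t: "\<And>n. periodic w (t n)" "\<And>n x. \<bar>t n x\<bar> \<le> 14" "0 \<le> C"
        "\<And>n. pw_lipschitz w (C * 6 ^ n) 0 (\<lambda>x. real_of_int (t n x))"
      and t40: "\<And>n x. \<bar>(l x - c) - (\<Sum>m<n. \<upsilon> * lam ^ m * (t m x - t m (x - \<tau> * lam ^ m)))\<bar> \<le> 40 * \<upsilon> * lam ^ n"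
      by (rule integer_rounding[where P = P and i = i and \<phi> = "\<lambda>x. l x - c", OF w \<upsilon> iP]) (rule that)
    define e where "e n x = (l x - c) - (\<Sum>m<n. \<upsilon> * lam ^ m * (t m x - t m (x - \<tau> * lam ^ m)))" for n x
    have e0: "e 0 x = l x - c" for x by (simp add: e_def)
    have eS: "e (Suc n) x = e n x - \<upsilon> * lam ^ n * (t n x - t n (x - \<tau> * lam ^ n))" for n x by (simp add: e_def)
    have eb: "\<bar>e n x\<bar> \<le> 40 * (\<upsilon> * lam ^ n)" for n x using t40[of x n] by (simp add: e_def mult.assoc)
    have eb': "\<bar>e n x\<bar> \<le> 40 * \<upsilon>" for n x
    proof -
      have "\<upsilon> * lam ^ n \<le> \<upsilon>" using \<upsilon> by (simp add: mult_left_le)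
      then show ?thesis using eb[of n x] by linarith
    qed
    have eper: "periodic w (e n)" for n
    proof -
      have "t m (x + w - s) = t m (x - s)" for m x s using periodic_shift[OF t(1), of m s] by (simp add: periodic_def)
      then show ?thesis using l(1) t(1) by (simp add: e_def periodic_def)
    qed
    have epl: "pl_family w e"
      by (rule rounding_errors_pl_family[OF w t(1,3,4) _ eb' eS]) (use l(2) e0 in simp)
    have K': "{0..2 * w} \<times> {0..25000 * \<upsilon>} \<subseteq> K" using K(2) by (simp add: \<upsilon>_def)
    define Lo where "Lo = slots w (4000 * \<upsilon>) (\<lambda>n x. 100 * ((1 - lam) * (\<upsilon> * lam ^ n)))"
    define R where "R f = slots w (4000 * \<upsilon> * lam) (\<lambda>n x. f (Suc n) x + 100 * (\<upsilon> * lam ^ Suc n))" for f :: "nat \<Rightarrow> real \<Rightarrow> real"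
    define S where "S f = strip w (\<lambda>_. 4000 * \<upsilon>) (\<lambda>x. 4000 * \<upsilon> + (f 0 x + 100 * \<upsilon>))" for f :: "nat \<Rightarrow> real \<Rightarrow> real"
    have SR: "ind (slots w (4000 * \<upsilon>) (\<lambda>n x. f n x + 100 * (\<upsilon> * lam ^ n))) = ind (S f) + ind (R f)"
      if "\<And>n x. \<bar>f n x\<bar> \<le> 40 * (\<upsilon> * lam ^ n)" for f
    proof -
      have "f k x + 100 * (\<upsilon> * lam ^ k) \<le> 0.1 * (4000 * \<upsilon>) * lam ^ k" for k x
        using that[of k x] u[of k] unfolding abs_le_iff by simp
      then show ?thesis using ind_slots_first[of "4000 * \<upsilon>" w "\<lambda>n x. f n x + 100 * (\<upsilon> * lam ^ n)"] \<upsilon>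
        by (simp add: S_def R_def)
    qed
    have move: "ceq K (ind (slots w (4000 * \<upsilon>) (\<lambda>n x. f (Suc n) x + 100 * (\<upsilon> * lam ^ n)))) (ind Lo + ind (R f))"
      if "pl_family w f" "\<And>n x. \<bar>f n x\<bar> \<le> 40 * (\<upsilon> * lam ^ n)" for f
      using slots_move[OF w \<upsilon> pl_family_Suc[OF that(1)] that(2) K(1) K'] unfolding Lo_def R_def slots_def
      by (simp add: mult.assoc)
    have pl100: "pl_family w (\<lambda>n x. 100 * (\<upsilon> * lam ^ n))"
      using pl_family_base[of "100 * \<upsilon>" w] \<upsilon> by (simp add: mult.assoc)
    have nR: "nice (R f)" "R f \<subseteq> K" if f: "pl_family w f" "\<And>n x. \<bar>f n x\<bar> \<le> 40 * (\<upsilon> * lam ^ n)" for f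
    proof -
      have Rb: "f (Suc n) x + 100 * (\<upsilon> * lam ^ Suc n) \<le> 140 * \<upsilon> * lam ^ n" for n x
      proof -
        have "\<upsilon> * lam ^ Suc n \<le> \<upsilon> * lam ^ n" using \<upsilon> by (intro mult_left_mono power_decreasing) auto
        then show ?thesis using f(2)[of "Suc n" x] unfolding abs_le_iff by linarith
      qed
      show "nice (R f)" unfolding R_def
        using Rb \<upsilon> by (intro nice_slots[where Y = "140 * \<upsilon>"] pl_family_Suc[of w "\<lambda>n x. f n x + 100 * (\<upsilon> * lam ^ n)"] pl_family_add f(1) pl100 w) auto
      have "R f \<subseteq> {0..2 * w} \<times> {0..25000 * \<upsilon>}"
      proof clarify
        fix x y assume "(x, y) \<in> R f"
        then obtain n where n: "0 \<le> x" "x < w" "4000 * \<upsilon> * lam * lam ^ n < y"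
          "y \<le> 4000 * \<upsilon> * lam * lam ^ n + (f (Suc n) x + 100 * (\<upsilon> * lam ^ Suc n))"
          by (auto simp: R_def slots_def strip_def)
        have "lam * lam ^ n \<le> 1" by (intro mult_le_one) auto
        then have "4000 * \<upsilon> * (lam * lam ^ n) \<le> 4000 * \<upsilon>" "140 * \<upsilon> * lam ^ n \<le> 140 * \<upsilon>"
          using \<upsilon> by (intro mult_left_le; simp)+
        moreover have "0 \<le> 4000 * \<upsilon> * lam * lam ^ n" using \<upsilon> by simp
        ultimately have "0 \<le> y" "y \<le> 25000 * \<upsilon>" using n Rb[of n x] \<upsilon> by (simp_all only: mult.assoc)
        then show "x \<in> {0..2 * w} \<and> y \<in> {0..25000 * \<upsilon>}" using n w by simp
      qed
      then show "R f \<subseteq> K" using K' by blast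
    qed
    have nLo: "nice Lo"
    proof -
      have "0 \<le> 100 * ((1 - lam) * \<upsilon>)" using \<upsilon> by simp
      then have "pl_family w (\<lambda>n x. 100 * ((1 - lam) * \<upsilon>) * lam ^ n)" by (rule pl_family_base)
      then show ?thesis unfolding Lo_def using \<upsilon> w by (intro nice_slots[where Y = "100 * ((1 - lam) * \<upsilon>)"]) (auto simp: mult.assoc)
    qed
    \<comment> \<open>The reference run: with zero errors there is nothing to round, and the shift
      of scales alone relates its slots to the same rectangles Lo.\<close>
    define z where "z = (\<lambda>(n::nat) (x::real). 0::real)"
    have z: "pl_family w z" "\<And>n x. \<bar>z n x\<bar> \<le> 40 * (\<upsilon> * lam ^ n)"
      using pl_family_const[of "\<lambda>_. 0" 0 w] u by (auto simp: z_def less_imp_le)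
    have 1: "ceq K (ind (S e) + ind (R e)) (ind Lo + ind (R e))"
      unfolding SR[OF eb, symmetric]
      using ceq_trans[OF slots_rounding[OF w less_imp_le[OF \<tau>(1)] \<tau>(2) \<upsilon> t eper epl eb eS K(1) K'] move[OF epl eb]] .
    have 2: "ceq K (ind (S z) + ind (R z)) (ind Lo + ind (R z))"
      unfolding SR[OF z(2), symmetric] using move[OF z] by (simp add: z_def)
    note nRe = nR[OF epl eb] and nRz = nR[OF z]
    have "ceq K (ind (S e) + ind (R e) + ind (R z)) (ind (S z) + ind (R e) + ind (R z))"
    proof -
      have "ceq K (ind (S e) + ind (R e) + ind (R z)) (ind Lo + ind (R e) + ind (R z))"
        by (rule ceq_add_eqf[OF 1 eqf_ind[OF nRz(1)]])
      also have "ind Lo + ind (R e) + ind (R z) = ind Lo + ind (R z) + ind (R e)" by (simp only: add_ac)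
      also have "ceq K \<dots> (ind (S z) + ind (R z) + ind (R e))"
        by (rule ceq_add_eqf[OF ceq_sym[OF 2] eqf_ind[OF nRe(1)]])
      also have "ind (S z) + ind (R z) + ind (R e) = ind (S z) + ind (R e) + ind (R z)" by (simp only: add_ac)
      finally show ?thesis .
    qed
    then have "ceq K (ind (S e) + ind (R e) + ind K) (ind (S z) + ind (R e) + ind K)"
      by (rule ceq_cat[OF _ nRz(2,1) K(1)])
    then have "ceq K (ind (S e) + ind K + ind (R e)) (ind (S z) + ind K + ind (R e))" by (simp only: add_ac)
    then have SS: "ceq K (ind (S e) + ind K + ind K) (ind (S z) + ind K + ind K)"
      by (rule ceq_cat[OF _ nRe(2,1) K(1)])
    \<comment> \<open>Both first slots contain the rectangle A up to height p: their tops are 4100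
      \<upsilon> + l - c = p + l and 4100 \<upsilon> = p + c. Once A is absorbed into K, the
      subgraph of l and the rectangle of height c remain.\<close>
    define p where "p = 4100 * \<upsilon> - c"
    define A where "A = strip w (\<lambda>_. 4000 * \<upsilon>) (\<lambda>_. p)"
    define V where "V f = strip w (\<lambda>_. p) (\<lambda>x. p + f x)" for f :: "real \<Rightarrow> real"
    have pp: "4000 * \<upsilon> \<le> p" "p \<le> 4100 * \<upsilon>" using c \<eta> \<upsilon> by (auto simp: p_def)
    have SA: "ind (S f) = ind A + ind (V g)" if fg: "\<And>x. g x = f 0 x + c" "\<And>x. 0 \<le> g x" for f :: "nat \<Rightarrow> real \<Rightarrow> real" and g
    proof -
      have f0: "f 0 x = g x - c" for x using fg(1)[of x] by simp
      have "S f = A \<union> V g"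
      proof -
        have "(x, y) \<in> S f \<longleftrightarrow> (x, y) \<in> A \<union> V g" for x y
          using fg(2)[of x] pp unfolding S_def A_def V_def strip_def f0 by (auto simp: p_def)
        then show ?thesis by (simp add: set_eq_iff split_paired_all)
      qed
      moreover have "A \<inter> V g = {}" by (auto simp: A_def V_def strip_def)
      ultimately show ?thesis by (simp add: ind_Un)
    qed
    have tV: "(+) (0, p) ` strip w (\<lambda>_. 0) f = V f" for f
      unfolding translation_vimage V_def by (auto simp: strip_def)
    have nA: "nice A" unfolding A_def using L by (intro nice_strip[OF w, where L = L]) auto
    have AK: "A \<subseteq> K"
    proof -
      have "A \<subseteq> {0..2 * w} \<times> {0..25000 * \<upsilon>}" using pp w \<upsilon> by (auto simp: A_def strip_def)
      then show ?thesis using K' by blast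
    qed
    have nl: "nice (strip w (\<lambda>_. 0) l)" using l(2) L by (intro nice_strip[OF w, where L = L]) auto
    have nc: "nice (strip w (\<lambda>_. 0) (\<lambda>_. c))" using L by (intro nice_strip[OF w, where L = L]) auto
    have "ind (S e) = ind A + ind (V l)" "ind (S z) = ind A + ind (V (\<lambda>_. c))"
      using l(3) c by (auto intro!: SA simp: e0 z_def)
    then have "ceq K (ind (V l) + ind K + ind K + ind A) (ind (V (\<lambda>_. c)) + ind K + ind K + ind A)"
      using SS by (simp only: add_ac)
    then have V: "ceq K (ind (V l) + ind K + ind K + ind K) (ind (V (\<lambda>_. c)) + ind K + ind K + ind K)"
      by (rule ceq_cat[OF _ AK nA K(1)])
    have "ceq K (ind (strip w (\<lambda>_. 0) l) + ind K + ind K + ind K) (ind (V l) + ind K + ind K + ind K)"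
      unfolding tV[symmetric] by (intro ceq_eqf K eqf_add eqf_ind eqf_translate nl)
    also note V
    also have "ceq K (ind (V (\<lambda>_. c)) + ind K + ind K + ind K) (ind (strip w (\<lambda>_. 0) (\<lambda>_. c)) + ind K + ind K + ind K)"
      unfolding tV[symmetric] by (intro ceq_eqf K eqf_add eqf_ind eqf_sym[OF eqf_translate] nc)
    finally have "ceq2 K (ind (strip w (\<lambda>_. 0) l)) (ind (strip w (\<lambda>_. 0) (\<lambda>_. c)))"
      unfolding ceq2_def by (simp only: add_ac)
    then show ?thesis using c by blast
  qed
  then show thesis using \<eta>(1) by (rule that[rotated])
qed

subsection \<open>Rectangles\<close>

lemma eqf_trans_eq [trans]: "F = G \<Longrightarrow> G \<asymp> H \<Longrightarrow> F \<asymp> H" "F \<asymp> G \<Longrightarrow> G = H \<Longrightarrow> F \<asymp> H"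
  by simp_all

text \<open>The map h is the linear part of g and transforms the translation vectors; the multiset
  functions are carried over by composition with the inverse of g.\<close>

lemma eqf_isometry:
  fixes g :: "'a::real_normed_vector \<Rightarrow> 'b::real_normed_vector"
  assumes g: "surj g" "\<And>x y. dist (g x) (g y) = dist x y" "\<And>v x. g (v + x) = h v + g x" and FG: "F \<asymp> G"
  shows "(\<lambda>y. F (inv g y)) \<asymp> (\<lambda>y. G (inv g y))"
proof -
  obtain n :: nat and P v where P: "\<And>i. i < n \<Longrightarrow> nice (P i)" "F = (\<Sum>i<n. ind (P i))"
     "G = (\<Sum>i<n. ind ((+) (v i) ` P i))" using FG unfolding eqf_def by auto
  have "inj g"
  proof (rule injI)
    fix x y assume "g x = g y"
    then show "x = y" using g(2)[of x y] by simp
  qed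
  then have mem: "inv g y \<in> A \<longleftrightarrow> y \<in> g ` A" for y A
    using surj_f_inv_f[OF g(1), of y] by (auto simp: inv_f_f image_iff) metis
  have sum: "(\<lambda>y. (\<Sum>i<n. ind (A i)) (inv g y)) = (\<Sum>i<n. ind (g ` A i))" for A
    by (rule ext) (simp add: sum_fun_apply ind_def mem)
  have "(\<Sum>i<n. ind (g ` P i)) \<asymp> (\<Sum>i<n. ind ((+) (h (v i)) ` g ` P i))"
    using P(1) nice_isometry[OF _ g(1,2)] by (intro eqf_sum) auto
  moreover have "(+) (h (v i)) ` g ` P i = g ` (+) (v i) ` P i" for i
    by (simp add: image_image g(3))
  ultimately show ?thesis unfolding P(2,3) sum by simp
qed

lemma ind_inv:
  assumes "bij g" shows "(\<lambda>y. ind A (inv g y)) = ind (g ` A)"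
proof
  fix y
  have "inv g y \<in> A \<longleftrightarrow> y \<in> g ` A"
    using assms by (metis bij_inv_eq_iff image_iff)
  then show "ind A (inv g y) = ind (g ` A) y" by (simp add: ind_def)
qed

definition rect :: "real \<Rightarrow> real \<Rightarrow> (real \<times> real) set" where
  "rect a b = {0..<a} \<times> {0<..b}"

lemma nice_rect [simp]: "nice (rect a b)"
  unfolding rect_def by (rule nice_halfopen_box)

lemma strip_rect: "strip a (\<lambda>_. 0) (\<lambda>_. b) = rect a b"
  by (auto simp: strip_def rect_def)

text \<open>\<open>A\<close> and \<open>B\<close> are fundamental domains of the lattice generated by \<open>u\<close> in \<open>S\<close>.\<close>

lemma eqf_shear:
  fixes \<sigma> \<sigma>' :: "'a::real_normed_vector \<Rightarrow> real"
  assumes A: "\<And>z. z \<in> A \<longleftrightarrow> z \<in> S \<and> 0 \<le> \<sigma> z \<and> \<sigma> z < 1" and B: "\<And>z. z \<in> B \<longleftrightarrow> z \<in> S \<and> 0 \<le> \<sigma>' z \<and> \<sigma>' z < 1"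
    and u: "\<And>z k. z - of_int k *\<^sub>R u \<in> S \<longleftrightarrow> z \<in> S" "\<And>z k. \<sigma> (z - of_int k *\<^sub>R u) = \<sigma> z - of_int k"
       "\<And>z k. \<sigma>' (z - of_int k *\<^sub>R u) = \<sigma>' z - of_int k"
    and N: "\<And>z. z \<in> S \<Longrightarrow> \<bar>\<sigma> z - \<sigma>' z\<bar> \<le> C" and nice: "nice A" "nice B"
  shows "ind A \<asymp> ind B"
proof -
  define N where "N = nat \<lceil>C\<rceil> + 1"
  define P where "P k = A \<inter> (+) (of_int k *\<^sub>R u) ` B" for k :: int
  have mP: "z \<in> P k \<longleftrightarrow> z \<in> S \<and> 0 \<le> \<sigma> z \<and> \<sigma> z < 1 \<and> 0 \<le> \<sigma>' z - of_int k \<and> \<sigma>' z - of_int k < 1" for z k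
    unfolding P_def Int_iff translation_vimage vimage_eq A B u by blast
  have mP': "z \<in> (+) (- of_int k *\<^sub>R u) ` P k \<longleftrightarrow> z \<in> S \<and> 0 \<le> \<sigma>' z \<and> \<sigma>' z < 1 \<and> 0 \<le> \<sigma> z + of_int k \<and> \<sigma> z + of_int k < 1" for z k
    using u[of z "- k"] unfolding translation_vimage vimage_eq mP by auto
  have bound: "k \<in> {- int N..int N}" if "z \<in> S" "0 \<le> a" "a < 1" "0 \<le> b" "b < 1" "\<bar>a - b + of_int k\<bar> = \<bar>\<sigma> z - \<sigma>' z\<bar>" for z k a b
  proof -
    have "C + 1 \<le> real N" by (simp add: N_def of_nat_ceiling)
    then have "\<bar>real_of_int k\<bar> < real N + 1" using N[OF that(1)] that by linarith
    then show ?thesis by auto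
  qed
  have "ind A = (\<Sum>k\<in>{- int N..int N}. ind (P k))"
  proof -
    have "A = (\<Union>k\<in>{- int N..int N}. P k)"
    proof
      show "A \<subseteq> (\<Union>k\<in>{- int N..int N}. P k)"
      proof
        fix z assume z: "z \<in> A"
        have f: "0 \<le> \<sigma>' z - of_int \<lfloor>\<sigma>' z\<rfloor>" "\<sigma>' z - of_int \<lfloor>\<sigma>' z\<rfloor> < 1" by linarith+
        then have "\<lfloor>\<sigma>' z\<rfloor> \<in> {- int N..int N}"
          using z unfolding A by (intro bound[of z "\<sigma>' z - of_int \<lfloor>\<sigma>' z\<rfloor>" "\<sigma> z"]) (auto simp: abs_minus_commute)
        then show "z \<in> (\<Union>k\<in>{- int N..int N}. P k)" using z f unfolding A UN_iff mP by blast
      qed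
    qed (auto simp: P_def)
    moreover have "disjoint_family_on P {- int N..int N}"
      unfolding disjoint_family_on_def
    proof (intro ballI impI)
      fix k l :: int assume "k \<noteq> l"
      have "k = l" if "z \<in> P k" "z \<in> P l" for z using that unfolding mP by linarith
      then show "P k \<inter> P l = {}" using \<open>k \<noteq> l\<close> by blast
    qed
    ultimately show ?thesis by (simp add: ind_UN)
  qed
  also have "\<dots> \<asymp> (\<Sum>k\<in>{- int N..int N}. ind ((+) (- of_int k *\<^sub>R u) ` P k))"
    unfolding P_def by (intro eqf_sum nice_Int nice nice_translation) auto
  also have "\<dots> = ind B"
  proof -
    have "B = (\<Union>k\<in>{- int N..int N}. (+) (- of_int k *\<^sub>R u) ` P k)"
    proof
      show "B \<subseteq> (\<Union>k\<in>{- int N..int N}. (+) (- of_int k *\<^sub>R u) ` P k)"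
      proof
        fix z assume z: "z \<in> B"
        have f: "0 \<le> \<sigma> z + of_int (- \<lfloor>\<sigma> z\<rfloor>)" "\<sigma> z + of_int (- \<lfloor>\<sigma> z\<rfloor>) < 1" by simp_all linarith
        then have "- \<lfloor>\<sigma> z\<rfloor> \<in> {- int N..int N}"
          using z unfolding B by (intro bound[of z "\<sigma>' z" "\<sigma> z + of_int (- \<lfloor>\<sigma> z\<rfloor>)"]) auto
        then show "z \<in> (\<Union>k\<in>{- int N..int N}. (+) (- of_int k *\<^sub>R u) ` P k)" using z f unfolding B UN_iff mP' by blast
      qed
      show "(\<Union>k\<in>{- int N..int N}. (+) (- of_int k *\<^sub>R u) ` P k) \<subseteq> B" using mP' B by blast
    qed
    moreover have "disjoint_family_on (\<lambda>k. (+) (- of_int k *\<^sub>R u) ` P k) {- int N..int N}"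
      unfolding disjoint_family_on_def
    proof (intro ballI impI)
      fix k l :: int assume "k \<noteq> l"
      have "k = l" if "z \<in> (+) (- of_int k *\<^sub>R u) ` P k" "z \<in> (+) (- of_int l *\<^sub>R u) ` P l" for z
        using that unfolding mP' by linarith
      then show "(+) (- of_int k *\<^sub>R u) ` P k \<inter> (+) (- of_int l *\<^sub>R u) ` P l = {}" using \<open>k \<noteq> l\<close> by blast
    qed
    ultimately show ?thesis by (simp add: ind_UN)
  qed
  finally show ?thesis .
qed

section \<open>Quarter turns and the change of shape of rectangles\<close>

definition turn :: "real \<times> real \<Rightarrow> real \<times> real" where
  "turn z = (snd z, - fst z)"

lemma turn: "surj turn" "bij turn" "dist (turn x) (turn y) = dist x y" "turn (v + x) = turn v + turn x"
proof -
  have "turn (- snd z, fst z) = z" for z by (simp add: turn_def)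
  then show "surj turn" by (rule surjI)
  moreover have "inj turn" by (auto simp: inj_def turn_def prod_eq_iff)
  ultimately show "bij turn" by (simp add: bij_def)
qed (auto simp: turn_def dist_prod_def dist_real_def power2_eq_square add.commute algebra_simps)

lemma turn_image: "z \<in> turn ` A \<longleftrightarrow> (- snd z, fst z) \<in> A"
  by (force simp: turn_def image_iff)

lemma nice_turn: "nice A \<Longrightarrow> nice (turn ` A)"
  by (rule nice_isometry[OF _ turn(1,3)])

lemma abs_mult_le: "0 \<le> c \<Longrightarrow> \<bar>x\<bar> \<le> 1 \<Longrightarrow> \<bar>c * x\<bar> \<le> c" for c x :: real
  by (simp add: abs_mult mult_left_le)

text \<open>Shears along \<open>(0, b)\<close>, along \<open>(a, -b')\<close> and along \<open>(a', 0)\<close> turn one rectangle into the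
  other; \<open>a b = a' b'\<close> makes the second shear land on a parallelogram with a horizontal side.\<close>

lemma rect_turn:
  assumes ab: "0 < a" "0 < b" "0 < a'" "0 < b'" and eq: "a * b = a' * b'"
  shows "ind (rect a b) \<asymp> ind (turn ` rect b' a')"
proof -
  define R1 where "R1 = strip a (\<lambda>x. - (b' / a) * x) (\<lambda>x. - (b' / a) * x + b)"
  define R2 where "R2 = turn ` strip b' (\<lambda>y. (a / b') * y) (\<lambda>y. (a / b') * y + a')"
  have lip: "\<bar>(c * x + d) - (c * y + d)\<bar> \<le> \<bar>c\<bar> * \<bar>x - y\<bar>" for c d x y :: real
    by (simp flip: right_diff_distrib abs_mult)
  have nR: "nice R1" "nice R2"
    unfolding R1_def R2_def
    using lip[of "- (b' / a)" _ 0] lip[of "- (b' / a)" _ b] lip[of "a / b'" _ 0] lip[of "a / b'" _ a'] ab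
    by (intro nice_turn nice_strip[where L = "\<bar>- (b' / a)\<bar>"] nice_strip[where L = "\<bar>a / b'\<bar>"]; simp)+
  have "ind (rect a b) \<asymp> ind R1"
  proof (rule eqf_shear[where u = "(0, - b)" and S = "{0..<a} \<times> UNIV" and \<sigma> = "\<lambda>z. 1 - snd z / b"
        and \<sigma>' = "\<lambda>z. 1 - (snd z + b' / a * fst z) / b" and C = "b' / b"])
    fix z :: "real \<times> real" and k :: int
    show "z \<in> rect a b \<longleftrightarrow> z \<in> {0..<a} \<times> UNIV \<and> 0 \<le> 1 - snd z / b \<and> 1 - snd z / b < 1"
      using ab by (auto simp: rect_def mem_Times_iff pos_divide_le_eq zero_less_divide_iff)
    show "z \<in> R1 \<longleftrightarrow> z \<in> {0..<a} \<times> UNIV \<and> 0 \<le> 1 - (snd z + b' / a * fst z) / b \<and> 1 - (snd z + b' / a * fst z) / b < 1"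
      using ab by (auto simp: R1_def strip_def mem_Times_iff pos_divide_le_eq zero_less_divide_iff)
    show "\<bar>1 - snd z / b - (1 - (snd z + b' / a * fst z) / b)\<bar> \<le> b' / b" if "z \<in> {0..<a} \<times> UNIV"
    proof -
      have "1 - snd z / b - (1 - (snd z + b' / a * fst z) / b) = (b' / b) * (fst z / a)" by (simp add: add_divide_distrib)
      moreover have "0 \<le> fst z / a" "fst z / a \<le> 1" using that ab by (auto simp: mem_Times_iff)
      then have "\<bar>fst z / a\<bar> \<le> 1" by linarith
      then have "\<bar>(b' / b) * (fst z / a)\<bar> \<le> b' / b" using ab by (intro abs_mult_le) auto
      ultimately show ?thesis by simp
    qed
  qed (use ab nR in \<open>auto simp: mem_Times_iff field_simps\<close>)
  also have "ind R1 \<asymp> ind R2"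
  proof (rule eqf_shear[where u = "(a, - b')" and S = "{z. 0 < (snd z + b' / a * fst z) / b \<and> (snd z + b' / a * fst z) / b \<le> 1}"
        and \<sigma> = "\<lambda>z. fst z / a" and \<sigma>' = "\<lambda>z. - snd z / b'" and C = "b / b'"])
    fix z :: "real \<times> real" and k :: int
    \<comment> \<open>Equality of areas enters here: the strip along (a, -b') is the same set
      whether it is measured by its vertical width b or by its horizontal width a'.\<close>
    have e: "(snd z + b' / a * fst z) / b = (fst z + a / b' * snd z) / a'"
    proof -
      have "(snd z + b' / a * fst z) / b = (a * snd z + b' * fst z) / (a * b)" using ab by (simp add: field_simps)
      also have "\<dots> = (fst z + a / b' * snd z) / a'" unfolding eq using ab by (simp add: field_simps)
      finally show ?thesis .
    qed
    show "z \<in> R1 \<longleftrightarrow> z \<in> {z. 0 < (snd z + b' / a * fst z) / b \<and> (snd z + b' / a * fst z) / b \<le> 1} \<and> 0 \<le> fst z / a \<and> fst z / a < 1"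
      using ab by (auto simp: R1_def strip_def pos_divide_le_eq zero_less_divide_iff zero_le_divide_iff)
    show "z \<in> R2 \<longleftrightarrow> z \<in> {z. 0 < (snd z + b' / a * fst z) / b \<and> (snd z + b' / a * fst z) / b \<le> 1} \<and> 0 \<le> - snd z / b' \<and> - snd z / b' < 1"
    proof -
      have "0 < (fst z + a / b' * snd z) / a' \<longleftrightarrow> 0 < fst z + a / b' * snd z" using ab by (simp only: zero_less_divide_iff) auto
      moreover have "0 \<le> - snd z / b' \<longleftrightarrow> 0 \<le> - snd z" using ab by (simp only: zero_le_divide_iff) auto
      ultimately show ?thesis
        unfolding mem_Collect_eq e pos_divide_le_eq[OF ab(3)] pos_divide_less_eq[OF ab(4)] R2_def turn_image strip_def by auto
    qed
    show "\<bar>fst z / a - (- snd z / b')\<bar> \<le> b / b'" if "z \<in> {z. 0 < (snd z + b' / a * fst z) / b \<and> (snd z + b' / a * fst z) / b \<le> 1}"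
    proof -
      have "fst z / a - (- snd z / b') = (b / b') * ((snd z + b' / a * fst z) / b)" using ab by (simp add: field_simps)
      moreover have "\<bar>(snd z + b' / a * fst z) / b\<bar> \<le> 1" using that unfolding mem_Collect_eq by linarith
      then have "\<bar>(b / b') * ((snd z + b' / a * fst z) / b)\<bar> \<le> b / b'" using ab by (intro abs_mult_le) auto
      ultimately show ?thesis by simp
    qed
    have "snd (z - of_int k *\<^sub>R (a, - b')) + b' / a * fst (z - of_int k *\<^sub>R (a, - b')) = snd z + b' / a * fst z"
      using ab by (simp add: field_simps)
    then show "z - of_int k *\<^sub>R (a, - b') \<in> {z. 0 < (snd z + b' / a * fst z) / b \<and> (snd z + b' / a * fst z) / b \<le> 1}
       \<longleftrightarrow> z \<in> {z. 0 < (snd z + b' / a * fst z) / b \<and> (snd z + b' / a * fst z) / b \<le> 1}"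
      by (simp only: mem_Collect_eq)
  qed (use ab nR in \<open>auto simp: field_simps\<close>)
  also have "ind R2 \<asymp> ind (turn ` rect b' a')"
  proof (rule eqf_shear[where u = "(- a', 0)" and S = "UNIV \<times> {- b'<..0}" and \<sigma> = "\<lambda>z. 1 - (fst z + a / b' * snd z) / a'"
        and \<sigma>' = "\<lambda>z. 1 - fst z / a'" and C = "a / a'"])
    fix z :: "real \<times> real" and k :: int
    show "z \<in> R2 \<longleftrightarrow> z \<in> UNIV \<times> {- b'<..0} \<and> 0 \<le> 1 - (fst z + a / b' * snd z) / a' \<and> 1 - (fst z + a / b' * snd z) / a' < 1"
      using ab by (auto simp: R2_def turn_image strip_def mem_Times_iff pos_divide_le_eq zero_less_divide_iff)
    show "z \<in> turn ` rect b' a' \<longleftrightarrow> z \<in> UNIV \<times> {- b'<..0} \<and> 0 \<le> 1 - fst z / a' \<and> 1 - fst z / a' < 1"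
      using ab by (auto simp: turn_image rect_def mem_Times_iff pos_divide_le_eq zero_less_divide_iff)
    show "\<bar>1 - (fst z + a / b' * snd z) / a' - (1 - fst z / a')\<bar> \<le> a / a'" if "z \<in> UNIV \<times> {- b'<..0}"
    proof -
      have "1 - (fst z + a / b' * snd z) / a' - (1 - fst z / a') = - ((a / a') * (snd z / b'))" by (simp add: add_divide_distrib)
      moreover have "-1 \<le> snd z / b'" "snd z / b' \<le> 1"
        unfolding pos_le_divide_eq[OF ab(4)] pos_divide_le_eq[OF ab(4)] using that ab by (auto simp: mem_Times_iff)
      then have "\<bar>snd z / b'\<bar> \<le> 1" by linarith
      then have "\<bar>(a / a') * (snd z / b')\<bar> \<le> a / a'" using ab by (intro abs_mult_le) auto
      ultimately show ?thesis by simp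
    qed
  qed (use ab nR nice_turn in \<open>auto simp: mem_Times_iff field_simps\<close>)
  finally show ?thesis .
qed

text \<open>Both rectangles are compared with the same turned rectangle, the second one by
  \<open>rect_turn\<close> applied to itself.\<close>

lemma rect_change:
  assumes "0 < a" "0 < b" "0 < c" "0 < d" "a * b = c * d"
  shows "ind (rect a b) \<asymp> ind (rect c d)"
  using eqf_trans[OF rect_turn[OF assms] eqf_sym[OF rect_turn[OF assms(3,4) assms(3,4) refl]]] .

lemma rect_stack:
  assumes "0 \<le> b" "0 \<le> c"
  shows "ind (rect a b) + ind (rect a c) \<asymp> ind (rect a (b + c))"
proof -
  have t: "(+) (0, b) ` rect a c = {0..<a} \<times> {b<..b + c}" unfolding translation_vimage by (auto simp: rect_def)
  have "ind (rect a b) + ind (rect a c) \<asymp> ind (rect a b) + ind ((+) (0, b) ` rect a c)"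
    by (intro eqf_add eqf_ind eqf_translate) auto
  also have "\<dots> = ind (rect a b \<union> (+) (0, b) ` rect a c)"
    unfolding t by (intro ind_Un[symmetric]) (auto simp: rect_def)
  also have "rect a b \<union> (+) (0, b) ` rect a c = rect a (b + c)"
    unfolding t using assms by (auto simp: rect_def)
  finally show ?thesis .
qed

text \<open>Its area is w^2/6, so the six copies in \<open>ceq2\<close> can be exchanged for one
  square of side w, and it contains the box that \<open>profile\<close> demands for Y =
  w/36.\<close>

definition frame :: "real \<Rightarrow> (real \<times> real) set" where
  "frame w = {0..<3 * w} \<times> {- (w / 36)<..w / 36}"

lemma frame: assumes "0 < w" shows "nice (frame w)" "{0..2 * w} \<times> {0..w / 36} \<subseteq> frame w"
  "(ind (frame w) + ind (frame w) + ind (frame w)) + (ind (frame w) + ind (frame w) + ind (frame w)) \<asymp> ind (rect w w)"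
proof -
  show "nice (frame w)" unfolding frame_def by (rule nice_halfopen_box)
  then have "ind (frame w) \<asymp> ind ((+) (0, w / 36) ` frame w)" by (rule eqf_translate)
  also have "(+) (0, w / 36) ` frame w = rect (3 * w) (w / 18)"
    unfolding translation_vimage frame_def rect_def by auto
  also have "ind (rect (3 * w) (w / 18)) \<asymp> ind (rect w (w / 6))" using assms by (intro rect_change) auto
  finally have 1: "ind (frame w) \<asymp> ind (rect w (w / 6))" .
  have "ind (frame w) + ind (frame w) \<asymp> ind (rect w (w / 3))"
    using eqf_trans[OF eqf_add[OF 1 1] rect_stack[of "w / 6" "w / 6" w]] assms by simp
  from eqf_trans[OF eqf_add[OF this 1] rect_stack[of "w / 3" "w / 6" w]]
  have 3: "ind (frame w) + ind (frame w) + ind (frame w) \<asymp> ind (rect w (w / 2))" using assms by simp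
  from eqf_trans[OF eqf_add[OF 3 3] rect_stack[of "w / 2" "w / 2" w]]
  show "(ind (frame w) + ind (frame w) + ind (frame w)) + (ind (frame w) + ind (frame w) + ind (frame w)) \<asymp> ind (rect w w)"
    using assms by simp
  show "{0..2 * w} \<times> {0..w / 36} \<subseteq> frame w" using assms by (auto simp: frame_def)
qed

lemma ceq2_frame:
  assumes w: "0 < w" and FG: "ceq2 (frame w) F G" "F \<asymp> F" "G \<asymp> G"
  shows "F + ind (rect w w) \<asymp> G + ind (rect w w)"
proof -
  let ?K = "ind (frame w) + ind (frame w) + ind (frame w)"
  have K: "?K + ?K \<asymp> ind (rect w w)" by (rule frame(3)[OF w])
  have "F + ind (rect w w) \<asymp> F + (?K + ?K)" by (intro eqf_add FG eqf_sym[OF K])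
  also have "F + (?K + ?K) \<asymp> G + (?K + ?K)" using FG(1) unfolding ceq2_def ceq_def by (simp only: add.assoc)
  also have "G + (?K + ?K) \<asymp> G + ind (rect w w)" by (intro eqf_add FG K)
  finally show ?thesis .
qed

text \<open>Layer-cake decomposition into layers so thin that \<open>profile\<close> applies.\<close>

lemma subgraph_rect:
  assumes w: "0 < w" and g: "periodic w g" "\<And>x y. \<bar>g x - g y\<bar> \<le> L * \<bar>x - y\<bar>" "\<And>x. 0 \<le> g x"
  obtains h where "0 \<le> h" "ind (strip w (\<lambda>_. 0) g) + ind (rect w w) \<asymp> ind (rect w h) + ind (rect w w)"
proof -
  have L: "0 \<le> L" using g(2)[of 0 1] by simp
  have "0 < w / 36" using w by simp
  then obtain \<eta> where \<eta>: "0 < \<eta>"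
    "\<And>l K. periodic w l \<Longrightarrow> (\<And>x y. \<bar>l x - l y\<bar> \<le> L * \<bar>x - y\<bar>) \<Longrightarrow> (\<And>x. 0 \<le> l x) \<Longrightarrow> (\<And>x. l x \<le> \<eta>) \<Longrightarrow>
      nice K \<Longrightarrow> {0..2 * w} \<times> {0..w / 36} \<subseteq> K \<Longrightarrow>
      \<exists>c. 0 \<le> c \<and> c \<le> \<eta> \<and> ceq2 K (ind (strip w (\<lambda>_. 0) l)) (ind (strip w (\<lambda>_. 0) (\<lambda>_. c)))"
    using profile[OF w _ L] by blast
  have layer: "\<exists>h. 0 \<le> h \<and> ind (strip w (\<lambda>_. 0) f) + ind (rect w w) \<asymp> ind (rect w h) + ind (rect w w)"
    if "periodic w f" "\<And>x y. \<bar>f x - f y\<bar> \<le> L * \<bar>x - y\<bar>" "\<And>x. 0 \<le> f x" "\<And>x. f x \<le> real n * \<eta>" for n f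
    using that
  proof (induction n arbitrary: f)
    case 0
    then have "strip w (\<lambda>_. 0) f = rect w 0" by (auto simp: strip_def rect_def) (metis leD order.trans)
    then show ?case by (intro exI[of _ 0] conjI order_refl) (simp only:, intro eqf_add eqf_ind nice_rect)
  next
    case (Suc n)
    define f1 where "f1 x = min (f x) \<eta>" for x
    define f2 where "f2 x = max (f x - \<eta>) 0" for x
    have f1: "periodic w f1" "\<bar>f1 x - f1 y\<bar> \<le> L * \<bar>x - y\<bar>" "0 \<le> f1 x" "f1 x \<le> \<eta>" for x y
      using Suc.prems(1) Suc.prems(2)[of x y] Suc.prems(3)[of x] \<eta>(1) by (auto simp: f1_def periodic_def)
    have f2: "periodic w f2" "\<bar>f2 x - f2 y\<bar> \<le> L * \<bar>x - y\<bar>" "0 \<le> f2 x" "f2 x \<le> real n * \<eta>" for x y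
      using Suc.prems(1) Suc.prems(2)[of x y] Suc.prems(4)[of x] \<eta>(1) by (auto simp: f2_def periodic_def algebra_simps)
    have nice: "nice (strip w (\<lambda>_. 0) f1)" "nice (strip w (\<lambda>_. 0) f2)"
      using f1(2) f2(2) L by (intro nice_strip[OF w, where L = L]; simp)+
    obtain c where c: "0 \<le> c" "ceq2 (frame w) (ind (strip w (\<lambda>_. 0) f1)) (ind (rect w c))"
      using \<eta>(2)[OF f1 frame(1,2)[OF w]] unfolding strip_rect by blast
    have 1: "ind (strip w (\<lambda>_. 0) f1) + ind (rect w w) \<asymp> ind (rect w c) + ind (rect w w)"
      by (rule ceq2_frame[OF w c(2) eqf_ind[OF nice(1)] eqf_ind]) simp
    obtain h where h: "0 \<le> h" "ind (strip w (\<lambda>_. 0) f2) + ind (rect w w) \<asymp> ind (rect w h) + ind (rect w w)"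
      using Suc.IH[OF f2] by blast
    have t: "(+) (0, \<eta>) ` strip w (\<lambda>_. 0) f2 = strip w (\<lambda>_. \<eta>) (\<lambda>x. \<eta> + f2 x)"
      unfolding translation_vimage by (auto simp: strip_def)
    have "ind (strip w (\<lambda>_. 0) f) = ind (strip w (\<lambda>_. 0) f1 \<union> (+) (0, \<eta>) ` strip w (\<lambda>_. 0) f2)"
    proof -
      have "(x, y) \<in> strip w (\<lambda>_. 0) f \<longleftrightarrow> (x, y) \<in> strip w (\<lambda>_. 0) f1 \<union> (+) (0, \<eta>) ` strip w (\<lambda>_. 0) f2" for x y
        unfolding t using \<eta>(1) by (auto simp: strip_def f1_def f2_def)
      then show ?thesis by (metis set_eqI surj_pair)
    qed
    also have "\<dots> = ind (strip w (\<lambda>_. 0) f1) + ind ((+) (0, \<eta>) ` strip w (\<lambda>_. 0) f2)"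
      unfolding t by (intro ind_Un) (auto simp: strip_def f1_def)
    also have "\<dots> \<asymp> ind (strip w (\<lambda>_. 0) f1) + ind (strip w (\<lambda>_. 0) f2)"
      by (intro eqf_add eqf_ind eqf_sym[OF eqf_translate] nice)
    finally have "ind (strip w (\<lambda>_. 0) f) + ind (rect w w) \<asymp> ind (strip w (\<lambda>_. 0) f1) + ind (strip w (\<lambda>_. 0) f2) + ind (rect w w)"
      by (intro eqf_add eqf_ind) auto
    also have "\<dots> = ind (strip w (\<lambda>_. 0) f1) + (ind (strip w (\<lambda>_. 0) f2) + ind (rect w w))" by (simp only: add.assoc)
    also have "\<dots> \<asymp> ind (strip w (\<lambda>_. 0) f1) + (ind (rect w h) + ind (rect w w))"
      by (intro eqf_add eqf_ind nice h)
    also have "\<dots> = ind (strip w (\<lambda>_. 0) f1) + ind (rect w w) + ind (rect w h)" by (simp only: add_ac)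
    also have "\<dots> \<asymp> ind (rect w c) + ind (rect w w) + ind (rect w h)" by (intro eqf_add 1 eqf_ind) simp
    also have "\<dots> = ind (rect w c) + ind (rect w h) + ind (rect w w)" by (simp only: add_ac)
    also have "\<dots> \<asymp> ind (rect w (c + h)) + ind (rect w w)" by (intro eqf_add rect_stack c h eqf_ind) simp
    finally show ?case using c(1) h(1) by (intro exI[of _ "c + h"] conjI add_nonneg_nonneg)
  qed
  obtain n where n: "(\<bar>g 0\<bar> + L * w) / \<eta> \<le> real n" using real_arch_simple by blast
  have "g x \<le> real n * \<eta>" for x
  proof -
    have "g x = g (wrap w x)" using periodic_wrap[OF g(1)] by metis
    also have "\<dots> \<le> \<bar>g 0\<bar> + L * \<bar>wrap w x - 0\<bar>" using g(2)[of "wrap w x" 0] by linarith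
    also have "\<dots> \<le> \<bar>g 0\<bar> + L * w" using wrap_range[OF w, of x] L by (intro add_left_mono mult_left_mono) auto
    also have "\<dots> \<le> real n * \<eta>" using n \<eta>(1) by (simp add: pos_divide_le_eq)
    finally show ?thesis .
  qed
  then show thesis using layer[OF g, of n] that by blast
qed

subsection \<open>Squares and disks\<close>

lemma tame_segment:
  fixes c :: real
  assumes w: "0 < w" and U: "open U"
  shows "tame (w + 1) k (({0..w} \<inter> U) \<times> {c})"
  unfolding tame_def
proof (intro conjI ballI)
  let ?S = "({0..w} \<inter> U) \<times> {c}"
  have "?S = ({0..w} \<times> {c}) \<inter> (U \<times> UNIV)" by auto
  moreover have c: "closed ({0..w} \<times> {c})" by (intro closed_Times) auto
  moreover have "open (U \<times> (UNIV :: real set))" using U by (intro open_Times) auto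
  ultimately show "delta2 ?S" by (simp only: delta2_Int delta2_closed delta2_open)
  fix e :: real assume "e \<in> {0<..1}"
  then have e: "0 < e" "e \<le> 1" by auto
  have "?S \<subseteq> {0..w} \<times> {c}" by auto
  then have "closure ?S \<subseteq> {0..w} \<times> {c}" using c by (rule closure_minimal)
  also have "{0..w} \<times> {c} = (\<lambda>t. (t, c)) ` {0..w}" by auto
  finally have "frontier ?S \<subseteq> (\<lambda>t. (t, c)) ` {0..w}" unfolding frontier_def by blast
  moreover have "covered ((\<lambda>t. (t, c)) ` {0..w}) e ((1 * w + 1) / e)"
    using w e by (intro covered_lipschitz_arc[where a = 0]) (auto simp: dist_Pair_Pair dist_real_def)
  moreover have "(1 * w + 1) / e \<le> (w + 1) * 10 ^ k / e"
    using w e by (intro divide_right_mono) (auto simp: mult_le_cancel_left1)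
  ultimately show "covered (frontier ?S) e ((w + 1) * 10 ^ k / e)" using covered_mono by blast
qed

text \<open>Hilbert's hotel: shifting the segments at heights \<open>b \<lambda>\<^sup>k\<close> to the next height frees the first one.\<close>

lemma rect_absorb:
  assumes w: "0 < w" and U: "open U"
  shows "ind (({0..w} \<inter> U) \<times> {c}) + ind (rect w w) \<asymp> ind (rect w w)"
proof -
  \<comment> \<open>216 = 6 * 36, so that the height 6 b required by \<open>ceq_vertical\<close> is
    the height w/36 available in the frame.\<close>
  define b where "b = w / 216"
  have b: "0 < b" "6 * b = w / 36" using w by (auto simp: b_def)
  define I where "I = {0..w} \<inter> U"
  define P where "P k = I \<times> {b * lam ^ k}" for k
  have "tame (w + 1) k (P k)" for k unfolding P_def I_def by (rule tame_segment[OF w U])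
  then have tP: "tame_family P" unfolding tame_family_def by blast
  have bl: "0 < b * lam ^ k" "b * lam ^ k \<le> b" for k using b by (auto intro: mult_left_le)
  have zone: "P k \<subseteq> {0..w} \<times> {b * lam ^ k..(1.04 * b) * lam ^ k}" for k
    using bl(1)[of k] by (auto simp: P_def I_def)
  have zone0: "P k \<subseteq> {0..w} \<times> {0..b * lam ^ k}" for k
    using bl(1)[of k] by (auto simp: P_def I_def)
  note K = frame(1,2)[OF w]
  have "{0..w} \<times> {0..6 * b} \<subseteq> {0..2 * w} \<times> {0..w / 36}" unfolding b(2) using w by (intro box_mono) auto
  then have K2: "{0..w} \<times> {0..6 * b} \<subseteq> frame w" using K(2) by blast
  have sh: "(+) (lam ^ k *\<^sub>R (0, (lam - 1) * b)) ` P k = P (Suc k)" for k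
    unfolding P_def translation_vimage by (auto simp: algebra_simps)
  have "0.64 \<le> lam" "lam \<le> 0.7225" using lam by auto
  from ceq_vertical[OF tP zone b(1) this K(1) K2]
  have 1: "ceq (frame w) (ind (\<Union>k. P k)) (ind (\<Union>k. P (Suc k)))" unfolding sh .
  have "ind (\<Union>k. P k) = ind (P 0) + ind (\<Union>k. P (Suc k))"
  proof -
    have "(\<Union>k. P k) = P 0 \<union> (\<Union>k. P (Suc k))"
      by (metis UN_insert UNIV_nat_eq image_image)
    moreover have "P 0 \<inter> (\<Union>k. P (Suc k)) = {}"
    proof -
      have "lam * lam ^ k \<noteq> 1" for k using power_Suc_less_one[of lam k] by simp
      then show ?thesis using b(1) by (auto simp: P_def)
    qed
    ultimately show ?thesis by (simp add: ind_Un)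
  qed
  then have "ceq (frame w) (ind (P 0) + ind (\<Union>k. P (Suc k))) (0 + ind (\<Union>k. P (Suc k)))" using 1 by (simp only: add_0)
  moreover have "(\<Union>k. P (Suc k)) \<subseteq> frame w"
  proof -
    have "P k \<subseteq> {0..w} \<times> {0..6 * b}" for k
    proof -
      have "b * lam ^ k \<le> 6 * b" using bl(2)[of k] b(1) by linarith
      then show ?thesis using bl(1)[of k] by (simp only: P_def I_def) auto
    qed
    then show ?thesis using K2 by blast
  qed
  moreover have "nice (\<Union>k. P (Suc k))"
    unfolding sh[symmetric] by (rule nice_slices(1)[OF tP zone0])
  ultimately have "ceq (frame w) (ind (P 0) + ind (frame w)) (0 + ind (frame w))" using K(1) by (rule ceq_cat)
  moreover have "ind (frame w) + ind (frame w) \<asymp> ind (frame w) + ind (frame w)" by (intro eqf_add eqf_ind K)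
  ultimately have "ceq (frame w) (ind (P 0) + ind (frame w) + (ind (frame w) + ind (frame w))) (0 + ind (frame w) + (ind (frame w) + ind (frame w)))"
    by (rule ceq_add_eqf)
  then have c2: "ceq2 (frame w) (ind (P 0)) 0" unfolding ceq2_def by (simp only: add.assoc)
  have nP: "nice (P 0)" using tP tame_nice unfolding tame_family_def by blast
  have "ind (P 0) + ind (rect w w) \<asymp> 0 + ind (rect w w)" by (rule ceq2_frame[OF w c2 eqf_ind[OF nP] eqf_0])
  then have 2: "ind (P 0) + ind (rect w w) \<asymp> ind (rect w w)" by (simp only: add_0)
  have "(+) (0, c - b) ` P 0 = ({0..w} \<inter> U) \<times> {c}" unfolding translation_vimage by (auto simp: P_def I_def)
  then have "ind (({0..w} \<inter> U) \<times> {c}) \<asymp> ind (P 0)" using eqf_sym[OF eqf_translate[OF nP, of "(0, c - b)"]] by simp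
  from eqf_add[OF this eqf_ind[OF nice_rect]] 2 show ?thesis by (rule eqf_trans)
qed

lemma eqf_turn:
  assumes "F \<asymp> G" shows "(\<lambda>y. F (inv turn y)) \<asymp> (\<lambda>y. G (inv turn y))"
  by (rule eqf_isometry[OF turn(1,3,4) assms])

lemma eqf_turn_add:
  assumes "ind A + ind B \<asymp> ind C + ind B"
  shows "ind (turn ` A) + ind (turn ` B) \<asymp> ind (turn ` C) + ind (turn ` B)"
proof -
  have "(\<lambda>y. (ind X + ind B) (inv turn y)) = ind (turn ` X) + ind (turn ` B)" for X
    using ind_inv[OF turn(2)] by (simp add: fun_eq_iff)
  then show ?thesis using eqf_turn[OF assms] by simp
qed

lemma rect_turn_self: "0 \<le> b \<Longrightarrow> ind (rect a b) \<asymp> ind (turn ` rect a b)"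
proof -
  assume b: "0 \<le> b"
  show ?thesis
  proof (cases "0 < a \<and> 0 < b")
    case True
    then show ?thesis using rect_turn[of a b b a] by (simp add: mult.commute)
  next
    case False
    then have "rect a b = {}" using b by (auto simp: rect_def)
    then show ?thesis using eqf_0 by (simp only: image_empty ind_empty)
  qed
qed

text \<open>The catalyst, a square, is equidecomposable with its own rotation, so absorption is
  transferred from horizontal to vertical position.\<close>

lemma turn_absorb:
  assumes "ind A + ind (rect w w) \<asymp> ind C + ind (rect w w)" "0 < w" "nice A" "ind (turn ` C) \<asymp> ind C'"
  shows "ind (turn ` A) + ind (rect w w) \<asymp> ind C' + ind (rect w w)"
proof -
  have r: "ind (rect w w) \<asymp> ind (turn ` rect w w)" using assms(2) by (intro rect_turn_self) auto
  have "ind (turn ` A) + ind (rect w w) \<asymp> ind (turn ` A) + ind (turn ` rect w w)"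
    by (intro eqf_add eqf_ind nice_turn assms r)
  also have "\<dots> \<asymp> ind (turn ` C) + ind (turn ` rect w w)" by (rule eqf_turn_add[OF assms(1)])
  also have "\<dots> \<asymp> ind C' + ind (rect w w)" by (intro eqf_add assms eqf_sym[OF r])
  finally show ?thesis .
qed

text \<open>The closed square exceeds the half-open one by its bottom edge and by the right edge
  without its lower end. The right edge is a rotated half-open segment; both are absorbed by the
  square itself.\<close>

lemma closed_square_rect:
  fixes w :: real
  assumes w: "0 < w" shows "ind ({0..w} \<times> {0..w}) \<asymp> ind (rect w w)" and "nice ({0..w} \<times> {0..w})"
proof -
  define A where "A = ({0..w} \<inter> UNIV) \<times> {0::real}"
  define B where "B = ({0..w} \<inter> {..<w}) \<times> {0::real}"
  have nA: "nice A" and nB: "nice B" unfolding A_def B_def using w by (intro tame_nice[OF tame_segment[where k = 0]]; simp)+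
  have "z \<in> (+) (w, w) ` turn ` B \<longleftrightarrow> z \<in> {w} \<times> {0<..w}" for z
    unfolding translation_vimage vimage_eq turn_image B_def using w by (cases z) auto
  then have tB: "(+) (w, w) ` turn ` B = {w} \<times> {0<..w}" by blast
  have 1: "ind A + ind (rect w w) \<asymp> ind (rect w w)" unfolding A_def using w by (intro rect_absorb) auto
  have "ind B + ind (rect w w) \<asymp> ind {} + ind (rect w w)"
    unfolding B_def ind_empty add_0 using w by (intro rect_absorb) auto
  then have "ind (turn ` B) + ind (rect w w) \<asymp> ind {} + ind (rect w w)"
    by (rule turn_absorb[OF _ w nB]) (use eqf_0 in \<open>simp only: image_empty ind_empty\<close>)
  then have 2: "ind (turn ` B) + ind (rect w w) \<asymp> ind (rect w w)" by (simp only: ind_empty add_0)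
  have eq: "{0..w} \<times> {0..w} = A \<union> (rect w w \<union> (+) (w, w) ` turn ` B)"
    unfolding tB A_def rect_def using w by auto
  show "nice ({0..w} \<times> {0..w})" unfolding eq by (intro nice_Un nA nice_rect nice_translation nice_turn nB)
  have "ind ({0..w} \<times> {0..w}) = ind (A \<union> (rect w w \<union> (+) (w, w) ` turn ` B))"
    using eq by simp
  also have "\<dots> = ind A + ind (rect w w \<union> (+) (w, w) ` turn ` B)"
    by (rule ind_Un) (unfold tB, auto simp: A_def rect_def)
  also have "ind (rect w w \<union> (+) (w, w) ` turn ` B) = ind (rect w w) + ind ((+) (w, w) ` turn ` B)"
    by (rule ind_Un) (unfold tB, auto simp: rect_def)
  finally have "ind ({0..w} \<times> {0..w}) = ind A + (ind (rect w w) + ind ((+) (w, w) ` turn ` B))" .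
  also have "\<dots> \<asymp> ind A + (ind (rect w w) + ind (turn ` B))"
    by (intro eqf_add eqf_ind nA nice_rect eqf_sym[OF eqf_translate] nice_turn nB)
  also have "\<dots> = ind A + (ind (turn ` B) + ind (rect w w))" by (simp only: add_ac)
  also have "\<dots> \<asymp> ind A + ind (rect w w)" by (intro eqf_add eqf_ind nA 2)
  also note 1
  finally show "ind ({0..w} \<times> {0..w}) \<asymp> ind (rect w w)" .
qed

text \<open>For points in different periods the comparison passes through the ends w and 0, where f
  has equal values; their distances to these ends add up to at most the distance of the
  points.\<close>

lemma lipschitz_wrap:
  fixes f :: "real \<Rightarrow> real"
  assumes w: "0 < w" and f: "\<And>x y. 0 \<le> x \<Longrightarrow> x \<le> w \<Longrightarrow> 0 \<le> y \<Longrightarrow> y \<le> w \<Longrightarrow> \<bar>f x - f y\<bar> \<le> L * \<bar>x - y\<bar>"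
    and e: "f 0 = f w"
  shows "\<bar>f (wrap w x) - f (wrap w y)\<bar> \<le> L * \<bar>x - y\<bar>"
proof -
  have "0 \<le> L * w" using f[of 0 w] w by simp
  then have L: "0 \<le> L" using w by (simp add: zero_le_mult_iff)
  have le: "\<bar>f (wrap w x) - f (wrap w y)\<bar> \<le> L * \<bar>x - y\<bar>" if xy: "x \<le> y" for x y
  proof -
    have r: "0 \<le> wrap w x" "wrap w x \<le> w" "0 \<le> wrap w y" "wrap w y \<le> w" using wrap_range[OF w] less_imp_le by auto
    have "\<lfloor>x / w\<rfloor> \<le> \<lfloor>y / w\<rfloor>" using xy w by (intro floor_mono divide_right_mono) auto
    then consider "\<lfloor>x / w\<rfloor> = \<lfloor>y / w\<rfloor>" | "\<lfloor>x / w\<rfloor> + 1 \<le> \<lfloor>y / w\<rfloor>" by linarith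
    then show ?thesis
    proof cases
      case 1
      then show ?thesis using f[OF r] by (simp add: wrap_def)
    next
      case 2
      then have "of_int (\<lfloor>x / w\<rfloor> + 1) \<le> (of_int \<lfloor>y / w\<rfloor> :: real)" by (rule of_int_le_iff[THEN iffD2])
      then have "w * (of_int \<lfloor>x / w\<rfloor> + 1) \<le> w * of_int \<lfloor>y / w\<rfloor>" using w by (intro mult_left_mono) auto
      then have d: "(w - wrap w x) + wrap w y \<le> y - x" by (simp add: wrap_def algebra_simps)
      have "\<bar>f (wrap w x) - f w\<bar> \<le> L * (w - wrap w x)" "\<bar>f 0 - f (wrap w y)\<bar> \<le> L * wrap w y"
        using f[of "wrap w x" w] f[of 0 "wrap w y"] r w by auto
      then have "\<bar>f (wrap w x) - f (wrap w y)\<bar> \<le> L * ((w - wrap w x) + wrap w y)"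
        using e by (simp add: algebra_simps)
      also have "\<dots> \<le> L * (y - x)" using d L by (rule mult_left_mono)
      finally show ?thesis using xy by simp
    qed
  qed
  show ?thesis using le[of x y] le[of y x] by (cases "x \<le> y") (auto simp: abs_minus_commute)
qed

lemma disk_rect:
  assumes r: "0 < r"
  obtains w b where "0 < w" "0 < b" "ind {z :: real \<times> real. (fst z)\<^sup>2 + (snd z)\<^sup>2 \<le> r\<^sup>2} \<asymp> ind (rect w b)"
proof -
  define D where "D = {z :: real \<times> real. (fst z)\<^sup>2 + (snd z)\<^sup>2 \<le> r\<^sup>2}"
  \<comment> \<open>Half the side of the inscribed square. Over [-a, a] the circle has slope at most
    1, and its height over the square vanishes at both ends, so the cap is the subgraph of a
    periodic Lipschitz function.\<close>
  define a where "a = r / sqrt 2"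
  define w where "w = 2 * a"
  have a: "0 < a" "2 * a\<^sup>2 = r\<^sup>2" using r by (auto simp: a_def power_divide)
  have w: "0 < w" using a by (simp add: w_def)
  define s where "s t = sqrt (r\<^sup>2 - t\<^sup>2)" for t
  have s: "a \<le> s t" "(s t)\<^sup>2 = r\<^sup>2 - t\<^sup>2" if "\<bar>t\<bar> \<le> a" for t
  proof -
    have "\<bar>t\<bar>\<^sup>2 \<le> a\<^sup>2" using that by (intro power_mono) auto
    then have "t\<^sup>2 \<le> a\<^sup>2" "t\<^sup>2 \<le> r\<^sup>2" using a(2) zero_le_power2[of a] by (simp, unfold power2_abs, linarith)
    then show "a \<le> s t" "(s t)\<^sup>2 = r\<^sup>2 - t\<^sup>2" using a unfolding s_def by (auto intro!: real_le_rsqrt)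
  qed
  have ls: "\<bar>s t - s t'\<bar> \<le> 1 * \<bar>t - t'\<bar>" if t: "\<bar>t\<bar> \<le> a" "\<bar>t'\<bar> \<le> a" for t t'
  proof -
    have "(s t - s t') * (s t + s t') = (t' - t) * (t' + t)"
      using s(2)[OF t(1)] s(2)[OF t(2)] by (simp add: power2_eq_square algebra_simps)
    then have "\<bar>s t - s t'\<bar> * \<bar>s t + s t'\<bar> = \<bar>t' - t\<bar> * \<bar>t' + t\<bar>" by (metis abs_mult)
    also have "\<dots> \<le> \<bar>t' - t\<bar> * (2 * a)" using t by (intro mult_left_mono) auto
    finally have "\<bar>s t - s t'\<bar> * \<bar>s t + s t'\<bar> \<le> \<bar>t' - t\<bar> * (2 * a)" .
    moreover have "\<bar>s t - s t'\<bar> * (2 * a) \<le> \<bar>s t - s t'\<bar> * \<bar>s t + s t'\<bar>"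
      using s(1)[OF t(1)] s(1)[OF t(2)] by (intro mult_left_mono) auto
    ultimately have "\<bar>s t - s t'\<bar> * (2 * a) \<le> \<bar>t' - t\<bar> * (2 * a)" by linarith
    then show ?thesis using a(1) by (simp add: abs_minus_commute)
  qed
  define g where "g x = s (wrap w x - a) - a" for x
  have wr: "\<bar>wrap w x - a\<bar> \<le> a" for x using wrap_range[OF w, of x] by (auto simp: w_def)
  have g: "periodic w g" "0 \<le> g x" "\<bar>g x - g y\<bar> \<le> 1 * \<bar>x - y\<bar>" for x y
  proof -
    have "wrap w (x + w) = wrap w x" for x using w by (simp add: wrap_def add_divide_distrib algebra_simps)
    then show "periodic w g" by (simp add: periodic_def g_def)
    show "0 \<le> g x" using s(1)[OF wr] by (simp add: g_def)
    show "\<bar>g x - g y\<bar> \<le> 1 * \<bar>x - y\<bar>"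
      unfolding g_def
    proof (rule lipschitz_wrap[OF w, where f = "\<lambda>x. s (x - a) - a"])
      show "\<bar>s (x - a) - a - (s (y - a) - a)\<bar> \<le> 1 * \<bar>x - y\<bar>" if "0 \<le> x" "x \<le> w" "0 \<le> y" "y \<le> w" for x y
        using ls[of "x - a" "y - a"] that by (auto simp: w_def)
    qed (simp add: s_def w_def)
  qed
  obtain h where h: "0 \<le> h" "ind (strip w (\<lambda>_. 0) g) + ind (rect w w) \<asymp> ind (rect w h) + ind (rect w w)"
    using subgraph_rect[OF w g(1,3,2)] by blast
  define T where "T = (+) (- a, a) ` strip w (\<lambda>_. 0) g"
  have nS: "nice (strip w (\<lambda>_. 0) g)" using g(3) by (intro nice_strip[OF w, where L = 1]) auto
  have nT: "nice T" unfolding T_def by (intro nice_translation nS)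
  have memT: "z \<in> T \<longleftrightarrow> z \<in> D \<and> a < snd z" for z
  proof -
    have "wrap w (fst z + a) = fst z + a" if "- a \<le> fst z" "fst z < a"
      using that w by (intro wrap_eqI[where n = 0]) (auto simp: w_def)
    then have "z \<in> T \<longleftrightarrow> - a \<le> fst z \<and> fst z < a \<and> a < snd z \<and> snd z \<le> s (fst z)"
      unfolding T_def translation_vimage by (auto simp: strip_def g_def w_def)
    also have "\<dots> \<longleftrightarrow> z \<in> D \<and> a < snd z"
    proof
      assume z: "- a \<le> fst z \<and> fst z < a \<and> a < snd z \<and> snd z \<le> s (fst z)"
      then have "(snd z)\<^sup>2 \<le> (s (fst z))\<^sup>2" using a(1) by (intro power_mono) auto
      then show "z \<in> D \<and> a < snd z" using s(2)[of "fst z"] z by (simp add: D_def abs_le_iff)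
    next
      assume z: "z \<in> D \<and> a < snd z"
      then have "a\<^sup>2 < (snd z)\<^sup>2" using a(1) by (intro power_strict_mono) auto
      then have "(fst z)\<^sup>2 < a\<^sup>2" using z a(2) by (auto simp: D_def)
      then have f: "\<bar>fst z\<bar> < a" using a(1) by (intro power2_less_imp_less[of "\<bar>fst z\<bar>" a]) auto
      have "snd z \<le> s (fst z)" unfolding s_def using z by (intro real_le_rsqrt) (auto simp: D_def)
      then show "- a \<le> fst z \<and> fst z < a \<and> a < snd z \<and> snd z \<le> s (fst z)" using f z by auto
    qed
    finally show ?thesis .
  qed
  define E where "E k = (((`) turn) ^^ k) T" for k
  have E: "E 0 = T" "E (Suc k) = turn ` E k" for k by (auto simp: E_def)
  have nE: "nice (E k)" for k by (induction k) (auto simp: E nT nice_turn)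
  have eE: "ind (E k) + ind (rect w w) \<asymp> ind (rect w h) + ind (rect w w)" for k
  proof (induction k)
    case 0
    have "ind T \<asymp> ind (strip w (\<lambda>_. 0) g)" unfolding T_def by (rule eqf_sym[OF eqf_translate[OF nS]])
    then have "ind T + ind (rect w w) \<asymp> ind (strip w (\<lambda>_. 0) g) + ind (rect w w)" by (intro eqf_add eqf_ind nice_rect)
    then show ?case unfolding E using h(2) by (rule eqf_trans)
  next
    case (Suc k)
    show ?case unfolding E by (rule turn_absorb[OF Suc w nE eqf_sym[OF rect_turn_self[OF h(1)]]])
  qed
  have turnD: "z \<in> turn ` A \<longleftrightarrow> (- snd z, fst z) \<in> A" for z A by (rule turn_image)
  have mE: "z \<in> E 0 \<longleftrightarrow> z \<in> D \<and> a < snd z" "z \<in> E 1 \<longleftrightarrow> z \<in> D \<and> a < fst z"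
     "z \<in> E 2 \<longleftrightarrow> z \<in> D \<and> a < - snd z" "z \<in> E 3 \<longleftrightarrow> z \<in> D \<and> a < - fst z" for z
    by (simp_all add: E memT turnD numeral_2_eq_2 numeral_3_eq_3 D_def add.commute)
  define S where "S = {- a..a} \<times> {- a..a}"
  have SD: "S \<subseteq> D"
  proof
    fix z assume "z \<in> S"
    then have "(fst z)\<^sup>2 \<le> a\<^sup>2" "(snd z)\<^sup>2 \<le> a\<^sup>2" using a(1) by (auto simp: S_def abs_le_square_iff[symmetric])
    then show "z \<in> D" using a(2) by (simp add: D_def)
  qed
  have one: "\<not> (a < \<bar>fst z\<bar> \<and> a < \<bar>snd z\<bar>)" if "z \<in> D" for z
  proof
    assume "a < \<bar>fst z\<bar> \<and> a < \<bar>snd z\<bar>"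
    then have "a\<^sup>2 < \<bar>fst z\<bar>\<^sup>2" "a\<^sup>2 < \<bar>snd z\<bar>\<^sup>2" using a(1) by (intro power_strict_mono; simp)+
    then show False using that a(2) by (simp add: D_def)
  qed
  have "ind D = ind S + (ind (E 0) + (ind (E 1) + (ind (E 2) + ind (E 3))))"
  proof
    fix z
    show "ind D z = (ind S + (ind (E 0) + (ind (E 1) + (ind (E 2) + ind (E 3))))) z"
    proof (cases "z \<in> D")
      case True
      have "z \<in> S \<longleftrightarrow> - a \<le> fst z \<and> fst z \<le> a \<and> - a \<le> snd z \<and> snd z \<le> a" by (auto simp: S_def mem_Times_iff)
      then show ?thesis using True one[OF True] a(1) unfolding plus_fun_apply ind_def mE by (auto simp: of_bool_def)
    next
      case False
      then have "z \<notin> S" using SD by blast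
      then show ?thesis using False unfolding plus_fun_apply ind_def mE by simp
    qed
  qed
  moreover have "ind S \<asymp> ind (rect w w)"
  proof -
    have "(+) (- a, - a) ` ({0..w} \<times> {0..w}) = S" unfolding translation_vimage by (auto simp: S_def w_def)
    moreover have "nice ({0..w} \<times> {0..w})" by (rule closed_square_rect(2)[OF w])
    ultimately have "ind S \<asymp> ind ({0..w} \<times> {0..w})" using eqf_sym[OF eqf_translate[of "{0..w} \<times> {0..w}" "(- a, - a)"]] by simp
    then show ?thesis using closed_square_rect(1)[OF w] by (rule eqf_trans)
  qed
  ultimately have "ind D \<asymp> ind (rect w w) + (ind (E 0) + (ind (E 1) + (ind (E 2) + ind (E 3))))"
    by (auto intro!: eqf_add eqf_ind nE)
  \<comment> \<open>The inscribed square serves as the catalyst for the four caps in turn and is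
    stacked with the resulting rectangles only afterwards.\<close>
  also have "\<dots> = (ind (E 0) + ind (rect w w)) + (ind (E 1) + (ind (E 2) + ind (E 3)))" by (simp only: add_ac)
  also have "\<dots> \<asymp> (ind (rect w h) + ind (rect w w)) + (ind (E 1) + (ind (E 2) + ind (E 3)))" by (intro eqf_add eE eqf_ind nE)
  also have "\<dots> = (ind (E 1) + ind (rect w w)) + (ind (rect w h) + (ind (E 2) + ind (E 3)))" by (simp only: add_ac)
  also have "\<dots> \<asymp> (ind (rect w h) + ind (rect w w)) + (ind (rect w h) + (ind (E 2) + ind (E 3)))" by (intro eqf_add eE eqf_ind nE nice_rect)
  also have "\<dots> = (ind (E 2) + ind (rect w w)) + (ind (rect w h) + ind (rect w h) + ind (E 3))" by (simp only: add_ac)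
  also have "\<dots> \<asymp> (ind (rect w h) + ind (rect w w)) + (ind (rect w h) + ind (rect w h) + ind (E 3))" by (intro eqf_add eE eqf_ind nE nice_rect)
  also have "\<dots> = (ind (E 3) + ind (rect w w)) + (ind (rect w h) + ind (rect w h) + ind (rect w h))" by (simp only: add_ac)
  also have "\<dots> \<asymp> (ind (rect w h) + ind (rect w w)) + (ind (rect w h) + ind (rect w h) + ind (rect w h))" by (intro eqf_add eE eqf_ind nE nice_rect)
  also have "\<dots> = (ind (rect w w) + ind (rect w h)) + ind (rect w h) + ind (rect w h) + ind (rect w h)" by (simp only: add_ac)
  also have "\<dots> \<asymp> ind (rect w (w + h)) + ind (rect w h) + ind (rect w h) + ind (rect w h)" using w h by (intro eqf_add rect_stack eqf_ind) auto
  also have "\<dots> \<asymp> ind (rect w (w + h + h)) + ind (rect w h) + ind (rect w h)" using w h by (intro eqf_add rect_stack eqf_ind) auto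
  also have "\<dots> \<asymp> ind (rect w (w + h + h + h)) + ind (rect w h)" using w h by (intro eqf_add rect_stack eqf_ind) auto
  also have "\<dots> \<asymp> ind (rect w (w + h + h + h + h))" using w h by (intro rect_stack) auto
  finally have "ind D \<asymp> ind (rect w (w + h + h + h + h))" .
  moreover have "0 < w + h + h + h + h" using w h(1) by simp
  ultimately show thesis using that w unfolding D_def by blast
qed

subsection \<open>Measure and box dimension\<close>

lemma nice_borel: fixes A :: "'a::metric_space set" shows "nice A \<Longrightarrow> A \<in> sets borel"
proof -
  assume "nice A"
  then have A: "A \<in> algebra UNIV hull {S. fsigma_in euclidean S}"
    unfolding nice_def boolean_fsigma_def generated_algebra_def by blast
  have "algebra UNIV (sets borel :: 'a set set)"
    by (metis sets.sigma_algebra_axioms sigma_algebra.axioms(1) space_borel)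
  moreover have "{S :: 'a set. fsigma_in euclidean S} \<subseteq> sets borel"
  proof clarify
    fix S :: "'a set" assume "fsigma_in euclidean S"
    then obtain C :: "nat \<Rightarrow> 'a set" where "\<And>n. closedin euclidean (C n)" "\<Union>(range C) = S"
      unfolding fsigma_in_ascending by blast
    then have "\<And>n. closed (C n)" "(\<Union>n. C n) = S" by auto
    then show "S \<in> sets borel" using borel_closed by blast
  qed
  ultimately have "algebra UNIV hull {S :: 'a set. fsigma_in euclidean S} \<subseteq> sets borel"
    by (rule hull_minimal[rotated])
  then show ?thesis using A by blast
qed

lemma eqf_nn_integral:
  fixes F G :: "'a::euclidean_space \<Rightarrow> nat"
  assumes "F \<asymp> G"
  shows "(\<integral>\<^sup>+x. of_nat (F x) \<partial>lborel) = (\<integral>\<^sup>+x. of_nat (G x) \<partial>lborel)"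
proof -
  obtain n :: nat and P v where P: "\<And>i. i < n \<Longrightarrow> nice (P i)" "F = (\<Sum>i<n. ind (P i))"
     "G = (\<Sum>i<n. ind ((+) (v i) ` P i))" using assms unfolding eqf_def by auto
  have int: "(\<integral>\<^sup>+x. of_nat ((\<Sum>i<n. ind (A i)) x) \<partial>lborel) = (\<Sum>i<n. emeasure lborel (A i))"
    if A: "\<And>i. i < n \<Longrightarrow> A i \<in> sets borel" for A :: "nat \<Rightarrow> 'a set"
  proof -
    have "of_nat ((\<Sum>i<n. ind (A i)) x) = (\<Sum>i<n. indicator (A i) x :: ennreal)" for x
      by (simp add: sum_fun_apply ind_def indicator_def of_bool_def if_distrib cong: if_cong)
    moreover have "(\<integral>\<^sup>+x. (\<Sum>i<n. indicator (A i) x) \<partial>lborel) = (\<Sum>i<n. \<integral>\<^sup>+x. indicator (A i) x \<partial>lborel)"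
      using A by (intro nn_integral_sum) auto
    ultimately show ?thesis using A by simp
  qed
  have tr: "emeasure lborel ((+) u ` A) = emeasure lborel A" if "A \<in> sets borel" for u and A :: "'a set"
  proof -
    have "emeasure lborel A = emeasure (distr lborel borel ((+) (- u))) A" by (simp add: lborel_distr_plus)
    also have "\<dots> = emeasure lborel ((+) (- u) -` A)" using that by (subst emeasure_distr) auto
    also have "(+) (- u) -` A = (+) u ` A" unfolding translation_vimage by (auto simp: algebra_simps)
    finally show ?thesis by simp
  qed
  have "(+) (v i) ` P i \<in> sets borel" if "i < n" for i by (rule nice_borel[OF nice_translation[OF P(1)[OF that]]])
  then have "(\<integral>\<^sup>+x. of_nat (G x) \<partial>lborel) = (\<Sum>i<n. emeasure lborel ((+) (v i) ` P i))" unfolding P(3) by (rule int)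
  also have "\<dots> = (\<Sum>i<n. emeasure lborel (P i))" by (intro sum.cong refl tr nice_borel P(1)) auto
  also have "\<dots> = (\<integral>\<^sup>+x. of_nat (F x) \<partial>lborel)" unfolding P(2) by (intro int[symmetric] nice_borel P(1))
  finally show ?thesis ..
qed

lemma nn_integral_ind: "A \<in> sets borel \<Longrightarrow> (\<integral>\<^sup>+x. of_nat (ind A x) \<partial>lborel) = emeasure lborel A" for A :: "'a::euclidean_space set"
proof -
  assume "A \<in> sets borel"
  moreover have "of_nat (ind A x) = (indicator A x :: ennreal)" for x by (simp add: ind_def indicator_def)
  ultimately show ?thesis by simp
qed

lemma interior_emeasure_pos:
  fixes A :: "'a::euclidean_space set"
  assumes "nice A" "interior A \<noteq> {}"
  shows "0 < emeasure lborel A"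
proof -
  obtain x e where x: "0 < e" "cball x e \<subseteq> A"
    using assms(2) unfolding mem_interior_cball by (metis ex_in_conv mem_interior_cball)
  have "0 < emeasure lborel (cball x e)" using x(1) by (simp add: emeasure_cball)
  also have "\<dots> \<le> emeasure lborel A" using x(2) nice_borel[OF assms(1)] by (intro emeasure_mono) auto
  finally show ?thesis .
qed

text \<open>Comparison of areas: order e^(-1.987) disks of radius e have total area of order
  e^0.013, which tends to 0 and cannot cover a fixed disk.\<close>

lemma small_interior_empty:
  fixes S :: "(real ^ 2) set"
  assumes "small S" shows "interior S = {}"
proof (rule ccontr)
  assume "interior S \<noteq> {}"
  then obtain x \<rho> where x: "0 < \<rho>" "cball x \<rho> \<subseteq> S" by (metis ex_in_conv mem_interior_cball)
  obtain C where C: "\<And>e. e \<in> {0<..1} \<Longrightarrow> covered S e (C * e powr - 1.987)" using assms unfolding small_def by blast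
  define V where "V = unit_ball_vol 2"
  have V: "0 < V" by (simp add: V_def)
  have vol: "measure lborel (cball p r) = V * r\<^sup>2" if "0 \<le> r" for p :: "real ^ 2" and r
    using content_cball[OF that, of p] by (simp add: V_def)
  have key: "\<rho>\<^sup>2 \<le> C * e powr 0.013" if e: "0 < e" "e \<le> 1" for e
  proof -
    obtain F where F: "finite F" "real (card F) \<le> C * e powr - 1.987" "S \<subseteq> (\<Union>p\<in>F. cball p e)"
      using C[of e] e unfolding covered_def by auto
    have "V * \<rho>\<^sup>2 = measure lborel (cball x \<rho>)" using x(1) by (simp add: vol)
    also have "\<dots> \<le> measure lborel (\<Union>p\<in>F. cball p e)"
    proof (rule measure_mono_fmeasurable)
      show "(\<Union>p\<in>F. cball p e) \<in> fmeasurable lborel" using F(1) by (intro fmeasurable_compact compact_UN) auto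
    qed (use x F in auto)
    also have "\<dots> \<le> (\<Sum>p\<in>F. measure lborel (cball p e))"
      using F(1) by (intro measure_UNION_le) auto
    also have "\<dots> = real (card F) * (V * e\<^sup>2)" using e by (simp add: vol)
    also have "\<dots> \<le> (C * e powr - 1.987) * (V * e\<^sup>2)" using F(2) V by (intro mult_right_mono) auto
    also have "\<dots> = V * (C * (e powr - 1.987 * e powr 2))" using e by (simp add: powr_numeral)
    also have "e powr - 1.987 * e powr 2 = e powr 0.013" by (simp flip: powr_add)
    finally show ?thesis using V by simp
  qed
  have "((\<lambda>e. C * e powr 0.013) \<longlongrightarrow> C * 0) (at_right 0)"
  proof (intro tendsto_intros)
    show "((\<lambda>e::real. e powr 0.013) \<longlongrightarrow> 0) (at_right 0)"
    proof (rule tendsto_zero_powrI)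
      show "((\<lambda>e::real. e) \<longlongrightarrow> 0) (at_right 0)" by (rule tendsto_ident_at)
    qed (auto simp: eventually_at_right_less intro: eventually_mono[OF eventually_at_right_less])
  qed
  then have "\<forall>\<^sub>F e in at_right 0. C * e powr 0.013 < \<rho>\<^sup>2" using x(1) by (intro order_tendstoD(2)) auto
  moreover have "\<forall>\<^sub>F e in at_right 0. e \<in> {0<..<1::real}" by (rule eventually_at_right_real) simp
  ultimately have "\<forall>\<^sub>F e in at_right (0::real). False"
    by eventually_elim (use key in force)
  then show False by simp
qed

text \<open>In each coordinate the index of a box that meets the ball lies in an interval of length
  3, which contains at most 4 integers.\<close>

lemma meeting_boxes_ball:
  fixes p :: "real ^ 2"
  assumes "0 < \<delta>"
  shows "finite (meeting_boxes \<delta> (cball p \<delta>))" "card (meeting_boxes \<delta> (cball p \<delta>)) \<le> 16"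
proof -
  define m where "m i = \<lceil>p $ i / \<delta> - 2\<rceil>" for i
  define B where "B n = cbox (\<chi> i. \<delta> * of_int (n $ i)) (\<chi> i. \<delta> * (of_int (n $ i) + 1))" for n :: "int ^ 2"
  define N where "N = (\<lambda>(a, b). vector [a, b] :: int ^ 2) ` ({m 1..m 1 + 3} \<times> {m 2..m 2 + 3})"
  have "finite N" by (simp add: N_def)
  have "card N \<le> card ({m 1..m 1 + 3} \<times> {m 2..m 2 + 3})" unfolding N_def by (rule card_image_le) simp
  then have N: "card N \<le> 16" by simp
  have sub: "meeting_boxes \<delta> (cball p \<delta>) \<subseteq> B ` N"
  proof
    fix K assume "K \<in> meeting_boxes \<delta> (cball p \<delta>)"
    then have "K \<in> range B" "K \<inter> cball p \<delta> \<noteq> {}"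
      unfolding meeting_boxes_def grid_boxes_def B_def by simp_all
    then obtain n y where "K = B n" "y \<in> K" "y \<in> cball p \<delta>" by blast
    then have n: "K = B n" "y \<in> B n" "dist p y \<le> \<delta>" by auto
    have "n $ i \<in> {m i..m i + 3}" for i
    proof -
      have y: "\<delta> * of_int (n $ i) \<le> y $ i" "y $ i \<le> \<delta> * (of_int (n $ i) + 1)"
        using n(2) unfolding B_def mem_box_cart by auto
      have "\<bar>(p - y) $ i\<bar> \<le> norm (p - y)" by (rule component_le_norm_cart)
      then have "\<bar>p $ i - y $ i\<bar> \<le> \<delta>" using n(3) by (simp add: dist_norm)
      then have "p $ i \<le> (of_int (n $ i) + 2) * \<delta>" "(of_int (n $ i) - 1) * \<delta> \<le> p $ i"
        using y by (auto simp: algebra_simps abs_le_iff)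
      then have "p $ i / \<delta> \<le> of_int (n $ i) + 2" "of_int (n $ i) - 1 \<le> p $ i / \<delta>"
        using assms by (simp_all add: pos_divide_le_eq pos_le_divide_eq)
      then show ?thesis unfolding m_def by (simp add: ceiling_le_iff) linarith
    qed
    moreover have "n = vector [n $ 1, n $ 2]" by (simp add: vec_eq_iff forall_2)
    ultimately have "n \<in> N" unfolding N_def by (intro image_eqI[of _ _ "(n $ 1, n $ 2)"]) auto
    then show "K \<in> B ` N" using n(1) by blast
  qed
  then show "finite (meeting_boxes \<delta> (cball p \<delta>))" using \<open>finite N\<close> finite_surj by blast
  have "card (meeting_boxes \<delta> (cball p \<delta>)) \<le> card (B ` N)" using sub \<open>finite N\<close> by (intro card_mono) auto
  also have "\<dots> \<le> card N" using \<open>finite N\<close> by (rule card_image_le)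
  finally show "card (meeting_boxes \<delta> (cball p \<delta>)) \<le> 16" using N by simp
qed

lemma upper_minkowski_dim_small:
  fixes S :: "(real ^ 2) set"
  assumes "small S" shows "upper_minkowski_dim S \<le> ereal 1.987"
proof -
  obtain C0 where C0: "\<And>e. e \<in> {0<..1} \<Longrightarrow> covered S e (C0 * e powr - 1.987)" using assms unfolding small_def by blast
  \<comment> \<open>At least 1, so that the logarithm of the bound splits into a constant and a
    multiple of ln (1/\<delta>).\<close>
  define C where "C = max C0 1"
  have C: "1 \<le> C" "C0 \<le> C" by (auto simp: C_def)
  have le: "log_box_count \<delta> S / ereal (ln (1 / \<delta>)) \<le> ereal (ln (16 * C) / ln (1 / \<delta>) + 1.987)" if \<delta>: "0 < \<delta>" "\<delta> < 1" for \<delta>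
  proof -
    have l: "0 < ln (1 / \<delta>)" using \<delta> by simp
    obtain F where F: "finite F" "real (card F) \<le> C0 * \<delta> powr - 1.987" "S \<subseteq> (\<Union>p\<in>F. cball p \<delta>)"
      using C0[of \<delta>] \<delta> unfolding covered_def by auto
    have sub: "meeting_boxes \<delta> S \<subseteq> (\<Union>p\<in>F. meeting_boxes \<delta> (cball p \<delta>))"
      using F(3) unfolding meeting_boxes_def by blast
    have fin: "finite (\<Union>p\<in>F. meeting_boxes \<delta> (cball p \<delta>))" using F(1) meeting_boxes_ball(1)[OF \<delta>(1)] by blast
    then have fS: "finite (meeting_boxes \<delta> S)" using sub finite_subset by blast
    have "card (meeting_boxes \<delta> S) \<le> card (\<Union>p\<in>F. meeting_boxes \<delta> (cball p \<delta>))" by (rule card_mono[OF fin sub])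
    also have "\<dots> \<le> (\<Sum>p\<in>F. card (meeting_boxes \<delta> (cball p \<delta>)))" by (rule card_UN_le[OF F(1)])
    also have "\<dots> \<le> (\<Sum>p\<in>F. 16)" by (intro sum_mono meeting_boxes_ball(2) \<delta>)
    finally have "real (card (meeting_boxes \<delta> S)) \<le> 16 * real (card F)" by simp
    also have "\<dots> \<le> 16 * (C * \<delta> powr - 1.987)"
    proof -
      have "C0 * \<delta> powr - 1.987 \<le> C * \<delta> powr - 1.987" using C by (intro mult_right_mono) auto
      then show ?thesis using F(2) by linarith
    qed
    finally have card: "real (card (meeting_boxes \<delta> S)) \<le> 16 * C * \<delta> powr - 1.987" by simp
    show ?thesis
    proof (cases "meeting_boxes \<delta> S = {}")
      case True
      then show ?thesis using l by (simp add: log_box_count_def)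
    next
      case False
      then have "0 < card (meeting_boxes \<delta> S)" using fS by (simp add: card_gt_0_iff)
      then have "ln (real (card (meeting_boxes \<delta> S))) \<le> ln (16 * C * \<delta> powr - 1.987)" using card by simp
      also have "\<dots> = ln (16 * C) + 1.987 * ln (1 / \<delta>)"
        using C \<delta> by (simp add: ln_mult ln_powr ln_div)
      finally have "ln (real (card (meeting_boxes \<delta> S))) / ln (1 / \<delta>) \<le> (ln (16 * C) + 1.987 * ln (1 / \<delta>)) / ln (1 / \<delta>)"
        using l by (intro divide_right_mono) auto
      also have "\<dots> = ln (16 * C) / ln (1 / \<delta>) + 1.987" using l by (simp add: add_divide_distrib)
      finally show ?thesis using fS False l by (simp add: log_box_count_def)
    qed
  qed
  have "upper_minkowski_dim S \<le> Limsup (at_right 0) (\<lambda>\<delta>. ereal (ln (16 * C) / ln (1 / \<delta>) + 1.987))"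
    unfolding upper_minkowski_dim_def
  proof (rule Limsup_mono)
    have "\<forall>\<^sub>F \<delta> in at_right 0. \<delta> \<in> {0<..<1::real}" by (rule eventually_at_right_real) simp
    then show "\<forall>\<^sub>F \<delta> in at_right 0. log_box_count \<delta> S / ereal (ln (1 / \<delta>)) \<le> ereal (ln (16 * C) / ln (1 / \<delta>) + 1.987)"
      by eventually_elim (use le in auto)
  qed
  also have "\<dots> = ereal (0 + 1.987)"
  proof (rule lim_imp_Limsup)
    have "((\<lambda>\<delta>::real. ln (16 * C) / ln (1 / \<delta>) + 1.987) \<longlongrightarrow> 0 + 1.987) (at_right 0)"
    proof (intro tendsto_add tendsto_const)
      have "filterlim (\<lambda>\<delta>::real. inverse \<delta>) at_top (at_right 0)" by (rule filterlim_inverse_at_top_right)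
      then have "filterlim (\<lambda>\<delta>::real. ln (1 / \<delta>)) at_top (at_right 0)"
        unfolding inverse_eq_divide by (rule filterlim_compose[OF ln_at_top])
      then show "((\<lambda>\<delta>::real. ln (16 * C) / ln (1 / \<delta>)) \<longlongrightarrow> 0) (at_right 0)"
        by (intro real_tendsto_divide_at_top[OF tendsto_const])
    qed
    then show "((\<lambda>\<delta>::real. ereal (ln (16 * C) / ln (1 / \<delta>) + 1.987)) \<longlongrightarrow> ereal (0 + 1.987)) (at_right 0)" by simp
  qed simp
  finally show ?thesis by simp
qed

subsection \<open>Pieces with interior\<close>

definition mv :: "'a::ab_group_add set \<times> 'a \<Rightarrow> 'a set" where
  "mv a = (+) (snd a) ` fst a"

text \<open>Disjointness of the pieces and of their images is contained in the two sums being
  indicators. Empty pieces are excluded, so that a piece whose vector is not good is exactly one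
  point.\<close>

definition dec :: "'a::real_normed_vector set \<Rightarrow> 'a set \<Rightarrow> ('a set \<times> 'a) multiset \<Rightarrow> bool" where
  "dec D Q M \<longleftrightarrow> (\<forall>a\<in>#M. nice (fst a) \<and> fst a \<noteq> {}) \<and>
     (\<Sum>a\<in>#M. ind (fst a)) = ind D \<and> (\<Sum>a\<in>#M. ind (mv a)) = ind Q"

lemma dec_replace:
  assumes "dec D Q (X + R)" "\<And>a. a \<in># Y \<Longrightarrow> nice (fst a) \<and> fst a \<noteq> {}"
    "(\<Sum>a\<in>#Y. ind (fst a)) = (\<Sum>a\<in>#X. ind (fst a))" "(\<Sum>a\<in>#Y. ind (mv a)) = (\<Sum>a\<in>#X. ind (mv a))"
  shows "dec D Q (Y + R)"
  using assms unfolding dec_def by auto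

lemma eqf_dec:
  assumes "ind D \<asymp> ind Q" obtains M where "dec D Q M"
proof -
  obtain n :: nat and P v where P: "\<And>i. i < n \<Longrightarrow> nice (P i)" "ind D = (\<Sum>i<n. ind (P i))"
     "ind Q = (\<Sum>i<n. ind ((+) (v i) ` P i))" using assms unfolding eqf_def by auto
  define I where "I = {i \<in> {..<n}. P i \<noteq> {}}"
  have "(\<Sum>i<n. f i) = (\<Sum>i\<in>I. f i)" if "\<And>i. P i = {} \<Longrightarrow> f i = 0" for f :: "nat \<Rightarrow> 'a \<Rightarrow> nat"
    using that by (intro sum.mono_neutral_right) (auto simp: I_def)
  then have "ind D = (\<Sum>i\<in>I. ind (P i))" "ind Q = (\<Sum>i\<in>I. ind ((+) (v i) ` P i))"
    unfolding P(2,3) by simp_all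
  then have "dec D Q (image_mset (\<lambda>i. (P i, v i)) (mset_set I))"
    using P(1) unfolding dec_def by (auto simp: I_def sum_unfold_sum_mset image_mset.compositionality comp_def mv_def)
  then show thesis by (rule that)
qed

lemma sum_mset_ind_le:
  assumes "a \<in># M" "z \<in> f a" shows "1 \<le> (\<Sum>b\<in>#M. ind (f b)) z"
proof -
  obtain R where "M = add_mset a R" using assms(1) by (metis insert_DiffM)
  then show ?thesis using assms(2) by (simp add: ind_def)
qed

lemma dec_mem:
  assumes "dec D Q M"
  shows "z \<in> D \<longleftrightarrow> (\<exists>a\<in>#M. z \<in> fst a)" "z \<in> Q \<longleftrightarrow> (\<exists>a\<in>#M. z \<in> mv a)"
proof -
  have *: "(\<Sum>b\<in>#M. ind (f b)) z = 0" if "\<And>a. a \<in># M \<Longrightarrow> z \<notin> f a" for f :: "_ \<Rightarrow> 'a set"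
    using that by (induction M) (auto simp: ind_def)
  have "z \<in> S \<longleftrightarrow> (\<exists>a\<in>#M. z \<in> f a)" if "(\<Sum>b\<in>#M. ind (f b)) = ind S" for S and f :: "_ \<Rightarrow> 'a set"
  proof (cases "\<exists>a\<in>#M. z \<in> f a")
    case True
    then have "1 \<le> ind S z" using sum_mset_ind_le[of _ M z f] that by auto
    then show ?thesis using True by (cases "z \<in> S") (simp_all add: ind_def)
  next
    case False
    then have "ind S z = 0" using *[of f] that by auto
    then show ?thesis using False by (simp add: ind_def)
  qed
  then show "z \<in> D \<longleftrightarrow> (\<exists>a\<in>#M. z \<in> fst a)" "z \<in> Q \<longleftrightarrow> (\<exists>a\<in>#M. z \<in> mv a)"
    using assms unfolding dec_def by blast+
qed

lemma dec_disjoint: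
  assumes "dec D Q (add_mset a (add_mset b R))" shows "fst a \<inter> fst b = {}" "mv a \<inter> mv b = {}"
proof -
  have *: "f a \<inter> f b = {}" if s: "(\<Sum>c\<in>#add_mset a (add_mset b R). ind (f c)) = ind S" for S and f :: "_ \<Rightarrow> 'a set"
  proof (rule ccontr)
    assume "f a \<inter> f b \<noteq> {}"
    then obtain z where z: "z \<in> f a" "z \<in> f b" by blast
    have "(\<Sum>c\<in>#add_mset a (add_mset b R). ind (f c)) z = ind S z" using s by simp
    then show False using z by (simp add: ind_def of_bool_def split: if_splits)
  qed
  show "fst a \<inter> fst b = {}" "mv a \<inter> mv b = {}"
    using assms *[of fst] *[of mv] unfolding dec_def by blast+
qed

lemma ind_Diff: "W \<subseteq> P \<Longrightarrow> ind W + ind (P - W) = ind P"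
  by (auto simp: ind_def fun_eq_iff)

lemma dec_split:
  assumes d: "dec D Q (add_mset (P, v) R)" and W: "W \<subseteq> P" "nice W" "W \<noteq> {}" "P - W \<noteq> {}"
  shows "dec D Q (add_mset (W, v) (add_mset (P - W, v) R))"
proof -
  have "dec D Q ({#(P, v)#} + R)" using d by simp
  then have "dec D Q ({#(W, v), (P - W, v)#} + R)"
  proof (rule dec_replace)
    have P: "nice P" using d by (simp add: dec_def)
    show "nice (fst a) \<and> fst a \<noteq> {}" if "a \<in># {#(W, v), (P - W, v)#}" for a
      using that W P nice_Diff by auto
    show "(\<Sum>a\<in>#{#(W, v), (P - W, v)#}. ind (fst a)) = (\<Sum>a\<in>#{#(P, v)#}. ind (fst a))"
      using ind_Diff[OF W(1)] by (simp add: add.commute)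
    have "(+) v ` (P - W) = (+) v ` P - (+) v ` W" by (rule image_set_diff) simp
    then show "(\<Sum>a\<in>#{#(W, v), (P - W, v)#}. ind (mv a)) = (\<Sum>a\<in>#{#(P, v)#}. ind (mv a))"
      using ind_Diff[of "(+) v ` W" "(+) v ` P"] W(1) by (simp add: mv_def image_mono add.commute)
  qed
  then show ?thesis by simp
qed

lemma dec_merge:
  assumes d: "dec D Q (add_mset (A, v) (add_mset (B, v) R))"
  shows "dec D Q (add_mset (A \<union> B, v) R)"
proof -
  have "dec D Q ({#(A, v), (B, v)#} + R)" using d by simp
  then have "dec D Q ({#(A \<union> B, v)#} + R)"
  proof (rule dec_replace)
    show "nice (fst a) \<and> fst a \<noteq> {}" if "a \<in># {#(A \<union> B, v)#}" for a
      using that d nice_Un by (auto simp: dec_def)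
    show "(\<Sum>a\<in>#{#(A \<union> B, v)#}. ind (fst a)) = (\<Sum>a\<in>#{#(A, v), (B, v)#}. ind (fst a))"
      using ind_Un[OF dec_disjoint(1)[OF d]] by simp
    show "(\<Sum>a\<in>#{#(A \<union> B, v)#}. ind (mv a)) = (\<Sum>a\<in>#{#(A, v), (B, v)#}. ind (mv a))"
      using ind_Un[OF dec_disjoint(2)[OF d]] by (simp add: mv_def image_Un)
  qed
  then show ?thesis by simp
qed

lemma dec_swap:
  assumes d: "dec D Q (add_mset (W, v1) (add_mset (W', v2) R))"
    and W: "(+) v1' ` W = (+) v2 ` W'" "(+) v2' ` W' = (+) v1 ` W"
  shows "dec D Q (add_mset (W, v1') (add_mset (W', v2') R))"
proof -
  have "dec D Q ({#(W, v1), (W', v2)#} + R)" using d by simp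
  then have "dec D Q ({#(W, v1'), (W', v2')#} + R)"
  proof (rule dec_replace)
    show "nice (fst a) \<and> fst a \<noteq> {}" if "a \<in># {#(W, v1'), (W', v2')#}" for a
      using that d by (auto simp: dec_def)
  qed (use W in \<open>simp_all add: mv_def add.commute\<close>)
  then show ?thesis by simp
qed

lemma interior_Diff_point: "y \<in> interior P \<Longrightarrow> y \<notin> closure W \<Longrightarrow> interior (P - W) \<noteq> {}"
proof -
  assume "y \<in> interior P" "y \<notin> closure W"
  moreover have "open (interior P - closure W)" by (intro open_Diff) auto
  moreover have "interior P - closure W \<subseteq> P - W" using interior_subset closure_subset by blast
  ultimately show ?thesis by (metis DiffI emptyE interiorI)
qed

lemma interior_if_not_frontier: "x \<in> A \<Longrightarrow> x \<notin> frontier A \<Longrightarrow> x \<in> interior A"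
  using closure_subset by (auto simp: frontier_def)

lemma another_point:
  fixes x :: "'a::euclidean_space"
  assumes "x \<in> interior P" "finite F" obtains y where "y \<in> interior P" "y \<notin> F"
proof -
  have "infinite (interior P)" using assms(1) finite_imp_not_open[of "interior P"] by auto
  then show thesis using assms(2) that by (meson finite_subset subsetI)
qed

section \<open>Small nice neighbourhoods in the Euclidean plane\<close>

definition planar :: "real \<times> real \<Rightarrow> real ^ 2" where
  "planar z = vector [fst z, snd z]"

lemma planar: "surj planar" "dist (planar x) (planar y) = dist x y"
proof -
  have "planar (z $ 1, z $ 2) = z" for z by (simp add: planar_def vec_eq_iff forall_2)
  then show "surj planar" by (rule surjI)
  show "dist (planar x) (planar y) = dist x y"
    by (simp add: planar_def dist_prod_def dist_vec_def L2_set_def sum_2)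
qed

lemma isometry_interior:
  fixes g :: "'a::metric_space \<Rightarrow> 'b::metric_space"
  assumes g: "surj g" "\<And>x y. dist (g x) (g y) = dist x y" and x: "x \<in> interior A"
  shows "g x \<in> interior (g ` A)"
proof -
  obtain e where e: "0 < e" "ball x e \<subseteq> A" using x unfolding mem_interior by blast
  have "ball (g x) e \<subseteq> g ` A"
  proof
    fix y assume y: "y \<in> ball (g x) e"
    obtain z where z: "y = g z" using g(1) by (metis surjD)
    then have "z \<in> ball x e" using y by (simp add: g(2))
    then show "y \<in> g ` A" using e(2) z by blast
  qed
  then show ?thesis using e(1) unfolding mem_interior by blast
qed

lemma nice_neighbourhood:
  fixes x :: "real ^ 2"
  assumes "0 < \<delta>" obtains W where "nice W" "x \<in> interior W" "W \<subseteq> ball x \<delta>"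
proof -
  obtain z where z: "x = planar z" using planar(1) by (metis surjD)
  define e where "e = \<delta> / 3"
  have e: "0 < e" using assms by (simp add: e_def)
  define B where "B = {fst z - e..<fst z + e} \<times> {snd z - e<..snd z + e}"
  have ball: "ball z e \<subseteq> B"
  proof
    fix y assume "y \<in> ball z e"
    then have "dist (fst z) (fst y) < e" "dist (snd z) (snd y) < e"
      using dist_fst_le[of z y] dist_snd_le[of z y] by auto
    then show "y \<in> B" by (auto simp: B_def mem_Times_iff dist_real_def)
  qed
  have "planar ` B \<subseteq> ball x \<delta>"
  proof clarify
    fix a b assume ab: "(a, b) \<in> B"
    have "dist z (a, b) \<le> dist (fst z) a + dist (snd z) b" by (cases z) (simp add: dist_Pair_Pair sqrt_sum_squares_le_sum)
    also have "\<dots> \<le> e + e" using ab by (intro add_mono) (auto simp: B_def dist_real_def)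
    also have "e + e < \<delta>" using assms by (simp add: e_def)
    finally show "planar (a, b) \<in> ball x \<delta>" by (simp add: z planar(2))
  qed
  moreover have "x \<in> interior (planar ` B)"
    unfolding z using ball e by (intro isometry_interior planar) (auto simp: mem_interior)
  moreover have "nice (planar ` B)" unfolding B_def by (intro nice_isometry nice_halfopen_box planar)
  ultimately show thesis using that by blast
qed

text \<open>The vectors that some piece with interior could have. A piece without interior can be
  merged into one with interior only if its own vector is of this kind.\<close>

definition good :: "'a::real_normed_vector set \<Rightarrow> 'a set \<Rightarrow> 'a \<Rightarrow> bool" where
  "good D Q v \<longleftrightarrow> (\<exists>x. x \<in> interior D \<and> x + v \<in> interior Q)"

lemma open_avoids_frontiers:
  fixes U :: "(real ^ 2) set"
  assumes U: "open U" "x \<in> U" and S: "finite I" "\<And>i. i \<in> I \<Longrightarrow> small (S i)"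
  obtains y where "y \<in> U" "\<And>i. i \<in> I \<Longrightarrow> y \<notin> S i"
proof -
  have "small (\<Union>i\<in>I. S i)" using S by (induction I rule: finite_induct) (auto intro: small_Un)
  then have "interior (\<Union>i\<in>I. S i) = {}" by (rule small_interior_empty)
  then have "\<not> U \<subseteq> (\<Union>i\<in>I. S i)" using U by (metis emptyE interiorI)
  then show thesis using that by blast
qed

text \<open>The properties of the closed disk and the closed square that the merging uses. The
  midpoint condition expresses strict convexity, which the disk has and the square has not; so D and
  Q enter differently.\<close>

locale target =
  fixes D Q :: "(real ^ 2) set"
  assumes D: "D \<subseteq> closure (interior D)" "D \<noteq> {}" "\<And>x y. x \<in> D \<Longrightarrow> y \<in> D \<Longrightarrow> x \<noteq> y \<Longrightarrow> midpoint x y \<in> interior D"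
    and Q: "Q \<subseteq> closure (interior Q)" "convex Q"
begin

lemma goodI1: "z \<in> interior D \<Longrightarrow> z + v \<in> Q \<Longrightarrow> good D Q v"
proof -
  assume z: "z \<in> interior D" "z + v \<in> Q"
  have "open ((+) v ` interior D)" by (intro open_translation open_interior)
  moreover have "z + v \<in> (+) v ` interior D" using z(1) by (auto simp: add.commute)
  moreover have "z + v \<in> closure (interior Q)" using z(2) Q(1) by blast
  ultimately obtain y where "y \<in> (+) v ` interior D" "y \<in> interior Q"
    unfolding closure_iff_nhds_not_empty by blast
  then show ?thesis unfolding good_def by (auto simp: add.commute)
qed

lemma goodI2: "z \<in> D \<Longrightarrow> z + v \<in> interior Q \<Longrightarrow> good D Q v"
proof -
  assume z: "z \<in> D" "z + v \<in> interior Q"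
  have "open ((+) (- v) ` interior Q)" by (intro open_translation open_interior)
  moreover have "z \<in> (+) (- v) ` interior Q" using z(2) unfolding translation_vimage by simp
  moreover have "z \<in> closure (interior D)" using z(1) D(1) by blast
  ultimately obtain y where "y \<in> (+) (- v) ` interior Q" "y \<in> interior D"
    unfolding closure_iff_nhds_not_empty by blast
  then show ?thesis unfolding good_def translation_vimage by auto
qed

text \<open>Two distinct points of the piece would have their midpoint in the interior of D, and by
  convexity its translate would lie in Q, which makes the vector good.\<close>

lemma bad_singleton:
  assumes "dec D Q M" "(A, v) \<in># M" "\<not> good D Q v" obtains p where "A = {p}"
proof -
  have sub: "A \<subseteq> D" "(+) v ` A \<subseteq> Q" using dec_mem[OF assms(1)] assms(2) by (fastforce simp: mv_def)+
  have "x = y" if "x \<in> A" "y \<in> A" for x y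
  proof (rule ccontr)
    assume "x \<noteq> y"
    then have "midpoint x y \<in> interior D" using sub that D(3) by blast
    moreover have "midpoint x y + v \<in> Q"
    proof -
      have "v + x \<in> Q" "v + y \<in> Q" using sub that by blast+
      then have "(1/2) *\<^sub>R (v + x) + (1/2) *\<^sub>R (v + y) \<in> Q" using convexD[OF Q(2)] by simp
      also have "(1/2) *\<^sub>R (v + x) + (1/2) *\<^sub>R (v + y) = midpoint x y + v"
        by (simp add: midpoint_def vec_eq_iff field_simps)
      finally show ?thesis .
    qed
    ultimately show False using goodI1 assms(3) by blast
  qed
  moreover have "A \<noteq> {}" using assms(1,2) unfolding dec_def by fastforce
  ultimately show thesis using that by blast
qed

lemma dec_subset:
  assumes "dec D Q M" "a \<in># M"
  shows "interior (fst a) \<subseteq> interior D" "fst a \<subseteq> D" "mv a \<subseteq> Q" "z \<in> interior (fst a) \<Longrightarrow> z + snd a \<in> interior Q"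
proof -
  show 1: "fst a \<subseteq> D" "mv a \<subseteq> Q" using dec_mem[OF assms(1)] assms(2) by blast+
  show "interior (fst a) \<subseteq> interior D" by (rule interior_mono[OF 1(1)])
  assume "z \<in> interior (fst a)"
  then have "z + snd a \<in> interior (mv a)" unfolding mv_def interior_translation by (auto simp: add.commute)
  then show "z + snd a \<in> interior Q" using interior_mono[OF 1(2)] by blast
qed

lemma nice_singleton: "nice {x :: real ^ 2}"
proof -
  have "fsigma_in euclidean {x}" by (simp add: closed_imp_fsigma_in)
  moreover have "small {x}"
  proof (rule small_if_covered)
    fix e :: real assume e: "0 < e" "e \<le> 1"
    then have "covered {x} e 1" unfolding covered_def by (intro exI[of _ "{x}"]) auto
    then show "covered {x} e (1 / e)" using e by (elim covered_mono) auto
  qed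
  ultimately show ?thesis unfolding nice_def using small_mono[of "{x}" "frontier {x}"] boolean_fsigma_fsigma frontier_subset_closed[of "{x}"] by auto
qed

text \<open>The single point p of the bad piece exchanges its target with a point y in the interior
  of D that is also interior to its own piece. The two new vectors are good, since y is interior to
  D and the target which p receives is interior to Q.\<close>

lemma reroute_bad:
  assumes d: "dec D Q M" and a: "a \<in># M" "\<not> good D Q (snd a)"
  shows "\<exists>M'. dec D Q M' \<and> size {#a \<in># M'. \<not> good D Q (snd a)#} < size {#a \<in># M. \<not> good D Q (snd a)#}"
proof -
  obtain A v where av: "a = (A, v)" by (cases a)
  obtain p where p: "A = {p}" using bad_singleton[OF d, of A v] a av by auto
  have "interior D \<noteq> {}" using D(1,2) by (metis closure_empty subset_empty)
  then obtain x where x: "x \<in> interior D" by blast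
  have sm: "small (frontier (fst b))" if "b \<in> set_mset M" for b using d that unfolding dec_def nice_def by blast
  obtain y where y: "y \<in> interior D" "\<And>b. b \<in> set_mset M \<Longrightarrow> y \<notin> frontier (fst b)"
    by (rule open_avoids_frontiers[OF open_interior x finite_set_mset[of M], where S = "\<lambda>b. frontier (fst b)"]) (use sm that in auto)
  have "y \<in> D" using y(1) interior_subset by blast
  then obtain b where b: "b \<in># M" "y \<in> fst b" using dec_mem(1)[OF d] by blast
  then have yb: "y \<in> interior (fst b)" using y(2)[of b] by (intro interior_if_not_frontier) auto
  obtain B w where bw: "b = (B, w)" by (cases b)
  have gw: "good D Q w" using goodI1[OF y(1), of w] dec_subset(3)[OF d b(1)] b(2) by (auto simp: bw mv_def add.commute)
  have "b \<noteq> a" using gw a(2) bw by auto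
  then obtain R where M: "M = add_mset b (add_mset a R)" using a(1) b(1) by (metis insert_noteq_member multi_member_split)
  obtain y' where "y' \<in> interior B" "y' \<notin> {y}" using another_point[of y B "{y}"] yb bw by auto
  then have ne: "B - {y} \<noteq> {}" using interior_subset by blast
  have "dec D Q (add_mset ({y}, w) (add_mset (B - {y}, w) (add_mset ({p}, v) R)))"
    using d b(2) ne unfolding M av bw p by (intro dec_split nice_singleton) auto
  then have "dec D Q (add_mset ({y}, w) (add_mset ({p}, v) (add_mset (B - {y}, w) R)))" by (simp only: add_mset_commute)
  then have d': "dec D Q (add_mset ({y}, p + v - y) (add_mset ({p}, y + w - p) (add_mset (B - {y}, w) R)))"
    by (rule dec_swap) (simp_all add: add.commute)
  have "p \<in> D" "p + v \<in> Q" using dec_subset(2,3)[OF d a(1)] by (auto simp: av p mv_def add.commute)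
  then have "good D Q (p + v - y)" "good D Q (y + w - p)"
    using goodI1[OF y(1), of "p + v - y"] goodI2[of p "y + w - p"] dec_subset(4)[OF d b(1) yb] by (auto simp: bw)
  then have "size {#a \<in># add_mset ({y}, p + v - y) (add_mset ({p}, y + w - p) (add_mset (B - {y}, w) R)). \<not> good D Q (snd a)#}
     < size {#a \<in># M. \<not> good D Q (snd a)#}"
    using gw a(2) by (simp add: M bw)
  then show ?thesis using d' by blast
qed

text \<open>A thin piece A with vector v has to meet a fat piece with the same vector. Take a
  generic y such that y is interior to a piece B and y + v is interior to the image of a piece C. A
  neighbourhood W of y in B and its translate W' in C exchange their targets; then W moves by v and
  is united with A. If C already moves by v, it is united with A directly.\<close>

lemma reroute_thin:
  assumes d: "dec D Q M" and g: "\<And>b. b \<in># M \<Longrightarrow> good D Q (snd b)" and a: "a \<in># M" "interior (fst a) = {}"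
  shows "\<exists>M'. dec D Q M' \<and> (\<forall>b\<in>#M'. good D Q (snd b)) \<and>
     size {#b \<in># M'. interior (fst b) = {}#} < size {#b \<in># M. interior (fst b) = {}#}"
proof -
  obtain A v where av: "a = (A, v)" by (cases a)
  define U where "U = interior D \<inter> (+) (- v) ` interior Q"
  have U: "open U" unfolding U_def by (intro open_Int open_translation open_interior)
  obtain x where x: "x \<in> U" using g[OF a(1)] unfolding good_def U_def translation_vimage av by auto
  define \<S> where "\<S> = (\<lambda>b. frontier (fst b)) ` set_mset M \<union> (\<lambda>b. frontier ((+) (- v) ` mv b)) ` set_mset M"
  have sm: "small S" if "S \<in> \<S>" for S
  proof -
    have "nice (fst b)" "nice ((+) (- v) ` mv b)" if "b \<in># M" for b
      using d that nice_translation unfolding dec_def mv_def by blast+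
    then show ?thesis using that unfolding \<S>_def nice_def by blast
  qed
  have "finite \<S>" by (simp add: \<S>_def)
  then obtain y where y: "y \<in> U" "\<And>S. S \<in> \<S> \<Longrightarrow> y \<notin> S"
    using open_avoids_frontiers[OF U x, of \<S> "\<lambda>S. S"] sm by blast
  have yD: "y \<in> interior D" "y + v \<in> interior Q" using y(1) unfolding U_def translation_vimage by auto
  then have "y \<in> D" "y + v \<in> Q" using interior_subset by blast+
  then obtain b c where b: "b \<in># M" "y \<in> fst b" and c: "c \<in># M" "y + v \<in> mv c" using dec_mem[OF d] by blast
  obtain B w where bw: "b = (B, w)" by (cases b)
  obtain C w' where cw: "c = (C, w')" by (cases c)
  define u where "u = v - w'"
  have "frontier (fst b) \<in> \<S>" using b(1) unfolding \<S>_def by blast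
  then have yB: "y \<in> interior B" using y(2) b(2) unfolding bw by (intro interior_if_not_frontier) auto
  have yC: "y + u \<in> interior C"
  proof -
    have "y \<in> (+) (- v) ` mv c" unfolding translation_vimage using c(2) by simp
    moreover have "y \<notin> frontier ((+) (- v) ` mv c)" using y(2) c(1) unfolding \<S>_def by blast
    ultimately have "y \<in> interior ((+) (- v) ` mv c)" by (rule interior_if_not_frontier)
    also have "(+) (- v) ` mv c = (+) (- u) ` C"
      unfolding mv_def cw fst_conv snd_conv image_image u_def by (intro image_cong) (auto simp: algebra_simps)
    finally have "y \<in> (+) (- u) ` interior C" unfolding interior_translation .
    then show ?thesis unfolding translation_vimage by simp
  qed
  have gv: "good D Q v" using g[OF a(1)] by (simp add: av)
  have bca: "b \<noteq> a" "c \<noteq> a" using yB yC a(2) unfolding bw cw by auto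
  show ?thesis
  proof (cases "w' = v")
    case True
    obtain R where M: "M = add_mset a (add_mset c R)" using a(1) c(1) bca by (metis insert_noteq_member multi_member_split)
    have "dec D Q (add_mset (A \<union> C, v) R)" using d True unfolding M av cw by (intro dec_merge) auto
    moreover have "interior (A \<union> C) \<noteq> {}" using yC interior_mono[of C "A \<union> C"] by auto
    then have "size {#b \<in># add_mset (A \<union> C, v) R. interior (fst b) = {}#} < size {#b \<in># M. interior (fst b) = {}#}"
      using a(2) yC by (auto simp: M cw)
    moreover have "\<forall>b\<in>#add_mset (A \<union> C, v) R. good D Q (snd b)" using g gv by (simp add: M)
    ultimately show ?thesis by blast
  next
    case False
    then have u: "u \<noteq> 0" by (simp add: u_def)
    obtain R where M: "M = add_mset b (add_mset a R)" using a(1) b(1) bca by (metis insert_noteq_member multi_member_split)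
    obtain y1 where y1: "y1 \<in> interior B" "y1 \<notin> {y, y + u}" using another_point[OF yB, of "{y, y + u}"] by auto
    obtain y2 where y2: "y2 \<in> interior C" "y2 \<notin> {y, y + u}" using another_point[OF yC, of "{y, y + u}"] by auto
    \<comment> \<open>The ball of radius \<open>norm u / 2\<close> keeps W and W' disjoint, even
      when B and C are the same piece. The four removed points keep y1 and y2 away from the closures
      of the cut-out sets, so that the rests of B and C still have interior.\<close>
    define O1 where "O1 = interior B \<inter> (+) (- u) ` interior C \<inter> ball y (norm u / 2) - {y1, y2, y1 - u, y2 - u}"
    have "open O1" unfolding O1_def by (intro open_Diff open_Int open_translation open_interior open_ball finite_imp_closed) auto
    moreover have "y \<in> O1" using yB yC y1 y2 u unfolding O1_def translation_vimage by auto
    ultimately obtain \<delta> where \<delta>: "0 < \<delta>" "cball y \<delta> \<subseteq> O1" unfolding open_contains_cball by blast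
    obtain W where W: "nice W" "y \<in> interior W" "W \<subseteq> ball y \<delta>" using nice_neighbourhood[OF \<delta>(1)] by blast
    have cW: "closure W \<subseteq> O1"
    proof -
      have "W \<subseteq> cball y \<delta>" using W(3) ball_subset_cball by blast
      then have "closure W \<subseteq> cball y \<delta>" by (intro closure_minimal) auto
      then show ?thesis using \<delta>(2) by blast
    qed
    have WO: "W \<subseteq> O1" using cW closure_subset by blast
    define W' where "W' = (+) u ` W"
    have W': "nice W'" "interior W' \<noteq> {}" using W by (auto simp: W'_def nice_translation interior_translation)
    have cW': "z \<in> closure W' \<longleftrightarrow> z - u \<in> closure W" for z
      unfolding W'_def closure_translation unfolding translation_vimage by simp
    have WB: "W \<subseteq> B" using WO interior_subset[of B] by (auto simp: O1_def)
    have WC: "W' \<subseteq> C"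
    proof -
      have "W \<subseteq> (+) (- u) ` interior C" using WO by (auto simp: O1_def)
      then show ?thesis unfolding W'_def translation_vimage using interior_subset[of C] by fastforce
    qed
    have WW': "W \<inter> W' = {}"
    proof (rule ccontr)
      assume "W \<inter> W' \<noteq> {}"
      then obtain z where z: "z \<in> W" "z - u \<in> W" unfolding W'_def translation_vimage by auto
      then have "dist y z < norm u / 2" "dist y (z - u) < norm u / 2" using WO by (auto simp: O1_def)
      then have "dist z (z - u) < norm u" using dist_triangle2[of z "z - u" y] by (simp add: dist_commute)
      then show False by (simp add: dist_norm)
    qed
    have out: "y1 \<notin> closure W" "y1 \<notin> closure W'" "y2 \<notin> closure W'"
      using cW unfolding cW' by (auto simp: O1_def)
    have fB: "interior (B - W) \<noteq> {}" by (rule interior_Diff_point[OF y1(1) out(1)])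
    have Wne: "W \<noteq> {}" "W' \<noteq> {}" using W(2) interior_subset W'(2) by auto
    have "dec D Q (add_mset (W, w) (add_mset (B - W, w) (add_mset a R)))"
      using d WB W(1) Wne fB interior_subset unfolding M bw by (intro dec_split) auto
    then have d1: "dec D Q (add_mset (W, w) (add_mset a (add_mset (B - W, w) R)))" by (simp only: add_mset_commute)
    have "c = b \<or> c \<in># R" using c(1) bca(2) by (auto simp: M)
    \<comment> \<open>E is the piece from which W' is cut: C itself, or what W has left of B when C
      and B are the same piece.\<close>
    then obtain E R' where E: "add_mset (B - W, w) R = add_mset (E, w') R'" "W' \<subseteq> E" "interior (E - W') \<noteq> {}"
    proof
      assume "c = b"
      then have "C = B" "w' = w" by (auto simp: bw cw)
      moreover have "interior (B - (W \<union> W')) \<noteq> {}"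
        using interior_Diff_point[OF y1(1), of "W \<union> W'"] out by simp
      ultimately show thesis using WC WW' by (intro that[of "B - W" R]) (auto simp: Diff_Un Diff_Int_distrib set_diff_eq)
    next
      assume "c \<in># R"
      then obtain R1 where "R = add_mset (C, w') R1" unfolding cw by (metis multi_member_split)
      then show thesis using WC interior_Diff_point[OF y2(1) out(3)]
        by (intro that[of C "add_mset (B - W, w) R1"]) auto
    qed
    have "dec D Q (add_mset (E, w') (add_mset (W, w) (add_mset a R')))" using d1 unfolding E(1) by (simp only: add_mset_commute)
    then have "dec D Q (add_mset (W', w') (add_mset (E - W', w') (add_mset (W, w) (add_mset a R'))))"
      using E interior_subset W' Wne by (intro dec_split) auto
    then have "dec D Q (add_mset (W, w) (add_mset (W', w') (add_mset a (add_mset (E - W', w') R'))))" by (simp only: add_mset_commute)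
    then have "dec D Q (add_mset (W, v) (add_mset (W', w - u) (add_mset a (add_mset (E - W', w') R'))))"
    proof (rule dec_swap)
      show "(+) v ` W = (+) w' ` W'" "(+) (w - u) ` W' = (+) w ` W" by (simp_all add: W'_def u_def image_image)
    qed
    then have "dec D Q (add_mset (W, v) (add_mset (A, v) (add_mset (W', w - u) (add_mset (E - W', w') R'))))"
      unfolding av by (simp only: add_mset_commute)
    then have d2: "dec D Q (add_mset (W \<union> A, v) (add_mset (W', w - u) (add_mset (E - W', w') R')))" by (rule dec_merge)
    have fE: "interior E \<noteq> {}" using E(3) interior_mono[of "E - W'" E] by auto
    have fat: "interior (W \<union> A) \<noteq> {}" using W(2) interior_mono[of W "W \<union> A"] by auto
    have eqR: "{#b \<in># R'. interior (fst b) = {}#} = {#b \<in># R. interior (fst b) = {}#}"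
    proof -
      have "{#b \<in># add_mset (E, w') R'. interior (fst b) = {}#} = {#b \<in># add_mset (B - W, w) R. interior (fst b) = {}#}"
        by (simp only: E(1))
      then show ?thesis using fE fB by simp
    qed
    have "size {#b \<in># add_mset (W \<union> A, v) (add_mset (W', w - u) (add_mset (E - W', w') R')). interior (fst b) = {}#}
       < size {#b \<in># M. interior (fst b) = {}#}"
      using fat W'(2) E(3) a(2) yB by (auto simp: M bw eqR)
    moreover have "\<forall>b\<in>#add_mset (W \<union> A, v) (add_mset (W', w - u) (add_mset (E - W', w') R')). good D Q (snd b)"
    proof -
      have "good D Q (w - u)"
      proof (rule goodI1)
        show "y + u \<in> interior D" using yC dec_subset(1)[OF d c(1)] by (auto simp: cw)
        show "y + u + (w - u) \<in> Q" using b(2) dec_subset(3)[OF d b(1)] by (auto simp: bw mv_def add.commute)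
      qed
      moreover have "good D Q (snd z)" if "z \<in># add_mset (E, w') R'" for z
      proof -
        have "z = (B - W, w) \<or> z \<in># R" using that unfolding E(1)[symmetric] by simp
        then show ?thesis using g[OF b(1)] g[of z] by (auto simp: M bw)
      qed
      then have "good D Q w'" "\<forall>z\<in>#R'. good D Q (snd z)" by fastforce+
      ultimately show ?thesis using gv by simp
    qed
    ultimately show ?thesis using d2 by blast
  qed
qed

lemma fat_decomposition:
  assumes "ind D \<asymp> ind Q"
  obtains N P t where "translation_equidecomposition N P t D Q" "\<And>i. i < N \<Longrightarrow> nice (P i) \<and> interior (P i) \<noteq> {}"
proof -
  obtain M0 where M0: "dec D Q M0" using eqf_dec[OF assms] by blast
  have "\<exists>M. dec D Q M \<and> (\<forall>b\<in>#M. good D Q (snd b))"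
    using M0
  proof (induction "size {#a \<in># M0. \<not> good D Q (snd a)#}" arbitrary: M0 rule: less_induct)
    case less
    show ?case
    proof (cases "\<forall>b\<in>#M0. good D Q (snd b)")
      case False
      then obtain a where "a \<in># M0" "\<not> good D Q (snd a)" by blast
      from reroute_bad[OF less.prems this] show ?thesis using less.hyps by blast
    qed (use less.prems in blast)
  qed
  then obtain M1 where M1: "dec D Q M1" "\<forall>b\<in>#M1. good D Q (snd b)" by blast
  have "\<exists>M. dec D Q M \<and> (\<forall>b\<in>#M. interior (fst b) \<noteq> {})"
    using M1
  proof (induction "size {#b \<in># M1. interior (fst b) = {}#}" arbitrary: M1 rule: less_induct)
    case less
    show ?case
    proof (cases "\<forall>b\<in>#M1. interior (fst b) \<noteq> {}")
      case False
      then obtain a where a: "a \<in># M1" "interior (fst a) = {}" by blast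
      show ?thesis using reroute_thin[OF less.prems(1) _ a] less.prems(2) less.hyps by blast
    qed (use less.prems in blast)
  qed
  then obtain M where M: "dec D Q M" "\<And>b. b \<in># M \<Longrightarrow> interior (fst b) \<noteq> {}" by blast
  obtain xs where xs: "mset xs = M" using ex_mset by blast
  define N where "N = length xs"
  define P where "P i = fst (xs ! i)" for i
  define t where "t i = snd (xs ! i)" for i
  have sum: "(\<Sum>a\<in>#M. f a) = (\<Sum>i<N. f (xs ! i))" for f :: "_ \<Rightarrow> real ^ 2 \<Rightarrow> nat"
  proof -
    have "(\<Sum>a\<in>#M. f a) = sum_list (map f xs)" unfolding xs[symmetric] by (simp only: mset_map[symmetric] sum_mset_sum_list)
    also have "\<dots> = (\<Sum>i<N. map f xs ! i)" unfolding N_def sum_list_sum_nth atLeast0LessThan length_map ..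
    also have "\<dots> = (\<Sum>i<N. f (xs ! i))" by (intro sum.cong) (auto simp: N_def)
    finally show ?thesis .
  qed
  have part: "(\<Union>i<N. A i) = S \<and> disjoint_family_on A {..<N}" if s: "(\<Sum>i<N. ind (A i)) = ind S" for A :: "nat \<Rightarrow> (real ^ 2) set" and S
  proof
    have card: "card {i \<in> {..<N}. z \<in> A i} = ind S z" for z
      using sum_ind_card[of "{..<N}" A z] s by simp
    show "(\<Union>i<N. A i) = S"
    proof (intro set_eqI)
      fix z
      have "z \<in> S \<longleftrightarrow> card {i \<in> {..<N}. z \<in> A i} \<noteq> 0" unfolding card by (simp add: ind_def)
      also have "\<dots> \<longleftrightarrow> z \<in> (\<Union>i<N. A i)" by auto
      finally show "z \<in> (\<Union>i<N. A i) \<longleftrightarrow> z \<in> S" by blast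
    qed
    show "disjoint_family_on A {..<N}"
      unfolding disjoint_family_on_def
    proof (intro ballI impI)
      fix i j assume ij: "i \<in> {..<N}" "j \<in> {..<N}" "i \<noteq> j"
      have False if z: "z \<in> A i" "z \<in> A j" for z
      proof -
        have "card {i, j} \<le> card {i \<in> {..<N}. z \<in> A i}" using ij z by (intro card_mono) auto
        then show False using ij(3) unfolding card by (cases "z \<in> S") (simp_all add: ind_def)
      qed
      then show "A i \<inter> A j = {}" by blast
    qed
  qed
  have "translation_equidecomposition N P t D Q"
    unfolding translation_equidecomposition_def
    using part[of P D] part[of "\<lambda>i. (+) (t i) ` P i" Q] M(1) unfolding dec_def sum mv_def P_def t_def by auto
  moreover have "nice (P i) \<and> interior (P i) \<noteq> {}" if "i < N" for i
  proof -
    have "xs ! i \<in># M" using that unfolding xs[symmetric] N_def by simp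
    then show ?thesis using M unfolding dec_def P_def by blast
  qed
  ultimately show thesis by (rule that)
qed

end

subsection \<open>The equidecomposition\<close>

lemma eqf_emeasure_add:
  fixes A B C :: "'a::euclidean_space set"
  assumes "ind A + ind B \<asymp> ind C" "A \<in> sets borel" "B \<in> sets borel" "C \<in> sets borel"
  shows "emeasure lborel A + emeasure lborel B = emeasure lborel C"
proof -
  have "of_nat (ind S x) = (indicator S x :: ennreal)" for S :: "'a set" and x by (simp add: ind_def indicator_def)
  then have "(\<integral>\<^sup>+x. of_nat ((ind A + ind B) x) \<partial>lborel) = (\<integral>\<^sup>+x. indicator A x + indicator B x \<partial>lborel)" by simp
  also have "\<dots> = emeasure lborel A + emeasure lborel B" using assms by (subst nn_integral_add) auto
  finally show ?thesis using eqf_nn_integral[OF assms(1)] nn_integral_ind[OF assms(4)] by simp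
qed

lemma midpoint_in_ball:
  fixes c :: "'a::real_inner"
  assumes "x \<in> cball c r" "y \<in> cball c r" "x \<noteq> y" shows "midpoint x y \<in> ball c r"
proof -
  define a b where "a = x - c" and "b = y - c"
  have ab: "norm a \<le> r" "norm b \<le> r" "a - b \<noteq> 0" using assms by (auto simp: a_def b_def dist_norm norm_minus_commute)
  have r: "0 \<le> r" using ab(1) norm_ge_zero order_trans by blast
  have "(norm (a + b))\<^sup>2 + (norm (a - b))\<^sup>2 = 2 * (norm a)\<^sup>2 + 2 * (norm b)\<^sup>2"
    by (simp add: power2_norm_eq_inner inner_add inner_diff inner_commute)
  moreover have "(norm a)\<^sup>2 \<le> r\<^sup>2" "(norm b)\<^sup>2 \<le> r\<^sup>2" using ab by (auto intro: power_mono)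
  moreover have "0 < (norm (a - b))\<^sup>2" using ab(3) by simp
  moreover have "(2 * r)\<^sup>2 = 4 * r\<^sup>2" by (simp add: power_mult_distrib)
  ultimately have "(norm (a + b))\<^sup>2 < (2 * r)\<^sup>2" by linarith
  then have "norm (a + b) < 2 * r" by (rule power2_less_imp_less) (use r in simp)
  moreover have "c - midpoint x y = - ((1 / 2) *\<^sub>R (a + b))"
  proof -
    have "c = (1 / 2) *\<^sub>R c + (1 / 2) *\<^sub>R c" by (simp flip: scaleR_add_left)
    then show ?thesis by (simp add: midpoint_def a_def b_def algebra_simps)
  qed
  then have "norm (c - midpoint x y) = norm (a + b) / 2" by simp
  ultimately show ?thesis by (simp add: dist_norm)
qed

theorem theorem1p2:
  fixes c :: "real ^ 2" and r :: real and D Q :: "(real ^ 2) set"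
  assumes "r > 0" and "D = cball c r"
    and "closed_square Q"
    and "measure lebesgue D = measure lebesgue Q"
  shows "\<exists>N P t. translation_equidecomposition N P t D Q \<and>
           (\<forall>i<N. upper_minkowski_dim (frontier (P i)) \<le> ereal 1.987 \<and>
                  P i \<in> generated_algebra {S. fsigma_in euclidean S} \<and>
                  emeasure lebesgue (P i) > 0)"
proof -
  obtain p u v where u: "u \<noteq> 0" "norm v = norm u" "u \<bullet> v = 0"
    and Q: "Q = {p + a *\<^sub>R u + b *\<^sub>R v | a b. a \<in> {0..1} \<and> b \<in> {0..1}}"
    using assms(3) unfolding closed_square_def by blast
  define q where "q = norm u"
  have q: "0 < q" using u by (simp add: q_def)
  \<comment> \<open>A linear isometry onto the plane that maps the axes to the directions of the
    sides of Q. The disk is invariant under rotations about its centre, so it can be described in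
    the same coordinates.\<close>
  define h where "h z = (fst z / q) *\<^sub>R u + (snd z / q) *\<^sub>R v" for z :: "real \<times> real"
  define f where "f z = p + h z" for z
  have h_add: "h (x + y) = h x + h y" for x y by (simp add: h_def add_divide_distrib algebra_simps)
  have h_diff: "h x - h y = h (x - y)" for x y by (simp add: h_def diff_divide_distrib algebra_simps)
  have h_norm: "norm (h z) = norm z" for z
  proof -
    have "(norm (h z))\<^sup>2 = (fst z / q)\<^sup>2 * (norm u)\<^sup>2 + (snd z / q)\<^sup>2 * (norm v)\<^sup>2"
      unfolding h_def using u(3) by (subst norm_add_Pythagorean) (simp_all add: orthogonal_def power_mult_distrib power_divide)
    also have "\<dots> = (fst z)\<^sup>2 + (snd z)\<^sup>2" unfolding u(2) q_def[symmetric] using q by (simp add: power_divide)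
    finally have "norm (h z) = sqrt ((fst z)\<^sup>2 + (snd z)\<^sup>2)" by (metis norm_ge_zero real_sqrt_unique)
    then show ?thesis by (simp add: norm_prod_def)
  qed
  have h_surj: "surj h"
  proof -
    have lin: "linear h" by (rule linearI) (auto simp: h_add, auto simp: h_def algebra_simps)
    have "inj h"
    proof (rule injI)
      fix x y assume "h x = h y"
      then show "x = y" using h_norm[of "x - y"] h_diff[of x y] by simp
    qed
    then have "dim (range h) = dim (UNIV :: (real \<times> real) set)" using lin by (intro dim_image_eq) auto
    then have "dim (range h) = DIM(real ^ 2)" by simp
    then have "span (range h) = UNIV" by (simp only: dim_eq_full)
    then show ?thesis using linear_span_image[OF lin, of UNIV] by simp
  qed
  have iso: "surj (\<lambda>z. x + h z)" "dist (x + h y) (x + h z) = dist y z" "x + h (y + z) = h y + (x + h z)" for x y z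
  proof -
    have "\<exists>z. w = x + h z" for w
    proof -
      obtain z where "w - x = h z" using surjD[OF h_surj] by blast
      then have "w = x + h z" by (simp add: algebra_simps)
      then show ?thesis ..
    qed
    then show "surj (\<lambda>z. x + h z)" unfolding surj_def by blast
    show "dist (x + h y) (x + h z) = dist y z" by (simp add: dist_norm h_diff h_norm)
  qed (simp add: h_add)
  have transfer: "(\<lambda>y. F (inv (\<lambda>z. x + h z) y)) \<asymp> (\<lambda>y. G (inv (\<lambda>z. x + h z) y))" if "F \<asymp> G" for F G x
    by (rule eqf_isometry[OF iso that])
  have bij: "bij (\<lambda>z. x + h z)" for x
  proof -
    have "inj (\<lambda>z. x + h z)"
    proof (rule injI)
      fix y z assume "x + h y = x + h z"
      then show "y = z" using iso(2)[of x y z] by simp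
    qed
    then show ?thesis using iso(1) by (simp add: bij_def)
  qed
  define R where "R y = f ` rect q y" for y
  have f: "f = (\<lambda>z. p + h z)" by (simp add: f_def[abs_def])
  have nR: "nice (R y)" for y unfolding R_def f by (intro nice_isometry nice_rect iso)
  have Rint: "interior (R y) \<noteq> {}" if "0 < y" for y
  proof -
    have "open ({0<..<q} \<times> {0<..<y})" by (intro open_Times) auto
    moreover have "(q / 2, y / 2) \<in> {0<..<q} \<times> {0<..<y}" using q that by auto
    moreover have "{0<..<q} \<times> {0<..<y} \<subseteq> rect q y" by (auto simp: rect_def)
    ultimately have "(q / 2, y / 2) \<in> interior (rect q y)" by (rule interiorI)
    then have "f (q / 2, y / 2) \<in> interior (R y)" unfolding R_def f by (intro isometry_interior iso)
    then show ?thesis by blast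
  qed
  have Rpos: "0 < emeasure lborel (R y)" if "0 < y" for y
    by (rule interior_emeasure_pos[OF nR Rint[OF that]])
  have Radd: "emeasure lborel (R x) + emeasure lborel (R y) = emeasure lborel (R (x + y))" if "0 \<le> x" "0 \<le> y" for x y
  proof (rule eqf_emeasure_add)
    show "ind (R x) + ind (R y) \<asymp> ind (R (x + y))"
      using transfer[OF rect_stack[OF that, of q], of p] ind_inv[OF bij, of _ p]
      unfolding R_def f by (simp add: fun_eq_iff plus_fun_def)
  qed (intro nice_borel nR)+
  obtain c0 where c0: "c = f c0" unfolding f using iso(1)[of p] by (metis surjD)
  define D0 where "D0 = {z :: real \<times> real. (fst z)\<^sup>2 + (snd z)\<^sup>2 \<le> r\<^sup>2}"
  have D: "D = (\<lambda>z. c + h z) ` D0"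
  proof -
    have "z \<in> D0 \<longleftrightarrow> norm z \<le> r" for z
    proof -
      have "norm z \<le> r \<longleftrightarrow> (norm z)\<^sup>2 \<le> r\<^sup>2" using assms(1) by (simp add: abs_le_square_iff[symmetric])
      then show ?thesis by (simp add: D0_def norm_prod_def)
    qed
    then have "c + h z \<in> D \<longleftrightarrow> z \<in> D0" for z using assms(2) by (simp add: dist_norm h_norm)
    show ?thesis
    proof
      show "(\<lambda>z. c + h z) ` D0 \<subseteq> D" using \<open>\<And>z. c + h z \<in> D \<longleftrightarrow> z \<in> D0\<close> by blast
      show "D \<subseteq> (\<lambda>z. c + h z) ` D0"
      proof
        fix y assume y: "y \<in> D"
        obtain z where "y = c + h z" using surjD[OF iso(1)[of c]] by blast
        then show "y \<in> (\<lambda>z. c + h z) ` D0" using y \<open>\<And>z. c + h z \<in> D \<longleftrightarrow> z \<in> D0\<close> by blast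
      qed
    qed
  qed
  obtain w b where wb: "0 < w" "0 < b" "ind D0 \<asymp> ind (rect w b)"
    using disk_rect[OF assms(1)] unfolding D0_def by blast
  define b' where "b' = w * b / q"
  have b': "0 < b'" "w * b = q * b'" using wb q by (auto simp: b'_def)
  have "ind D0 \<asymp> ind (rect q b')" using wb(3) rect_change[OF wb(1,2) q b'] by (rule eqf_trans)
  from transfer[OF this, of c] have "ind D \<asymp> ind ((\<lambda>z. c + h z) ` rect q b')"
    unfolding ind_inv[OF bij] D .
  also have "(\<lambda>z. c + h z) ` rect q b' = (+) (c - p) ` R b'" by (simp add: R_def f image_image)
  also have "ind ((+) (c - p) ` R b') \<asymp> ind (R b')" by (rule eqf_sym[OF eqf_translate[OF nR]])
  finally have DR: "ind D \<asymp> ind (R b')" .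
  have Qf: "Q = f ` ({0..q} \<times> {0..q})"
  proof
    show "Q \<subseteq> f ` ({0..q} \<times> {0..q})"
    proof
      fix z assume "z \<in> Q"
      then obtain a b where "a \<in> {0..1}" "b \<in> {0..1}" "z = p + a *\<^sub>R u + b *\<^sub>R v" unfolding Q by blast
      then have "z = f (a * q, b * q)" "(a * q, b * q) \<in> {0..q} \<times> {0..q}"
        using q by (auto simp: f_def h_def intro: mult_left_le_one_le)
      then show "z \<in> f ` ({0..q} \<times> {0..q})" by blast
    qed
    show "f ` ({0..q} \<times> {0..q}) \<subseteq> Q"
    proof clarify
      fix a b assume "a \<in> {0..q}" "b \<in> {0..q}"
      then have "f (a, b) = p + (a / q) *\<^sub>R u + (b / q) *\<^sub>R v" "a / q \<in> {0..1}" "b / q \<in> {0..1}"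
        using q by (auto simp: f_def h_def)
      then show "f (a, b) \<in> Q" unfolding Q by blast
    qed
  qed
  from transfer[OF closed_square_rect(1)[OF q], of p] have QR: "ind Q \<asymp> ind (R q)"
    unfolding ind_inv[OF bij] Qf R_def f .
  have borel: "D \<in> sets borel" "Q \<in> sets borel"
  proof -
    show "D \<in> sets borel" using assms(2) by simp
    have "nice Q" unfolding Qf f by (intro nice_isometry closed_square_rect(2)[OF q] iso)
    then show "Q \<in> sets borel" by (rule nice_borel)
  qed
  have em: "emeasure lborel D = emeasure lborel (R b')" "emeasure lborel Q = emeasure lborel (R q)"
    using eqf_nn_integral[OF DR] eqf_nn_integral[OF QR] borel nice_borel[OF nR] by (simp_all add: nn_integral_ind)
  have fin: "emeasure lborel D < \<infinity>" "emeasure lborel Q < \<infinity>"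
  proof -
    show "emeasure lborel D < \<infinity>" using assms(1,2) by (simp add: emeasure_cball)
    have "Q \<subseteq> cball p (3 * q)"
      unfolding Qf f
    proof clarify
      fix a b assume "a \<in> {0..q}" "b \<in> {0..q}"
      then have "norm (h (a, b)) \<le> 2 * q" unfolding h_norm
        using norm_Pair_le[of a b] by (simp add: algebra_simps)
      then show "p + h (a, b) \<in> cball p (3 * q)" using q by (simp add: dist_norm)
    qed
    then have "emeasure lborel Q \<le> emeasure lborel (cball p (3 * q))" by (intro emeasure_mono) auto
    also have "\<dots> < \<infinity>" using q by (simp add: emeasure_cball)
    finally show "emeasure lborel Q < \<infinity>" .
  qed
  have "measure lborel D = measure lborel Q" using assms(4) borel by (simp add: measure_def)
  then have eqm: "emeasure lborel D = emeasure lborel Q"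
    using fin by (simp add: emeasure_eq_ennreal_measure less_top)
  \<comment> \<open>Equidecomposability preserves measure, so R b' and R q have equal finite
    measure. By \<open>Radd\<close> and \<open>Rpos\<close> the measure of R y is strictly
    increasing in y, so the two heights agree without any formula for the area of the disk.\<close>
  have "b' = q"
  proof (rule ccontr)
    assume "b' \<noteq> q"
    have *: False if "0 \<le> x" "x < y" "emeasure lborel (R x) = emeasure lborel (R y)" "emeasure lborel (R x) < \<infinity>" for x y
    proof -
      have "emeasure lborel (R x) + emeasure lborel (R (y - x)) = emeasure lborel (R x) + 0"
        using Radd[of x "y - x"] that by simp
      then have "emeasure lborel (R (y - x)) = 0" using that(4) ennreal_add_left_cancel by auto
      then show False using Rpos[of "y - x"] that(2) by simp
    qed
    then show False using \<open>b' \<noteq> q\<close> eqm em fin b'(1) q by (metis less_imp_le linorder_neqE_linordered_idom)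
  qed
  then have DQ: "ind D \<asymp> ind Q" using eqf_trans[OF DR] eqf_sym[OF QR] by simp
  interpret target D Q
  proof
    have "interior D = ball c r" "closure (interior D) = D" using assms(1,2) by (auto simp: interior_cball)
    then show "D \<subseteq> closure (interior D)" "D \<noteq> {}" "\<And>x y. x \<in> D \<Longrightarrow> y \<in> D \<Longrightarrow> x \<noteq> y \<Longrightarrow> midpoint x y \<in> interior D"
      using assms(1,2) midpoint_in_ball by (auto simp: interior_cball)
    show cQ: "convex Q"
    proof (rule convexI)
      fix x y and s t :: real assume xy: "x \<in> Q" "y \<in> Q" and st: "0 \<le> s" "0 \<le> t" "s + t = 1"
      obtain a b a' b' where ab: "a \<in> {0..1}" "b \<in> {0..1}" "x = p + a *\<^sub>R u + b *\<^sub>R v"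
        "a' \<in> {0..1}" "b' \<in> {0..1}" "y = p + a' *\<^sub>R u + b' *\<^sub>R v"
        using xy unfolding Q by blast
      have "s *\<^sub>R x + t *\<^sub>R y = (s + t) *\<^sub>R p + (s * a + t * a') *\<^sub>R u + (s * b + t * b') *\<^sub>R v"
        unfolding ab by (simp add: algebra_simps)
      moreover have "s * a + t * a' \<in> {0..1}" "s * b + t * b' \<in> {0..1}"
        using convexD[OF convex_real_interval(5)[of 0 1]] ab st by (auto intro: convex_bound_le)
      ultimately show "s *\<^sub>R x + t *\<^sub>R y \<in> Q" unfolding Q st(3) by auto
    qed
    have "R q \<subseteq> Q" unfolding R_def Qf by (intro image_mono) (auto simp: rect_def)
    then have "interior Q \<noteq> {}" using Rint[OF q] interior_mono by blast
    then show "Q \<subseteq> closure (interior Q)" using convex_closure_interior[OF cQ] closure_subset by blast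
  qed
  obtain N P t where P: "translation_equidecomposition N P t D Q" "\<And>i. i < N \<Longrightarrow> nice (P i) \<and> interior (P i) \<noteq> {}"
    using fat_decomposition[OF DQ] by blast
  have "upper_minkowski_dim (frontier (P i)) \<le> ereal 1.987 \<and>
      P i \<in> generated_algebra {S. fsigma_in euclidean S} \<and> emeasure lebesgue (P i) > 0" if "i < N" for i
  proof -
    have n: "nice (P i)" "interior (P i) \<noteq> {}" using P(2)[OF that] by auto
    have "emeasure lebesgue (P i) = emeasure lborel (P i)" using nice_borel[OF n(1)] by simp
    then show ?thesis
      using n interior_emeasure_pos[OF n] upper_minkowski_dim_small
      unfolding nice_def boolean_fsigma_def by simp
  qed
  then show ?thesis using P(1) by blast
qed

end
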